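(* Let $\Delta \in \mathcal{D}iscs$. Let $w_\Delta = 3$ if $\Delta$ is a perfect square and $w_\Delta = 1$ otherwise, and let $\eta_\Delta = 1/3$ if $\Delta > 0$ and $\eta_\Delta = 1$ if $\Delta < 0$. Then $2 w_\Delta \eta_\Delta \hat h(\Delta)$ equals \[ \sum_{\substack{g>0,\ \Delta'\in\mathcal{D}iscs \\ \Delta' g^2 = \Delta}} \ \sum_{J} \lvert \operatorname{Pic}(\mathcal{O}_{\Delta'})[3] \rvert, \] where for each pair $(g,\Delta')$ the inner sum runs over the invertible integral ideals $J \subseteq \mathcal{O}_{\Delta'}$ of norm $[\mathcal{O}_{\Delta'}:J]=g$ whose class in $\operatorname{Pic}(\mathcal{O}_{\Delta'})$ is a cube.
   Context: $\mathcal{D}iscs = (4\mathbb{Z}\setminus\{0\}) \cup (1+4\mathbb{Z})$. For $\Delta\in\mathcal{D}iscs$, $\mathcal{O}_\Delta$ is the unique quadratic ring over $\mathbb{Z}$ of discriminant $\Delta$, and $\operatorname{Pic}(\mathcal{O}_\Delta)$ its group of invertible fractional ideals modulo principal ones; $\operatorname{Pic}(\mathcal{O}_{\Delta'})[3]$ is its $3$-torsion subgroup. A cubic ring is a commutative ring with unit isomorphic to $\mathbb{Z}^3$ as a $\mathbb{Z}$-module; it is $\mathbb{Z}$-mat if every element has trace divisible by $3$. $\hat h(\Delta)$ is the sum of $1/\lvert\operatorname{Aut} C\rvert$ over isomorphism classes of $\mathbb{Z}$-mat cubic rings $C$ of discriminant $-27\Delta$. *)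

theory Defs
  imports
    "HOL-Algebra.Algebra"
    "Jordan_Normal_Form.Determinant"
begin

definition Discs :: "int set" where
  "Discs = {d. 4 dvd d \<and> d \<noteq> 0} \<union> {d. d mod 4 = 1}"


section \<open>Rings that are free of finite rank over the integers\<close>

definition rank_ring :: "nat \<Rightarrow> ('a, 'm) ring_scheme \<Rightarrow> bool" where
  "rank_ring n R \<longleftrightarrow>
     cring R \<and> add_monoid R \<cong> product_group {..<n} (\<lambda>_. integer_group)"

abbreviation cubic_ring :: "('a, 'm) ring_scheme \<Rightarrow> bool" where
  "cubic_ring \<equiv> rank_ring 3"

definition zcomb :: "nat \<Rightarrow> ('a, 'm) ring_scheme \<Rightarrow> (nat \<Rightarrow> 'a) \<Rightarrow> (nat \<Rightarrow> int) \<Rightarrow> 'a" where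
  "zcomb n R b c = (\<Oplus>\<^bsub>R\<^esub>i\<in>{..<n}. add_pow R (c i) (b i))"

definition zbasis :: "nat \<Rightarrow> ('a, 'm) ring_scheme \<Rightarrow> (nat \<Rightarrow> 'a) \<Rightarrow> bool" where
  "zbasis n R b \<longleftrightarrow>
     b \<in> {..<n} \<rightarrow> carrier R \<and>
     bij_betw (zcomb n R b) ({..<n} \<rightarrow>\<^sub>E (UNIV :: int set)) (carrier R)"

definition zcoord :: "nat \<Rightarrow> ('a, 'm) ring_scheme \<Rightarrow> (nat \<Rightarrow> 'a) \<Rightarrow> 'a \<Rightarrow> nat \<Rightarrow> int" where
  "zcoord n R b = the_inv_into ({..<n} \<rightarrow>\<^sub>E UNIV) (zcomb n R b)"

text \<open>The trace of multiplication by \<open>x\<close>, and the determinant of the trace form, computed in a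
  given basis. Neither depends on the basis, so an arbitrary one is chosen afterwards.\<close>

definition trace_wrt :: "nat \<Rightarrow> ('a, 'm) ring_scheme \<Rightarrow> (nat \<Rightarrow> 'a) \<Rightarrow> 'a \<Rightarrow> int" where
  "trace_wrt n R b x = (\<Sum>i<n. zcoord n R b (x \<otimes>\<^bsub>R\<^esub> b i) i)"

definition disc_wrt :: "nat \<Rightarrow> ('a, 'm) ring_scheme \<Rightarrow> (nat \<Rightarrow> 'a) \<Rightarrow> int" where
  "disc_wrt n R b =
     Determinant.det (mat n n (\<lambda>(i, j). trace_wrt n R b (b i \<otimes>\<^bsub>R\<^esub> b j)))"

definition ring_trace :: "nat \<Rightarrow> ('a, 'm) ring_scheme \<Rightarrow> 'a \<Rightarrow> int" where
  "ring_trace n R = trace_wrt n R (SOME b. zbasis n R b)"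

definition ring_disc :: "nat \<Rightarrow> ('a, 'm) ring_scheme \<Rightarrow> int" where
  "ring_disc n R = disc_wrt n R (SOME b. zbasis n R b)"


section \<open>Cubic rings with all traces divisible by 3\<close>

definition Z_mat :: "('a, 'm) ring_scheme \<Rightarrow> bool" where
  "Z_mat C \<longleftrightarrow> (\<forall>x\<in>carrier C. 3 dvd ring_trace 3 C x)"

text \<open>Automorphisms are taken extensional, so that functions agreeing on the carrier are
  not counted separately.\<close>

definition ring_Aut :: "('a, 'm) ring_scheme \<Rightarrow> ('a \<Rightarrow> 'a) set" where
  "ring_Aut C = ring_iso C C \<inter> extensional (carrier C)"

text \<open>Every cubic ring is isomorphic to one whose elements form a subset of the countable type
  \<open>int \<times> int \<times> int\<close> (see \<open>cubic_ring_representable\<close> below), so the isomorphism classes of cubic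
  rings are represented by the rings over that type.\<close>

definition Z_mat_cubic_rings :: "int \<Rightarrow> (int \<times> int \<times> int) ring set" where
  "Z_mat_cubic_rings D = {C. cubic_ring C \<and> Z_mat C \<and> ring_disc 3 C = D}"

definition h_hat :: "int \<Rightarrow> rat" where
  "h_hat \<Delta> =
     (let S = Z_mat_cubic_rings (- 27 * \<Delta>)
      in \<Sum>cl \<in> S // {(C, D). C \<in> S \<and> D \<in> S \<and> C \<simeq> D}.
           1 / of_nat (card (ring_Aut (SOME C. C \<in> cl))))"

lemma cubic_ring_representable:
  fixes R :: "('a, 'm) ring_scheme"
  assumes "cubic_ring R"
  shows "\<exists>C :: (int \<times> int \<times> int) ring. cubic_ring C \<and> R \<simeq> C"
proof -
  interpret cring R using assms by (simp add: rank_ring_def)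
  let ?Z = "product_group {..<3::nat} (\<lambda>_. integer_group)"
  obtain \<phi> where \<phi>: "\<phi> \<in> iso (add_monoid R) ?Z"
    using assms by (auto simp: rank_ring_def is_iso_def)
  define t where "t f = (f 0, f 1, f 2)" for f :: "nat \<Rightarrow> int"
  have "inj_on t (carrier ?Z)"
  proof (rule inj_onI)
    fix f g assume fg: "f \<in> carrier ?Z" "g \<in> carrier ?Z" "t f = t g"
    show "f = g"
    proof
      fix i :: nat
      consider "i = 0" | "i = 1" | "i = 2" | "i \<notin> {..<3}" by force
      then show "f i = g i"
        using fg by cases (auto simp: t_def PiE_def extensional_def)
    qed
  qed
  moreover have "inj_on \<phi> (carrier R)" "\<phi> ` carrier R = carrier ?Z"
    using \<phi> by (auto simp: iso_def bij_betw_def)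
  ultimately have "inj_on (t \<circ> \<phi>) (carrier R)"
    by (simp add: comp_inj_on)
  then have iso: "t \<circ> \<phi> \<in> ring_iso R (image_ring (t \<circ> \<phi>) R)"
    by (rule inj_imp_image_ring_iso)
  let ?C = "image_ring (t \<circ> \<phi>) R"
  have "cring ?C"
    using ring_iso_imp_img_cring[OF iso]
    by (simp add: image_ring_def image_group_def monoid.defs)
  moreover have "t \<circ> \<phi> \<in> iso (add_monoid R) (add_monoid ?C)"
    using iso by (auto simp: ring_iso_def iso_def Ring.ring_hom_def hom_def)
  then have "add_monoid ?C \<cong> add_monoid R"
    by (intro add.iso_sym is_isoI)
  then have "add_monoid ?C \<cong> ?Z"
    using iso_trans[OF _ is_isoI[OF \<phi>]] by blast
  ultimately have "cubic_ring ?C" by (simp add: rank_ring_def)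
  then show ?thesis using iso by (auto simp: is_ring_iso_def)
qed


section \<open>Quadratic orders\<close>

text \<open>\<open>quad_alg \<Delta>\<close> is \<open>\<rat>[x]/(x\<^sup>2 - \<Delta>)\<close>, a pair \<open>(a, b)\<close> standing for
  \<open>a + b \<surd>\<Delta>\<close>; for a nonzero square \<open>\<Delta>\<close> it is isomorphic to \<open>\<rat> \<times> \<rat>\<close>, not a field. The order of
  discriminant \<open>\<Delta>\<close> is its subring spanned over the integers by \<open>1\<close> and \<open>(\<Delta> + \<surd>\<Delta>) / 2\<close>,
  and \<open>quad_alg \<Delta>\<close> is the total ring of fractions of that order.\<close>

definition quad_alg :: "int \<Rightarrow> (rat \<times> rat) ring" where
  "quad_alg \<Delta> =
     \<lparr> carrier = UNIV,
       monoid.mult = (\<lambda>(a, b) (c, d). (a * c + of_int \<Delta> * b * d, a * d + b * c)),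
       monoid.one = (1, 0),
       ring.zero = (0, 0),
       ring.add = (\<lambda>(a, b) (c, d). (a + c, b + d)) \<rparr>"

definition quad_elt :: "int \<Rightarrow> int \<Rightarrow> int \<Rightarrow> rat \<times> rat" where
  "quad_elt \<Delta> a b = (of_int a + of_int b * of_int \<Delta> / 2, of_int b / 2)"

definition quad_ring :: "int \<Rightarrow> (rat \<times> rat) ring" where
  "quad_ring \<Delta> = (quad_alg \<Delta>) \<lparr> carrier := {quad_elt \<Delta> a b | a b. True} \<rparr>"

lemma quad_ring_simps:
  "carrier (quad_ring \<Delta>) = {quad_elt \<Delta> a b | a b. True}"
  "(a, b) \<otimes>\<^bsub>quad_ring \<Delta>\<^esub> (c, d) = (a * c + of_int \<Delta> * b * d, a * d + b * c)"
  "(a, b) \<oplus>\<^bsub>quad_ring \<Delta>\<^esub> (c, d) = (a + c, b + d)"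
  "\<one>\<^bsub>quad_ring \<Delta>\<^esub> = (1, 0)"
  "\<zero>\<^bsub>quad_ring \<Delta>\<^esub> = (0, 0)"
  by (simp_all add: quad_ring_def quad_alg_def)

lemma quad_elt_arith:
  "quad_elt \<Delta> a b \<oplus>\<^bsub>quad_ring \<Delta>\<^esub> quad_elt \<Delta> c d = quad_elt \<Delta> (a + c) (b + d)"
  "\<one>\<^bsub>quad_ring \<Delta>\<^esub> = quad_elt \<Delta> 1 0"
  "\<zero>\<^bsub>quad_ring \<Delta>\<^esub> = quad_elt \<Delta> 0 0"
  by (simp_all add: quad_elt_def quad_ring_simps field_simps)

lemma quad_elt_mult:
  assumes "\<Delta> * \<Delta> - \<Delta> = 4 * e"
  shows "quad_elt \<Delta> a b \<otimes>\<^bsub>quad_ring \<Delta>\<^esub> quad_elt \<Delta> c d =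
    quad_elt \<Delta> (a * c - b * d * e) (a * d + b * c + b * d * \<Delta>)"
proof -
  have e: "of_int e = (of_int \<Delta> * of_int \<Delta> - of_int \<Delta>) / (4 :: rat)"
    using arg_cong[OF assms, of "of_int :: int \<Rightarrow> rat"] by simp
  show ?thesis
    unfolding quad_elt_def quad_ring_simps of_int_diff of_int_add of_int_mult e
    by (simp add: field_simps)
qed

lemma quad_elt_carrier [simp]: "quad_elt \<Delta> a b \<in> carrier (quad_ring \<Delta>)"
  by (auto simp: quad_ring_simps)

lemma quad_ringE:
  assumes "x \<in> carrier (quad_ring \<Delta>)"
  obtains a b where "x = quad_elt \<Delta> a b"
  using assms by (auto simp: quad_ring_simps)

lemma quad_elt_eq_iff: "quad_elt \<Delta> a b = quad_elt \<Delta> c d \<longleftrightarrow> a = c \<and> b = d"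
  by (auto simp: quad_elt_def)

lemma Discs_obtain:
  assumes "\<Delta> \<in> Discs"
  obtains e where "\<Delta> * \<Delta> - \<Delta> = 4 * e"
proof -
  have "\<Delta> mod 4 = 0 \<or> \<Delta> mod 4 = 1"
    using assms by (auto simp: Discs_def)
  then have "4 dvd \<Delta> \<or> 4 dvd \<Delta> - 1" by presburger
  then have "4 dvd \<Delta> * (\<Delta> - 1)" by (metis dvd_mult dvd_mult2)
  then show ?thesis using that by (auto simp: dvd_def algebra_simps)
qed

lemma cring_quad_ring:
  assumes "\<Delta> \<in> Discs"
  shows "cring (quad_ring \<Delta>)"
proof -
  obtain e where e: "\<Delta> * \<Delta> - \<Delta> = 4 * e" using assms by (rule Discs_obtain)
  show ?thesis
  proof (rule cringI)
    show "abelian_group (quad_ring \<Delta>)"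
    proof (rule abelian_groupI)
      fix x assume "x \<in> carrier (quad_ring \<Delta>)"
      then obtain a b where x: "x = quad_elt \<Delta> a b" by (auto simp: quad_ring_simps)
      show "\<exists>y\<in>carrier (quad_ring \<Delta>). y \<oplus>\<^bsub>quad_ring \<Delta>\<^esub> x = \<zero>\<^bsub>quad_ring \<Delta>\<^esub>"
        by (rule bexI[of _ "quad_elt \<Delta> (- a) (- b)"])
           (simp_all add: x quad_elt_arith)
    qed ((elim quad_ringE)?; simp add: quad_elt_arith quad_elt_eq_iff)+
    show "comm_monoid (quad_ring \<Delta>)"
    proof (rule comm_monoidI)
      fix x y z
      assume "x \<in> carrier (quad_ring \<Delta>)" "y \<in> carrier (quad_ring \<Delta>)"
        "z \<in> carrier (quad_ring \<Delta>)"
      then show "x \<otimes>\<^bsub>quad_ring \<Delta>\<^esub> y \<otimes>\<^bsub>quad_ring \<Delta>\<^esub> z =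
          x \<otimes>\<^bsub>quad_ring \<Delta>\<^esub> (y \<otimes>\<^bsub>quad_ring \<Delta>\<^esub> z)"
        unfolding quad_ring_def quad_alg_def by (auto simp: split_def algebra_simps)
    qed ((elim quad_ringE)?;
        simp add: quad_elt_arith quad_elt_mult[OF e] quad_elt_eq_iff mult.commute add.commute)+
  qed ((elim quad_ringE)?;
      simp add: quad_elt_arith quad_elt_mult[OF e] quad_elt_eq_iff algebra_simps)+
qed

lemma zcomb_quad_basis:
  assumes "\<Delta> \<in> Discs"
  shows "zcomb 2 (quad_ring \<Delta>) (\<lambda>i. if i = 0 then quad_elt \<Delta> 1 0 else quad_elt \<Delta> 0 1) c =
    quad_elt \<Delta> (c 0) (c 1)"
proof -
  interpret cring "quad_ring \<Delta>" using assms by (rule cring_quad_ring)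
  have nat: "add_pow (quad_ring \<Delta>) n (quad_elt \<Delta> a b) = quad_elt \<Delta> (int n * a) (int n * b)"
    for n :: nat and a b
    by (induction n) (simp_all add: quad_elt_arith algebra_simps)
  have inv: "\<ominus>\<^bsub>quad_ring \<Delta>\<^esub> quad_elt \<Delta> a b = quad_elt \<Delta> (- a) (- b)" for a b
    by (rule minus_equality) (simp_all add: quad_elt_arith)
  have int: "add_pow (quad_ring \<Delta>) k (quad_elt \<Delta> a b) = quad_elt \<Delta> (k * a) (k * b)"
    for k :: int and a b
  proof (cases "k < 0")
    case True
    then have "add_pow (quad_ring \<Delta>) k (quad_elt \<Delta> a b) =
        \<ominus>\<^bsub>quad_ring \<Delta>\<^esub> add_pow (quad_ring \<Delta>) (nat (- k)) (quad_elt \<Delta> a b)"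
      unfolding add_pow_def int_pow_def2 a_inv_def by simp
    then show ?thesis using True by (simp add: nat inv)
  next
    case False
    then have "add_pow (quad_ring \<Delta>) k (quad_elt \<Delta> a b) =
        add_pow (quad_ring \<Delta>) (nat k) (quad_elt \<Delta> a b)"
      unfolding add_pow_def int_pow_def2 by simp
    then show ?thesis using False by (simp add: nat)
  qed
  have "{..<2::nat} = {0, 1}" by auto
  then show ?thesis
    by (simp add: zcomb_def Pi_iff int quad_elt_arith)
qed

lemma zbasis_quad_ring:
  assumes "\<Delta> \<in> Discs"
  shows "zbasis 2 (quad_ring \<Delta>) (\<lambda>i. if i = 0 then quad_elt \<Delta> 1 0 else quad_elt \<Delta> 0 1)"
    (is "zbasis 2 ?R ?b")
proof -
  have "inj_on (zcomb 2 ?R ?b) ({..<2} \<rightarrow>\<^sub>E UNIV)"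
  proof (rule inj_onI)
    fix c d :: "nat \<Rightarrow> int"
    assume cd: "c \<in> {..<2} \<rightarrow>\<^sub>E UNIV" "d \<in> {..<2} \<rightarrow>\<^sub>E UNIV"
      "zcomb 2 ?R ?b c = zcomb 2 ?R ?b d"
    then have "c 0 = d 0" "c 1 = d 1"
      by (simp_all add: zcomb_quad_basis[OF assms] quad_elt_eq_iff)
    moreover have "i = 0 \<or> i = 1" if "i < 2" for i :: nat using that by auto
    ultimately show "c = d"
      by (intro PiE_ext[OF cd(1,2)]) auto
  qed
  moreover have "zcomb 2 ?R ?b ` ({..<2} \<rightarrow>\<^sub>E UNIV) = carrier ?R"
  proof (intro equalityI subsetI)
    fix x assume "x \<in> carrier ?R"
    then obtain a b where "x = quad_elt \<Delta> a b" by (auto simp: quad_ring_simps)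
    then have "x = zcomb 2 ?R ?b (\<lambda>i\<in>{..<2}. if i = 0 then a else b)"
      by (simp add: zcomb_quad_basis[OF assms])
    then show "x \<in> zcomb 2 ?R ?b ` ({..<2} \<rightarrow>\<^sub>E UNIV)"
      by (intro image_eqI) auto
  next
    fix x assume "x \<in> zcomb 2 ?R ?b ` ({..<2} \<rightarrow>\<^sub>E UNIV)"
    then show "x \<in> carrier ?R"
      by (force simp: zcomb_quad_basis[OF assms])
  qed
  ultimately show ?thesis
    unfolding zbasis_def bij_betw_def by simp
qed

lemma disc_quad_ring:
  assumes "\<Delta> \<in> Discs"
  shows "disc_wrt 2 (quad_ring \<Delta>) (\<lambda>i. if i = 0 then quad_elt \<Delta> 1 0 else quad_elt \<Delta> 0 1) = \<Delta>"
    (is "disc_wrt 2 ?R ?b = \<Delta>")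
proof -
  obtain e where e: "\<Delta> * \<Delta> - \<Delta> = 4 * e" using assms by (rule Discs_obtain)
  have coord: "zcoord 2 ?R ?b (quad_elt \<Delta> p q) i = (if i = 0 then p else q)"
    if "i < 2" for p q and i :: nat
  proof -
    let ?c = "\<lambda>i\<in>{..<2::nat}. if i = 0 then p else q"
    have "zcoord 2 ?R ?b (zcomb 2 ?R ?b ?c) = ?c"
      unfolding zcoord_def using zbasis_quad_ring[OF assms]
      by (intro the_inv_into_f_f) (auto simp: zbasis_def bij_betw_def)
    then show ?thesis using that by (simp add: zcomb_quad_basis[OF assms])
  qed
  have trace: "trace_wrt 2 ?R ?b (quad_elt \<Delta> p q) = 2 * p + q * \<Delta>" for p q
    unfolding trace_wrt_def using coord[of 0] coord[of 1]
    by (simp add: lessThan_Suc numeral_2_eq_2 quad_elt_mult[OF e])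
  have entries: "trace_wrt 2 ?R ?b (?b i \<otimes>\<^bsub>?R\<^esub> ?b j) =
      (if i = 0 then if j = 0 then 2 else \<Delta> else if j = 0 then \<Delta> else \<Delta> * \<Delta> - 2 * e)"
    for i j :: nat
    by (simp add: quad_elt_mult[OF e] trace)
  have "finite {1::nat}" "0 \<notin> {1::nat}" by auto
  note perms = sum_over_permutations_insert[OF this]
  have "{0..<2} = {0, 1::nat}" by auto
  then have "disc_wrt 2 ?R ?b = 2 * (\<Delta> * \<Delta> - 2 * e) - \<Delta> * \<Delta>"
    unfolding disc_wrt_def entries
    by (simp add: det_def'[of _ 2] perms permutes_sing sign_swap_id
        Transposition.transpose_def del: One_nat_def)
  then show ?thesis using e by simp
qed


section \<open>Invertible ideals and the Picard group\<close>

text \<open>In what follows \<open>R\<close> is a subring of \<open>K\<close>, and \<open>K\<close> is its total ring of fractions, so that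
  the non-zero-divisors of \<open>R\<close> are the elements of \<open>R\<close> that are units of \<open>K\<close>.\<close>

definition fractional_ideal ::
  "('a, 'm) ring_scheme \<Rightarrow> ('a, 'k) ring_scheme \<Rightarrow> 'a set \<Rightarrow> bool" where
  "fractional_ideal K R I \<longleftrightarrow>
     additive_subgroup I K \<and>
     (\<forall>r\<in>carrier R. \<forall>x\<in>I. r \<otimes>\<^bsub>K\<^esub> x \<in> I) \<and>
     (\<exists>d\<in>carrier R \<inter> Units K. \<forall>x\<in>I. d \<otimes>\<^bsub>K\<^esub> x \<in> carrier R)"

definition invertible_fractional_ideal ::
  "('a, 'm) ring_scheme \<Rightarrow> ('a, 'k) ring_scheme \<Rightarrow> 'a set \<Rightarrow> bool" where
  "invertible_fractional_ideal K R I \<longleftrightarrow>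
     fractional_ideal K R I \<and>
     (\<exists>J. fractional_ideal K R J \<and> ideal_prod K I J = carrier R)"

definition inv_ideal_group ::
  "('a, 'm) ring_scheme \<Rightarrow> ('a, 'k) ring_scheme \<Rightarrow> 'a set monoid" where
  "inv_ideal_group K R =
     \<lparr> carrier = {I. invertible_fractional_ideal K R I},
       monoid.mult = ideal_prod K,
       monoid.one = carrier R \<rparr>"

definition principal_fractional_ideals ::
  "('a, 'm) ring_scheme \<Rightarrow> ('a, 'k) ring_scheme \<Rightarrow> 'a set set" where
  "principal_fractional_ideals K R = {(\<lambda>r. x \<otimes>\<^bsub>K\<^esub> r) ` carrier R | x. x \<in> Units K}"

definition Pic :: "int \<Rightarrow> (rat \<times> rat) set set monoid" where
  "Pic \<Delta> =
     inv_ideal_group (quad_alg \<Delta>) (quad_ring \<Delta>)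
       Mod principal_fractional_ideals (quad_alg \<Delta>) (quad_ring \<Delta>)"

definition Pic_class :: "int \<Rightarrow> (rat \<times> rat) set \<Rightarrow> (rat \<times> rat) set set" where
  "Pic_class \<Delta> J =
     principal_fractional_ideals (quad_alg \<Delta>) (quad_ring \<Delta>)
       #>\<^bsub>inv_ideal_group (quad_alg \<Delta>) (quad_ring \<Delta>)\<^esub> J"

definition torsion :: "nat \<Rightarrow> ('a, 'm) monoid_scheme \<Rightarrow> 'a set" where
  "torsion n G = {x \<in> carrier G. x [^]\<^bsub>G\<^esub> n = \<one>\<^bsub>G\<^esub>}"

definition cube_class_ideals :: "int \<Rightarrow> nat \<Rightarrow> (rat \<times> rat) set set" where
  "cube_class_ideals \<Delta> g =
     {J. ideal J (quad_ring \<Delta>) \<and>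
         invertible_fractional_ideal (quad_alg \<Delta>) (quad_ring \<Delta>) J \<and>
         card (carrier (quad_ring \<Delta> Quot J)) = g \<and>
         (\<exists>c\<in>carrier (Pic \<Delta>). Pic_class \<Delta> J = c [^]\<^bsub>Pic \<Delta>\<^esub> (3::nat))}"

end

theory Submission
  imports
    Defs
    "HOL-Library.Product_Plus"
    "HOL-Analysis.Kronecker_Approximation_Theorem"
begin

text \<open>In a cubic ring with all traces divisible by 3 the elements of trace \<open>0\<close> form a complement of the
  integers, and multiplication on it is governed by a binary cubic form
  \<open>f = a x\<^sup>3 + 3 b x\<^sup>2 y + 3 c x y\<^sup>2 + d y\<^sup>3\<close> of suitably normalised discriminant \<open>\<Delta>\<close>. This makes the groupoid of such rings
  equivalent to that of forms under a twisted action of \<open>GL\<^sub>2\<close>; passing to \<open>SL\<^sub>2\<close> doubles the mass.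
  The Hessian of \<open>f\<close> is \<open>g\<close> times a primitive binary quadratic form of discriminant \<open>\<Delta>' = \<Delta> / g\<^sup>2\<close>, which is the
  norm form of an invertible ideal \<open>I\<close> of the order of discriminant \<open>\<Delta>'\<close>, and \<open>f\<close> itself is a coordinate of the
  cube map \<open>x \<mapsto> \<gamma> x\<^sup>3\<close> on \<open>I\<close>, where \<open>\<gamma> I\<^sup>3 = g J\<close> for an integral ideal \<open>J\<close> of norm \<open>g\<close>.
  So \<open>SL\<^sub>2\<close>-classes of forms correspond to pairs \<open>(I, \<gamma>)\<close> up to \<open>(\<kappa> I, \<kappa>\<^sup>-\<^sup>3 \<gamma>)\<close>. For fixed \<open>J\<close> the possible classes of \<open>I\<close>
  form a coset of the 3-torsion of the class group (empty unless the class of \<open>J\<close> is a cube), and each class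
  contributes \<open>|U / U\<^sup>3| / |U[3]|\<close> for the unit group \<open>U\<close> of the order. This is 3 for a real quadratic order that is a
  domain and 1 otherwise; it is the inverse of \<open>w \<eta>\<close>.\<close>

text \<open>Two facts shape the proof: for square \<Delta> the algebra is split, with zero divisors,
  and the orders need not be maximal. So field arguments and unique factorisation are replaced by
  explicit bases: units are recognised by nonzero norm, and an invertible ideal is a lattice whose
  norm form, divided by the oriented area \<open>ar\<close>, is integral and primitive. Orientation
  is tied to \<gamma> by \<open>nm \<gamma> * ar^3 = g^3\<close>; a swap of the basis changes the
  sign of the cube, so such a basis exists, and it is unique up to SL_2. The twist of the GL_2
  action comes from pairing the trace-0 part of a product with a third vector by a determinant,
  which contributes a factor \<open>det M\<close>. For a fixed ideal the admissible \<gamma> form a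
  coset of \<open>U\<close>; two of them are isomorphic when they differ by the cube of a unit, and
  the automorphisms are the units of order dividing 3. A sum over infinitely many classes is 0 in
  the formal mass, so finiteness travels along with the equalities. Its sources are the class group,
  the ideals of given norm and the units modulo cubes.\<close>

section \<open>Weighted counting of isomorphism classes in groupoids\<close>

definition hom_rel :: "'a set \<Rightarrow> ('a \<Rightarrow> 'a \<Rightarrow> 'm set) \<Rightarrow> ('a \<times> 'a) set" where
  "hom_rel A H = {(x, y). x \<in> A \<and> y \<in> A \<and> H x y \<noteq> {}}"

text \<open>Groupoid cardinality. An infinite automorphism group contributes 0, and the whole sum is
  0 when there are infinitely many classes, so finiteness of the set of classes has to be tracked
  beside the masses.\<close>

definition mass :: "'a set \<Rightarrow> ('a \<Rightarrow> 'a \<Rightarrow> 'm set) \<Rightarrow> rat" where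
  "mass A H = (\<Sum>c \<in> A // hom_rel A H. 1 / of_nat (card (H (SOME x. x \<in> c) (SOME x. x \<in> c))))"

text \<open>What makes \<open>mass\<close> independent of the representatives picked by
  \<open>SOME\<close>. Composition does not appear, so the property passes along comparisons that
  need not be functorial.\<close>

definition weighted :: "'a set \<Rightarrow> ('a \<Rightarrow> 'a \<Rightarrow> 'm set) \<Rightarrow> bool" where
  "weighted A H \<longleftrightarrow> equiv A (hom_rel A H) \<and>
     (\<forall>x\<in>A. \<forall>y\<in>A. H x y \<noteq> {} \<longrightarrow> card (H x x) = card (H y y))"

lemma card_some_hom:
  assumes "weighted A H" "c \<in> A // hom_rel A H" "x \<in> c"
  shows "card (H (SOME x. x \<in> c) (SOME x. x \<in> c)) = card (H x x)"
proof -
  let ?y = "SOME x. x \<in> c"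
  have y: "?y \<in> c" using assms(3) by (rule someI)
  have "(?y, x) \<in> hom_rel A H"
    using assms y by (auto simp: weighted_def dest: quotient_eq_iff)
  then show ?thesis using assms(1) unfolding weighted_def hom_rel_def by blast
qed

text \<open>A relation \<open>R\<close> between objects plays the part of an equivalence of
  groupoids: total on both sides, and matching Hom sets in size. Emptiness is compared separately,
  since an infinite Hom set also has \<open>card\<close> 0. A choice function \<open>g\<close>
  inside \<open>R\<close> induces the bijection of classes.\<close>

lemma
  assumes w: "weighted A' H'"
    and l: "\<And>x. x \<in> A \<Longrightarrow> \<exists>x'\<in>A'. R x x'"
    and r: "\<And>x'. x' \<in> A' \<Longrightarrow> \<exists>x\<in>A. R x x'"
    and b: "\<And>x x' y y'. x \<in> A \<Longrightarrow> x' \<in> A' \<Longrightarrow> y \<in> A \<Longrightarrow> y' \<in> A' \<Longrightarrow> R x x' \<Longrightarrow> R y y' \<Longrightarrow>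
           (H x y = {} \<longleftrightarrow> H' x' y' = {}) \<and> card (H x y) = card (H' x' y')"
  shows weighted_transfer: "weighted A H" and mass_transfer: "mass A H = mass A' H'"
    and finite_transfer: "finite (A // hom_rel A H) \<longleftrightarrow> finite (A' // hom_rel A' H')"
proof -
  have ne: "H x y = {} \<longleftrightarrow> H' x' y' = {}" and cd: "card (H x y) = card (H' x' y')"
    if "x \<in> A" "x' \<in> A'" "y \<in> A" "y' \<in> A'" "R x x'" "R y y'" for x x' y y'
    using b[OF that] by auto
  let ?E = "hom_rel A H" and ?E' = "hom_rel A' H'"
  have E': "equiv A' ?E'" using w by (simp add: weighted_def)
  define g where "g x = (SOME x'. x' \<in> A' \<and> R x x')" for x
  have g: "g x \<in> A'" "R x (g x)" if "x \<in> A" for x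
    using someI_ex[of "\<lambda>x'. x' \<in> A' \<and> R x x'"] l[OF that] unfolding g_def by auto
  have rel: "(x, y) \<in> ?E \<longleftrightarrow> (x', y') \<in> ?E'"
    if "x \<in> A" "x' \<in> A'" "y \<in> A" "y' \<in> A'" "R x x'" "R y y'" for x x' y y'
    using that ne[OF that] by (auto simp: hom_rel_def)
  have relg: "(x, y) \<in> ?E \<longleftrightarrow> (g x, g y) \<in> ?E'" if "x \<in> A" "y \<in> A" for x y
    using rel that g by blast
  have E: "equiv A ?E"
  proof (rule equivI)
    show "?E \<subseteq> A \<times> A" by (auto simp: hom_rel_def)
    show "refl_on A ?E"
      using relg E' g by (auto simp: refl_on_def equiv_def hom_rel_def)
    show "sym ?E" using relg E'
      by (metis (no_types, lifting) case_prodD equiv_def hom_rel_def mem_Collect_eq sym_def)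
    show "trans ?E"
    proof (rule transI)
      fix x y z assume a: "(x, y) \<in> ?E" "(y, z) \<in> ?E"
      then have A: "x \<in> A" "y \<in> A" "z \<in> A" by (auto simp: hom_rel_def)
      then show "(x, z) \<in> ?E" using a relg E'
        by (meson equiv_def transD)
    qed
  qed
  show W: "weighted A H"
    unfolding weighted_def
  proof (intro conjI E ballI impI)
    fix x y assume xy: "x \<in> A" "y \<in> A" "H x y \<noteq> {}"
    have "card (H' (g x) (g x)) = card (H' (g y) (g y))"
      using w xy g ne[of x "g x" y "g y"] by (simp add: weighted_def)
    then show "card (H x x) = card (H y y)" using cd g xy by metis
  qed
  define F where "F c = ?E' `` (g ` c)" for c
  have Fc: "F (?E `` {x}) = ?E' `` {g x}" if "x \<in> A" for x
  proof (intro equalityI subsetI)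
    fix z assume "z \<in> F (?E `` {x})"
    then obtain y where y: "(x, y) \<in> ?E" "(g y, z) \<in> ?E'" by (auto simp: F_def)
    then have "y \<in> A" by (auto simp: hom_rel_def)
    then show "z \<in> ?E' `` {g x}" using y relg[OF that] E' by (auto simp: equiv_def dest: transD)
  next
    fix z assume "z \<in> ?E' `` {g x}"
    then show "z \<in> F (?E `` {x})" using E that unfolding F_def equiv_def refl_on_def by blast
  qed
  have bij: "bij_betw F (A // ?E) (A' // ?E')"
  proof (rule bij_betwI')
    fix c d assume "c \<in> A // ?E" "d \<in> A // ?E"
    then obtain x y where xy: "x \<in> A" "y \<in> A" "c = ?E `` {x}" "d = ?E `` {y}"
      by (auto elim!: quotientE)
    show "F c = F d \<longleftrightarrow> c = d"
      using xy Fc relg[of x y] eq_equiv_class_iff[OF E, of x y] eq_equiv_class_iff[OF E', of "g x" "g y"] g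
      by simp
  next
    fix c assume "c \<in> A // ?E"
    then show "F c \<in> A' // ?E'" using Fc g(1) by (metis quotientE quotientI)
  next
    fix c' assume "c' \<in> A' // ?E'"
    then obtain x' where x': "x' \<in> A'" "c' = ?E' `` {x'}" by (auto elim!: quotientE)
    obtain x where x: "x \<in> A" "R x x'" using r x' by blast
    have "(g x, x') \<in> ?E'" using rel[of x "g x" x x'] x x' g E by (auto simp: equiv_def refl_on_def)
    then have "c' = F (?E `` {x})" using Fc x x' equiv_class_eq[OF E'] by metis
    then show "\<exists>c\<in>A // ?E. c' = F c" using x by (auto intro: quotientI)
  qed
  then show "finite (A // ?E) \<longleftrightarrow> finite (A' // ?E')" by (rule bij_betw_finite)
  show "mass A H = mass A' H'"
    unfolding mass_def sum.reindex_bij_betw[OF bij, symmetric]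
  proof (rule sum.cong[OF refl])
    fix c assume c: "c \<in> A // ?E"
    then obtain x where x: "x \<in> A" "c = ?E `` {x}" by (auto elim!: quotientE)
    then have xc: "x \<in> c" using E by (auto simp: equiv_def refl_on_def)
    have "F c = ?E' `` {g x}" using Fc x by simp
    then have gx: "g x \<in> F c" "F c \<in> A' // ?E'"
      using g x E' by (auto simp: equiv_def refl_on_def intro: quotientI)
    show "1 / of_nat (card (H (SOME x. x \<in> c) (SOME x. x \<in> c))) =
      (1 :: rat) / of_nat (card (H' (SOME x. x \<in> F c) (SOME x. x \<in> F c)))"
      using card_some_hom[OF W c xc] card_some_hom[OF w gx(2,1)] cd[of x "g x" x "g x"] x g by simp
  qed
qed

text \<open>Delivers the comparison of Hom sets in the shape that \<open>mass_transfer\<close> asks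
  for. In the applications a morphism and its counterpart are linked by an equation, and unique
  solvability in each direction is easier to state than a pair of inverse maps.\<close>

lemma bij_rel_card:
  assumes A: "\<And>a. a \<in> A \<Longrightarrow> \<exists>!b. b \<in> B \<and> P a b"
    and B: "\<And>b. b \<in> B \<Longrightarrow> \<exists>!a. a \<in> A \<and> P a b"
  shows "(A = {} \<longleftrightarrow> B = {}) \<and> card A = card B"
proof
  show "A = {} \<longleftrightarrow> B = {}" using A B by blast
  have "bij_betw (\<lambda>a. THE b. b \<in> B \<and> P a b) A B"
  proof (rule bij_betw_byWitness[where f' = "\<lambda>b. THE a. a \<in> A \<and> P a b"])
    show "\<forall>a\<in>A. (THE a'. a' \<in> A \<and> P a' (THE b. b \<in> B \<and> P a b)) = a"
      using theI'[OF A] by (intro ballI the1_equality[OF B]) auto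
    show "\<forall>b\<in>B. (THE b'. b' \<in> B \<and> P (THE a. a \<in> A \<and> P a b) b') = b"
      using theI'[OF B] by (intro ballI the1_equality[OF A]) auto
    show "(\<lambda>a. THE b. b \<in> B \<and> P a b) ` A \<subseteq> B" using theI'[OF A] by blast
    show "(\<lambda>b. THE a. a \<in> A \<and> P a b) ` B \<subseteq> A" using theI'[OF B] by blast
  qed
  then show "card A = card B" by (rule bij_betw_same_card)
qed

text \<open>Morphisms are bare values (matrices, scalars) and composition is a total operation on
  them. The four cancellation laws make composition with a fixed morphism a bijection of Hom sets,
  on which the cardinality comparisons rest.\<close>

locale hom_groupoid =
  fixes A :: "'a set" and H :: "'a \<Rightarrow> 'a \<Rightarrow> 'm set" and cmp :: "'m \<Rightarrow> 'm \<Rightarrow> 'm" and ivs :: "'m \<Rightarrow> 'm"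
  assumes ident: "x \<in> A \<Longrightarrow> H x x \<noteq> {}"
    and cmp: "x \<in> A \<Longrightarrow> y \<in> A \<Longrightarrow> z \<in> A \<Longrightarrow> m \<in> H x y \<Longrightarrow> n \<in> H y z \<Longrightarrow> cmp n m \<in> H x z"
    and ivs: "x \<in> A \<Longrightarrow> y \<in> A \<Longrightarrow> m \<in> H x y \<Longrightarrow> ivs m \<in> H y x"
    and cancel_left: "x \<in> A \<Longrightarrow> y \<in> A \<Longrightarrow> z \<in> A \<Longrightarrow> m \<in> H x y \<Longrightarrow> n \<in> H z x \<Longrightarrow> cmp (ivs m) (cmp m n) = n"
    and cancel_left': "x \<in> A \<Longrightarrow> y \<in> A \<Longrightarrow> z \<in> A \<Longrightarrow> m \<in> H x y \<Longrightarrow> n \<in> H z y \<Longrightarrow> cmp m (cmp (ivs m) n) = n"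
    and cancel_right: "x \<in> A \<Longrightarrow> y \<in> A \<Longrightarrow> z \<in> A \<Longrightarrow> m \<in> H x y \<Longrightarrow> n \<in> H y z \<Longrightarrow> cmp (cmp n m) (ivs m) = n"
    and cancel_right': "x \<in> A \<Longrightarrow> y \<in> A \<Longrightarrow> z \<in> A \<Longrightarrow> m \<in> H x y \<Longrightarrow> n \<in> H x z \<Longrightarrow> cmp (cmp n (ivs m)) m = n"
begin

lemma card_hom_left:
  assumes "x \<in> A" "y \<in> A" "z \<in> A" "m \<in> H x y" shows "card (H z x) = card (H z y)"
  by (rule bij_betw_same_card, rule bij_betw_byWitness[where f = "cmp m" and f' = "cmp (ivs m)"])
     (use assms cancel_left[of x y z m] cancel_left'[of x y z m] cmp ivs in blast)+

lemma card_hom_right: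
  assumes "x \<in> A" "y \<in> A" "z \<in> A" "m \<in> H x y" shows "card (H y z) = card (H x z)"
  by (rule bij_betw_same_card, rule bij_betw_byWitness[where f = "\<lambda>n. cmp n m" and f' = "\<lambda>n. cmp n (ivs m)"])
     (use assms cancel_right[of x y z m] cancel_right'[of x y z m] cmp ivs in blast)+

lemma equiv_hom_rel: "equiv A (hom_rel A H)"
proof (rule equivI)
  show "hom_rel A H \<subseteq> A \<times> A" by (auto simp: hom_rel_def)
  show "refl_on A (hom_rel A H)" using ident by (auto simp: hom_rel_def refl_on_def)
  show "sym (hom_rel A H)" unfolding sym_def hom_rel_def using ivs by blast
  show "trans (hom_rel A H)" unfolding trans_def hom_rel_def using cmp by blast
qed

lemma weighted: "weighted A H"
  unfolding weighted_def
proof (intro conjI equiv_hom_rel ballI impI)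
  fix x y assume xy: "x \<in> A" "y \<in> A" "H x y \<noteq> {}"
  then obtain m where "m \<in> H x y" by blast
  with xy show "card (H x x) = card (H y y)"
    using card_hom_left[of x y x m] card_hom_right[of x y y m] by simp
qed

end

text \<open>Every object has an odd morphism to some object, so an isomorphism class either splits into two
  classes for even morphisms, or stays whole while its automorphism group is halved.\<close>

lemma (in hom_groupoid) mass_even:
  fixes sg :: "'m \<Rightarrow> int"
  assumes sg: "\<And>x y m. x \<in> A \<Longrightarrow> y \<in> A \<Longrightarrow> m \<in> H x y \<Longrightarrow> sg m = 1 \<or> sg m = -1"
    and sg_cmp: "\<And>m n. sg (cmp m n) = sg m * sg n"
    and sg_ivs: "\<And>x y m. x \<in> A \<Longrightarrow> y \<in> A \<Longrightarrow> m \<in> H x y \<Longrightarrow> sg (ivs m) = sg m"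
    and odd: "\<And>x. x \<in> A \<Longrightarrow> \<exists>y\<in>A. \<exists>m\<in>H x y. sg m = -1"
    and even: "\<And>x y. H1 x y = {m \<in> H x y. sg m = 1}"
    and fin: "finite (A // hom_rel A H1)"
  shows "mass A H1 = 2 * mass A H"
proof -
  have one: "\<exists>m\<in>H x x. sg m = 1" if x: "x \<in> A" for x
  proof -
    obtain m where m: "m \<in> H x x" using ident[OF x] by auto
    then have "cmp m (ivs m) \<in> H x x" using cmp[of x x x "ivs m" m] ivs[of x x m] x by simp
    moreover have "sg (cmp m (ivs m)) = 1"
      using sg[OF x x m] sg_ivs[OF x x m] by (auto simp: sg_cmp)
    ultimately show ?thesis by blast
  qed
  interpret E: hom_groupoid A H1 cmp ivs
  proof unfold_locales
    fix x assume "x \<in> A" then show "H1 x x \<noteq> {}" using one[of x] by (auto simp: even)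
  next
    fix x y z m n assume "x \<in> A" "y \<in> A" "z \<in> A" "m \<in> H1 x y" "n \<in> H1 y z"
    then show "cmp n m \<in> H1 x z" using cmp[of x y z m n] by (auto simp: even sg_cmp)
  next
    fix x y m assume "x \<in> A" "y \<in> A" "m \<in> H1 x y"
    then show "ivs m \<in> H1 y x" using ivs[of x y m] sg_ivs[of x y m] by (auto simp: even)
  next
    fix x y z m n assume "x \<in> A" "y \<in> A" "z \<in> A" "m \<in> H1 x y" "n \<in> H1 z x"
    then show "cmp (ivs m) (cmp m n) = n" using cancel_left[of x y z m n] by (simp add: even)
  next
    fix x y z m n assume "x \<in> A" "y \<in> A" "z \<in> A" "m \<in> H1 x y" "n \<in> H1 z y"
    then show "cmp m (cmp (ivs m) n) = n" using cancel_left'[of x y z m n] by (simp add: even)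
  next
    fix x y z m n assume "x \<in> A" "y \<in> A" "z \<in> A" "m \<in> H1 x y" "n \<in> H1 y z"
    then show "cmp (cmp n m) (ivs m) = n" using cancel_right[of x y z m n] by (simp add: even)
  next
    fix x y z m n assume "x \<in> A" "y \<in> A" "z \<in> A" "m \<in> H1 x y" "n \<in> H1 x z"
    then show "cmp (cmp n (ivs m)) m = n" using cancel_right'[of x y z m n] by (simp add: even)
  qed
  let ?E = "hom_rel A H" and ?E1 = "hom_rel A H1"
  have sub: "?E1 \<subseteq> ?E" by (auto simp: hom_rel_def even)
  have rfl: "x \<in> ?E `` {x}" "x \<in> ?E1 `` {x}" if "x \<in> A" for x
    using equiv_hom_rel E.equiv_hom_rel that by (auto simp: equiv_def refl_on_def)
  have cls: "?E `` (?E1 `` {x}) = ?E `` {x}" if "x \<in> A" for x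
  proof (intro equalityI subsetI)
    fix z assume "z \<in> ?E `` (?E1 `` {x})"
    then obtain y where "(x, y) \<in> ?E" "(y, z) \<in> ?E" using sub by blast
    then show "z \<in> ?E `` {x}" using equiv_hom_rel by (auto simp: equiv_def dest: transD)
  qed (use rfl[OF that] in blast)
  have img: "(\<lambda>d. ?E `` d) ` (A // ?E1) \<subseteq> A // ?E"
    using cls by (auto elim!: quotientE intro!: quotientI)
  have surj: "A // ?E \<subseteq> (\<lambda>d. ?E `` d) ` (A // ?E1)"
  proof
    fix c assume "c \<in> A // ?E"
    then obtain x where "x \<in> A" "c = ?E `` {x}" by (auto elim!: quotientE)
    then show "c \<in> (\<lambda>d. ?E `` d) ` (A // ?E1)" using cls by (metis image_eqI quotientI)
  qed
  have finE: "finite (A // ?E)" using finite_subset[OF surj] fin by blast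
  \<comment> \<open>Even classes are grouped by the full class that contains them; each group is
    shown to contribute twice the weight of that class.\<close>
  have "mass A H1 = (\<Sum>c\<in>A // ?E. \<Sum>d | d \<in> A // ?E1 \<and> ?E `` d = c.
      1 / of_nat (card (H1 (SOME x. x \<in> d) (SOME x. x \<in> d))))"
    unfolding mass_def by (rule sum.group[OF fin finE img, symmetric])
  also have "\<dots> = (\<Sum>c\<in>A // ?E. 2 * (1 / of_nat (card (H (SOME x. x \<in> c) (SOME x. x \<in> c)))))"
  proof (rule sum.cong[OF refl])
    fix c assume c: "c \<in> A // ?E"
    then obtain x where x: "x \<in> A" "c = ?E `` {x}" by (auto elim!: quotientE)
    obtain y m where y: "y \<in> A" and m: "m \<in> H x y" "sg m = -1" using odd x by blast
    have c_wt: "card (H (SOME x. x \<in> c) (SOME x. x \<in> c)) = card (H x x)"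
      using card_some_hom[OF weighted c] rfl x by blast
    have d_wt: "card (H1 (SOME x. x \<in> ?E1 `` {z}) (SOME x. x \<in> ?E1 `` {z})) = card (H1 z z)"
      if "z \<in> A" for z
      using card_some_hom[OF E.weighted quotientI[OF that]] rfl that by blast
    have "?E `` {y} = c"
      using x y m equiv_class_eq[OF equiv_hom_rel, of x y] by (auto simp: hom_rel_def)
    \<comment> \<open>Any \<open>z\<close> in the class receives a morphism from \<open>x\<close>.
      If it is odd, composing it with the inverse of the odd \<open>m\<close> gives an even one from
      \<open>y\<close>, so at most two even classes lie over \<open>c\<close>.\<close>
    then have fib: "{d \<in> A // ?E1. ?E `` d = c} = {?E1 `` {x}, ?E1 `` {y}}" (is "?L = ?R")
    proof (intro equalityI subsetI)
      fix d assume "d \<in> ?L"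
      then have d: "d \<in> A // ?E1" "?E `` d = c" by blast+
      from d(1) obtain z where z: "z \<in> A" "d = ?E1 `` {z}" by (rule quotientE)
      have "?E `` {z} = ?E `` {x}" using cls[OF z(1)] d z x by simp
      then have "(x, z) \<in> ?E" using x z(1) eq_equiv_class_iff[OF equiv_hom_rel, of x z] by simp
      then obtain n where n: "n \<in> H x z" unfolding hom_rel_def by blast
      show "d \<in> ?R"
      proof (cases "sg n = 1")
        case True
        then have "(x, z) \<in> ?E1" using n x z by (auto simp: hom_rel_def even)
        then show ?thesis using z equiv_class_eq[OF E.equiv_hom_rel, of x z] by simp
      next
        case False
        then have "cmp n (ivs m) \<in> H1 y z"
          using n m x y z cmp[of y x z "ivs m" n] ivs[of x y m] sg[of x z n] sg_ivs[of x y m]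
          by (auto simp: even sg_cmp)
        then have "(y, z) \<in> ?E1" using y z by (auto simp: hom_rel_def)
        then show ?thesis using z equiv_class_eq[OF E.equiv_hom_rel, of y z] by simp
      qed
    qed (use x y cls in \<open>auto intro: quotientI\<close>)
    show "(\<Sum>d | d \<in> A // ?E1 \<and> ?E `` d = c. 1 / of_nat (card (H1 (SOME x. x \<in> d) (SOME x. x \<in> d)))) =
        2 * (1 / rat_of_nat (card (H (SOME x. x \<in> c) (SOME x. x \<in> c))))"
    proof (cases "?E1 `` {x} = ?E1 `` {y}")
      \<comment> \<open>One even class: an even \<open>n\<close> from \<open>x\<close> to
        \<open>y\<close> turns \<open>m\<close> into an odd automorphism \<open>s\<close> of
        \<open>x\<close>, and composing with \<open>s\<close> exchanges even and odd automorphisms.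
        The weight doubles because the group is halved.\<close>
      case True
      then have "(x, y) \<in> ?E1" using eq_equiv_class_iff[OF E.equiv_hom_rel x(1) y] by simp
      then obtain n where n: "n \<in> H x y" "sg n = 1" unfolding hom_rel_def even by blast
      define s where "s = cmp (ivs n) m"
      have s: "s \<in> H x x" "sg s = -1"
        using n m x y cmp[of x y x m "ivs n"] ivs[of x y n] sg_ivs[of x y n] by (auto simp: s_def sg_cmp)
      have "bij_betw (cmp s) (H1 x x) {n \<in> H x x. sg n \<noteq> 1}"
      proof (rule bij_betw_byWitness[where f' = "cmp (ivs s)"])
        show "cmp s ` H1 x x \<subseteq> {n \<in> H x x. sg n \<noteq> 1}"
        proof
          fix k assume "k \<in> cmp s ` H1 x x"
          then obtain n where n: "k = cmp s n" "n \<in> H x x" "sg n = 1" unfolding even by blast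
          then show "k \<in> {n \<in> H x x. sg n \<noteq> 1}"
            using s x cmp[of x x x n s] by (simp add: sg_cmp)
        qed
        show "cmp (ivs s) ` {n \<in> H x x. sg n \<noteq> 1} \<subseteq> H1 x x"
        proof
          fix k assume "k \<in> cmp (ivs s) ` {n \<in> H x x. sg n \<noteq> 1}"
          then obtain n where n: "k = cmp (ivs s) n" "n \<in> H x x" "sg n \<noteq> 1" by blast
          then show "k \<in> H1 x x"
            using s x cmp[of x x x n "ivs s"] ivs[of x x s] sg[of x x n] sg_ivs[of x x s]
            by (simp add: even sg_cmp)
        qed
        show "\<forall>a\<in>H1 x x. cmp (ivs s) (cmp s a) = a"
          using s x cancel_left[of x x x s] unfolding even by blast
        show "\<forall>a\<in>{n \<in> H x x. sg n \<noteq> 1}. cmp s (cmp (ivs s) a) = a"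
          using s x cancel_left'[of x x x s] by blast
      qed
      note bij = this
      have un: "H x x = H1 x x \<union> {n \<in> H x x. sg n \<noteq> 1}" by (auto simp: even)
      have "card (H x x) = 2 * card (H1 x x)"
      proof (cases "finite (H1 x x)")
        case True
        then have "card (H x x) = card (H1 x x) + card {n \<in> H x x. sg n \<noteq> 1}"
          using bij_betw_finite[OF bij] by (subst un, intro card_Un_disjoint) (auto simp: even)
        then show ?thesis using bij_betw_same_card[OF bij] by simp
      next
        case False
        then have "infinite (H x x)" using un by (metis finite_Un)
        then show ?thesis using False by simp
      qed
      then show ?thesis unfolding fib c_wt using True d_wt[OF x(1)] by simp
    next
      \<comment> \<open>Two even classes: an odd automorphism of \<open>x\<close> or
        \<open>y\<close> would turn \<open>m\<close> into an even morphism, so all automorphisms are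
        even and both classes keep the full weight.\<close>
      case False
      have no: "sg n = 1" if z: "z \<in> {x, y}" and n: "n \<in> H z z" for z n
      proof (rule ccontr)
        assume "sg n \<noteq> 1"
        then have n1: "sg n = -1" using sg[OF _ _ n] x y z by blast
        have "\<exists>k. k \<in> H1 x y"
        proof (cases "z = x")
          case True
          then have "cmp m n \<in> H1 x y" using True n n1 m x y cmp[of x x y n m] by (auto simp: even sg_cmp)
          then show ?thesis ..
        next
          case False
          then have "cmp n m \<in> H1 x y" using False n n1 m x y z cmp[of x y y m n] by (auto simp: even sg_cmp)
          then show ?thesis ..
        qed
        then have "(x, y) \<in> ?E1" using x y unfolding hom_rel_def by blast
        then show False using \<open>?E1 `` {x} \<noteq> ?E1 `` {y}\<close>
            eq_equiv_class_iff[OF E.equiv_hom_rel x(1) y] by simp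
      qed
      have "H1 x x = H x x" unfolding even using no[of x] by blast
      moreover have "H1 y y = H y y" unfolding even using no[of y] by blast
      moreover have "card (H y y) = card (H x x)"
        using card_hom_left[OF x(1) y x(1) m(1)] card_hom_right[OF x(1) y y m(1)] by simp
      ultimately show ?thesis unfolding fib c_wt using False d_wt[OF x(1)] d_wt[OF y] by simp
    qed
  qed
  also have "\<dots> = 2 * mass A H" by (simp add: mass_def sum_distrib_left)
  finally show ?thesis .
qed

lemma class_restrict:
  assumes inv: "\<And>x y. x \<in> A \<Longrightarrow> y \<in> A \<Longrightarrow> H x y \<noteq> {} \<Longrightarrow> p x = p y" and x: "x \<in> A"
  shows "hom_rel {y \<in> A. p y = p x} H `` {x} = hom_rel A H `` {x}"
  using assms by (fastforce simp: hom_rel_def)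

text \<open>By invariance a class never leaves its fibre, so the classes of the fibres are literally
  the classes of the whole groupoid, and the sum is only regrouped.\<close>

lemma
  assumes W: "weighted A H"
    and inv: "\<And>x y. x \<in> A \<Longrightarrow> y \<in> A \<Longrightarrow> H x y \<noteq> {} \<Longrightarrow> p x = p y"
    and T: "finite T" "p ` A \<subseteq> T"
    and fin: "\<And>t. t \<in> T \<Longrightarrow> finite ({x \<in> A. p x = t} // hom_rel {x \<in> A. p x = t} H)"
  shows mass_partition: "mass A H = (\<Sum>t\<in>T. mass {x \<in> A. p x = t} H)"
    and finite_partition: "finite (A // hom_rel A H)"
proof -
  define Q where "Q t = {x \<in> A. p x = t} // hom_rel {x \<in> A. p x = t} H" for t
  have Q: "A // hom_rel A H = (\<Union>t\<in>T. Q t)"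
  proof (intro equalityI subsetI)
    fix c assume "c \<in> A // hom_rel A H"
    then obtain x where "x \<in> A" "c = hom_rel A H `` {x}" by (auto elim!: quotientE)
    then have "c \<in> Q (p x)" "p x \<in> T"
      using T class_restrict[of A H p x, OF inv] quotientI[of x "{y \<in> A. p y = p x}" "hom_rel {y \<in> A. p y = p x} H"]
      by (auto simp: Q_def)
    then show "c \<in> (\<Union>t\<in>T. Q t)" by blast
  next
    fix c assume "c \<in> (\<Union>t\<in>T. Q t)"
    then obtain x where "x \<in> A" "c = hom_rel {y \<in> A. p y = p x} H `` {x}" by (auto simp: Q_def elim!: quotientE)
    then show "c \<in> A // hom_rel A H" using class_restrict[of A H p x, OF inv] by (auto intro: quotientI)
  qed
  show "finite (A // hom_rel A H)" unfolding Q using T fin by (auto simp: Q_def)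
  have disj: "Q s \<inter> Q t = {}" if "s \<noteq> t" for s t
  proof -
    have "False" if cs: "c \<in> Q s" "c \<in> Q t" for c
    proof -
      obtain x where x: "x \<in> A" "p x = s" "c = hom_rel {x \<in> A. p x = s} H `` {x}"
        using cs unfolding Q_def by (elim quotientE) auto
      obtain y where y: "y \<in> A" "p y = t" "c = hom_rel {x \<in> A. p x = t} H `` {y}"
        using cs unfolding Q_def by (elim quotientE) auto
      have "c = hom_rel A H `` {x}" using x class_restrict[of A H p x, OF inv] by simp
      then have "x \<in> c" using W x by (auto simp: weighted_def equiv_def refl_on_def)
      then show False using x y \<open>s \<noteq> t\<close> by (auto simp: hom_rel_def)
    qed
    then show ?thesis by blast
  qed
  show "mass A H = (\<Sum>t\<in>T. mass {x \<in> A. p x = t} H)"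
    unfolding mass_def Q
    by (subst sum.UNION_disjoint) (use T fin disj in \<open>auto simp: Q_def\<close>)
qed

section \<open>Ideals of quadratic orders\<close>

text \<open>The product of \<open>quad_alg D\<close> taken out of the record and combined with the
  addition of the product type, so that identities in the algebra become polynomial identities in
  the coordinates.\<close>

definition qmul :: "int \<Rightarrow> rat \<times> rat \<Rightarrow> rat \<times> rat \<Rightarrow> rat \<times> rat" where
  "qmul D x y = (fst x * fst y + of_int D * snd x * snd y, fst x * snd y + snd x * fst y)"

definition qconj :: "rat \<times> rat \<Rightarrow> rat \<times> rat" where
  "qconj x = (fst x, - snd x)"

definition qnorm :: "int \<Rightarrow> rat \<times> rat \<Rightarrow> rat" where
  "qnorm D x = fst x * fst x - of_int D * snd x * snd x"

definition qscale :: "rat \<Rightarrow> rat \<times> rat \<Rightarrow> rat \<times> rat" where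
  "qscale q x = (q * fst x, q * snd x)"

lemmas q_defs = qmul_def qconj_def qnorm_def qscale_def

lemma quad_alg_simps [simp]:
  "carrier (quad_alg D) = UNIV"
  "x \<otimes>\<^bsub>quad_alg D\<^esub> y = qmul D x y"
  "x \<oplus>\<^bsub>quad_alg D\<^esub> y = x + y"
  "\<one>\<^bsub>quad_alg D\<^esub> = (1, 0)"
  "\<zero>\<^bsub>quad_alg D\<^esub> = 0"
  by (simp_all add: quad_alg_def qmul_def split_def prod_eq_iff)

lemma qmul_comm: "qmul D x y = qmul D y x"
  and qmul_assoc: "qmul D (qmul D x y) z = qmul D x (qmul D y z)"
  and qmul_left_comm: "qmul D x (qmul D y z) = qmul D y (qmul D x z)"
  and qmul_add_left: "qmul D (x + y) z = qmul D x z + qmul D y z"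
  and qmul_add_right: "qmul D x (y + z) = qmul D x y + qmul D x z"
  and qmul_one: "qmul D (1, 0) x = x" "qmul D x (1, 0) = x"
  and qmul_zero: "qmul D 0 x = 0" "qmul D x 0 = 0"
  and qmul_minus: "qmul D (- x) y = - qmul D x y" "qmul D x (- y) = - qmul D x y"
  and qmul_scale: "qmul D (qscale q x) y = qscale q (qmul D x y)"
     "qmul D x (qscale q y) = qscale q (qmul D x y)"
  by (simp_all add: q_defs prod_eq_iff algebra_simps)

lemmas qmul_ac = qmul_assoc qmul_comm qmul_left_comm

lemma qscale_simps:
  "qscale q (x + y) = qscale q x + qscale q y" "qscale (q + r) x = qscale q x + qscale r x"
  "qscale q (qscale r x) = qscale (q * r) x" "qscale 1 x = x" "qscale 0 x = 0" "qscale q 0 = 0"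
  "qscale (- q) x = - qscale q x" "qscale q (- x) = - qscale q x"
  by (simp_all add: q_defs prod_eq_iff algebra_simps)

lemma qconj_simps:
  "qconj (qmul D x y) = qmul D (qconj x) (qconj y)" "qconj (x + y) = qconj x + qconj y"
  "qconj (- x) = - qconj x" "qconj (qconj x) = x" "qconj (qscale q x) = qscale q (qconj x)"
  "qconj 0 = 0"
  by (simp_all add: q_defs prod_eq_iff algebra_simps)

lemma qnorm_mult: "qnorm D (qmul D x y) = qnorm D x * qnorm D y"
  by (simp add: q_defs algebra_simps)

lemma qnorm_simps: "qnorm D (1, 0) = 1" "qnorm D (q, 0) = q * q" "qnorm D (qconj x) = qnorm D x"
  "qnorm D (qscale q x) = q * q * qnorm D x"
  by (simp_all add: q_defs algebra_simps)

lemma qmul_conj: "qmul D x (qconj x) = (qnorm D x, 0)" "qmul D (qconj x) x = (qnorm D x, 0)"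
  by (simp_all add: q_defs algebra_simps)

lemma qmul_rat: "qmul D (q, 0) x = qscale q x" "qmul D x (q, 0) = qscale q x"
  by (simp_all add: q_defs)

definition qinv :: "int \<Rightarrow> rat \<times> rat \<Rightarrow> rat \<times> rat" where
  "qinv D x = qscale (1 / qnorm D x) (qconj x)"

lemma qmul_qinv:
  assumes "qnorm D x \<noteq> 0" shows "qmul D x (qinv D x) = (1, 0)" "qmul D (qinv D x) x = (1, 0)"
  using assms by (simp_all add: qinv_def qmul_scale qmul_conj) (simp_all add: qscale_def)

lemma qmul_cancel:
  assumes "qnorm D x \<noteq> 0" "qmul D x y = qmul D x z" shows "y = z"
proof -
  have "qmul D (qinv D x) (qmul D x y) = qmul D (qinv D x) (qmul D x z)" using assms by simp
  then show ?thesis using qmul_qinv(2)[OF assms(1)] by (metis qmul_assoc qmul_one(1))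
qed

lemma cring_quad_alg: "cring (quad_alg D)"
proof (rule cringI)
  show "abelian_group (quad_alg D)"
  proof (rule abelian_groupI)
    fix x :: "rat \<times> rat"
    show "\<exists>y\<in>carrier (quad_alg D). y \<oplus>\<^bsub>quad_alg D\<^esub> x = \<zero>\<^bsub>quad_alg D\<^esub>"
      by (rule bexI[of _ "- x"]) simp_all
  qed (simp_all add: algebra_simps)
  show "comm_monoid (quad_alg D)"
    by (rule comm_monoidI) (simp_all add: qmul_ac qmul_one)
qed (simp add: qmul_add_left)

text \<open>The norm is multiplicative, and \<open>qinv\<close> inverts wherever it does not vanish.
  For square \<open>D\<close> there are nonzero zero divisors, hence conditions of the form
  \<open>qnorm D x \<noteq> 0\<close> in place of \<open>x \<noteq> 0\<close> below.\<close>

lemma Units_quad_alg: "Units (quad_alg D) = {x. qnorm D x \<noteq> 0}"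
proof (intro equalityI subsetI)
  fix x assume "x \<in> Units (quad_alg D)"
  then obtain y where "qmul D y x = (1, 0)" by (auto simp: Units_def)
  then have "qnorm D y * qnorm D x = 1" by (metis qnorm_mult qnorm_simps(1))
  then show "x \<in> {x. qnorm D x \<noteq> 0}" by auto
next
  fix x assume "x \<in> {x. qnorm D x \<noteq> 0}"
  then show "x \<in> Units (quad_alg D)" unfolding Units_def using qmul_qinv[of D x]
    by (intro CollectI conjI bexI[of _ "qinv D x"]) simp_all
qed

lemma a_inv_quad_alg: "\<ominus>\<^bsub>quad_alg D\<^esub> x = - x"
proof -
  interpret cring "quad_alg D" by (rule cring_quad_alg)
  show ?thesis by (rule minus_equality) simp_all
qed

lemma additive_subgroup_quad_alg:
  "additive_subgroup I (quad_alg D) \<longleftrightarrow> 0 \<in> I \<and> (\<forall>x\<in>I. \<forall>y\<in>I. x + y \<in> I) \<and> (\<forall>x\<in>I. - x \<in> I)"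
proof -
  have inv: "inv\<^bsub>add_monoid (quad_alg D)\<^esub> x = - x" for x
    using a_inv_quad_alg[of D x] unfolding a_inv_def .
  show ?thesis
    unfolding additive_subgroup_def subgroup_def inv
    by (intro iffI conjI ballI allI impI subsetI; (elim conjE)?; simp del: split_paired_All)
qed

lemma quad_ring_carrier: "(x, y) \<in> carrier (quad_ring D) \<longleftrightarrow>
    (\<exists>a b. x = of_int a + of_int b * of_int D / 2 \<and> y = of_int b / 2)"
  by (auto simp: quad_ring_simps quad_elt_def)

lemma quad_ring_mult: "x \<otimes>\<^bsub>quad_ring D\<^esub> y = qmul D x y"
  and quad_ring_add: "x \<oplus>\<^bsub>quad_ring D\<^esub> y = x + y"
  and quad_ring_one: "\<one>\<^bsub>quad_ring D\<^esub> = (1, 0)"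
  and quad_ring_zero: "\<zero>\<^bsub>quad_ring D\<^esub> = 0"
  using quad_alg_simps[of D] by (simp_all add: quad_ring_def)

lemma int_scale_mem:
  assumes "0 \<in> I" "\<forall>x\<in>I. \<forall>y\<in>I. x + y \<in> I" "\<forall>x\<in>I. - x \<in> I" "x \<in> I"
  shows "qscale (of_int n) x \<in> I"
proof -
  have nat: "qscale (of_nat k) x \<in> I" for k
    using assms by (induction k) (auto simp: qscale_simps)
  show ?thesis
  proof (cases "n \<ge> 0")
    case True then show ?thesis using nat[of "nat n"] by simp
  next
    case False
    then have "qscale (of_int n) x = - qscale (of_nat (nat (- n))) x"
      by (simp add: qscale_simps(7)[symmetric])
    then show ?thesis using nat[of "nat (- n)"] assms by simp
  qed
qed

locale quad =
  fixes D :: int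
  assumes D: "D \<in> Discs"
begin

abbreviation "K \<equiv> quad_alg D"
abbreviation "\<O> \<equiv> quad_ring D"
abbreviation qm (infixl \<open>\<odot>\<close> 70) where "x \<odot> y \<equiv> qmul D x y"
abbreviation nm where "nm \<equiv> qnorm D"
abbreviation ip (infixl \<open>\<diamondop>\<close> 70) where "I \<diamondop> J \<equiv> ideal_prod K I J"
abbreviation "AA \<equiv> inv_ideal_group K \<O>"
abbreviation "pr x \<equiv> (\<lambda>r. x \<odot> r) ` carrier \<O>"

sublocale O: cring \<O> using D by (rule cring_quad_ring)
sublocale K: cring K by (rule cring_quad_alg)

lemma D_nonzero: "D \<noteq> 0" using D by (auto simp: Discs_def)

lemma O_closed: "x \<in> carrier \<O> \<Longrightarrow> y \<in> carrier \<O> \<Longrightarrow> x \<odot> y \<in> carrier \<O>"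
  "x \<in> carrier \<O> \<Longrightarrow> y \<in> carrier \<O> \<Longrightarrow> x + y \<in> carrier \<O>"
  "(1, 0) \<in> carrier \<O>" "0 \<in> carrier \<O>"
  using O.m_closed[of x y] O.a_closed[of x y] O.one_closed O.zero_closed
  by (simp_all add: quad_ring_mult quad_ring_add quad_ring_one quad_ring_zero)

lemma O_uminus: "x \<in> carrier \<O> \<Longrightarrow> - x \<in> carrier \<O>"
proof (cases x)
  case (Pair u v)
  assume "x \<in> carrier \<O>"
  then obtain a b where "u = of_int a + of_int b * of_int D / 2" "v = of_int b / 2"
    using Pair quad_ring_carrier by blast
  then have "- u = of_int (-a) + of_int (-b) * of_int D / 2" "- v = of_int (-b) / 2" by simp_all
  then show ?thesis using Pair quad_ring_carrier[of "-u" "-v"] by (metis uminus_Pair)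
qed

definition module :: "(rat \<times> rat) set \<Rightarrow> bool" where
  "module I \<longleftrightarrow> 0 \<in> I \<and> (\<forall>x\<in>I. \<forall>y\<in>I. x + y \<in> I) \<and> (\<forall>x\<in>I. - x \<in> I) \<and>
     (\<forall>r\<in>carrier \<O>. \<forall>x\<in>I. r \<odot> x \<in> I)"

lemma fractional_iff: "fractional_ideal K \<O> I \<longleftrightarrow>
   module I \<and> (\<exists>d\<in>carrier \<O>. nm d \<noteq> 0 \<and> (\<forall>x\<in>I. d \<odot> x \<in> carrier \<O>))"
  unfolding fractional_ideal_def additive_subgroup_quad_alg module_def Units_quad_alg by auto

lemma ip_mem: "x \<in> I \<Longrightarrow> y \<in> J \<Longrightarrow> x \<odot> y \<in> I \<diamondop> J"
  using ideal_prod.prod[of x I y J K] by simp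

lemma ip_add: "x \<in> I \<diamondop> J \<Longrightarrow> y \<in> I \<diamondop> J \<Longrightarrow> x + y \<in> I \<diamondop> J"
  using ideal_prod.sum[of x K I J y] by simp

lemma ip_induct [consumes 1, case_names prod sum]:
  assumes "s \<in> I \<diamondop> J" "\<And>x y. x \<in> I \<Longrightarrow> y \<in> J \<Longrightarrow> P (x \<odot> y)"
    "\<And>s t. s \<in> I \<diamondop> J \<Longrightarrow> t \<in> I \<diamondop> J \<Longrightarrow> P s \<Longrightarrow> P t \<Longrightarrow> P (s + t)"
  shows "P s"
  using assms(1) by (induction rule: ideal_prod.induct) (use assms in auto)

lemma ip_subset: "(\<And>x y. x \<in> I \<Longrightarrow> y \<in> J \<Longrightarrow> x \<odot> y \<in> L) \<Longrightarrow>
    (\<And>x y. x \<in> L \<Longrightarrow> y \<in> L \<Longrightarrow> x + y \<in> L) \<Longrightarrow> I \<diamondop> J \<subseteq> L"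
proof
  fix s assume *: "\<And>x y. x \<in> I \<Longrightarrow> y \<in> J \<Longrightarrow> x \<odot> y \<in> L" "\<And>x y. x \<in> L \<Longrightarrow> y \<in> L \<Longrightarrow> x + y \<in> L" "s \<in> I \<diamondop> J"
  from *(3) show "s \<in> L" by (induction rule: ip_induct) (use * in blast)+
qed

lemma ip_comm_subset: "I \<diamondop> J \<subseteq> J \<diamondop> I"
  by (rule ip_subset) (metis ip_mem qmul_comm, rule ip_add)

lemma ip_comm: "I \<diamondop> J = J \<diamondop> I"
  using ip_comm_subset by blast

lemma ip_assoc_subset: "(I \<diamondop> J) \<diamondop> L \<subseteq> I \<diamondop> (J \<diamondop> L)"
proof (rule ip_subset)
  fix s z assume "s \<in> I \<diamondop> J" "z \<in> L"
  then show "s \<odot> z \<in> I \<diamondop> (J \<diamondop> L)"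
    by (induction rule: ip_induct) (simp_all add: qmul_assoc qmul_add_left ip_mem ip_add)
qed (rule ip_add)

lemma ip_assoc: "(I \<diamondop> J) \<diamondop> L = I \<diamondop> (J \<diamondop> L)"
proof (rule equalityI[OF ip_assoc_subset])
  have "I \<diamondop> (J \<diamondop> L) = (L \<diamondop> J) \<diamondop> I" by (metis ip_comm)
  also have "\<dots> \<subseteq> L \<diamondop> (J \<diamondop> I)" by (rule ip_assoc_subset)
  also have "\<dots> = (I \<diamondop> J) \<diamondop> L" by (metis ip_comm)
  finally show "I \<diamondop> (J \<diamondop> L) \<subseteq> (I \<diamondop> J) \<diamondop> L" .
qed

lemma ip_mono: "I \<subseteq> I' \<Longrightarrow> J \<subseteq> J' \<Longrightarrow> I \<diamondop> J \<subseteq> I' \<diamondop> J'"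
  by (rule ip_subset) (auto intro: ip_mem ip_add)

lemma ip_O: assumes "module I" shows "carrier \<O> \<diamondop> I = I"
proof
  show "carrier \<O> \<diamondop> I \<subseteq> I" using assms by (intro ip_subset) (auto simp: module_def)
  show "I \<subseteq> carrier \<O> \<diamondop> I" using ip_mem[OF O_closed(3)] by (auto simp: qmul_one)
qed

lemma module_ip: assumes "module I" "module J" shows "module (I \<diamondop> J)"
  unfolding module_def
proof (intro conjI ballI)
  show "0 \<in> I \<diamondop> J" using ip_mem[of 0 I 0 J] assms by (simp add: module_def qmul_zero)
  show "x + y \<in> I \<diamondop> J" if "x \<in> I \<diamondop> J" "y \<in> I \<diamondop> J" for x y using that by (rule ip_add)
  show "- x \<in> I \<diamondop> J" if "x \<in> I \<diamondop> J" for x using that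
  proof (induction rule: ip_induct)
    case (prod x y)
    then show ?case using ip_mem[of "- x" I y J] assms by (simp add: module_def qmul_minus)
  next
    case (sum s t) then show ?case using ip_add[of "- s" I J "- t"] by simp
  qed
  show "r \<odot> x \<in> I \<diamondop> J" if "r \<in> carrier \<O>" "x \<in> I \<diamondop> J" for r x using that(2)
  proof (induction rule: ip_induct)
    case (prod x y)
    then show ?case using ip_mem[of "r \<odot> x" I y J] assms that by (simp add: module_def qmul_assoc)
  next
    case (sum s t) then show ?case by (simp add: qmul_add_right ip_add)
  qed
qed

lemma module_O: "module (carrier \<O>)"
  using O_closed O_uminus by (auto simp: module_def)

lemma fractional_O: "fractional_ideal K \<O> (carrier \<O>)"
  unfolding fractional_iff using module_O O_closed(3)
  by (auto simp: qmul_one qnorm_simps intro!: bexI[of _ "(1, 0)"])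

lemma fractional_ip:
  assumes "fractional_ideal K \<O> I" "fractional_ideal K \<O> J"
  shows "fractional_ideal K \<O> (I \<diamondop> J)"
proof -
  obtain d e where d: "d \<in> carrier \<O>" "nm d \<noteq> 0" "\<forall>x\<in>I. d \<odot> x \<in> carrier \<O>"
    and e: "e \<in> carrier \<O>" "nm e \<noteq> 0" "\<forall>x\<in>J. e \<odot> x \<in> carrier \<O>"
    using assms unfolding fractional_iff by blast
  have "(d \<odot> e) \<odot> s \<in> carrier \<O>" if "s \<in> I \<diamondop> J" for s using that
  proof (induction rule: ip_induct)
    case (prod x y)
    have "(d \<odot> e) \<odot> (x \<odot> y) = (d \<odot> x) \<odot> (e \<odot> y)" by (simp add: qmul_ac)
    then show ?case using prod d e O_closed by simp
  next
    case (sum s t) then show ?case by (simp add: qmul_add_right O_closed)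
  qed
  then show ?thesis
    using assms d e O_closed(1)[of d e] unfolding fractional_iff
    by (intro conjI bexI[of _ "d \<odot> e"]) (simp_all add: module_ip qnorm_mult)
qed

lemma AA_simps [simp]: "carrier AA = {I. invertible_fractional_ideal K \<O> I}"
  "I \<otimes>\<^bsub>AA\<^esub> J = I \<diamondop> J" "\<one>\<^bsub>AA\<^esub> = carrier \<O>"
  by (simp_all add: inv_ideal_group_def)

lemma AA_frac: "I \<in> carrier AA \<Longrightarrow> fractional_ideal K \<O> I"
  by (simp add: invertible_fractional_ideal_def)

lemma AA_module: "I \<in> carrier AA \<Longrightarrow> module I"
  using AA_frac fractional_iff by blast

lemma AA_I: "fractional_ideal K \<O> I \<Longrightarrow> fractional_ideal K \<O> J \<Longrightarrow> I \<diamondop> J = carrier \<O> \<Longrightarrow> I \<in> carrier AA"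
  by (auto simp: invertible_fractional_ideal_def)

lemma AA_E:
  assumes "I \<in> carrier AA"
  obtains J where "J \<in> carrier AA" "I \<diamondop> J = carrier \<O>"
  using assms by (auto simp: invertible_fractional_ideal_def) (metis ip_comm)

lemma comm_group_AA: "comm_group AA"
proof (rule comm_groupI)
  fix I J assume IJ: "I \<in> carrier AA" "J \<in> carrier AA"
  obtain I' where I': "I' \<in> carrier AA" "I \<diamondop> I' = carrier \<O>" using AA_E IJ by blast
  obtain J' where J': "J' \<in> carrier AA" "J \<diamondop> J' = carrier \<O>" using AA_E IJ by blast
  have "(I \<diamondop> J) \<diamondop> (J' \<diamondop> I') = I \<diamondop> ((J \<diamondop> J') \<diamondop> I')" by (simp add: ip_assoc)
  also have "\<dots> = carrier \<O>" using I' J' ip_O AA_module by simp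
  finally have "(I \<diamondop> J) \<diamondop> (J' \<diamondop> I') = carrier \<O>" .
  then have "I \<diamondop> J \<in> carrier AA"
    by (intro AA_I[of "I \<diamondop> J" "J' \<diamondop> I'"] fractional_ip AA_frac IJ I'(1) J'(1))
  then show "I \<otimes>\<^bsub>AA\<^esub> J \<in> carrier AA" by simp
next
  show "\<one>\<^bsub>AA\<^esub> \<in> carrier AA"
    using AA_I[OF fractional_O fractional_O] ip_O[OF module_O] by simp
next
  fix I assume I: "I \<in> carrier AA"
  show "\<one>\<^bsub>AA\<^esub> \<otimes>\<^bsub>AA\<^esub> I = I" using ip_O[OF AA_module[OF I]] by simp
  show "\<exists>J\<in>carrier AA. J \<otimes>\<^bsub>AA\<^esub> I = \<one>\<^bsub>AA\<^esub>"
    using AA_E[OF I] ip_comm by (metis AA_simps(2,3))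
next
  fix I J L show "I \<otimes>\<^bsub>AA\<^esub> J \<otimes>\<^bsub>AA\<^esub> L = I \<otimes>\<^bsub>AA\<^esub> (J \<otimes>\<^bsub>AA\<^esub> L)" by (simp add: ip_assoc)
next
  fix I J show "I \<otimes>\<^bsub>AA\<^esub> J = J \<otimes>\<^bsub>AA\<^esub> I" by (simp add: ip_comm)
qed

sublocale A: comm_group AA by (rule comm_group_AA)
sublocale KU: comm_group "units_of K" by (rule K.units_comm_group)

lemma KU_simps: "carrier (units_of K) = {x. nm x \<noteq> 0}" "x \<otimes>\<^bsub>units_of K\<^esub> y = x \<odot> y"
  "\<one>\<^bsub>units_of K\<^esub> = (1, 0)"
  by (simp_all add: units_of_def Units_quad_alg)

lemma ip_pr:
  assumes "module I" shows "pr x \<diamondop> I = (\<lambda>y. x \<odot> y) ` I"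
proof
  show "pr x \<diamondop> I \<subseteq> (\<lambda>y. x \<odot> y) ` I"
  proof (rule ip_subset)
    fix s y assume "s \<in> pr x" "y \<in> I"
    then obtain r where "r \<in> carrier \<O>" "s = x \<odot> r" by auto
    then show "s \<odot> y \<in> (\<lambda>y. x \<odot> y) ` I"
      using assms \<open>y \<in> I\<close> by (auto simp: qmul_assoc module_def)
  next
    fix s t assume "s \<in> (\<lambda>y. x \<odot> y) ` I" "t \<in> (\<lambda>y. x \<odot> y) ` I"
    then obtain y z where "y \<in> I" "z \<in> I" "s + t = x \<odot> (y + z)" by (auto simp: qmul_add_right)
    then show "s + t \<in> (\<lambda>y. x \<odot> y) ` I" using assms unfolding module_def by blast
  qed
  show "(\<lambda>y. x \<odot> y) ` I \<subseteq> pr x \<diamondop> I"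
  proof
    fix s assume "s \<in> (\<lambda>y. x \<odot> y) ` I"
    then obtain y where y: "y \<in> I" "s = x \<odot> y" by auto
    have "x \<odot> (1, 0) \<in> pr x" using O_closed by blast
    then show "s \<in> pr x \<diamondop> I" using ip_mem[of "x \<odot> (1,0)" "pr x" y I] y by (simp add: qmul_one)
  qed
qed

lemma module_scale: assumes "module I" shows "module ((\<lambda>y. x \<odot> y) ` I)"
  unfolding module_def
proof (intro conjI ballI)
  show "0 \<in> (\<lambda>y. x \<odot> y) ` I" using assms by (auto simp: module_def qmul_zero intro: image_eqI[of _ _ 0])
  fix s assume "s \<in> (\<lambda>y. x \<odot> y) ` I"
  then obtain y where y: "y \<in> I" "s = x \<odot> y" by auto
  show "- s \<in> (\<lambda>y. x \<odot> y) ` I"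
    using y assms by (auto simp: module_def qmul_minus intro: image_eqI[of _ _ "- y"])
  show "r \<odot> s \<in> (\<lambda>y. x \<odot> y) ` I" if "r \<in> carrier \<O>" for r
    using y that assms unfolding module_def by (metis qmul_left_comm imageI)
  fix t assume "t \<in> (\<lambda>y. x \<odot> y) ` I"
  then obtain z where "z \<in> I" "s + t = x \<odot> (y + z)" using y by (auto simp: qmul_add_right)
  then show "s + t \<in> (\<lambda>y. x \<odot> y) ` I" using y assms unfolding module_def by blast
qed

lemma O_scale_denom:
  obtains d where "d \<in> carrier \<O>" "nm d \<noteq> 0" "d \<odot> x \<in> carrier \<O>"
proof (cases x)
  case (Pair u v)
  obtain a n where u: "u = of_int a / of_int n" "n > 0" by (metis Rat_cases Fract_of_int_quotient)
  obtain b m where v: "v = of_int b / of_int m" "m > 0" by (metis Rat_cases Fract_of_int_quotient)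
  have d: "(of_int (n * m), 0) \<in> carrier \<O>"
    unfolding quad_ring_carrier by (rule exI[of _ "n * m"], rule exI[of _ 0]) simp
  have "(of_int (n * m), 0) \<odot> x = (of_int (a * m), of_int (b * n))"
    using u v Pair by (simp add: q_defs field_simps)
  moreover have "(of_int (a * m), of_int (b * n)) \<in> carrier \<O>"
    unfolding quad_ring_carrier
    by (rule exI[of _ "a * m - b * n * D"], rule exI[of _ "2 * b * n"]) simp
  moreover have "nm (of_int (n * m), 0) \<noteq> 0" using u v by (simp add: qnorm_def)
  ultimately show ?thesis using that[OF d] by simp
qed

lemma fractional_pr: "fractional_ideal K \<O> (pr x)"
proof -
  obtain d where d: "d \<in> carrier \<O>" "nm d \<noteq> 0" "d \<odot> x \<in> carrier \<O>" by (rule O_scale_denom)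
  then show ?thesis unfolding fractional_iff using module_scale[OF module_O]
    by (auto simp: qmul_assoc[symmetric] O_closed intro!: bexI[of _ d])
qed

lemma pr_mult: "pr x \<diamondop> pr y = pr (x \<odot> y)"
  by (simp add: ip_pr[OF module_scale[OF module_O]] image_image qmul_assoc)

lemma pr_AA: "nm x \<noteq> 0 \<Longrightarrow> pr x \<in> carrier AA"
  by (rule AA_I[OF fractional_pr fractional_pr[of "qinv D x"]]) (simp add: pr_mult qmul_qinv qmul_one)

lemma pr_hom: "(\<lambda>x. pr x) \<in> hom (units_of K) AA"
  using pr_AA pr_mult unfolding hom_def KU_simps AA_simps by auto

lemma principal_eq: "principal_fractional_ideals K \<O> = (\<lambda>x. pr x) ` carrier (units_of K)"
  by (auto simp: principal_fractional_ideals_def KU_simps Units_quad_alg)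

lemma Pic_eq: "Pic D = AA Mod ((\<lambda>x. pr x) ` carrier (units_of K))"
  by (simp add: Pic_def principal_eq)

lemma Pic_class_eq: "Pic_class D J = (\<lambda>x. pr x) ` carrier (units_of K) #>\<^bsub>AA\<^esub> J"
  by (simp add: Pic_class_def principal_eq)

end

section \<open>Counting cube roots in an extension of groups\<close>

text \<open>The group theory behind the count, free of number theory. \<open>A\<close> will be the
  invertible fractional ideals, \<open>W\<close> the units of the quadratic algebra and
  \<open>pr\<close> the passage to principal ideals; then \<open>C\<close> is the class group, and
  \<open>U\<close>, the kernel of \<open>pr\<close>, is the unit group of the order.\<close>

locale cube_count = A: comm_group A + W: comm_group W
  for A :: "('a, 'b) monoid_scheme" (structure) and W :: "('w, 'c) monoid_scheme" +
  fixes pr :: "'w \<Rightarrow> 'a"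
  assumes pr: "pr \<in> hom W A"
begin

abbreviation "P \<equiv> pr ` carrier W"
abbreviation "C \<equiv> A Mod P"
abbreviation wm (infixl \<open>\<odot>\<close> 70) where "x \<odot> y \<equiv> x \<otimes>\<^bsub>W\<^esub> y"
definition U where "U = {u \<in> carrier W. pr u = \<one>}"
definition cubes where "cubes a = {(I, \<gamma>). I \<in> carrier A \<and> \<gamma> \<in> carrier W \<and> pr \<gamma> \<otimes> (I [^] (3::nat)) = a}"
text \<open>The cube keeps \<open>pr \<gamma> \<otimes> I [^] 3\<close> constant along morphisms:
  the ideal is divided by \<open>pr \<kappa>\<close> while the second component is multiplied by the
  cube of \<kappa>.\<close>

definition H where
  "H x y = {\<kappa> \<in> carrier W. fst x = pr \<kappa> \<otimes> fst y \<and> snd y = \<kappa> [^]\<^bsub>W\<^esub> (3::nat) \<odot> snd x}"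
definition HU where "HU u v = {\<kappa> \<in> U. v = \<kappa> [^]\<^bsub>W\<^esub> (3::nat) \<odot> u}"
definition objs where "objs = carrier A \<times> carrier W"

sublocale pr: group_hom W A pr
  using pr by (simp add: group_hom_def group_hom_axioms_def A.group_axioms W.group_axioms)

lemma P_subgroup: "subgroup P A" by (rule pr.img_is_subgroup)
lemma P_normal: "P \<lhd> A" by (rule A.subgroup_imp_normal[OF P_subgroup])
sublocale P: normal P A by (rule P_normal)
sublocale C: comm_group C by (rule A.abelian_FactGroup[OF P_subgroup])

lemma class_hom: "(\<lambda>a. P #> a) \<in> hom A C" by (rule P.r_coset_hom_Mod)

sublocale cl: group_hom A C "\<lambda>a. P #> a"
  using class_hom by (simp add: group_hom_def group_hom_axioms_def A.group_axioms C.group_axioms)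

lemma C_carrier: "c \<in> carrier C \<longleftrightarrow> (\<exists>a\<in>carrier A. c = P #> a)"
  by (auto simp: FactGroup_def RCOSETS_def)

lemma class_eq_iff:
  assumes "I \<in> carrier A" "J \<in> carrier A"
  shows "P #> I = P #> J \<longleftrightarrow> (\<exists>\<kappa>\<in>carrier W. I = pr \<kappa> \<otimes> J)"
proof
  assume "P #> I = P #> J"
  then have "I \<in> P #> J" using A.rcos_self[OF assms(1) P_subgroup] by simp
  then show "\<exists>\<kappa>\<in>carrier W. I = pr \<kappa> \<otimes> J" by (auto simp: r_coset_def)
next
  assume "\<exists>\<kappa>\<in>carrier W. I = pr \<kappa> \<otimes> J"
  then have "I \<in> P #> J" by (auto simp: r_coset_def)
  then show "P #> I = P #> J" using A.repr_independence[OF _ assms(2) P_subgroup] by simp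
qed

lemma pow3_mult: "x \<in> carrier W \<Longrightarrow> y \<in> carrier W \<Longrightarrow>
    (x \<odot> y) [^]\<^bsub>W\<^esub> (3::nat) = x [^]\<^bsub>W\<^esub> (3::nat) \<odot> y [^]\<^bsub>W\<^esub> (3::nat)"
  by (rule W.nat_pow_distrib)

lemma pow3_inv: "x \<in> carrier W \<Longrightarrow> (inv\<^bsub>W\<^esub> x) [^]\<^bsub>W\<^esub> (3::nat) = inv\<^bsub>W\<^esub> (x [^]\<^bsub>W\<^esub> (3::nat))"
  by (rule W.nat_pow_inv)

lemma groupoid_H:
  assumes "S \<subseteq> objs"
  shows "hom_groupoid S H (\<odot>) (m_inv W)"
proof unfold_locales
  fix x assume "x \<in> S"
  then have "\<one>\<^bsub>W\<^esub> \<in> H x x" using assms by (auto simp: H_def objs_def)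
  then show "H x x \<noteq> {}" by blast
next
  fix x y z m n assume xyz: "x \<in> S" "y \<in> S" "z \<in> S" and m: "m \<in> H x y" "n \<in> H y z"
  obtain I \<gamma> J \<delta> L \<epsilon> where e: "x = (I, \<gamma>)" "y = (J, \<delta>)" "z = (L, \<epsilon>)" by (cases x; cases y; cases z) auto
  have c: "m \<in> carrier W" "n \<in> carrier W" "\<gamma> \<in> carrier W" "L \<in> carrier A"
    using xyz m assms e by (auto simp: H_def objs_def)
  have "I = pr m \<otimes> (pr n \<otimes> L)" "\<epsilon> = n [^]\<^bsub>W\<^esub> (3::nat) \<odot> (m [^]\<^bsub>W\<^esub> (3::nat) \<odot> \<gamma>)" using m e by (auto simp: H_def)
  then have "I = pr (n \<odot> m) \<otimes> L" "\<epsilon> = (n \<odot> m) [^]\<^bsub>W\<^esub> (3::nat) \<odot> \<gamma>"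
    using c by (simp_all add: pow3_mult A.m_assoc W.m_assoc A.m_lcomm)
  then show "n \<odot> m \<in> H x z" using c e by (simp add: H_def)
next
  fix x y m assume xy: "x \<in> S" "y \<in> S" and m: "m \<in> H x y"
  obtain I \<gamma> J \<delta> where e: "x = (I, \<gamma>)" "y = (J, \<delta>)" by (cases x; cases y) auto
  have c: "m \<in> carrier W" "I \<in> carrier A" "\<gamma> \<in> carrier W" "J \<in> carrier A" "\<delta> \<in> carrier W"
    using xy m assms e by (auto simp: H_def objs_def)
  have "I = pr m \<otimes> J" "\<delta> = m [^]\<^bsub>W\<^esub> (3::nat) \<odot> \<gamma>" using m e by (auto simp: H_def)
  then have "J = pr (inv\<^bsub>W\<^esub> m) \<otimes> I" "\<gamma> = (inv\<^bsub>W\<^esub> m) [^]\<^bsub>W\<^esub> (3::nat) \<odot> \<delta>"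
    using c by (simp_all add: pow3_inv A.m_assoc[symmetric] W.m_assoc[symmetric])
  then show "inv\<^bsub>W\<^esub> m \<in> H y x" using c e by (simp add: H_def)
next
  fix x y z m n assume "m \<in> H x y" "n \<in> H z x"
  then have "m \<in> carrier W" "n \<in> carrier W" by (auto simp: H_def)
  then show "inv\<^bsub>W\<^esub> m \<odot> (m \<odot> n) = n" by (simp add: W.m_assoc[symmetric])
next
  fix x y z m n assume "m \<in> H x y" "n \<in> H z y"
  then have "m \<in> carrier W" "n \<in> carrier W" by (auto simp: H_def)
  then show "m \<odot> (inv\<^bsub>W\<^esub> m \<odot> n) = n" by (simp add: W.m_assoc[symmetric])
next
  fix x y z m n assume "m \<in> H x y" "n \<in> H y z"
  then have "m \<in> carrier W" "n \<in> carrier W" by (auto simp: H_def)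
  then show "n \<odot> m \<odot> inv\<^bsub>W\<^esub> m = n" by (simp add: W.m_assoc)
next
  fix x y z m n assume "m \<in> H x y" "n \<in> H x z"
  then have "m \<in> carrier W" "n \<in> carrier W" by (auto simp: H_def)
  then show "n \<odot> inv\<^bsub>W\<^esub> m \<odot> m = n" by (simp add: W.m_assoc)
qed

lemma U_closed: "u \<in> U \<Longrightarrow> v \<in> U \<Longrightarrow> u \<odot> v \<in> U" "u \<in> U \<Longrightarrow> u \<in> carrier W" "\<one>\<^bsub>W\<^esub> \<in> U"
  "u \<in> U \<Longrightarrow> inv\<^bsub>W\<^esub> u \<in> U" "u \<in> U \<Longrightarrow> u [^]\<^bsub>W\<^esub> (n::nat) \<in> U"
proof -
  show "u \<in> U \<Longrightarrow> v \<in> U \<Longrightarrow> u \<odot> v \<in> U" "u \<in> U \<Longrightarrow> u \<in> carrier W" "\<one>\<^bsub>W\<^esub> \<in> U"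
    "u \<in> U \<Longrightarrow> inv\<^bsub>W\<^esub> u \<in> U" by (auto simp: U_def)
  show "u \<in> U \<Longrightarrow> u [^]\<^bsub>W\<^esub> (n::nat) \<in> U"
    by (auto simp: U_def pr.hom_nat_pow)
qed

lemma H_base:
  assumes "I \<in> carrier A" "\<gamma> \<in> carrier W" "u \<in> U" "v \<in> U"
  shows "H (I, u \<odot> \<gamma>) (I, v \<odot> \<gamma>) = HU u v"
proof -
  have 1: "I = pr \<kappa> \<otimes> I \<longleftrightarrow> pr \<kappa> = \<one>" if "\<kappa> \<in> carrier W" for \<kappa>
    using that assms A.l_cancel_one[of I "pr \<kappa>"] A.r_cancel_one'[of I "pr \<kappa>"] by auto
  have 2: "v \<odot> \<gamma> = \<kappa> [^]\<^bsub>W\<^esub> (3::nat) \<odot> (u \<odot> \<gamma>) \<longleftrightarrow> v = \<kappa> [^]\<^bsub>W\<^esub> (3::nat) \<odot> u" if "\<kappa> \<in> carrier W" for \<kappa>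
    using that assms U_closed by (simp add: W.m_assoc[symmetric])
  show ?thesis using 1 2 by (auto simp: H_def HU_def U_def)
qed

text \<open>Every pair whose ideal lies in the class of \<open>I0\<close> can be moved to one with
  ideal \<open>I0\<close>. There the admissible second components form the coset
  \<open>U \<gamma>0\<close>, and the scalars that fix \<open>I0\<close> are the elements of
  \<open>U\<close>, so \<open>HU\<close> describes the fibre.\<close>

lemma fibre_mass:
  assumes z: "(I0, \<gamma>0) \<in> cubes a"
    and S: "S = {z \<in> cubes a. P #> fst z = P #> I0}"
  shows "mass S H = mass U HU" "finite (S // hom_rel S H) \<longleftrightarrow> finite (U // hom_rel U HU)"
proof -
  have c: "I0 \<in> carrier A" "\<gamma>0 \<in> carrier W" "pr \<gamma>0 \<otimes> (I0 [^] (3::nat)) = a"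
    using z by (auto simp: cubes_def)
  let ?b = "\<lambda>u. (I0, u \<odot> \<gamma>0)"
  have obj: "cubes a \<subseteq> objs" "S \<subseteq> objs" using S by (auto simp: cubes_def objs_def)
  interpret G: hom_groupoid "objs" H "(\<odot>)" "m_inv W" by (rule groupoid_H) simp
  have bS: "?b u \<in> S" if "u \<in> U" for u
    using that c(1,2) c(3)[symmetric] U_closed(2)[OF that] unfolding S by (simp add: cubes_def U_def A.m_assoc)
  have l: "\<exists>u\<in>U. H z (?b u) \<noteq> {}" if zS: "z \<in> S" for z
  proof -
    obtain I \<gamma> where e: "z = (I, \<gamma>)" by (cases z)
    have zc: "I \<in> carrier A" "\<gamma> \<in> carrier W" "pr \<gamma> \<otimes> (I [^] (3::nat)) = a" "P #> I = P #> I0"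
      using zS S e by (auto simp: cubes_def)
    obtain k where k: "k \<in> carrier W" "I = pr k \<otimes> I0" using class_eq_iff zc c by blast
    \<comment> \<open>Scaling by \<open>k\<close> takes \<open>z\<close> to an object with ideal
      \<open>I0\<close>; \<open>u\<close> compares its second component with
      \<open>\<gamma>0\<close>, and lies in the kernel of \<open>pr\<close> because both objects
      have the same invariant \<open>a\<close>.\<close>
    define u where "u = k [^]\<^bsub>W\<^esub> (3::nat) \<odot> \<gamma> \<odot> inv\<^bsub>W\<^esub> \<gamma>0"
    have uW: "u \<in> carrier W" using k(1) zc(2) c(2) by (simp add: u_def)
    have u0: "u \<odot> \<gamma>0 = k [^]\<^bsub>W\<^esub> (3::nat) \<odot> \<gamma>" using k(1) zc(2) c(2) by (simp add: u_def W.m_assoc)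
    have "pr u \<otimes> a = pr (u \<odot> \<gamma>0) \<otimes> I0 [^] (3::nat)"
      unfolding c(3)[symmetric] using c(1,2) uW by (simp add: A.m_assoc)
    also have "\<dots> = (pr \<gamma> \<otimes> pr k [^] (3::nat)) \<otimes> I0 [^] (3::nat)"
      unfolding u0 using k(1) zc(2) c(1,2) by (simp add: pr.hom_nat_pow A.m_comm)
    also have "\<dots> = pr \<gamma> \<otimes> (pr k \<otimes> I0) [^] (3::nat)"
      using k(1) zc(2) c(1,2) by (simp add: A.nat_pow_distrib A.m_assoc)
    also have "\<dots> = a" using zc(3) k(2) by simp
    finally have "pr u \<otimes> a = a" .
    moreover have "a \<in> carrier A" using c(1,2) unfolding c(3)[symmetric] by simp
    ultimately have "u \<in> U" using uW A.r_cancel_one[of a "pr u"] by (simp add: U_def)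
    moreover have "k \<in> H z (?b u)" unfolding e H_def using k u0 by simp
    ultimately show ?thesis by blast
  qed
  have r: "\<exists>z\<in>S. H z (?b u) \<noteq> {}" if "u \<in> U" for u
    using bS[OF that] obj(2) G.ident[of "?b u"] by blast
  have b: "(H z w = {} \<longleftrightarrow> HU u v = {}) \<and> card (H z w) = card (HU u v)"
    if h: "z \<in> S" "u \<in> U" "w \<in> S" "v \<in> U" "H z (?b u) \<noteq> {}" "H w (?b v) \<noteq> {}" for z u w v
  proof -
    have o: "z \<in> objs" "w \<in> objs" "?b u \<in> objs" "?b v \<in> objs" using h obj bS by blast+
    obtain k l where k: "k \<in> H z (?b u)" and l: "l \<in> H w (?b v)" using h(5,6) by blast
    have "card (H z w) = card (H (?b u) (?b v))"
      using G.card_hom_left[OF o(2,4,1) l] G.card_hom_right[OF o(1,3,4) k] by simp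
    moreover have "H z w = {} \<longleftrightarrow> H (?b u) (?b v) = {}"
    proof -
      have "H (?b u) (?b v) \<noteq> {}" if "m \<in> H z w" for m
        using G.cmp[OF o(3,1,2) G.ivs[OF o(1,3) k] that] G.cmp[OF o(3,2,4) _ l] by blast
      moreover have "H z w \<noteq> {}" if "m \<in> H (?b u) (?b v)" for m
        using G.cmp[OF o(1,3,4) k that] G.cmp[OF o(1,4,2) _ G.ivs[OF o(2,4) l]] by blast
      ultimately show ?thesis by blast
    qed
    ultimately show ?thesis using H_base[OF c(1,2) h(2,4)] by simp
  qed
  have w: "weighted U HU"
  proof (rule weighted_transfer[where A' = "?b ` U" and H' = H and R = "\<lambda>u z. z = ?b u"])
    have "?b ` U \<subseteq> objs" using bS obj by blast
    from groupoid_H[OF this] show "weighted (?b ` U) H" by (rule hom_groupoid.weighted)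
    show "(HU x y = {} \<longleftrightarrow> H x' y' = {}) \<and> card (HU x y) = card (H x' y')"
      if "x \<in> U" "y \<in> U" "x' = ?b x" "y' = ?b y" for x x' y y'
      using H_base[OF c(1,2) that(1,2)] unfolding that(3,4) by simp
    show "\<exists>x'\<in>?b ` U. x' = ?b x" if "x \<in> U" for x using that by blast
    show "\<exists>x\<in>U. x' = ?b x" if "x' \<in> ?b ` U" for x' using that by blast
  qed
  show "mass S H = mass U HU"
    by (rule mass_transfer[where R = "\<lambda>z u. H z (?b u) \<noteq> {}", OF w l r b])
  show "finite (S // hom_rel S H) \<longleftrightarrow> finite (U // hom_rel U HU)"
    by (rule finite_transfer[where R = "\<lambda>z u. H z (?b u) \<noteq> {}", OF w l r b])
qed

lemma card_cube_roots:
  assumes "c \<in> carrier C"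
  shows "card {x \<in> carrier C. x [^]\<^bsub>C\<^esub> (3::nat) = c [^]\<^bsub>C\<^esub> (3::nat)} = card (torsion 3 C)"
proof (rule bij_betw_same_card[OF bij_betw_byWitness[where f = "\<lambda>x. x \<otimes>\<^bsub>C\<^esub> inv\<^bsub>C\<^esub> c" and f' = "\<lambda>x. x \<otimes>\<^bsub>C\<^esub> c"]])
  show "(\<lambda>x. x \<otimes>\<^bsub>C\<^esub> inv\<^bsub>C\<^esub> c) ` {x \<in> carrier C. x [^]\<^bsub>C\<^esub> (3::nat) = c [^]\<^bsub>C\<^esub> (3::nat)} \<subseteq> torsion 3 C"
    using assms by (auto simp del: mult_FactGroup one_FactGroup simp: torsion_def C.nat_pow_distrib C.nat_pow_inv)
  show "(\<lambda>x. x \<otimes>\<^bsub>C\<^esub> c) ` torsion 3 C \<subseteq> {x \<in> carrier C. x [^]\<^bsub>C\<^esub> (3::nat) = c [^]\<^bsub>C\<^esub> (3::nat)}"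
    using assms by (auto simp del: mult_FactGroup one_FactGroup simp: torsion_def C.nat_pow_distrib)
qed (use assms in \<open>auto simp del: mult_FactGroup one_FactGroup simp: torsion_def C.m_assoc\<close>)

text \<open>The class of \<open>I\<close> is an invariant with values among the cube roots of the
  class of \<open>a\<close>. Each root occurs, because \<open>I [^] 3\<close> and \<open>a\<close>
  then differ by a principal factor; the roots form a coset of the 3-torsion, and every fibre has
  the mass of \<open>HU\<close>.\<close>

lemma cubes_mass:
  assumes a: "a \<in> carrier A" and c: "c \<in> carrier C" "P #> a = c [^]\<^bsub>C\<^esub> (3::nat)"
    and fin: "finite (carrier C)" "finite (U // hom_rel U HU)"
  shows "mass (cubes a) H = of_nat (card (torsion 3 C)) * mass U HU"
    "finite (cubes a // hom_rel (cubes a) H)"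
proof -
  define T where "T = {x \<in> carrier C. x [^]\<^bsub>C\<^esub> (3::nat) = c [^]\<^bsub>C\<^esub> (3::nat)}"
  have cl: "P #> (pr \<gamma> \<otimes> I) = P #> I" if "I \<in> carrier A" "\<gamma> \<in> carrier W" for I \<gamma>
    using class_eq_iff[of "pr \<gamma> \<otimes> I" I] that by auto
  have ex: "\<exists>I \<gamma>. (I, \<gamma>) \<in> cubes a \<and> P #> I = x" if x: "x \<in> T" for x
  proof -
    have "x \<in> carrier C" using x by (simp add: T_def)
    then obtain I where I: "I \<in> carrier A" "x = P #> I" unfolding C_carrier by blast
    have "P #> (I [^] (3::nat)) = P #> a"
      using x I c cl.hom_nat_pow[OF I(1), of 3] by (simp add: T_def)
    then obtain k where "k \<in> carrier W" "a = pr k \<otimes> I [^] (3::nat)"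
      using class_eq_iff[of a "I [^] (3::nat)"] a I by auto
    then show ?thesis using I by (auto simp: cubes_def)
  qed
  have im: "(\<lambda>z. P #> fst z) ` cubes a \<subseteq> T"
  proof
    fix x assume "x \<in> (\<lambda>z. P #> fst z) ` cubes a"
    then obtain I \<gamma> where I: "I \<in> carrier A" "\<gamma> \<in> carrier W" "pr \<gamma> \<otimes> (I [^] (3::nat)) = a" "x = P #> I"
      by (auto simp: cubes_def)
    then have "x [^]\<^bsub>C\<^esub> (3::nat) = P #> a"
      using cl.hom_nat_pow[OF I(1), of 3] cl[of "I [^] (3::nat)" \<gamma>] by simp
    then show "x \<in> T" using c I C_carrier by (auto simp: T_def)
  qed
  have fib: "mass {z \<in> cubes a. P #> fst z = x} H = mass U HU"
    "finite ({z \<in> cubes a. P #> fst z = x} // hom_rel {z \<in> cubes a. P #> fst z = x} H)" if x: "x \<in> T" for x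
  proof -
    obtain I \<gamma> where I: "(I, \<gamma>) \<in> cubes a" "P #> I = x" using ex[OF x] by blast
    show "mass {z \<in> cubes a. P #> fst z = x} H = mass U HU"
      using fibre_mass(1)[OF I(1) refl] I(2) by simp
    show "finite ({z \<in> cubes a. P #> fst z = x} // hom_rel {z \<in> cubes a. P #> fst z = x} H)"
      using fibre_mass(2)[OF I(1) refl] I(2) fin by simp
  qed
  have "cubes a \<subseteq> objs" by (auto simp: cubes_def objs_def)
  then have w: "weighted (cubes a) H" by (rule hom_groupoid.weighted[OF groupoid_H])
  have inv: "P #> fst x = P #> fst y" if "x \<in> cubes a" "y \<in> cubes a" "H x y \<noteq> {}" for x y
    using that cl by (auto simp: H_def cubes_def)
  have finT: "finite T" using fin by (auto simp: T_def)
  have "mass (cubes a) H = (\<Sum>x\<in>T. mass {z \<in> cubes a. P #> fst z = x} H)"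
    by (rule mass_partition[OF w inv finT im fib(2)])
  also have "\<dots> = of_nat (card T) * mass U HU" using fib(1) by simp
  finally show "mass (cubes a) H = of_nat (card (torsion 3 C)) * mass U HU"
    using card_cube_roots[OF c(1)] by (simp add: T_def)
  show "finite (cubes a // hom_rel (cubes a) H)"
    by (rule finite_partition[OF w inv finT im fib(2)])
qed

end

section \<open>Rank-two lattices in the quadratic algebra\<close>

definition lat :: "rat \<times> rat \<Rightarrow> rat \<times> rat \<Rightarrow> (rat \<times> rat) set" where
  "lat \<alpha> \<beta> = {qscale (of_int m) \<alpha> + qscale (of_int n) \<beta> | m n. True}"

text \<open>Twice the oriented area, which is \<open>1\<close> on the standard basis \<open>1\<close>, \<open>(D + \<surd>D) / 2\<close>, and the
  polarisation of the norm form.\<close>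

definition ar :: "rat \<times> rat \<Rightarrow> rat \<times> rat \<Rightarrow> rat" where
  "ar \<alpha> \<beta> = 2 * (fst \<alpha> * snd \<beta> - snd \<alpha> * fst \<beta>)"

definition tr2 :: "int \<Rightarrow> rat \<times> rat \<Rightarrow> rat \<times> rat \<Rightarrow> rat" where
  "tr2 D \<alpha> \<beta> = 2 * (fst \<alpha> * fst \<beta> - of_int D * snd \<alpha> * snd \<beta>)"

lemma ar_simps: "ar \<alpha> (\<beta> + \<gamma>) = ar \<alpha> \<beta> + ar \<alpha> \<gamma>" "ar (\<alpha> + \<beta>) \<gamma> = ar \<alpha> \<gamma> + ar \<beta> \<gamma>"
  "ar (qscale q \<alpha>) \<beta> = q * ar \<alpha> \<beta>" "ar \<alpha> (qscale q \<beta>) = q * ar \<alpha> \<beta>" "ar \<alpha> \<alpha> = 0"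
  "ar (qmul D \<gamma> \<alpha>) (qmul D \<gamma> \<beta>) = qnorm D \<gamma> * ar \<alpha> \<beta>" "ar \<beta> \<alpha> = - ar \<alpha> \<beta>"
  "ar \<alpha> (qmul D \<gamma> \<alpha>) = qnorm D \<alpha> * ar (1, 0) \<gamma>"
  by (simp_all add: ar_def q_defs algebra_simps)

lemma conj_mult: "qmul D (qconj \<alpha>) \<beta> = (tr2 D \<alpha> \<beta> / 2, ar \<alpha> \<beta> / 2)"
  by (simp add: ar_def tr2_def q_defs algebra_simps)

text \<open>This is the norm of \<open>qmul D (qconj \<alpha>) \<beta>\<close>, whose coordinates
  \<open>conj_mult\<close> gives. It relates the discriminant of the norm form on the basis
  \<alpha>, \<beta> to the square of the area.\<close>

lemma disc_norm_form: "tr2 D \<alpha> \<beta> ^ 2 - 4 * qnorm D \<alpha> * qnorm D \<beta> = of_int D * ar \<alpha> \<beta> ^ 2"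
  by (simp add: ar_def tr2_def q_defs power2_eq_square algebra_simps)

lemma conj_mult_add: "qmul D (qconj \<alpha>) \<beta> + qmul D \<alpha> (qconj \<beta>) = (tr2 D \<alpha> \<beta>, 0)"
  by (simp add: tr2_def q_defs algebra_simps)

lemma qscale_diff: "qscale q (x - y) = qscale q x - qscale q y"
  by (simp add: qscale_def algebra_simps)

lemma qscale_cancel: "q \<noteq> 0 \<Longrightarrow> qscale q x = qscale q y \<longleftrightarrow> x = y"
  by (auto simp: qscale_def prod_eq_iff)

lemma lat_mem: "\<alpha> \<in> lat \<alpha> \<beta>" "\<beta> \<in> lat \<alpha> \<beta>" "0 \<in> lat \<alpha> \<beta>"
  "qscale (of_int m) \<alpha> + qscale (of_int n) \<beta> \<in> lat \<alpha> \<beta>"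
proof -
  have "\<alpha> = qscale (of_int 1) \<alpha> + qscale (of_int 0) \<beta>" "\<beta> = qscale (of_int 0) \<alpha> + qscale (of_int 1) \<beta>"
    "0 = qscale (of_int 0) \<alpha> + qscale (of_int 0) \<beta>" by (simp_all add: qscale_simps)
  then show "\<alpha> \<in> lat \<alpha> \<beta>" "\<beta> \<in> lat \<alpha> \<beta>" "0 \<in> lat \<alpha> \<beta>" unfolding lat_def by blast+
  show "qscale (of_int m) \<alpha> + qscale (of_int n) \<beta> \<in> lat \<alpha> \<beta>" unfolding lat_def by blast
qed

lemma latE:
  assumes "x \<in> lat \<alpha> \<beta>"
  obtains m n where "x = qscale (of_int m) \<alpha> + qscale (of_int n) \<beta>"
  using assms unfolding lat_def by blast

lemma lat_closed: "x \<in> lat \<alpha> \<beta> \<Longrightarrow> y \<in> lat \<alpha> \<beta> \<Longrightarrow> x + y \<in> lat \<alpha> \<beta>"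
  "x \<in> lat \<alpha> \<beta> \<Longrightarrow> - x \<in> lat \<alpha> \<beta>"
  "x \<in> lat \<alpha> \<beta> \<Longrightarrow> qscale (of_int k) x \<in> lat \<alpha> \<beta>"
proof -
  assume "x \<in> lat \<alpha> \<beta>"
  then obtain m n where x: "x = qscale (of_int m) \<alpha> + qscale (of_int n) \<beta>" by (rule latE)
  have "- x = qscale (of_int (- m)) \<alpha> + qscale (of_int (- n)) \<beta>"
    unfolding x by (simp add: qscale_simps)
  then show "- x \<in> lat \<alpha> \<beta>" using lat_mem(4) by metis
  have "qscale (of_int k) x = qscale (of_int (k * m)) \<alpha> + qscale (of_int (k * n)) \<beta>"
    unfolding x by (simp add: qscale_simps)
  then show "qscale (of_int k) x \<in> lat \<alpha> \<beta>" using lat_mem(4) by metis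
  assume "y \<in> lat \<alpha> \<beta>"
  then obtain m' n' where y: "y = qscale (of_int m') \<alpha> + qscale (of_int n') \<beta>" by (rule latE)
  have "x + y = qscale (of_int (m + m')) \<alpha> + qscale (of_int (n + n')) \<beta>"
    unfolding x y by (simp add: qscale_simps algebra_simps)
  then show "x + y \<in> lat \<alpha> \<beta>" using lat_mem(4) by metis
qed

lemma lat_subset:
  assumes "0 \<in> I" "\<forall>x\<in>I. \<forall>y\<in>I. x + y \<in> I" "\<forall>x\<in>I. - x \<in> I" "\<alpha> \<in> I" "\<beta> \<in> I"
  shows "lat \<alpha> \<beta> \<subseteq> I"
proof
  fix x assume "x \<in> lat \<alpha> \<beta>"
  then obtain m n where "x = qscale (of_int m) \<alpha> + qscale (of_int n) \<beta>" by (rule latE)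
  then show "x \<in> I" using assms int_scale_mem[OF assms(1-3)] by simp
qed

lemma lat_scale: "(\<lambda>y. qmul D x y) ` lat \<alpha> \<beta> = lat (qmul D x \<alpha>) (qmul D x \<beta>)"
proof (intro equalityI subsetI)
  fix y assume "y \<in> (\<lambda>y. qmul D x y) ` lat \<alpha> \<beta>"
  then obtain z where z: "z \<in> lat \<alpha> \<beta>" "y = qmul D x z" by blast
  obtain m n where "z = qscale (of_int m) \<alpha> + qscale (of_int n) \<beta>" using z(1) by (rule latE)
  then show "y \<in> lat (qmul D x \<alpha>) (qmul D x \<beta>)"
    unfolding z(2) by (simp add: qmul_add_right qmul_scale lat_mem(4))
next
  fix y assume "y \<in> lat (qmul D x \<alpha>) (qmul D x \<beta>)"
  then obtain m n where "y = qscale (of_int m) (qmul D x \<alpha>) + qscale (of_int n) (qmul D x \<beta>)" by (rule latE)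
  then have "y = qmul D x (qscale (of_int m) \<alpha> + qscale (of_int n) \<beta>)" by (simp add: qmul_add_right qmul_scale)
  then show "y \<in> (\<lambda>y. qmul D x y) ` lat \<alpha> \<beta>" using lat_mem(4) by blast
qed

lemma lat_coords_unique:
  assumes "ar \<alpha> \<beta> \<noteq> 0"
    and "qscale m \<alpha> + qscale n \<beta> = qscale m' \<alpha> + qscale n' \<beta>"
  shows "m = m'" "n = n'"
proof -
  have "ar \<alpha> (qscale m \<alpha> + qscale n \<beta>) = ar \<alpha> (qscale m' \<alpha> + qscale n' \<beta>)"
    "ar (qscale m \<alpha> + qscale n \<beta>) \<beta> = ar (qscale m' \<alpha> + qscale n' \<beta>) \<beta>" using assms(2) by simp_all
  then show "m = m'" "n = n'" using assms(1) by (simp_all add: ar_simps(1-5))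
qed

lemma quad_elt_scale: "qscale (of_int m) (quad_elt D a b) = quad_elt D (m * a) (m * b)"
  "quad_elt D a b + quad_elt D c d = quad_elt D (a + c) (b + d)"
  "- quad_elt D a b = quad_elt D (- a) (- b)"
  by (simp_all add: quad_elt_def qscale_def algebra_simps add_divide_distrib)

lemma lat_quad_elt: "quad_elt D a b = qscale (of_int a) (1, 0) + qscale (of_int b) (of_int D / 2, 1 / 2)"
  by (simp add: quad_elt_def qscale_def)

lemma quad_ring_lat: "carrier (quad_ring D) = lat (1, 0) (of_int D / 2, 1 / 2)"
  by (auto simp: quad_ring_simps lat_quad_elt lat_def)

text \<open>Hermite normal form by two minima: \<open>c\<close> is the least positive second
  coordinate occurring in \<open>I\<close>, and \<open>a\<close> the least positive integer in
  \<open>I\<close>. The number \<open>m\<close> guarantees that both exist; division with remainder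
  does the rest.\<close>

lemma hermite_basis:
  assumes I: "0 \<in> I" "\<forall>x\<in>I. \<forall>y\<in>I. x + y \<in> I" "\<forall>x\<in>I. - x \<in> I" "I \<subseteq> carrier (quad_ring D)"
    and m: "m > 0" "quad_elt D m 0 \<in> I" "quad_elt D 0 m \<in> I"
  obtains a b c where "a > 0" "c > 0" "I = lat (quad_elt D a 0) (quad_elt D b c)"
proof -
  let ?e = "quad_elt D"
  define P where "P n \<longleftrightarrow> n > 0 \<and> (\<exists>b. ?e b (int n) \<in> I)" for n :: nat
  define Q where "Q n \<longleftrightarrow> n > 0 \<and> ?e (int n) 0 \<in> I" for n :: nat
  have exP: "P (nat m)" and exQ: "Q (nat m)" using m by (auto simp: P_def Q_def)
  define c where "c = (LEAST n. P n)"
  define a where "a = (LEAST n. Q n)"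
  have c: "P c" and cl: "\<And>n. n < c \<Longrightarrow> \<not> P n" unfolding c_def using exP by (auto intro: LeastI dest: not_less_Least)
  have a: "Q a" and al: "\<And>n. n < a \<Longrightarrow> \<not> Q n" unfolding a_def using exQ by (auto intro: LeastI dest: not_less_Least)
  obtain b where b: "?e b (int c) \<in> I" using c by (auto simp: P_def)
  have c0: "int c > 0" and a0: "int a > 0" using c a by (auto simp: P_def Q_def)
  have sub: "x + qscale (of_int (- k)) y \<in> I" if "x \<in> I" "y \<in> I" for x y k
    using that I int_scale_mem[OF I(1-3)] by blast
  have "I \<subseteq> lat (?e (int a) 0) (?e b (int c))"
  proof
    fix x assume x: "x \<in> I"
    then obtain u v where u: "x = ?e u v" using I(4) by (auto elim!: quad_ringE)
    define k where "k = v div int c"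
    have "x + qscale (of_int (- k)) (?e b (int c)) = ?e (u - k * b) (v mod int c)"
      unfolding u quad_elt_scale k_def by (simp add: minus_div_mult_eq_mod[symmetric])
    then have y: "?e (u - k * b) (v mod int c) \<in> I" using sub[OF x b, of k] by simp
    have "v mod int c = 0"
    proof (rule ccontr)
      assume "v mod int c \<noteq> 0"
      then have "P (nat (v mod int c))" "nat (v mod int c) < c"
        using y pos_mod_sign[OF c0, of v] pos_mod_bound[OF c0, of v] by (auto simp: P_def)
      then show False using cl by blast
    qed
    then have y: "?e (u - k * b) 0 \<in> I" and v: "v = k * int c" using y by (auto simp: k_def)
    define l where "l = (u - k * b) div int a"
    have "?e (u - k * b) 0 + qscale (of_int (- l)) (?e (int a) 0) = ?e ((u - k * b) mod int a) 0"
      unfolding quad_elt_scale l_def by (simp add: minus_div_mult_eq_mod[symmetric])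
    then have z: "?e ((u - k * b) mod int a) 0 \<in> I" using sub[OF y, of "?e (int a) 0" l] a by (simp add: Q_def)
    have "(u - k * b) mod int a = 0"
    proof (rule ccontr)
      assume "(u - k * b) mod int a \<noteq> 0"
      then have "Q (nat ((u - k * b) mod int a))" "nat ((u - k * b) mod int a) < a"
        using z pos_mod_sign[OF a0, of "u - k * b"] pos_mod_bound[OF a0, of "u - k * b"] by (auto simp: Q_def)
      then show False using al by blast
    qed
    then have "u - k * b = l * int a" by (auto simp: l_def)
    then have "x = qscale (of_int l) (?e (int a) 0) + qscale (of_int k) (?e b (int c))"
      unfolding u quad_elt_scale quad_elt_eq_iff using v by simp
    then show "x \<in> lat (?e (int a) 0) (?e b (int c))" using lat_mem(4) by metis
  qed
  moreover have "lat (?e (int a) 0) (?e b (int c)) \<subseteq> I"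
    using a b by (intro lat_subset I(1-3)) (auto simp: Q_def)
  ultimately show ?thesis using that a0 c0 by blast
qed

section \<open>Invertible ideals and primitive norm forms\<close>

context quad
begin

abbreviation "\<tau> \<equiv> (of_int D / 2 :: rat, 1 / 2 :: rat)"

lemma tau_O: "\<tau> \<in> carrier \<O>" by (simp add: quad_ring_lat lat_mem)

lemma moduleD: assumes "module I"
  shows "0 \<in> I" "\<forall>x\<in>I. \<forall>y\<in>I. x + y \<in> I" "\<forall>x\<in>I. - x \<in> I" "r \<in> carrier \<O> \<Longrightarrow> x \<in> I \<Longrightarrow> r \<odot> x \<in> I"
  using assms unfolding module_def by blast+

lemma module_add: "module M \<Longrightarrow> x \<in> M \<Longrightarrow> y \<in> M \<Longrightarrow> x + y \<in> M"
  and module_int: "module M \<Longrightarrow> x \<in> M \<Longrightarrow> qscale (of_int k) x \<in> M"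
  using moduleD(2) int_scale_mem[OF moduleD(1-3)] by blast+

lemma ip_left_comm: "I \<diamondop> (J \<diamondop> L) = J \<diamondop> (I \<diamondop> L)"
  by (metis ip_assoc ip_comm)

lemmas ip_ac = ip_assoc ip_comm ip_left_comm

lemma rat_O_iff: "(q, 0) \<in> carrier \<O> \<longleftrightarrow> (\<exists>n. q = of_int n)"
  unfolding quad_ring_carrier by (auto intro: exI[of _ 0])

lemma conj_O: "x \<in> carrier \<O> \<Longrightarrow> qconj x \<in> carrier \<O>"
proof -
  assume "x \<in> carrier \<O>"
  then obtain a b where "x = quad_elt D a b" by (rule quad_ringE)
  then have "qconj x = quad_elt D (a + b * D) (- b)"
    by (simp add: quad_elt_def qconj_def field_simps)
  then show ?thesis by simp
qed

lemma nm_O: "x \<in> carrier \<O> \<Longrightarrow> \<exists>n. nm x = of_int n"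
proof -
  assume "x \<in> carrier \<O>"
  then have "x \<odot> qconj x \<in> carrier \<O>" using conj_O O_closed(1) by blast
  then show ?thesis by (simp add: qmul_conj rat_O_iff)
qed

text \<open>Since 1 lies in the product of \<open>I\<close> and its inverse \<open>J\<close>, a
  denominator \<open>d\<close> of \<open>J\<close> equals \<open>d\<close> times 1 and so lies in
  \<open>I\<close>.\<close>

lemma unit_in_AA:
  assumes "I \<in> carrier AA" obtains e where "e \<in> I" "nm e \<noteq> 0"
proof -
  obtain J where J: "J \<in> carrier AA" "I \<diamondop> J = carrier \<O>" using AA_E[OF assms] by blast
  obtain d where d: "d \<in> carrier \<O>" "nm d \<noteq> 0" "\<forall>x\<in>J. d \<odot> x \<in> carrier \<O>"
    using AA_frac[OF J(1)] fractional_iff by blast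
  have "d \<odot> s \<in> I" if "s \<in> I \<diamondop> J" for s using that
  proof (induction rule: ip_induct)
    case (prod x y)
    have "(d \<odot> y) \<odot> x \<in> I" using prod d AA_module[OF assms] moduleD(4) by blast
    then show ?case by (simp add: qmul_ac)
  next
    case (sum s t) then show ?case using moduleD(2)[OF AA_module[OF assms]] by (simp add: qmul_add_right)
  qed
  from this[of "(1,0)"] show ?thesis using that[of d] d J O_closed(3) by (simp add: qmul_one)
qed

text \<open>Once \<open>nm d\<close> clears the denominators of \<open>qconj e\<close>, the rational
  number \<open>nm e * nm d\<close> is a multiple of \<open>e\<close> by an element of the order;
  multiplying by \<open>n * sgn a\<close> makes it a positive integer.\<close>

lemma int_in_module:
  assumes "module I" "e \<in> I" "nm e \<noteq> 0"
  obtains m where "m > 0" "(of_int m, 0) \<in> I"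
proof -
  have *: "(nm e, 0) \<odot> y \<in> I" if "y \<odot> qconj e \<in> carrier \<O>" for y
  proof -
    have "(y \<odot> qconj e) \<odot> e \<in> I" using moduleD(4)[OF assms(1) that assms(2)] .
    then show ?thesis by (simp add: qmul_assoc qmul_conj) (simp add: qmul_comm)
  qed
  obtain d where d: "d \<in> carrier \<O>" "nm d \<noteq> 0" "d \<odot> qconj e \<in> carrier \<O>" using O_scale_denom by blast
  have "(nm d, 0) \<odot> qconj e \<in> carrier \<O>"
    using O_closed(1)[OF conj_O[OF d(1)] d(3)] by (simp add: qmul_assoc[symmetric] qmul_conj)
  from *[OF this] have r: "(nm e * nm d, 0) \<in> I" by (simp add: qmul_rat qscale_def mult.commute)
  obtain a n where an: "nm e * nm d = of_int a / of_int n" "n > 0" by (metis Rat_cases Fract_of_int_quotient)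
  have a: "a \<noteq> 0" using an assms(3) d(2) by auto
  have "qscale (of_int (n * sgn a)) (nm e * nm d, 0) \<in> I"
    using int_scale_mem[OF moduleD(1-3)[OF assms(1)] r] .
  moreover have "qscale (of_int (n * sgn a)) (nm e * nm d, 0) = (of_int \<bar>a\<bar>, 0)"
    using an by (simp add: qscale_def abs_sgn mult.commute)
  ultimately show ?thesis using that[of "\<bar>a\<bar>"] a by simp
qed

lemma hermite_ideal:
  assumes "module I" "I \<subseteq> carrier \<O>" "e \<in> I" "nm e \<noteq> 0"
  obtains a b c where "a > 0" "c > 0" "I = lat (quad_elt D a 0) (quad_elt D b c)"
proof -
  obtain m where m: "m > 0" "(of_int m, 0) \<in> I" using int_in_module assms by blast
  have "quad_elt D m 0 \<in> I" using m by (simp add: quad_elt_def)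
  moreover have "quad_elt D 0 m = \<tau> \<odot> (of_int m, 0)" by (simp add: quad_elt_def qmul_rat qscale_def)
  then have "quad_elt D 0 m \<in> I" using moduleD(4)[OF assms(1) tau_O m(2)] by simp
  ultimately show ?thesis
    using hermite_basis[OF moduleD(1-3)[OF assms(1)] assms(2) m(1)] that by blast
qed

lemma ar_quad_elt: "ar (quad_elt D a 0) (quad_elt D b c) = of_int (a * c)"
  by (simp add: ar_def quad_elt_def)

lemma AA_basis:
  assumes I: "I \<in> carrier AA"
  obtains \<alpha> \<beta> where "I = lat \<alpha> \<beta>" "ar \<alpha> \<beta> \<noteq> 0"
proof -
  obtain d where d: "d \<in> carrier \<O>" "nm d \<noteq> 0" "\<forall>x\<in>I. d \<odot> x \<in> carrier \<O>"
    using AA_frac[OF I] fractional_iff by blast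
  obtain e where e: "e \<in> I" "nm e \<noteq> 0" using unit_in_AA[OF I] .
  let ?L = "(\<lambda>y. d \<odot> y) ` I"
  obtain a b c where abc: "a > 0" "c > 0" "?L = lat (quad_elt D a 0) (quad_elt D b c)"
    by (rule hermite_ideal[OF module_scale[OF AA_module[OF I]], of d "d \<odot> e"])
       (use d e in \<open>auto simp: qnorm_mult\<close>)
  have "I = (\<lambda>y. qinv D d \<odot> y) ` ?L"
    using qmul_qinv[OF d(2)] by (simp add: image_image qmul_assoc[symmetric] qmul_one)
  also have "\<dots> = lat (qinv D d \<odot> quad_elt D a 0) (qinv D d \<odot> quad_elt D b c)"
    unfolding abc lat_scale ..
  finally have I: "I = lat (qinv D d \<odot> quad_elt D a 0) (qinv D d \<odot> quad_elt D b c)" .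
  have "nm (qinv D d) * nm d = 1" using qmul_qinv(2)[OF d(2)] qnorm_mult qnorm_simps(1) by metis
  then have "ar (qinv D d \<odot> quad_elt D a 0) (qinv D d \<odot> quad_elt D b c) \<noteq> 0"
    using abc by (auto simp: ar_simps(6) ar_quad_elt)
  then show ?thesis using that I by blast
qed

text \<open>What preserves \<open>I\<close> also preserves \<open>I \<diamondop> J\<close>, which is
  the order for the inverse \<open>J\<close>, and hence sends 1 into the order: an invertible ideal
  has no larger ring of multipliers.\<close>

lemma multiplier:
  assumes "I \<in> carrier AA" "\<And>x. x \<in> I \<Longrightarrow> \<kappa> \<odot> x \<in> I"
  shows "\<kappa> \<in> carrier \<O>"
proof -
  obtain J where J: "J \<in> carrier AA" "I \<diamondop> J = carrier \<O>" using AA_E[OF assms(1)] by blast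
  have "\<kappa> \<odot> s \<in> I \<diamondop> J" if "s \<in> I \<diamondop> J" for s using that
    by (induction rule: ip_induct) (simp_all add: qmul_assoc[symmetric] qmul_add_right assms ip_mem ip_add)
  from this[of "(1, 0)"] show ?thesis using J O_closed(3) by (simp add: qmul_one)
qed

text \<open>The element is \<open>qconj \<alpha> \<odot> \<beta>\<close> divided by
  \<open>k * ar \<alpha> \<beta>\<close>. For \<open>k = 1\<close> this describes how the order acts
  on the basis; for a common divisor \<open>k\<close> of the coefficients of the norm form it is the
  extra multiplier that rules out imprimitive forms.\<close>

lemma form_mult:
  assumes w: "ar \<alpha> \<beta> \<noteq> 0" and k: "k \<noteq> 0"
    and h: "nm \<alpha> = ar \<alpha> \<beta> * (k * h0)" "tr2 D \<alpha> \<beta> = ar \<alpha> \<beta> * (k * h1)" "nm \<beta> = ar \<alpha> \<beta> * (k * h2)"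
  shows "(h1 / 2, 1 / (2 * k)) \<odot> \<alpha> = qscale h0 \<beta>"
    "(h1 / 2, 1 / (2 * k)) \<odot> \<beta> = qscale h1 \<beta> + qscale (- h2) \<alpha>"
proof -
  let ?\<kappa> = "(h1 / 2, 1 / (2 * k))"
  have \<kappa>: "qscale (ar \<alpha> \<beta> * k) ?\<kappa> = qconj \<alpha> \<odot> \<beta>"
    using k by (simp add: conj_mult h qscale_def)
  have "qscale (ar \<alpha> \<beta> * k) (?\<kappa> \<odot> \<alpha>) = (\<alpha> \<odot> qconj \<alpha>) \<odot> \<beta>"
    by (simp only: qmul_scale[symmetric] \<kappa>) (simp add: qmul_ac)
  also have "\<dots> = qscale (ar \<alpha> \<beta> * k) (qscale h0 \<beta>)"
    by (simp add: qmul_conj qmul_rat h qscale_simps mult.assoc)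
  finally show "?\<kappa> \<odot> \<alpha> = qscale h0 \<beta>" using w k by (simp add: qscale_cancel)
  have "qconj \<alpha> \<odot> \<beta> = (tr2 D \<alpha> \<beta>, 0) + - (\<alpha> \<odot> qconj \<beta>)"
    using conj_mult_add[of D \<alpha> \<beta>] by (simp add: algebra_simps)
  then have "qscale (ar \<alpha> \<beta> * k) (?\<kappa> \<odot> \<beta>) = ((tr2 D \<alpha> \<beta>, 0) + - (\<alpha> \<odot> qconj \<beta>)) \<odot> \<beta>"
    by (simp only: qmul_scale[symmetric] \<kappa>)
  also have "\<dots> = qscale (tr2 D \<alpha> \<beta>) \<beta> + - (\<alpha> \<odot> (qconj \<beta> \<odot> \<beta>))"
    by (simp only: qmul_add_left qmul_minus qmul_rat qmul_assoc)
  also have "\<dots> = qscale (ar \<alpha> \<beta> * k) (qscale h1 \<beta> + qscale (- h2) \<alpha>)"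
    by (simp add: qmul_conj qmul_rat h qscale_simps qscale_diff mult.assoc)
  finally show "?\<kappa> \<odot> \<beta> = qscale h1 \<beta> + qscale (- h2) \<alpha>" using w k by (simp add: qscale_cancel)
qed

text \<open>Dividing the norm by the oriented area turns it into the form
  \<open>h0 x^2 + h1 x y + h2 y^2\<close> on the lattice. Its integrality and primitivity encode
  that the lattice is an invertible ideal, by \<open>AA_norm_form\<close> and
  \<open>norm_form_AA\<close>.\<close>

definition norm_form :: "rat \<times> rat \<Rightarrow> rat \<times> rat \<Rightarrow> int \<Rightarrow> int \<Rightarrow> int \<Rightarrow> bool" where
  "norm_form \<alpha> \<beta> h0 h1 h2 \<longleftrightarrow> ar \<alpha> \<beta> \<noteq> 0 \<and> nm \<alpha> = ar \<alpha> \<beta> * of_int h0 \<and>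
     tr2 D \<alpha> \<beta> = ar \<alpha> \<beta> * of_int h1 \<and> nm \<beta> = ar \<alpha> \<beta> * of_int h2 \<and>
     (\<forall>k. k dvd h0 \<longrightarrow> k dvd h1 \<longrightarrow> k dvd h2 \<longrightarrow> k dvd 1)"

lemma norm_form_disc:
  assumes "norm_form \<alpha> \<beta> h0 h1 h2" shows "h1 ^ 2 - 4 * h0 * h2 = D"
proof -
  have w: "ar \<alpha> \<beta> \<noteq> 0" using assms by (simp add: norm_form_def)
  have "ar \<alpha> \<beta> ^ 2 * of_int (h1 ^ 2 - 4 * h0 * h2) = ar \<alpha> \<beta> ^ 2 * of_int D"
    using disc_norm_form[of D \<alpha> \<beta>] assms by (simp add: norm_form_def power2_eq_square algebra_simps)
  then show ?thesis using w by (simp only: mult_cancel_left of_int_eq_iff power_eq_0_iff) simp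
qed

lemma norm_form_parity:
  assumes "norm_form \<alpha> \<beta> h0 h1 h2" obtains l where "h1 = D + 2 * l"
proof -
  have "h1 ^ 2 = D + 2 * (2 * h0 * h2)" using norm_form_disc[OF assms] by simp
  then have "even (h1 ^ 2) \<longleftrightarrow> even D" by simp
  then have "even (h1 - D)" by simp
  then obtain l where "h1 - D = 2 * l" by (rule evenE)
  then show ?thesis using that[of l] by simp
qed

text \<open>The coefficients are integral combinations of \<open>D\<close> and the coordinates of
  \<open>\<tau> \<odot> \<alpha>\<close> and \<open>\<tau> \<odot> \<beta>\<close>, which are
  integers because \<tau> preserves the ideal. A common divisor \<open>k\<close> would give a
  multiplier with second coordinate \<open>1 / (2 * k)\<close>, and this lies in the order only if
  \<open>k\<close> divides 1.\<close>

lemma AA_norm_form: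
  assumes I: "lat \<alpha> \<beta> \<in> carrier AA" and w: "ar \<alpha> \<beta> \<noteq> 0"
  obtains h0 h1 h2 where "norm_form \<alpha> \<beta> h0 h1 h2"
proof -
  have "\<tau> \<odot> \<alpha> \<in> lat \<alpha> \<beta>" "\<tau> \<odot> \<beta> \<in> lat \<alpha> \<beta>"
    using moduleD(4)[OF AA_module[OF I] tau_O] lat_mem by blast+
  then obtain x y x' y' where e: "\<tau> \<odot> \<alpha> = qscale (of_int x) \<alpha> + qscale (of_int y) \<beta>"
    "\<tau> \<odot> \<beta> = qscale (of_int x') \<alpha> + qscale (of_int y') \<beta>" by (meson latE)
  have t: "ar (1, 0) \<tau> = 1" by (simp add: ar_def)
  have "nm \<alpha> = ar \<alpha> (\<tau> \<odot> \<alpha>)" by (simp add: ar_simps(8) t)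
  then have 0: "nm \<alpha> = ar \<alpha> \<beta> * of_int y" unfolding e by (simp add: ar_simps(1-5))
  have "nm \<beta> = ar \<beta> (\<tau> \<odot> \<beta>)" by (simp add: ar_simps(8) t)
  then have 2: "nm \<beta> = ar \<alpha> \<beta> * of_int (- x')" unfolding e by (simp add: ar_simps(1-5) ar_simps(7)[of \<beta> \<alpha>])
  have "tr2 D \<alpha> \<beta> = 2 * ar \<alpha> (\<tau> \<odot> \<beta>) - of_int D * ar \<alpha> \<beta>"
    by (simp add: ar_def tr2_def q_defs field_simps)
  then have 1: "tr2 D \<alpha> \<beta> = ar \<alpha> \<beta> * of_int (2 * y' - D)" unfolding e by (simp add: ar_simps(1-5) algebra_simps)
  have "k dvd 1" if k: "k dvd y" "k dvd 2 * y' - D" "k dvd - x'" for k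
  proof -
    obtain u v z where u: "y = k * u" "2 * y' - D = k * v" "- x' = k * z" using k unfolding dvd_def by blast
    have k0: "k \<noteq> 0"
    proof
      assume "k = 0"
      then have "of_int D * ar \<alpha> \<beta> ^ 2 = 0" using disc_norm_form[of D \<alpha> \<beta>] 0 1 2 u by simp
      then show False using w D_nonzero by simp
    qed
    let ?\<kappa> = "(of_int v / 2, 1 / (2 * of_int k))"
    have f: "?\<kappa> \<odot> \<alpha> = qscale (of_int u) \<beta>" "?\<kappa> \<odot> \<beta> = qscale (of_int v) \<beta> + qscale (- of_int z) \<alpha>"
      using form_mult[OF w, of "of_int k" "of_int u" "of_int v" "of_int z"] k0 0 1 2 unfolding u of_int_mult by auto
    have g: "?\<kappa> \<odot> \<alpha> \<in> lat \<alpha> \<beta>" "?\<kappa> \<odot> \<beta> \<in> lat \<alpha> \<beta>"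
      unfolding f using lat_mem(4)[of 0 \<alpha> u \<beta>] lat_mem(4)[of "- z" \<alpha> v \<beta>] by (simp_all add: qscale_simps(5) add.commute)
    have "?\<kappa> \<in> carrier \<O>"
    proof (rule multiplier[OF I])
      fix s assume "s \<in> lat \<alpha> \<beta>"
      then obtain m n where "s = qscale (of_int m) \<alpha> + qscale (of_int n) \<beta>" by (rule latE)
      then have "?\<kappa> \<odot> s = qscale (of_int m) (?\<kappa> \<odot> \<alpha>) + qscale (of_int n) (?\<kappa> \<odot> \<beta>)"
        by (simp only: qmul_add_right qmul_scale)
      then show "?\<kappa> \<odot> s \<in> lat \<alpha> \<beta>" using lat_closed(1)[OF lat_closed(3)[OF g(1)] lat_closed(3)[OF g(2)]] by simp
    qed
    then obtain b where "1 / (2 * of_int k) = (of_int b :: rat) / 2" unfolding quad_ring_carrier by blast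
    then have "(of_int (b * k) :: rat) = of_int 1" using k0 by (simp add: field_simps)
    then have "1 = k * b" unfolding of_int_eq_iff by (simp add: mult.commute)
    then show "k dvd 1" by (rule dvdI)
  qed
  then show ?thesis using that 0 1 2 w unfolding norm_form_def by blast
qed

lemma norm_form_module:
  assumes "norm_form \<alpha> \<beta> h0 h1 h2" shows "module (lat \<alpha> \<beta>)"
proof -
  note n = assms[unfolded norm_form_def]
  have f: "(of_int h1 / 2, 1 / 2) \<odot> \<alpha> = qscale (of_int h0) \<beta>"
    "(of_int h1 / 2, 1 / 2) \<odot> \<beta> = qscale (of_int h1) \<beta> + qscale (- of_int h2) \<alpha>"
    using form_mult[of \<alpha> \<beta> 1 "of_int h0" "of_int h1" "of_int h2"] n by simp_all
  \<comment> \<open>\<open>h1\<close> and \<open>D\<close> have the same parity, so \<tau> differs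
    by an integer from the element that acts on the basis through the form.\<close>
  obtain l where l: "h1 = D + 2 * l" using norm_form_parity[OF assms] .
  have t: "\<tau> = (of_int h1 / 2, 1 / 2) + (of_int (- l), 0)" by (simp add: l add_divide_distrib)
  have g: "\<tau> \<odot> \<alpha> \<in> lat \<alpha> \<beta>" "\<tau> \<odot> \<beta> \<in> lat \<alpha> \<beta>"
    unfolding t qmul_add_left qmul_rat f
    by (intro lat_closed lat_mem; simp flip: of_int_minus; intro lat_closed lat_mem)+
  show ?thesis unfolding module_def
  proof (intro conjI ballI)
    fix r x assume "r \<in> carrier \<O>" "x \<in> lat \<alpha> \<beta>"
    then obtain a b m n where r: "r = qscale (of_int a) (1, 0) + qscale (of_int b) \<tau>"
      and x: "x = qscale (of_int m) \<alpha> + qscale (of_int n) \<beta>" unfolding quad_ring_lat by (meson latE)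
    have "\<tau> \<odot> x = qscale (of_int m) (\<tau> \<odot> \<alpha>) + qscale (of_int n) (\<tau> \<odot> \<beta>)"
      unfolding x by (simp only: qmul_add_right qmul_scale)
    then have "\<tau> \<odot> x \<in> lat \<alpha> \<beta>" using g by (simp add: lat_closed)
    moreover have "r \<odot> x = qscale (of_int a) x + qscale (of_int b) (\<tau> \<odot> x)"
      unfolding r by (simp only: qmul_add_left qmul_scale qmul_one)
    ultimately show "r \<odot> x \<in> lat \<alpha> \<beta>" using \<open>x \<in> lat \<alpha> \<beta>\<close> by (simp add: lat_closed)
  qed (simp_all add: lat_closed lat_mem)
qed

lemma conj_lat: "qconj ` lat \<alpha> \<beta> = lat (qconj \<alpha>) (qconj \<beta>)"
proof (intro equalityI subsetI)
  fix x assume "x \<in> qconj ` lat \<alpha> \<beta>"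
  then obtain y where y: "y \<in> lat \<alpha> \<beta>" "x = qconj y" by blast
  from y(1) obtain m n where "y = qscale (of_int m) \<alpha> + qscale (of_int n) \<beta>" by (rule latE)
  then show "x \<in> lat (qconj \<alpha>) (qconj \<beta>)" using y by (simp add: qconj_simps lat_mem)
next
  fix x assume "x \<in> lat (qconj \<alpha>) (qconj \<beta>)"
  then obtain m n where "x = qscale (of_int m) (qconj \<alpha>) + qscale (of_int n) (qconj \<beta>)" by (rule latE)
  then have "x = qconj (qscale (of_int m) \<alpha> + qscale (of_int n) \<beta>)" by (simp add: qconj_simps)
  then show "x \<in> qconj ` lat \<alpha> \<beta>" using lat_mem(4) by blast
qed

lemma module_conj: assumes "module I" shows "module (qconj ` I)"
  unfolding module_def
proof (intro conjI ballI)
  show "0 \<in> qconj ` I" using moduleD(1)[OF assms] qconj_simps(6) by (metis imageI)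
  fix x assume "x \<in> qconj ` I"
  then obtain y where y: "y \<in> I" "x = qconj y" by blast
  show "- x \<in> qconj ` I" using y moduleD(3)[OF assms] by (metis imageI qconj_simps(3))
  show "r \<odot> x \<in> qconj ` I" if "r \<in> carrier \<O>" for r
    by (rule image_eqI[OF _ moduleD(4)[OF assms conj_O[OF that] y(1)]]) (simp add: y(2) qconj_simps)
  fix x' assume "x' \<in> qconj ` I"
  then obtain y' where y': "y' \<in> I" "x' = qconj y'" by blast
  show "x + x' \<in> qconj ` I"
    by (rule image_eqI[OF _ module_add[OF assms y(1) y'(1)]]) (simp add: y(2) y'(2) qconj_simps)
qed

lemma ip_conj: "qconj ` (I \<diamondop> J) = (qconj ` I) \<diamondop> (qconj ` J)"
proof -
  have s: "qconj ` (I \<diamondop> J) \<subseteq> (qconj ` I) \<diamondop> (qconj ` J)" for I J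
  proof
    fix x assume "x \<in> qconj ` (I \<diamondop> J)"
    then obtain y where y: "y \<in> I \<diamondop> J" "x = qconj y" by blast
    from y(1) have "qconj y \<in> (qconj ` I) \<diamondop> (qconj ` J)"
      by (induction rule: ip_induct) (simp_all add: qconj_simps ip_mem ip_add)
    then show "x \<in> (qconj ` I) \<diamondop> (qconj ` J)" using y by simp
  qed
  have cc: "qconj ` qconj ` I = I" for I by (simp add: image_image qconj_simps)
  have "(qconj ` I) \<diamondop> (qconj ` J) = qconj ` qconj ` ((qconj ` I) \<diamondop> (qconj ` J))" by (simp add: cc)
  also have "\<dots> \<subseteq> qconj ` (I \<diamondop> J)"
    by (rule image_mono) (use s[of "qconj ` I" "qconj ` J"] in \<open>simp add: cc\<close>)
  finally show ?thesis using s by blast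
qed

text \<open>The four products of basis elements with conjugates are the area times elements of the
  order; conversely primitivity gives a Bezout relation among \<open>h0\<close>, \<open>h1\<close>,
  \<open>h2\<close> that produces the area itself. So the area serves as the norm of the
  ideal.\<close>

lemma norm_ideal:
  assumes "norm_form \<alpha> \<beta> h0 h1 h2"
  shows "lat \<alpha> \<beta> \<diamondop> (qconj ` lat \<alpha> \<beta>) = pr (ar \<alpha> \<beta>, 0)"
proof
  let ?w = "ar \<alpha> \<beta>"
  note n = assms[unfolded norm_form_def]
  have modI: "module (lat \<alpha> \<beta>)" by (rule norm_form_module[OF assms])
  have M: "module (pr (?w, 0))" by (rule module_scale[OF module_O])
  obtain l where l: "h1 = D + 2 * l" using norm_form_parity[OF assms] .
  have ab: "qconj \<alpha> \<odot> \<beta> = (?w, 0) \<odot> quad_elt D l 1"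
    unfolding conj_mult using n by (simp add: qmul_rat qscale_def quad_elt_def l field_simps)
  have el: "\<alpha> \<odot> qconj \<alpha> \<in> pr (?w, 0)" "\<beta> \<odot> qconj \<beta> \<in> pr (?w, 0)" "\<beta> \<odot> qconj \<alpha> \<in> pr (?w, 0)"
     "\<alpha> \<odot> qconj \<beta> \<in> pr (?w, 0)"
  proof -
    have "\<alpha> \<odot> qconj \<alpha> = (?w, 0) \<odot> quad_elt D h0 0" "\<beta> \<odot> qconj \<beta> = (?w, 0) \<odot> quad_elt D h2 0"
      using n by (simp_all add: qmul_conj qmul_rat qscale_def quad_elt_def)
    then show "\<alpha> \<odot> qconj \<alpha> \<in> pr (?w, 0)" "\<beta> \<odot> qconj \<beta> \<in> pr (?w, 0)" by (metis imageI quad_elt_carrier)+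
    have "\<beta> \<odot> qconj \<alpha> = (?w, 0) \<odot> quad_elt D l 1" using ab qmul_comm by metis
    then show "\<beta> \<odot> qconj \<alpha> \<in> pr (?w, 0)" by (metis imageI quad_elt_carrier)
    have "\<alpha> \<odot> qconj \<beta> = qconj (qconj \<alpha> \<odot> \<beta>)" by (simp add: qconj_simps)
    also have "\<dots> = (?w, 0) \<odot> qconj (quad_elt D l 1)" unfolding ab by (simp add: qconj_simps) (simp add: qconj_def)
    finally show "\<alpha> \<odot> qconj \<beta> \<in> pr (?w, 0)" using conj_O[of "quad_elt D l 1"] by (metis imageI quad_elt_carrier)
  qed
  show "lat \<alpha> \<beta> \<diamondop> (qconj ` lat \<alpha> \<beta>) \<subseteq> pr (?w, 0)"
  proof (rule ip_subset)
    fix x y assume "x \<in> lat \<alpha> \<beta>" "y \<in> qconj ` lat \<alpha> \<beta>"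
    then obtain m n m' n' where x: "x = qscale (of_int m) \<alpha> + qscale (of_int n) \<beta>"
      and y: "y = qscale (of_int m') (qconj \<alpha>) + qscale (of_int n') (qconj \<beta>)" unfolding conj_lat by (meson latE)
    have eq: "x \<odot> y = (qscale (of_int (m * m')) (\<alpha> \<odot> qconj \<alpha>) + qscale (of_int (m * n')) (\<alpha> \<odot> qconj \<beta>)) +
       (qscale (of_int (n * m')) (\<beta> \<odot> qconj \<alpha>) + qscale (of_int (n * n')) (\<beta> \<odot> qconj \<beta>))"
      unfolding x y by (simp only: qmul_add_left qmul_add_right qmul_scale qscale_simps of_int_mult)
        (simp add: qscale_simps algebra_simps)
    show "x \<odot> y \<in> pr (?w, 0)"
      unfolding eq by (intro module_add[OF M] module_int[OF M] el)
  qed (rule module_add[OF M])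
  let ?N = "lat \<alpha> \<beta> \<diamondop> (qconj ` lat \<alpha> \<beta>)"
  have N: "module ?N" by (rule module_ip[OF modI module_conj[OF modI]])
  have "\<alpha> \<odot> qconj \<alpha> \<in> ?N" "\<beta> \<odot> qconj \<beta> \<in> ?N" "\<beta> \<odot> qconj \<alpha> \<in> ?N" "\<alpha> \<odot> qconj \<beta> \<in> ?N"
    by (intro ip_mem imageI lat_mem)+
  note N4 = this
  have N3: "(?w * of_int h0, 0) \<in> ?N" "(?w * of_int h2, 0) \<in> ?N"
    using N4(1,2) n by (simp_all only: qmul_conj)
  have "qconj \<alpha> \<odot> \<beta> + \<alpha> \<odot> qconj \<beta> \<in> ?N"
    by (rule module_add[OF N _ N4(4)]) (subst qmul_comm, rule N4(3))
  then have N5: "(?w * of_int h1, 0) \<in> ?N" using n by (simp only: conj_mult_add)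
  obtain x y where xy: "x * h0 + y * h1 = gcd h0 h1" using bezout_int by blast
  obtain u v where uv: "u * gcd h0 h1 + v * h2 = gcd (gcd h0 h1) h2" using bezout_int by blast
  have "gcd (gcd h0 h1) h2 dvd 1" using n by (metis dvd_trans gcd_dvd1 gcd_dvd2)
  then have g1: "gcd (gcd h0 h1) h2 = 1" by simp
  then have "1 = u * (x * h0 + y * h1) + v * h2" unfolding xy uv ..
  also have "\<dots> = u * x * h0 + u * y * h1 + v * h2" by (simp add: distrib_left mult.assoc)
  finally have "1 = u * x * h0 + u * y * h1 + v * h2" .
  then have r: "(1 :: rat) = of_int (u * x) * of_int h0 + of_int (u * y) * of_int h1 + of_int v * of_int h2"
    by (metis of_int_1 of_int_add of_int_mult)
  have eq: "(?w, 0) = qscale (of_int (u * x)) (?w * of_int h0, 0) + qscale (of_int (u * y)) (?w * of_int h1, 0)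
     + qscale (of_int v) (?w * of_int h2, 0)"
    using arg_cong[OF r, of "\<lambda>t. ?w * t"] by (simp add: qscale_def algebra_simps)
  have wN: "(?w, 0) \<in> ?N"
    unfolding eq by (intro module_add[OF N] module_int[OF N] N3 N5)
  show "pr (?w, 0) \<subseteq> ?N"
    using moduleD(4)[OF N _ wN] by (auto simp: qmul_comm)
qed

text \<open>By \<open>norm_ideal\<close> the inverse is the conjugate lattice divided by the
  area.\<close>

lemma norm_form_AA:
  assumes "norm_form \<alpha> \<beta> h0 h1 h2" shows "lat \<alpha> \<beta> \<in> carrier AA"
proof (rule AA_I)
  let ?w = "ar \<alpha> \<beta>"
  have w: "?w \<noteq> 0" using assms by (simp add: norm_form_def)
  have frac: "fractional_ideal K \<O> L" if "module L" "L = lat \<gamma> \<delta>" for L \<gamma> \<delta>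
  proof -
    obtain d where d: "d \<in> carrier \<O>" "nm d \<noteq> 0" "d \<odot> \<gamma> \<in> carrier \<O>" by (rule O_scale_denom)
    obtain e where e: "e \<in> carrier \<O>" "nm e \<noteq> 0" "e \<odot> \<delta> \<in> carrier \<O>" by (rule O_scale_denom)
    have g: "(d \<odot> e) \<odot> \<gamma> \<in> carrier \<O>" "(d \<odot> e) \<odot> \<delta> \<in> carrier \<O>"
      using O_closed(1)[OF e(1) d(3)] O_closed(1)[OF d(1) e(3)] by (simp_all add: qmul_ac)
    have "(\<lambda>y. (d \<odot> e) \<odot> y) ` L \<subseteq> carrier \<O>"
      unfolding that lat_scale by (rule lat_subset[OF moduleD(1-3)[OF module_O] g])
    then show ?thesis unfolding fractional_iff using that(1) d e O_closed(1)[of d e]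
      by (intro conjI bexI[of _ "d \<odot> e"]) (auto simp: qnorm_mult)
  qed
  have m: "module (lat \<alpha> \<beta>)" by (rule norm_form_module[OF assms])
  show "fractional_ideal K \<O> (lat \<alpha> \<beta>)" by (rule frac[OF m refl])
  show "fractional_ideal K \<O> (pr (1 / ?w, 0) \<diamondop> (qconj ` lat \<alpha> \<beta>))"
    by (rule fractional_ip[OF fractional_pr frac[OF module_conj[OF m] conj_lat]])
  have "lat \<alpha> \<beta> \<diamondop> (pr (1 / ?w, 0) \<diamondop> (qconj ` lat \<alpha> \<beta>)) = pr (1 / ?w, 0) \<diamondop> (lat \<alpha> \<beta> \<diamondop> (qconj ` lat \<alpha> \<beta>))"
    by (simp only: ip_ac)
  also have "\<dots> = carrier \<O>" unfolding norm_ideal[OF assms] pr_mult using w by (simp add: qmul_rat qscale_def qmul_one)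
  finally show "lat \<alpha> \<beta> \<diamondop> (pr (1 / ?w, 0) \<diamondop> (qconj ` lat \<alpha> \<beta>)) = carrier \<O>" .
qed

text \<open>Each generator is an integer multiple of the other, because the only rational elements
  of the order are the integers.\<close>

lemma pr_rat_eq: assumes "pr (q, 0) = pr (r, 0)" shows "\<bar>q\<bar> = \<bar>r\<bar>"
proof -
  have *: "\<exists>n. q = r * of_int n" if "pr (q, 0) \<subseteq> pr (r, 0)" for q r
  proof -
    have "(q, 0) \<odot> (1, 0) \<in> pr (r, 0)" using that O_closed(3) by blast
    then obtain x where "x \<in> carrier \<O>" "(q, 0) \<odot> (1, 0) = (r, 0) \<odot> x" by blast
    then have x: "x \<in> carrier \<O>" "(q, 0) = qscale r x" by (simp_all add: qmul_one qmul_rat qscale_simps)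
    show ?thesis
    proof (cases "r = 0")
      case True then show ?thesis using x by (simp add: qscale_def)
    next
      case False
      then have "x = (q / r, 0)" using x(2) by (simp add: qscale_def prod_eq_iff)
      then show ?thesis using x(1) False by (auto simp: rat_O_iff field_simps)
    qed
  qed
  obtain n where n: "q = r * of_int n" using * assms by blast
  obtain m where m: "r = q * of_int m" using * assms by blast
  show ?thesis
  proof (cases "q = 0")
    case False
    have "q * 1 = q * of_int (m * n)" using n unfolding m by (simp add: mult.assoc)
    then have "(of_int (m * n) :: rat) = of_int 1" using False by (simp only: mult_cancel_left) simp
    then have "m * n = 1" by (simp only: of_int_eq_iff)
    then have "n = 1 \<or> n = -1" by (auto simp: zmult_eq_1_iff)
    then show ?thesis using n by auto
  qed (use m in simp)
qed

text \<open>Both sides of the ideal identity are multiplied by their conjugates;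
  \<open>norm_ideal\<close> turns them into principal ideals with rational generators, which
  determine these generators up to sign only.\<close>

lemma norm_cube:
  assumes I: "norm_form \<alpha> \<beta> h0 h1 h2" and J: "norm_form \<alpha>' \<beta>' k0 k1 k2"
    and e: "pr \<gamma> \<diamondop> ((lat \<alpha> \<beta> \<diamondop> lat \<alpha> \<beta>) \<diamondop> lat \<alpha> \<beta>) = pr (g, 0) \<diamondop> lat \<alpha>' \<beta>'"
  shows "\<bar>nm \<gamma> * ar \<alpha> \<beta> ^ 3\<bar> = g ^ 2 * \<bar>ar \<alpha>' \<beta>'\<bar>"
proof -
  let ?I = "lat \<alpha> \<beta>" and ?J = "lat \<alpha>' \<beta>'"
  have cp: "qconj ` pr x = pr (qconj x)" for x
  proof -
    have "qconj ` carrier \<O> = carrier \<O>"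
      using conj_O qconj_simps(4) by (metis image_subsetI subsetI subset_antisym image_eqI)
    then have "pr (qconj x) = (\<lambda>r. qconj x \<odot> r) ` qconj ` carrier \<O>" by simp
    then show ?thesis by (simp add: image_image qconj_simps)
  qed
  let ?L = "pr \<gamma> \<diamondop> ((?I \<diamondop> ?I) \<diamondop> ?I)"
  have "?L \<diamondop> (qconj ` ?L) = (pr \<gamma> \<diamondop> ((?I \<diamondop> ?I) \<diamondop> ?I)) \<diamondop> (pr (qconj \<gamma>) \<diamondop> ((qconj ` ?I \<diamondop> qconj ` ?I) \<diamondop> qconj ` ?I))"
    by (simp only: ip_conj cp)
  also have "\<dots> = (pr \<gamma> \<diamondop> pr (qconj \<gamma>)) \<diamondop> ((?I \<diamondop> qconj ` ?I) \<diamondop> ((?I \<diamondop> qconj ` ?I) \<diamondop> (?I \<diamondop> qconj ` ?I)))"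
    by (simp only: ip_ac)
  also have "\<dots> = pr (nm \<gamma> * ar \<alpha> \<beta> ^ 3, 0)"
    unfolding norm_ideal[OF I] pr_mult by (simp add: qmul_conj qmul_rat qscale_def power3_eq_cube mult_ac)
  finally have 1: "?L \<diamondop> (qconj ` ?L) = pr (nm \<gamma> * ar \<alpha> \<beta> ^ 3, 0)" .
  have "?L \<diamondop> (qconj ` ?L) = (pr (g, 0) \<diamondop> ?J) \<diamondop> (pr (g, 0) \<diamondop> qconj ` ?J)"
    unfolding e by (simp only: ip_conj cp) (simp add: qconj_def)
  also have "\<dots> = (pr (g, 0) \<diamondop> pr (g, 0)) \<diamondop> (?J \<diamondop> qconj ` ?J)"
    by (simp only: ip_ac)
  also have "\<dots> = pr (g ^ 2 * ar \<alpha>' \<beta>', 0)"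
    unfolding norm_ideal[OF J] pr_mult by (simp add: qmul_rat qscale_def power2_eq_square mult_ac)
  finally have "pr (nm \<gamma> * ar \<alpha> \<beta> ^ 3, 0) = pr (g ^ 2 * ar \<alpha>' \<beta>', 0)" using 1 by simp
  from pr_rat_eq[OF this] show ?thesis by (simp add: abs_mult)
qed

end

section \<open>Change of basis, ideal norms and finiteness of the class group\<close>

lemma ar_comb: "ar (qscale p \<alpha> + qscale r \<beta>) (qscale q \<alpha> + qscale s \<beta>) = (p * s - q * r) * ar \<alpha> \<beta>"
  by (simp add: ar_def qscale_def algebra_simps)

lemma lat_comb:
  assumes "p * s - q * r = (1 :: int)"
  shows "lat (qscale (of_int p) \<alpha> + qscale (of_int r) \<beta>) (qscale (of_int q) \<alpha> + qscale (of_int s) \<beta>) = lat \<alpha> \<beta>"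
    (is "lat ?\<alpha> ?\<beta> = _")
proof
  show "lat ?\<alpha> ?\<beta> \<subseteq> lat \<alpha> \<beta>"
    by (rule lat_subset; (intro ballI)?; (rule lat_mem lat_closed; assumption?)+)
  have d: "(of_int p :: rat) * of_int s - of_int q * of_int r = 1"
    using assms by (metis of_int_1 of_int_diff of_int_mult)
  have "qscale (of_int s) ?\<alpha> + qscale (of_int (- r)) ?\<beta> = qscale (of_int p * of_int s - of_int q * of_int r) \<alpha>"
    "qscale (of_int (- q)) ?\<alpha> + qscale (of_int p) ?\<beta> = qscale (of_int p * of_int s - of_int q * of_int r) \<beta>"
    by (simp_all add: qscale_def algebra_simps)
  then have "\<alpha> = qscale (of_int s) ?\<alpha> + qscale (of_int (- r)) ?\<beta>"
    "\<beta> = qscale (of_int (- q)) ?\<alpha> + qscale (of_int p) ?\<beta>"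
    unfolding d by (simp_all only: qscale_simps)
  then have "\<alpha> \<in> lat ?\<alpha> ?\<beta>" "\<beta> \<in> lat ?\<alpha> ?\<beta>" using lat_mem(4) by metis+
  then show "lat \<alpha> \<beta> \<subseteq> lat ?\<alpha> ?\<beta>"
    by (intro lat_subset lat_mem ballI lat_closed)
qed

lemma lat_swap: "lat \<beta> (- \<alpha>) = lat \<alpha> \<beta>"
  using lat_comb[of 0 0 "-1" 1 \<alpha> \<beta>] by (simp add: qscale_simps)

lemma lat_shear: "lat \<alpha> (\<beta> + qscale (of_int k) \<alpha>) = lat \<alpha> \<beta>"
  using lat_comb[of 1 1 k 0 \<alpha> \<beta>] by (simp add: qscale_simps add.commute)

context quad
begin

lemma a_inv_O: "x \<in> carrier \<O> \<Longrightarrow> \<ominus>\<^bsub>\<O>\<^esub> x = - x"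
  by (rule O.minus_equality[OF _ _ O_uminus]) (simp_all only: quad_ring_add quad_ring_zero left_minus)

lemma ideal_O_iff: "ideal J \<O> \<longleftrightarrow> module J \<and> J \<subseteq> carrier \<O>"
proof
  assume "ideal J \<O>"
  then interpret ideal J \<O> .
  have 1: "- x \<in> J" if "x \<in> J" for x using a_inv_closed[OF that] a_inv_O[OF Icarr[OF that]] by simp
  have 2: "x + y \<in> J" if "x \<in> J" "y \<in> J" for x y
    using a_closed[OF that] by (simp add: quad_ring_add)
  have 3: "r \<odot> x \<in> J" if "r \<in> carrier \<O>" "x \<in> J" for r x
    using I_l_closed[OF that(2,1)] by (simp add: quad_ring_mult)
  have 4: "0 \<in> J" using zero_closed by (simp add: quad_ring_zero)
  have 5: "J \<subseteq> carrier \<O>" using a_subset .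
  show "module J \<and> J \<subseteq> carrier \<O>"
    unfolding module_def by (intro conjI ballI 5 4; rule 1 2 3; assumption)
next
  assume J: "module J \<and> J \<subseteq> carrier \<O>"
  note m = moduleD[OF conjunct1[OF J]]
  show "ideal J \<O>"
  proof (rule idealI)
    show "ring \<O>" by (rule O.ring_axioms)
    show "subgroup J (add_monoid \<O>)"
    proof (rule subgroup.intro)
      fix x y assume x: "x \<in> J" and y: "y \<in> J"
      have "inv\<^bsub>add_monoid \<O>\<^esub> x = - x" using a_inv_O[of x] x J unfolding a_inv_def by blast
      moreover have "- x \<in> J" using m(3) x by blast
      ultimately show "inv\<^bsub>add_monoid \<O>\<^esub> x \<in> J" by simp
      have "x + y \<in> J" using m(2) x y by blast
      then show "x \<otimes>\<^bsub>add_monoid \<O>\<^esub> y \<in> J" by (simp add: quad_ring_add)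
    next
      show "J \<subseteq> carrier (add_monoid \<O>)" using J by simp
      show "\<one>\<^bsub>add_monoid \<O>\<^esub> \<in> J" using m(1) by (simp add: quad_ring_zero)
    qed
    fix a x assume "a \<in> J" "x \<in> carrier \<O>"
    then show "x \<otimes>\<^bsub>\<O>\<^esub> a \<in> J" "a \<otimes>\<^bsub>\<O>\<^esub> x \<in> J"
      using m(4)[of x a] by (simp_all add: quad_ring_mult qmul_comm)
  qed
qed

text \<open>The box \<open>{0..<a} \<times> {0..<c}\<close> represents the cosets: the second
  coordinate is reduced modulo \<open>c\<close>, at the price of shifting the first by a multiple of
  \<open>b\<close>, and the first is then reduced modulo \<open>a\<close>.\<close>

lemma card_quotient:
  assumes J: "J = lat (quad_elt D a 0) (quad_elt D b c)" and a: "a > 0" and c: "c > 0"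
  shows "card (carrier (\<O> Quot J)) = nat (a * c)"
proof -
  define cs where "cs x = (\<lambda>j. j + x) ` J" for x :: "rat \<times> rat"
  have carr: "carrier (\<O> Quot J) = cs ` carrier \<O>"
    unfolding FactRing_def A_RCOSETS_def' a_r_coset_def' cs_def by (auto simp: quad_ring_add)
  have cl: "0 \<in> J" "x \<in> J \<Longrightarrow> y \<in> J \<Longrightarrow> x + y \<in> J" "x \<in> J \<Longrightarrow> - x \<in> J" for x y
    unfolding J by (auto intro: lat_mem lat_closed)
  have eq: "cs x = cs y \<longleftrightarrow> x - y \<in> J" for x y
  proof
    assume "cs x = cs y"
    then have "0 + x \<in> cs y" using cl unfolding cs_def by blast
    then obtain j where "j \<in> J" "0 + x = j + y" unfolding cs_def by blast
    then show "x - y \<in> J" by (simp add: algebra_simps)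
  next
    have *: "cs x \<subseteq> cs y" if "x - y \<in> J" for x y
    proof
      fix z assume "z \<in> cs x"
      then obtain j where j: "j \<in> J" "z = j + x" unfolding cs_def by blast
      then have "z = (j + (x - y)) + y" by simp
      then show "z \<in> cs y" unfolding cs_def using cl(2)[OF j(1) that] by blast
    qed
    assume h: "x - y \<in> J"
    have "y - x \<in> J" using cl(3)[OF h] by simp
    then show "cs x = cs y" using * h by blast
  qed
  have diff: "quad_elt D u v - quad_elt D u' v' = quad_elt D (u - u') (v - v')" for u v u' v'
    by (simp add: quad_elt_def algebra_simps diff_divide_distrib)
  have memJ: "quad_elt D u v \<in> J \<longleftrightarrow> (\<exists>m n. u = m * a + n * b \<and> v = n * c)" for u v
    unfolding J lat_def quad_elt_scale by (auto simp: quad_elt_eq_iff)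
  define f where "f = (\<lambda>(u, v). cs (quad_elt D u v))"
  have "bij_betw f ({0..<a} \<times> {0..<c}) (cs ` carrier \<O>)"
    unfolding bij_betw_def
  proof
    show "inj_on f ({0..<a} \<times> {0..<c})"
    proof (rule inj_onI, clarify)
      fix u v u' v' assume r: "u \<in> {0..<a}" "v \<in> {0..<c}" "u' \<in> {0..<a}" "v' \<in> {0..<c}"
        and "f (u, v) = f (u', v')"
      then obtain m n where mn: "u - u' = m * a + n * b" "v - v' = n * c"
        unfolding f_def by (auto simp: eq diff memJ)
      have "c dvd v - v'" "\<bar>v - v'\<bar> < c" using mn r by auto
      then have v: "v = v'" using dvd_imp_le_int[of "v - v'" c] by fastforce
      then have "n = 0" using mn c by simp
      then have "a dvd u - u'" "\<bar>u - u'\<bar> < a" using mn r by auto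
      then have "u = u'" using dvd_imp_le_int[of "u - u'" a] by fastforce
      with v show "u = u' \<and> v = v'" by simp
    qed
    show "f ` ({0..<a} \<times> {0..<c}) = cs ` carrier \<O>"
    proof (intro equalityI subsetI)
      fix S assume "S \<in> cs ` carrier \<O>"
      then obtain u v where S: "S = cs (quad_elt D u v)" by (auto elim!: quad_ringE)
      define k where "k = v div c"
      define w where "w = u - k * b"
      have "w mod a = w - (w div a) * a" "v mod c = v - k * c"
        unfolding k_def by (simp_all add: minus_div_mult_eq_mod)
      then have uv: "u - w mod a = (w div a) * a + k * b" "v - v mod c = k * c"
        by (simp_all add: w_def)
      have "quad_elt D (u - w mod a) (v - v mod c) \<in> J" unfolding memJ using uv by blast
      then have "S = f (w mod a, v mod c)" unfolding S f_def by (simp add: eq diff)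
      moreover have "(w mod a, v mod c) \<in> {0..<a} \<times> {0..<c}" using a c by simp
      ultimately show "S \<in> f ` ({0..<a} \<times> {0..<c})" by blast
    qed (auto simp: f_def)
  qed
  then have "card (cs ` carrier \<O>) = card ({0..<a} \<times> {0..<c})" by (simp add: bij_betw_same_card)
  then show ?thesis unfolding carr using a c by (simp add: card_cartesian_product nat_mult_distrib)
qed

lemma lat_area_eq:
  assumes "norm_form \<alpha> \<beta> h0 h1 h2" "norm_form \<gamma> \<delta> k0 k1 k2" "lat \<alpha> \<beta> = lat \<gamma> \<delta>"
  shows "\<bar>ar \<alpha> \<beta>\<bar> = \<bar>ar \<gamma> \<delta>\<bar>"
  using pr_rat_eq norm_ideal[OF assms(1)] norm_ideal[OF assms(2)] assms(3) by metis

lemma integral_AA_basis: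
  assumes J: "J \<in> carrier AA" "J \<subseteq> carrier \<O>"
  obtains a b c h0 h1 h2 where "a > 0" "c > 0" "J = lat (quad_elt D a 0) (quad_elt D b c)"
    "norm_form (quad_elt D a 0) (quad_elt D b c) h0 h1 h2"
proof -
  obtain e where e: "e \<in> J" "nm e \<noteq> 0" using unit_in_AA[OF J(1)] .
  obtain a b c where abc: "a > 0" "c > 0" "J = lat (quad_elt D a 0) (quad_elt D b c)"
    by (rule hermite_ideal[OF AA_module[OF J(1)] J(2) e])
  have "ar (quad_elt D a 0) (quad_elt D b c) \<noteq> 0" using abc by (simp add: ar_quad_elt)
  with AA_norm_form[of "quad_elt D a 0" "quad_elt D b c"] J(1) abc that show ?thesis by metis
qed

text \<open>The index is visible on a Hermite basis, where it equals the area; by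
  \<open>norm_ideal\<close> the area depends, up to sign, on the ideal only.\<close>

lemma card_quotient_area:
  assumes "norm_form \<alpha> \<beta> h0 h1 h2" "lat \<alpha> \<beta> \<subseteq> carrier \<O>"
  shows "of_nat (card (carrier (\<O> Quot lat \<alpha> \<beta>))) = \<bar>ar \<alpha> \<beta>\<bar>"
proof -
  obtain a b c k0 k1 k2 where abc: "a > 0" "c > 0" "lat \<alpha> \<beta> = lat (quad_elt D a 0) (quad_elt D b c)"
    "norm_form (quad_elt D a 0) (quad_elt D b c) k0 k1 k2"
    by (rule integral_AA_basis[OF norm_form_AA[OF assms(1)] assms(2)])
  have "\<bar>ar \<alpha> \<beta>\<bar> = of_int (a * c)"
    using lat_area_eq[OF assms(1) abc(4,3)] abc(1,2) by (simp add: ar_quad_elt)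
  moreover have "int (card (carrier (\<O> Quot lat \<alpha> \<beta>))) = a * c"
    unfolding card_quotient[OF abc(3,1,2)] using abc(1,2) by simp
  ultimately have "\<bar>ar \<alpha> \<beta>\<bar> = of_int (int (card (carrier (\<O> Quot lat \<alpha> \<beta>))))" by (simp only:)
  then show ?thesis by simp
qed

lemma finite_integral_ideals:
  "finite {J. J \<in> carrier AA \<and> J \<subseteq> carrier \<O> \<and> card (carrier (\<O> Quot J)) = n}" (is "finite ?S")
proof (rule finite_subset)
  let ?B = "{1..int n}"
  show "finite ((\<lambda>(a, b, c). lat (quad_elt D a 0) (quad_elt D b c)) ` (?B \<times> {0..int n} \<times> ?B))" by simp
  show "?S \<subseteq> (\<lambda>(a, b, c). lat (quad_elt D a 0) (quad_elt D b c)) ` (?B \<times> {0..int n} \<times> ?B)"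
  proof
    fix J assume J: "J \<in> ?S"
    then have J': "J \<in> carrier AA" "J \<subseteq> carrier \<O>" "card (carrier (\<O> Quot J)) = n" by blast+
    obtain a b c h0 h1 h2 where abc: "a > 0" "c > 0" "J = lat (quad_elt D a 0) (quad_elt D b c)"
      "norm_form (quad_elt D a 0) (quad_elt D b c) h0 h1 h2"
      by (rule integral_AA_basis[OF J'(1,2)])
    have "n = nat (a * c)" using J'(3) card_quotient[OF abc(3,1,2)] by simp
    then have "int n = a * c" using abc(1,2) by simp
    moreover have "a * 1 \<le> a * c" "1 * c \<le> a * c"
      by (rule mult_left_mono mult_right_mono; use abc(1,2) in simp)+
    ultimately have ac: "1 \<le> a" "1 \<le> c" "a \<le> int n" "c \<le> int n" using abc(1,2) by simp_all
    \<comment> \<open>A shear by the first basis vector brings \<open>b\<close> into the range below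
      \<open>a\<close>, and \<open>a * c = int n\<close> bounds the rest.\<close>
    have "b mod a = b + - (b div a) * a" using minus_div_mult_eq_mod[of b a] by simp
    then have "quad_elt D (b mod a) c = quad_elt D b c + qscale (of_int (- (b div a))) (quad_elt D a 0)"
      unfolding quad_elt_scale by simp
    then have "J = lat (quad_elt D a 0) (quad_elt D (b mod a) c)" unfolding abc(3) by (simp only: lat_shear)
    moreover have "0 \<le> b mod a" "b mod a \<le> int n" using ac pos_mod_sign[OF abc(1), of b] pos_mod_bound[OF abc(1), of b] by linarith+
    ultimately show "J \<in> (\<lambda>(a, b, c). lat (quad_elt D a 0) (quad_elt D b c)) ` (?B \<times> {0..int n} \<times> ?B)"
      using ac by (intro image_eqI[of _ _ "(a, b mod a, c)"]) simp_all
  qed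
qed

sublocale CC: cube_count AA "units_of K" "\<lambda>x. pr x"
  by unfold_locales (rule pr_hom)

lemma Pic_is_C: "Pic D = CC.C" by (rule Pic_eq)

lemma norm_form_shear:
  assumes "norm_form \<alpha> \<beta> h0 h1 h2"
  shows "norm_form \<alpha> (\<beta> + qscale (of_int k) \<alpha>) h0 (h1 + 2 * k * h0) (h2 + k * h1 + k ^ 2 * h0)"
    "norm_form (\<alpha> + qscale (of_int k) \<beta>) \<beta> (h0 + k * h1 + k ^ 2 * h2) (h1 + 2 * k * h2) h2"
    "norm_form \<beta> (- \<alpha>) h2 (- h1) h0"
proof -
  note n = assms[unfolded norm_form_def]
  have ar': "ar \<alpha> (\<beta> + qscale (of_int k) \<alpha>) = ar \<alpha> \<beta>" "ar (\<alpha> + qscale (of_int k) \<beta>) \<beta> = ar \<alpha> \<beta>"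
    "ar \<beta> (- \<alpha>) = ar \<alpha> \<beta>"
    by (simp_all add: ar_def qscale_def algebra_simps)
  have nm': "nm (\<beta> + qscale k \<alpha>) = nm \<beta> + k * tr2 D \<alpha> \<beta> + k ^ 2 * nm \<alpha>"
    "nm (\<alpha> + qscale k \<beta>) = nm \<alpha> + k * tr2 D \<alpha> \<beta> + k ^ 2 * nm \<beta>" "nm (- \<alpha>) = nm \<alpha>" for k
    by (simp_all add: q_defs tr2_def power2_eq_square algebra_simps)
  have tr': "tr2 D \<alpha> (\<beta> + qscale k \<alpha>) = tr2 D \<alpha> \<beta> + 2 * k * nm \<alpha>"
    "tr2 D (\<alpha> + qscale k \<beta>) \<beta> = tr2 D \<alpha> \<beta> + 2 * k * nm \<beta>" "tr2 D \<beta> (- \<alpha>) = - tr2 D \<alpha> \<beta>" for k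
    by (simp_all add: q_defs tr2_def power2_eq_square algebra_simps)
  have d: "m dvd 1" if "m dvd h0" "m dvd h1 + 2 * k * h0" "m dvd h2 + k * h1 + k ^ 2 * h0" for m
  proof -
    have "m dvd h1" using that(1,2) by (metis dvd_add_left_iff dvd_mult)
    moreover from this have "m dvd h2" using that(1,3) by (metis dvd_add_left_iff dvd_mult)
    ultimately show ?thesis using n that by blast
  qed
  have d': "m dvd 1" if "m dvd h2" "m dvd h1 + 2 * k * h2" "m dvd h0 + k * h1 + k ^ 2 * h2" for m
  proof -
    have "m dvd h1" using that(1,2) by (metis dvd_add_left_iff dvd_mult)
    moreover from this have "m dvd h0" using that(1,3) by (metis dvd_add_left_iff dvd_mult)
    ultimately show ?thesis using n that by blast
  qed
  show "norm_form \<alpha> (\<beta> + qscale (of_int k) \<alpha>) h0 (h1 + 2 * k * h0) (h2 + k * h1 + k ^ 2 * h0)"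
    unfolding norm_form_def ar' nm' tr' using n d by (auto simp: algebra_simps)
  show "norm_form (\<alpha> + qscale (of_int k) \<beta>) \<beta> (h0 + k * h1 + k ^ 2 * h2) (h1 + 2 * k * h2) h2"
    unfolding norm_form_def ar' nm' tr' using n d' by (auto simp: algebra_simps)
  show "norm_form \<beta> (- \<alpha>) h2 (- h1) h0"
    unfolding norm_form_def ar' nm' tr' using n by auto
qed

text \<open>Gauss reduction; when the form represents \<open>0\<close> the leading coefficient is bounded by the middle one.\<close>

lemma reduced_basis:
  assumes I: "norm_form \<alpha>0 \<beta>0 k0 k1 k2"
  obtains \<alpha> \<beta> h0 h1 h2 where "norm_form \<alpha> \<beta> h0 h1 h2" "lat \<alpha> \<beta> = lat \<alpha>0 \<beta>0"
    "h0 \<noteq> 0" "\<bar>h0\<bar> \<le> \<bar>D\<bar>" "\<bar>h1\<bar> \<le> \<bar>D\<bar>"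
proof -
  \<comment> \<open>The nonzero leading coefficient is minimised in absolute value over all norm
    forms of the lattice.\<close>
  define P where "P n \<longleftrightarrow> n > 0 \<and> (\<exists>\<alpha> \<beta> h0 h1 h2. norm_form \<alpha> \<beta> h0 h1 h2 \<and> lat \<alpha> \<beta> = lat \<alpha>0 \<beta>0 \<and> nat \<bar>h0\<bar> = n)" for n
  have P: "P (nat \<bar>h0\<bar>)" if "norm_form \<alpha> \<beta> h0 h1 h2" "lat \<alpha> \<beta> = lat \<alpha>0 \<beta>0" "h0 \<noteq> 0" for \<alpha> \<beta> h0 h1 h2
  proof -
    have "nat \<bar>h0\<bar> > 0" using that by simp
    then show ?thesis unfolding P_def using that by blast
  qed
  have lat2: "lat (\<alpha> + qscale (of_int k) \<beta>) \<beta> = lat \<alpha> \<beta>" for \<alpha> \<beta> k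
    using lat_comb[of 1 1 0 k \<alpha> \<beta>] by (simp add: qscale_simps)
  have "\<exists>n. P n"
  proof -
    consider "k0 \<noteq> 0" | "k2 \<noteq> 0" | "k0 = 0" "k2 = 0" by blast
    then show ?thesis
    proof cases
      case 1 then show ?thesis using P[OF I] by blast
    next
      case 2 then show ?thesis using P[OF norm_form_shear(3)[OF I] lat_swap] by blast
    next
      case 3
      then have "k1 \<noteq> 0" using norm_form_disc[OF I] D_nonzero by auto
      then show ?thesis using P[OF norm_form_shear(2)[OF I, of 1] lat2] 3 by auto
    qed
  qed
  then have L: "P (LEAST n. P n)" and min: "\<And>n. P n \<Longrightarrow> (LEAST n. P n) \<le> n"
    by (auto intro: LeastI_ex Least_le)
  from L obtain \<alpha> \<beta> h0 h1 h2 where b: "norm_form \<alpha> \<beta> h0 h1 h2" "lat \<alpha> \<beta> = lat \<alpha>0 \<beta>0"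
    "nat \<bar>h0\<bar> = (LEAST n. P n)" "h0 \<noteq> 0" unfolding P_def by auto
  define t where "t = 2 * \<bar>h0\<bar>"
  have t: "t > 0" using b(4) by (simp add: t_def)
  \<comment> \<open>Division with remainder by \<open>2 * \<bar>h0\<bar>\<close>, shifted by
    \<open>\<bar>h0\<bar>\<close>, centres the new middle coefficient between
    \<open>- \<bar>h0\<bar>\<close> and \<open>\<bar>h0\<bar>\<close>.\<close>
  define k where "k = - sgn h0 * ((h1 + \<bar>h0\<bar>) div t)"
  define h1' where "h1' = h1 + 2 * k * h0"
  define h2' where "h2' = h2 + k * h1 + k ^ 2 * h0"
  have "2 * k * h0 = - (t * ((h1 + \<bar>h0\<bar>) div t))"
    by (simp add: k_def t_def abs_sgn algebra_simps)
  then have "h1' + \<bar>h0\<bar> = (h1 + \<bar>h0\<bar>) mod t" unfolding h1'_def by (simp add: minus_mult_div_eq_mod[symmetric])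
  then have h1': "\<bar>h1'\<bar> \<le> \<bar>h0\<bar>" using pos_mod_sign[OF t, of "h1 + \<bar>h0\<bar>"] pos_mod_bound[OF t, of "h1 + \<bar>h0\<bar>"]
    unfolding t_def by linarith
  let ?\<beta> = "\<beta> + qscale (of_int k) \<alpha>"
  have n': "norm_form \<alpha> ?\<beta> h0 h1' h2'" unfolding h1'_def h2'_def by (rule norm_form_shear(1)[OF b(1)])
  have l': "lat \<alpha> ?\<beta> = lat \<alpha>0 \<beta>0" using b(2) by (simp add: lat_shear)
  have disc: "h1' ^ 2 - 4 * h0 * h2' = D" by (rule norm_form_disc[OF n'])
  have "\<bar>h0\<bar> \<le> \<bar>D\<bar>"
  proof (cases "h2' = 0")
    case True
    then have D1: "h1' ^ 2 = D" using disc by simp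
    then have h10: "h1' \<noteq> 0" using D_nonzero by auto
    \<comment> \<open>\<open>j\<close> simplifies to
      \<open>- sgn h1' * ((h0 - 1) div \<bar>h1'\<bar>)\<close>. Dividing \<open>h0 - 1\<close> and
      adding 1 back puts the new leading coefficient between 1 and \<open>\<bar>h1'\<bar>\<close>,
      so that it stays nonzero and competes with the minimum.\<close>
    define j where "j = sgn h1' * (1 - ((h0 - 1) div \<bar>h1'\<bar>)) - sgn h1'"
    have "j * h1' = - (\<bar>h1'\<bar> * ((h0 - 1) div \<bar>h1'\<bar>))"
      by (simp add: j_def abs_sgn algebra_simps)
    then have e: "h0 + j * h1' = (h0 - 1) mod \<bar>h1'\<bar> + 1" by (simp add: minus_mult_div_eq_mod[symmetric])
    have r: "0 < h0 + j * h1'" "h0 + j * h1' \<le> \<bar>h1'\<bar>"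
      unfolding e using h10 pos_mod_sign[of "\<bar>h1'\<bar>" "h0 - 1"] pos_mod_bound[of "\<bar>h1'\<bar>" "h0 - 1"] by linarith+
    have "P (nat \<bar>h0 + j * h1' + j ^ 2 * h2'\<bar>)"
      by (rule P[OF norm_form_shear(2)[OF n', of j]]) (use lat2 l' r True in auto)
    from min[OF this] have 1: "\<bar>h0\<bar> \<le> \<bar>h1'\<bar>" using b(3) r True by auto
    have "1 * \<bar>h1'\<bar> \<le> \<bar>h1'\<bar> * \<bar>h1'\<bar>" by (rule mult_right_mono) (use h10 in simp_all)
    then show ?thesis using 1 unfolding D1[symmetric] by (simp add: power2_eq_square abs_mult)
  next
    case False
    \<comment> \<open>Swapping the basis makes \<open>h2'\<close> a competitor, so
      \<open>\<bar>h0\<bar> \<le> \<bar>h2'\<bar>\<close>. With \<open>h1'\<close> centred, the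
      discriminant gives the classical \<open>3 h0^2 \<le> \<bar>D\<bar>\<close>, more than enough
      for a bound by \<open>\<bar>D\<bar>\<close>.\<close>
    have "P (nat \<bar>h2'\<bar>)" by (rule P[OF norm_form_shear(3)[OF n']]) (use lat_swap l' False in auto)
    from min[OF this] have le: "\<bar>h0\<bar> \<le> \<bar>h2'\<bar>" using b(3) by simp
    have "\<bar>h0\<bar> * \<bar>h0\<bar> \<le> \<bar>h0\<bar> * \<bar>h2'\<bar>" by (rule mult_left_mono[OF le]) simp
    moreover have "\<bar>h1'\<bar> * \<bar>h1'\<bar> \<le> \<bar>h0\<bar> * \<bar>h0\<bar>" by (rule mult_mono[OF h1' h1']) simp_all
    moreover have "4 * (\<bar>h0\<bar> * \<bar>h2'\<bar>) \<le> \<bar>h1'\<bar> * \<bar>h1'\<bar> + \<bar>D\<bar>"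
    proof -
      have "h1' * h1' - D = 4 * (h0 * h2')" unfolding disc[symmetric] by (simp add: power2_eq_square)
      then have "4 * (\<bar>h0\<bar> * \<bar>h2'\<bar>) = \<bar>h1' * h1' - D\<bar>" by (simp add: abs_mult)
      then show ?thesis using abs_triangle_ineq4[of "h1' * h1'" D] by (simp add: abs_mult)
    qed
    moreover have "1 * \<bar>h0\<bar> \<le> \<bar>h0\<bar> * \<bar>h0\<bar>" by (rule mult_right_mono) (use b(4) in simp_all)
    ultimately show ?thesis by linarith
  qed
  with that[OF n' l' b(4)] h1' show ?thesis by linarith
qed

lemma class_scale:
  assumes "I \<in> carrier AA" "nm x \<noteq> 0"
  shows "pr x \<diamondop> I \<in> carrier AA" "CC.P #>\<^bsub>AA\<^esub> (pr x \<diamondop> I) = CC.P #>\<^bsub>AA\<^esub> I"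
proof -
  show c: "pr x \<diamondop> I \<in> carrier AA" using A.m_closed[OF pr_AA[OF assms(2)] assms(1)] by simp
  have "\<exists>k\<in>carrier (units_of K). pr x \<diamondop> I = pr k \<otimes>\<^bsub>AA\<^esub> I"
    by (rule bexI[of _ x]) (simp_all add: KU_simps assms)
  then show "CC.P #>\<^bsub>AA\<^esub> (pr x \<diamondop> I) = CC.P #>\<^bsub>AA\<^esub> I"
    using CC.class_eq_iff[OF c assms(1)] by blast
qed

text \<open>After scaling by the inverse of \<alpha> every class contains a lattice spanned by 1 and
  \<open>(h1 + sqrt D) / (2 h0)\<close>, and reduction leaves finitely many pairs
  \<open>(h0, h1)\<close>.\<close>

lemma finite_Pic: "finite (carrier (Pic D))"
proof (rule finite_subset)
  let ?B = "{- \<bar>D\<bar>..\<bar>D\<bar>}"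
  let ?f = "\<lambda>(h0, h1). Pic_class D (lat (1, 0) (of_int h1 / (2 * of_int h0), 1 / (2 * of_int h0)))"
  show "finite (?f ` (?B \<times> ?B))" by simp
  show "carrier (Pic D) \<subseteq> ?f ` (?B \<times> ?B)"
  proof
    fix x assume "x \<in> carrier (Pic D)"
    then obtain I where I: "I \<in> carrier AA" "x = Pic_class D I"
      unfolding Pic_is_C Pic_class_eq using CC.C_carrier by blast
    obtain \<alpha>0 \<beta>0 where "I = lat \<alpha>0 \<beta>0" "ar \<alpha>0 \<beta>0 \<noteq> 0" using AA_basis[OF I(1)] .
    then obtain \<alpha> \<beta> h0 h1 h2 where b: "norm_form \<alpha> \<beta> h0 h1 h2" "lat \<alpha> \<beta> = I"
      "h0 \<noteq> 0" "\<bar>h0\<bar> \<le> \<bar>D\<bar>" "\<bar>h1\<bar> \<le> \<bar>D\<bar>"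
      using AA_norm_form[of \<alpha>0 \<beta>0] I(1) reduced_basis by metis
    note n = b(1)[unfolded norm_form_def]
    let ?\<theta> = "(of_int h1 / (2 * of_int h0), 1 / (2 * of_int h0))"
    have "(of_int h1 / 2, 1 / 2) \<odot> \<alpha> = qscale (of_int h0) \<beta>"
      using form_mult(1)[of \<alpha> \<beta> 1 "of_int h0" "of_int h1" "of_int h2"] n by simp
    moreover have "?\<theta> = qscale (1 / of_int h0) (of_int h1 / 2, 1 / 2)" by (simp add: qscale_def)
    ultimately have "\<alpha> \<odot> ?\<theta> = \<beta>" using b(3) by (simp only: qmul_comm[of D \<alpha>] qmul_scale) (simp add: qscale_simps)
    then have L: "I = (\<lambda>y. \<alpha> \<odot> y) ` lat (1, 0) ?\<theta>" unfolding lat_scale b(2)[symmetric] by (simp add: qmul_one)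
    have n\<alpha>: "nm \<alpha> \<noteq> 0" using n b(3) by simp
    then have L': "lat (1, 0) ?\<theta> = (\<lambda>y. qinv D \<alpha> \<odot> y) ` I"
      unfolding L using qmul_qinv[OF n\<alpha>] by (simp add: image_image qmul_assoc[symmetric] qmul_one)
    have ni: "nm (qinv D \<alpha>) \<noteq> 0" using qmul_qinv(2)[OF n\<alpha>] by (metis mult_zero_left qnorm_mult qnorm_simps(1) zero_neq_one)
    have "lat (1, 0) ?\<theta> = pr (qinv D \<alpha>) \<diamondop> I" unfolding L' using ip_pr[OF AA_module[OF I(1)]] by simp
    then have "Pic_class D (lat (1, 0) ?\<theta>) = x"
      unfolding I(2) Pic_class_eq using class_scale(2)[OF I(1) ni] by simp
    then show "x \<in> ?f ` (?B \<times> ?B)" using b(4,5) by (intro image_eqI[of _ _ "(h0, h1)"]) auto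
  qed
qed

lemma pow3_AA: "I \<in> carrier AA \<Longrightarrow> I [^]\<^bsub>AA\<^esub> (3::nat) = (I \<diamondop> I) \<diamondop> I"
  using A.l_one[of I] by (simp add: numeral_3_eq_3 A.nat_pow_Suc del: A.l_one)

lemma pow3_KU: "x [^]\<^bsub>units_of K\<^esub> (3::nat) = (x \<odot> x) \<odot> x"
  by (simp add: numeral_3_eq_3 KU.nat_pow_Suc KU_simps qmul_one)

text \<open>\<open>J\<close> is determined by the pair, as \<open>\<gamma> I^3\<close> divided by
  \<open>g\<close>; it is quantified here so that the objects are plain pairs, on which
  \<open>CC.H\<close> is defined.\<close>

definition cube_pairs :: "nat \<Rightarrow> ((rat \<times> rat) set \<times> (rat \<times> rat)) set" where
  "cube_pairs g = {(I, \<gamma>). I \<in> carrier AA \<and> nm \<gamma> \<noteq> 0 \<and>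
     (\<exists>J\<in>carrier AA. J \<subseteq> carrier \<O> \<and> card (carrier (\<O> Quot J)) = g \<and>
        pr \<gamma> \<diamondop> ((I \<diamondop> I) \<diamondop> I) = pr (of_nat g, 0) \<diamondop> J)}"

text \<open>The ideal \<open>J\<close>, recovered by \<open>p\<close>, is an isomorphism invariant
  with finitely many values, and the fibre over \<open>J\<close> consists of the cube roots of
  \<open>g J\<close>. Principal factors do not change classes, so the class of \<open>J\<close> is
  the cube of the class of \<open>I\<close>; this is where the condition in
  \<open>cube_class_ideals\<close> comes from.\<close>

lemma
  assumes g: "g > 0" and U: "finite (CC.U // hom_rel CC.U CC.HU)"
  shows weighted_cube_pairs: "weighted (cube_pairs g) CC.H"
    and mass_cube_pairs: "mass (cube_pairs g) CC.H =
      (\<Sum>J\<in>cube_class_ideals D g. of_nat (card (torsion 3 (Pic D))) * mass CC.U CC.HU)"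
    and finite_cube_pairs: "finite (cube_pairs g // hom_rel (cube_pairs g) CC.H)"
proof -
  have sub: "cube_pairs g \<subseteq> CC.objs" by (auto simp: cube_pairs_def CC.objs_def KU_simps)
  show w: "weighted (cube_pairs g) CC.H" by (rule hom_groupoid.weighted[OF CC.groupoid_H[OF sub]])
  have g0: "nm (of_nat g, 0) \<noteq> 0" "nm (1 / of_nat g, 0) \<noteq> 0" using g by (simp_all add: qnorm_def)
  let ?pg = "pr (of_nat g, 0)"
  define p where "p z = pr (1 / of_nat g, 0) \<diamondop> (pr (snd z) \<diamondop> ((fst z \<diamondop> fst z) \<diamondop> fst z))" for z
  have inv1: "pr (1 / of_nat g, 0) \<diamondop> (?pg \<diamondop> J) = J" "?pg \<diamondop> (pr (1 / of_nat g, 0) \<diamondop> J) = J" if "J \<in> carrier AA" for J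
  proof -
    have "pr (1 / of_nat g, 0) \<diamondop> ?pg = pr ((1 / of_nat g, 0) \<odot> (of_nat g, 0))" by (rule pr_mult)
    also have "(1 / of_nat g, 0) \<odot> (of_nat g, 0) = (1, 0)" using g by (simp add: qmul_rat qscale_def)
    finally have 1: "pr (1 / of_nat g, 0) \<diamondop> ?pg = carrier \<O>" by (simp add: qmul_one)
    show "pr (1 / of_nat g, 0) \<diamondop> (?pg \<diamondop> J) = J"
      using ip_O[OF AA_module[OF that]] by (simp only: ip_assoc[symmetric] 1)
    show "?pg \<diamondop> (pr (1 / of_nat g, 0) \<diamondop> J) = J"
      using ip_O[OF AA_module[OF that]] by (simp only: ip_assoc[symmetric] 1 ip_comm[of ?pg])
  qed
  have pz: "p (I, \<gamma>) = J \<longleftrightarrow> pr \<gamma> \<diamondop> ((I \<diamondop> I) \<diamondop> I) = ?pg \<diamondop> J"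
    if "I \<in> carrier AA" "nm \<gamma> \<noteq> 0" "J \<in> carrier AA" for I \<gamma> J
  proof -
    have "pr \<gamma> \<diamondop> ((I \<diamondop> I) \<diamondop> I) \<in> carrier AA"
      using A.m_closed pr_AA that by (metis AA_simps(2))
    then show ?thesis using inv1 that(3) unfolding p_def by (metis fst_conv snd_conv)
  qed
  have cl: "CC.P #>\<^bsub>AA\<^esub> (pr x \<diamondop> P) = CC.P #>\<^bsub>AA\<^esub> P" if "nm x \<noteq> 0" "P \<in> carrier AA" for x P
    by (rule class_scale(2)[OF that(2,1)])
  have cube: "J \<in> cube_class_ideals D g \<longleftrightarrow> J \<in> carrier AA \<and> J \<subseteq> carrier \<O> \<and>
      card (carrier (\<O> Quot J)) = g \<and> (\<exists>c\<in>carrier CC.C. CC.P #>\<^bsub>AA\<^esub> J = c [^]\<^bsub>CC.C\<^esub> (3::nat))" for J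
    unfolding cube_class_ideals_def ideal_O_iff Pic_is_C Pic_class_eq using AA_module[of J] by auto
  have fin: "finite (cube_class_ideals D g)"
    by (rule finite_subset[OF _ finite_integral_ideals[of g]]) (use cube in blast)
  have im: "p ` cube_pairs g \<subseteq> cube_class_ideals D g"
  proof
    fix J assume "J \<in> p ` cube_pairs g"
    then obtain I \<gamma> where z: "J = p (I, \<gamma>)" "(I, \<gamma>) \<in> cube_pairs g" by auto
    then obtain J' where c: "I \<in> carrier AA" "nm \<gamma> \<noteq> 0" "J' \<in> carrier AA" "J' \<subseteq> carrier \<O>" "card (carrier (\<O> Quot J')) = g"
      "pr \<gamma> \<diamondop> ((I \<diamondop> I) \<diamondop> I) = ?pg \<diamondop> J'" unfolding cube_pairs_def by blast
    then have J: "J = J'" using pz z by blast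
    have I3: "(I \<diamondop> I) \<diamondop> I \<in> carrier AA" using A.m_closed c(1) by (metis AA_simps(2))
    have "CC.P #>\<^bsub>AA\<^esub> J = CC.P #>\<^bsub>AA\<^esub> ((I \<diamondop> I) \<diamondop> I)"
      using cl[OF g0(1) c(3)] cl[OF c(2) I3] c(6) J by metis
    also have "\<dots> = (CC.P #>\<^bsub>AA\<^esub> I) [^]\<^bsub>CC.C\<^esub> (3::nat)"
      using CC.cl.hom_nat_pow[OF c(1), of 3] by (simp add: pow3_AA[OF c(1)])
    finally show "J \<in> cube_class_ideals D g"
      unfolding cube using J c CC.C_carrier by blast
  qed
  have fib: "{z \<in> cube_pairs g. p z = J} = CC.cubes (?pg \<diamondop> J)" if J: "J \<in> cube_class_ideals D g" for J
  proof -
    have J': "J \<in> carrier AA" "J \<subseteq> carrier \<O>" "card (carrier (\<O> Quot J)) = g" using J cube by blast+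
    have "(I, \<gamma>) \<in> {z \<in> cube_pairs g. p z = J} \<longleftrightarrow> (I, \<gamma>) \<in> CC.cubes (?pg \<diamondop> J)" for I \<gamma>
    proof -
      have "(I, \<gamma>) \<in> CC.cubes (?pg \<diamondop> J) \<longleftrightarrow> I \<in> carrier AA \<and> nm \<gamma> \<noteq> 0 \<and> pr \<gamma> \<diamondop> ((I \<diamondop> I) \<diamondop> I) = ?pg \<diamondop> J"
        unfolding CC.cubes_def using pow3_AA[of I] by (auto simp: KU_simps simp del: AA_simps(1))
      also have "\<dots> \<longleftrightarrow> (I, \<gamma>) \<in> {z \<in> cube_pairs g. p z = J}"
        using pz[OF _ _ J'(1)] J' unfolding cube_pairs_def by blast
      finally show ?thesis ..
    qed
    then show ?thesis by (metis (no_types, lifting) subsetI subset_antisym surj_pair)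
  qed
  have cub: "mass (CC.cubes (?pg \<diamondop> J)) CC.H = of_nat (card (torsion 3 (Pic D))) * mass CC.U CC.HU"
    "finite (CC.cubes (?pg \<diamondop> J) // hom_rel (CC.cubes (?pg \<diamondop> J)) CC.H)" if J: "J \<in> cube_class_ideals D g" for J
  proof -
    have J': "J \<in> carrier AA" using J cube by blast
    obtain c where c: "c \<in> carrier CC.C" "CC.P #>\<^bsub>AA\<^esub> J = c [^]\<^bsub>CC.C\<^esub> (3::nat)" using J cube by blast
    have a: "?pg \<diamondop> J \<in> carrier AA" using A.m_closed[OF pr_AA[OF g0(1)] J'] by simp
    have e: "CC.P #>\<^bsub>AA\<^esub> (?pg \<diamondop> J) = c [^]\<^bsub>CC.C\<^esub> (3::nat)" using cl[OF g0(1) J'] c(2) by simp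
    have f: "finite (carrier CC.C)" using finite_Pic by (simp only: Pic_is_C)
    show "mass (CC.cubes (?pg \<diamondop> J)) CC.H = of_nat (card (torsion 3 (Pic D))) * mass CC.U CC.HU"
      unfolding Pic_is_C by (rule CC.cubes_mass(1)[OF a c(1) e f U])
    show "finite (CC.cubes (?pg \<diamondop> J) // hom_rel (CC.cubes (?pg \<diamondop> J)) CC.H)"
      by (rule CC.cubes_mass(2)[OF a c(1) e f U])
  qed
  have pinv: "p x = p y" if xy: "x \<in> cube_pairs g" "y \<in> cube_pairs g" "CC.H x y \<noteq> {}" for x y
  proof -
    obtain k where k: "nm k \<noteq> 0" "fst x = pr k \<diamondop> fst y" "snd y = ((k \<odot> k) \<odot> k) \<odot> snd x"
      using xy(3) unfolding CC.H_def pow3_KU by (auto simp: KU_simps)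
    have "pr (snd y) = ((pr k \<diamondop> pr k) \<diamondop> pr k) \<diamondop> pr (snd x)" unfolding k(3) by (simp only: pr_mult)
    then show ?thesis unfolding p_def k(2) by (simp only: ip_ac)
  qed
  have f': "finite ({z \<in> cube_pairs g. p z = J} // hom_rel {z \<in> cube_pairs g. p z = J} CC.H)"
    if "J \<in> cube_class_ideals D g" for J using cub(2)[OF that] by (simp only: fib[OF that])
  have "mass (cube_pairs g) CC.H = (\<Sum>J\<in>cube_class_ideals D g. mass {z \<in> cube_pairs g. p z = J} CC.H)"
    by (rule mass_partition[OF w pinv fin im f'])
  also have "\<dots> = (\<Sum>J\<in>cube_class_ideals D g. of_nat (card (torsion 3 (Pic D))) * mass CC.U CC.HU)"
    by (rule sum.cong) (simp_all only: fib cub)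
  finally show "mass (cube_pairs g) CC.H =
      (\<Sum>J\<in>cube_class_ideals D g. of_nat (card (torsion 3 (Pic D))) * mass CC.U CC.HU)" .
  show "finite (cube_pairs g // hom_rel (cube_pairs g) CC.H)"
    by (rule finite_partition[OF w pinv fin im f'])
qed

end

section \<open>Binary cubic forms\<close>

text \<open>The quadruple \<open>(a, b, c, d)\<close> stands for \<open>a x\<^sup>3 + 3 b x\<^sup>2 y + 3 c x y\<^sup>2 + d y\<^sup>3\<close>, and
  \<open>(p, q, r, s)\<close> for the substitution \<open>x \<mapsto> p x + q y\<close>, \<open>y \<mapsto> r x + s y\<close>.\<close>

type_synonym quadruple = "int \<times> int \<times> int \<times> int"

text \<open>The usual discriminant of the cubic form divided by -27. The factors 3 in the middle
  coefficients make the quotient integral; it is also the discriminant of the Hessian.\<close>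

definition fdisc :: "quadruple \<Rightarrow> int" where
  "fdisc = (\<lambda>(a, b, c, d). a^2 * d^2 - 3 * b^2 * c^2 - 6 * a * b * c * d + 4 * a * c^3 + 4 * b^3 * d)"

text \<open>The symmetric trilinear form whose restriction to the diagonal is the cubic form,
  integral because of the factors 3. Its values at the columns \<open>(p, r)\<close> and
  \<open>(q, s)\<close> are the coefficients of the substituted form, whence the shape of
  \<open>act\<close>.\<close>

definition tri :: "quadruple \<Rightarrow> int \<Rightarrow> int \<Rightarrow> int \<Rightarrow> int \<Rightarrow> int \<Rightarrow> int \<Rightarrow> int" where
  "tri = (\<lambda>(a, b, c, d) x x' y y' z z'. a * x * y * z + b * (x * y * z' + x * y' * z + x' * y * z)
     + c * (x * y' * z' + x' * y * z' + x' * y' * z) + d * x' * y' * z')"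

definition act :: "quadruple \<Rightarrow> quadruple \<Rightarrow> quadruple" where
  "act = (\<lambda>(p, q, r, s) f. (tri f p r p r p r, tri f p r p r q s, tri f p r q s q s, tri f q s q s q s))"

definition mdet :: "quadruple \<Rightarrow> int" where
  "mdet = (\<lambda>(p, q, r, s). p * s - q * r)"

definition mmul :: "quadruple \<Rightarrow> quadruple \<Rightarrow> quadruple" where
  "mmul = (\<lambda>(p, q, r, s) (p', q', r', s'). (p * p' + q * r', p * q' + q * s', r * p' + s * r', r * q' + s * s'))"

definition fscale :: "int \<Rightarrow> quadruple \<Rightarrow> quadruple" where
  "fscale k = (\<lambda>(a, b, c, d). (k * a, k * b, k * c, k * d))"

text \<open>The inverse for determinant \<open>\<plusminus>1\<close>.\<close>

definition minv :: "quadruple \<Rightarrow> quadruple" where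
  "minv M = fscale (mdet M) ((\<lambda>(p, q, r, s). (s, - q, - r, p)) M)"

text \<open>The coefficients of minus the Hessian determinant of the form, divided by 36.\<close>

definition hess :: "quadruple \<Rightarrow> int \<times> int \<times> int" where
  "hess = (\<lambda>(a, b, c, d). (b^2 - a * c, b * c - a * d, c^2 - b * d))"

definition hcontent :: "quadruple \<Rightarrow> nat" where
  "hcontent f = (case hess f of (A, B, C) \<Rightarrow> nat (gcd A (gcd B C)))"

lemma tri_lin:
  "tri f (p * x + q * x') (r * x + s * x') y y' z z' = x * tri f p r y y' z z' + x' * tri f q s y y' z z'"
  "tri f y y' (p * x + q * x') (r * x + s * x') z z' = x * tri f y y' p r z z' + x' * tri f y y' q s z z'"
  "tri f y y' z z' (p * x + q * x') (r * x + s * x') = x * tri f y y' z z' p r + x' * tri f y y' z z' q s"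
  by (cases f; simp add: tri_def algebra_simps)+

lemma tri_sym: "tri f x x' y y' z z' = tri f y y' x x' z z'" "tri f x x' y y' z z' = tri f x x' z z' y y'"
  by (cases f; simp add: tri_def algebra_simps)+

lemma tri_act: "tri (act (p, q, r, s) f) x x' y y' z z' =
    tri f (p * x + q * x') (r * x + s * x') (p * y + q * y') (r * y + s * y') (p * z + q * z') (r * z + s * z')"
proof -
  have "tri f q s p r p r = tri f p r p r q s" "tri f p r q s p r = tri f p r p r q s"
    "tri f q s p r q s = tri f p r q s q s" "tri f q s q s p r = tri f p r q s q s"
    using tri_sym by metis+
  then show ?thesis unfolding tri_lin act_def prod.case
    by (subst tri_def) (simp add: algebra_simps)
qed

lemma act_mmul: "act (mmul M N) f = act N (act M f)"
proof -
  obtain p q r s p' q' r' s' where e: "M = (p, q, r, s)" "N = (p', q', r', s')" by (cases M; cases N)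
  have "act N (act M f) = (let F = act (p, q, r, s) f in
     (tri F p' r' p' r' p' r', tri F p' r' p' r' q' s', tri F p' r' q' s' q' s', tri F q' s' q' s' q' s'))"
    unfolding e by (subst (1) act_def) (simp add: Let_def)
  then show ?thesis unfolding Let_def tri_act unfolding e mmul_def act_def prod.case by simp
qed

lemma act_fscale: "act M (fscale k f) = fscale k (act M f)"
  by (cases M; cases f) (simp add: act_def tri_def fscale_def algebra_simps)

lemma fscale_fscale: "fscale k (fscale l f) = fscale (k * l) f" "fscale 1 f = f"
  by (cases f; simp add: fscale_def)+

lemma mdet_mmul: "mdet (mmul M N) = mdet M * mdet N"
  by (cases M; cases N) (simp add: mdet_def mmul_def algebra_simps)

lemma mdet_minv:
  assumes "mdet M = 1 \<or> mdet M = -1" shows "mdet (minv M) = mdet M"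
proof -
  have "mdet (minv M) = mdet M * (mdet M * mdet M)"
    by (cases M) (simp add: mdet_def minv_def fscale_def algebra_simps)
  then show ?thesis using assms by auto
qed

lemma mmul_assoc: "mmul (mmul L M) N = mmul L (mmul M N)"
  by (cases L; cases M; cases N) (simp add: mmul_def algebra_simps)

definition mone :: quadruple where "mone = (1, 0, 0, 1)"

lemma mmul_mone: "mmul mone M = M" "mmul M mone = M" "act mone f = f" "mdet mone = 1"
proof -
  show "mmul mone M = M" "mmul M mone = M" by (cases M; simp add: mmul_def mone_def)+
  show "act mone f = f" by (cases f) (simp add: act_def tri_def mone_def)
  show "mdet mone = 1" by (simp add: mdet_def mone_def)
qed

lemma mmul_minv:
  assumes "mdet M = 1 \<or> mdet M = -1"
  shows "mmul M (minv M) = mone" "mmul (minv M) M = mone"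
proof -
  obtain p q r s where M: "M = (p, q, r, s)" by (cases M)
  have d: "(p * s - q * r) * (p * s - q * r) = 1" using assms by (auto simp: M mdet_def)
  show "mmul M (minv M) = mone" "mmul (minv M) M = mone"
    unfolding M mmul_def minv_def fscale_def mdet_def mone_def prod.case prod.inject d[symmetric]
    by (simp_all add: algebra_simps)
qed

lemma fdisc_hess:
  assumes "hess f = (A, B, C)" shows "fdisc f = B^2 - 4 * A * C"
proof -
  obtain a b c d where f: "f = (a, b, c, d)" by (cases f)
  have e: "A = b^2 - a * c" "B = b * c - a * d" "C = c^2 - b * d"
    using assms by (auto simp: f hess_def)
  show ?thesis unfolding f e fdisc_def prod.case
    by (simp add: algebra_simps power2_eq_square power3_eq_cube)
qed

text \<open>Fixing one argument of \<open>tri\<close> at a column of the matrix gives a quadratic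
  form, and \<open>pol\<close> is the covariance of the polarised discriminant of two quadratic
  forms. This avoids expanding the Hessian of the substituted form, of degree 6 in the matrix
  entries; doubling keeps the polarisation free of fractions.\<close>

lemma hess_act:
  assumes "hess f = (A, B, C)"
  shows "hess (act (p, q, r, s) f) =
    ((p * s - q * r)^2 * (A * p^2 + B * p * r + C * r^2),
     (p * s - q * r)^2 * (2 * A * p * q + B * (p * s + q * r) + 2 * C * r * s),
     (p * s - q * r)^2 * (A * q^2 + B * q * s + C * s^2))"
proof -
  obtain a b c d where f: "f = (a, b, c, d)" by (cases f)
  have e: "A = b^2 - a * c" "B = b * c - a * d" "C = c^2 - b * d"
    using assms by (auto simp: f hess_def)
  define t0 where "t0 = tri f p r p r p r"
  define t1 where "t1 = tri f p r p r q s"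
  define t2 where "t2 = tri f p r q s q s"
  define t3 where "t3 = tri f q s q s q s"
  let ?e = "p * s - q * r"
  have pol: "(x0 * p * q + x1 * (p * s + q * r) + x2 * r * s) * (y0 * p * q + y1 * (p * s + q * r) + y2 * r * s) * 2 -
      (x0 * p * p + 2 * x1 * p * r + x2 * r * r) * (y0 * q * q + 2 * y1 * q * s + y2 * s * s) -
      (x0 * q * q + 2 * x1 * q * s + x2 * s * s) * (y0 * p * p + 2 * y1 * p * r + y2 * r * r) =
      ?e^2 * (2 * x1 * y1 - x0 * y2 - x2 * y0)" for x0 x1 x2 y0 y1 y2
    by (simp add: algebra_simps power2_eq_square)
  let ?x0 = "a * p + b * r" and ?x1 = "b * p + c * r" and ?x2 = "c * p + d * r"
  let ?y0 = "a * q + b * s" and ?y1 = "b * q + c * s" and ?y2 = "c * q + d * s"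
  have tx: "t0 = ?x0 * p * p + 2 * ?x1 * p * r + ?x2 * r * r" "t1 = ?x0 * p * q + ?x1 * (p * s + q * r) + ?x2 * r * s"
      "t2 = ?x0 * q * q + 2 * ?x1 * q * s + ?x2 * s * s"
    and ty: "t1 = ?y0 * p * p + 2 * ?y1 * p * r + ?y2 * r * r" "t2 = ?y0 * p * q + ?y1 * (p * s + q * r) + ?y2 * r * s"
      "t3 = ?y0 * q * q + 2 * ?y1 * q * s + ?y2 * s * s"
    by (simp_all add: t0_def t1_def t2_def t3_def f tri_def algebra_simps)
  have dbl: "u = ?e^2 * v" if "2 * u = ?e^2 * (2 * v)" for u v using that by (metis mult.left_commute mult_cancel_left zero_neq_numeral)
  have "2 * (t1^2 - t0 * t2) = t1 * t1 * 2 - t0 * t2 - t2 * t0" by (simp add: power2_eq_square)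
  also have "\<dots> = ?e^2 * (2 * ?x1 * ?x1 - ?x0 * ?x2 - ?x2 * ?x0)"
    unfolding tx by (rule pol)
  also have "\<dots> = ?e^2 * (2 * (A * p^2 + B * p * r + C * r^2))"
    unfolding e by (simp add: algebra_simps power2_eq_square)
  finally have 1: "t1^2 - t0 * t2 = ?e^2 * (A * p^2 + B * p * r + C * r^2)" by (rule dbl)
  have "2 * (t2^2 - t1 * t3) = t2 * t2 * 2 - t1 * t3 - t3 * t1" by (simp add: power2_eq_square)
  also have "\<dots> = ?e^2 * (2 * ?y1 * ?y1 - ?y0 * ?y2 - ?y2 * ?y0)"
    unfolding ty by (rule pol)
  also have "\<dots> = ?e^2 * (2 * (A * q^2 + B * q * s + C * s^2))"
    unfolding e by (simp add: algebra_simps power2_eq_square)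
  finally have 2: "t2^2 - t1 * t3 = ?e^2 * (A * q^2 + B * q * s + C * s^2)" by (rule dbl)
  have "t1 * t2 * 2 - t0 * t3 - t2 * t1 = ?e^2 * (2 * ?x1 * ?y1 - ?x0 * ?y2 - ?x2 * ?y0)"
    using pol[of ?x0 ?x1 ?x2 ?y0 ?y1 ?y2] unfolding tx(1)[symmetric] tx(2)[symmetric] tx(3)[symmetric] ty(1)[symmetric]
      ty(2)[symmetric] ty(3)[symmetric] .
  also have "\<dots> = ?e^2 * (2 * A * p * q + B * (p * s + q * r) + 2 * C * r * s)"
    unfolding e by (simp add: algebra_simps power2_eq_square)
  finally have 3: "t1 * t2 - t0 * t3 = ?e^2 * (2 * A * p * q + B * (p * s + q * r) + 2 * C * r * s)" by (simp add: mult.commute)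
  have "act (p, q, r, s) f = (t0, t1, t2, t3)" by (simp add: act_def t0_def t1_def t2_def t3_def)
  then show ?thesis using 1 2 3 by (simp add: hess_def)
qed

lemma hcontent_dvd:
  assumes "M = (p, q, r, s)" shows "int (hcontent f) dvd int (hcontent (act M f))"
proof -
  obtain A B C where h: "hess f = (A, B, C)" by (cases "hess f")
  let ?g = "gcd A (gcd B C)"
  have g: "?g dvd A" "?g dvd B" "?g dvd C" by (auto intro: dvd_trans[of _ "gcd B C"])
  have "?g dvd A * p^2 + B * p * r + C * r^2" "?g dvd A * q^2 + B * q * s + C * s^2"
    "?g dvd 2 * A * p * q + B * (p * s + q * r) + 2 * C * r * s"
    using g by (intro dvd_add; simp add: dvd_mult dvd_mult2)+
  then have "?g dvd gcd x (gcd y z)" if "hess (act M f) = (x, y, z)" for x y z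
    using that unfolding assms hess_act[OF h] by (auto intro!: gcd_greatest dvd_mult)
  then show ?thesis by (cases "hess (act M f)") (simp add: hcontent_def h)
qed

text \<open>The Hessian is substituted as a quadratic form, which multiplies its discriminant by
  \<open>mdet M ^ 2\<close>, and scaled by \<open>mdet M ^ 2\<close>, which contributes
  \<open>mdet M ^ 4\<close>.\<close>

lemma fdisc_act: "fdisc (act M f) = mdet M ^ 6 * fdisc f"
proof -
  obtain A B C where h: "hess f = (A, B, C)" by (cases "hess f")
  obtain p q r s where M: "M = (p, q, r, s)" by (cases M)
  let ?e = "p * s - q * r"
  have "(2 * A * p * q + B * (p * s + q * r) + 2 * C * r * s)^2 -
      4 * (A * p^2 + B * p * r + C * r^2) * (A * q^2 + B * q * s + C * s^2) = ?e^2 * (B^2 - 4 * A * C)"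
    by (simp add: algebra_simps power2_eq_square)
  moreover have "(E * x)^2 - 4 * (E * y) * (E * z) = E * E * (x^2 - 4 * y * z)" for E x y z :: int
    by (simp add: algebra_simps power2_eq_square)
  moreover have "?e ^ 6 = ?e^2 * ?e^2 * ?e^2" by (simp flip: power_add)
  ultimately show ?thesis
    unfolding M fdisc_hess[OF h] fdisc_hess[OF hess_act[OF h]] mdet_def prod.case by (simp only: mult.assoc)
qed

lemma fdisc_fscale: "k = 1 \<or> k = -1 \<Longrightarrow> fdisc (fscale k f) = fdisc f"
  by (cases f) (auto simp: fdisc_def fscale_def)

lemma hess_fscale: "k = 1 \<or> k = -1 \<Longrightarrow> hess (fscale k f) = hess f"
  by (cases f) (auto simp: hess_def fscale_def)

definition forms :: "int \<Rightarrow> quadruple set" where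
  "forms D = {f. fdisc f = D}"

text \<open>\<open>act\<close> pulls forms back, hence the order of \<open>f\<close> and
  \<open>f'\<close>. The factor \<open>mdet M\<close> is the twist under which matrices correspond
  to isomorphisms of the rings of the forms.\<close>

definition HGL :: "quadruple \<Rightarrow> quadruple \<Rightarrow> quadruple set" where
  "HGL f f' = {M. (mdet M = 1 \<or> mdet M = -1) \<and> act M f' = fscale (mdet M) f}"

definition HSL :: "quadruple \<Rightarrow> quadruple \<Rightarrow> quadruple set" where
  "HSL f f' = {M. mdet M = 1 \<and> act M f' = f}"

lemma HGL_I: "mdet M = 1 \<or> mdet M = -1 \<Longrightarrow> act M f' = fscale (mdet M) f \<Longrightarrow> M \<in> HGL f f'"
  by (simp add: HGL_def)

lemma HGL_groupoid: "hom_groupoid A HGL mmul minv"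
proof unfold_locales
  fix f show "HGL f f \<noteq> {}"
    using HGL_I[of mone f f] mmul_mone fscale_fscale(2) by auto
next
  fix f g h m n assume mn: "m \<in> HGL f g" "n \<in> HGL g h"
  then have d: "mdet m = 1 \<or> mdet m = -1" "mdet n = 1 \<or> mdet n = -1"
    and e: "act m g = fscale (mdet m) f" "act n h = fscale (mdet n) g" by (auto simp: HGL_def)
  show "mmul n m \<in> HGL f h"
    by (rule HGL_I) (use d e in \<open>auto simp: mdet_mmul act_mmul act_fscale fscale_fscale\<close>)
next
  fix f g m assume m: "m \<in> HGL f g"
  then have d: "mdet m = 1 \<or> mdet m = -1" and e: "act m g = fscale (mdet m) f" by (auto simp: HGL_def)
  have "act (minv m) (act m g) = g" using mmul_minv(1)[OF d] by (metis act_mmul mmul_mone(3))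
  then have "fscale (mdet m) (act (minv m) f) = g" by (simp add: e act_fscale)
  then have "fscale (mdet m) (fscale (mdet m) (act (minv m) f)) = fscale (mdet m) g" by simp
  then have "act (minv m) f = fscale (mdet m) g" using d by (auto simp: fscale_fscale)
  then show "minv m \<in> HGL g f" by (intro HGL_I) (simp_all add: mdet_minv d)
next
  fix f g h m n assume "m \<in> HGL f g"
  then have d: "mdet m = 1 \<or> mdet m = -1" by (auto simp: HGL_def)
  show "mmul (minv m) (mmul m n) = n" "mmul m (mmul (minv m) n) = n"
    "mmul (mmul n m) (minv m) = n" "mmul (mmul n (minv m)) m = n"
    using mmul_minv[OF d] by (simp_all add: mmul_mone flip: mmul_assoc) (simp_all add: mmul_mone mmul_assoc)
qed

lemma HSL_eq: "HSL f f' = {M \<in> HGL f f'. mdet M = 1}"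
  by (auto simp: HSL_def HGL_def fscale_fscale)

lemma hcontent_HSL: "HSL f f' \<noteq> {} \<Longrightarrow> hcontent f = hcontent f'"
proof -
  assume "HSL f f' \<noteq> {}"
  then obtain M where M: "M \<in> HSL f f'" by blast
  then have "minv M \<in> HGL f' f"
    using hom_groupoid.ivs[OF HGL_groupoid[of UNIV]] HSL_eq by blast
  then have "act (minv M) f = f'" using M by (auto simp: HGL_def HSL_def mdet_minv fscale_fscale)
  moreover have "act M f' = f" using M by (simp add: HSL_def)
  ultimately have "hcontent f dvd hcontent f'" "hcontent f' dvd hcontent f"
    using hcontent_dvd[of "minv M" _ _ _ _ f] hcontent_dvd[of M _ _ _ _ f'] by (metis int_dvd_int_iff prod_cases4)+
  then show ?thesis by (rule dvd_antisym)
qed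

text \<open>The determinant is the sign in \<open>mass_even\<close>; the diagonal matrix with
  entries 1 and -1 provides an odd morphism out of every form.\<close>

lemma mass_HSL:
  assumes "finite (forms D // hom_rel (forms D) HSL)"
  shows "mass (forms D) HSL = 2 * mass (forms D) HGL"
proof (rule hom_groupoid.mass_even[OF HGL_groupoid, where sg = mdet])
  fix f :: quadruple assume f: "f \<in> forms D"
  let ?m = "(1, 0, 0, -1) :: quadruple"
  have m: "mdet ?m = -1" by (simp add: mdet_def)
  obtain a b c d where e: "f = (a, b, c, d)" by (cases f)
  have "?m \<in> HGL f (fscale (-1) (act ?m f))"
    by (rule HGL_I) (simp_all add: e mdet_def act_def tri_def fscale_def)
  moreover have "fscale (-1) (act ?m f) \<in> forms D" using f m by (simp add: forms_def fdisc_fscale fdisc_act)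
  ultimately show "\<exists>g\<in>forms D. \<exists>m\<in>HGL f g. mdet m = -1" using m by blast
qed (use assms in \<open>auto simp: HGL_def mdet_mmul mdet_minv HSL_eq\<close>)

lemma hcontent_disc:
  assumes "fdisc f \<noteq> 0"
  obtains h0 h1 h2 where "hcontent f > 0" "hess f = (int (hcontent f) * h0, int (hcontent f) * h1, int (hcontent f) * h2)"
    "gcd h0 (gcd h1 h2) = 1" "fdisc f = int (hcontent f) ^ 2 * (h1^2 - 4 * h0 * h2)"
proof -
  obtain A B C where h: "hess f = (A, B, C)" by (cases "hess f")
  define G where "G = gcd A (gcd B C)"
  have g: "int (hcontent f) = G" by (simp add: hcontent_def h G_def)
  have G0: "G \<noteq> 0" using assms fdisc_hess[OF h] by (auto simp: G_def)
  have "G dvd A" "G dvd B" "G dvd C" unfolding G_def by (auto intro: dvd_trans[of _ "gcd B C"])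
  then obtain h0 h1 h2 where e: "A = G * h0" "B = G * h1" "C = G * h2" unfolding dvd_def by blast
  have "\<bar>G\<bar> * gcd h0 (gcd h1 h2) = gcd (G * h0) (gcd (G * h1) (G * h2))"
    by (simp add: gcd_mult_left abs_mult)
  also have "\<dots> = \<bar>G\<bar> * 1" unfolding e[symmetric] by (simp add: G_def)
  finally have "gcd h0 (gcd h1 h2) = 1" using G0 by simp
  moreover have "fdisc f = G ^ 2 * (h1^2 - 4 * h0 * h2)"
    unfolding fdisc_hess[OF h] e by (simp add: algebra_simps power2_eq_square)
  moreover have "hcontent f > 0" using g G0 by (cases "hcontent f = 0") auto
  ultimately show ?thesis using that h e g by metis
qed

section \<open>Binary cubic forms and cube maps on ideals\<close>

context quad
begin

text \<open>On the basis 1, \<tau> the second coordinate of an element is twice its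
  \<open>snd\<close>. So \<open>g\<close> times the cubic form is the \<tau>-coordinate of
  \<open>\<gamma> (x \<alpha> + y \<beta>)^3\<close>, stated coefficient by coefficient.\<close>

definition fits :: "nat \<Rightarrow> rat \<times> rat \<Rightarrow> rat \<times> rat \<Rightarrow> rat \<times> rat \<Rightarrow> quadruple \<Rightarrow> bool" where
  "fits g \<alpha> \<beta> \<gamma> = (\<lambda>(a, b, c, d).
     of_int (int g * a) = 2 * snd (\<gamma> \<odot> (\<alpha> \<odot> (\<alpha> \<odot> \<alpha>))) \<and>
     of_int (int g * b) = 2 * snd (\<gamma> \<odot> (\<alpha> \<odot> (\<alpha> \<odot> \<beta>))) \<and>
     of_int (int g * c) = 2 * snd (\<gamma> \<odot> (\<alpha> \<odot> (\<beta> \<odot> \<beta>))) \<and>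
     of_int (int g * d) = 2 * snd (\<gamma> \<odot> (\<beta> \<odot> (\<beta> \<odot> \<beta>))))"

lemma fits_unique: "g > 0 \<Longrightarrow> fits g \<alpha> \<beta> \<gamma> f \<Longrightarrow> fits g \<alpha> \<beta> \<gamma> f' \<Longrightarrow> f = f'"
proof (cases f; cases f')
  fix a b c d a' b' c' d'
  assume "g > 0" "fits g \<alpha> \<beta> \<gamma> f" "fits g \<alpha> \<beta> \<gamma> f'" "f = (a, b, c, d)" "f' = (a', b', c', d')"
  then have "rat_of_int (int g * a) = rat_of_int (int g * a')" "rat_of_int (int g * b) = rat_of_int (int g * b')"
    "rat_of_int (int g * c) = rat_of_int (int g * c')" "rat_of_int (int g * d) = rat_of_int (int g * d')" "g > 0"
    unfolding fits_def by simp_all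
  then have "a = a'" "b = b'" "c = c'" "d = d'" unfolding of_int_eq_iff by simp_all
  then show "f = f'" using \<open>f = (a, b, c, d)\<close> \<open>f' = (a', b', c', d')\<close> by simp
qed

lemma fits_scale:
  "fits g (\<kappa> \<odot> \<alpha>) (\<kappa> \<odot> \<beta>) \<gamma> f \<longleftrightarrow> fits g \<alpha> \<beta> (((\<kappa> \<odot> \<kappa>) \<odot> \<kappa>) \<odot> \<gamma>) f"
proof -
  have "\<gamma> \<odot> ((\<kappa> \<odot> x) \<odot> ((\<kappa> \<odot> y) \<odot> (\<kappa> \<odot> z))) = (((\<kappa> \<odot> \<kappa>) \<odot> \<kappa>) \<odot> \<gamma>) \<odot> (x \<odot> (y \<odot> z))" for x y z
    by (simp only: qmul_ac)
  then show ?thesis unfolding fits_def by simp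
qed

lemma fits_act:
  assumes "fits g \<alpha> \<beta> \<gamma> f"
  shows "fits g (qscale (of_int p) \<alpha> + qscale (of_int r) \<beta>) (qscale (of_int q) \<alpha> + qscale (of_int s) \<beta>) \<gamma>
    (act (p, q, r, s) f)"
proof -
  obtain a b c d where f: "f = (a, b, c, d)" by (cases f)
  define A0 where "A0 = \<gamma> \<odot> (\<alpha> \<odot> (\<alpha> \<odot> \<alpha>))"
  define A1 where "A1 = \<gamma> \<odot> (\<alpha> \<odot> (\<alpha> \<odot> \<beta>))"
  define A2 where "A2 = \<gamma> \<odot> (\<alpha> \<odot> (\<beta> \<odot> \<beta>))"
  define A3 where "A3 = \<gamma> \<odot> (\<beta> \<odot> (\<beta> \<odot> \<beta>))"
  have h: "2 * snd A0 = of_nat g * of_int a" "2 * snd A1 = of_nat g * of_int b"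
    "2 * snd A2 = of_nat g * of_int c" "2 * snd A3 = of_nat g * of_int d"
    using assms unfolding f fits_def A0_def A1_def A2_def A3_def by simp_all
  have perm: "\<gamma> \<odot> (\<alpha> \<odot> (\<beta> \<odot> \<alpha>)) = A1" "\<gamma> \<odot> (\<beta> \<odot> (\<alpha> \<odot> \<alpha>)) = A1"
    "\<gamma> \<odot> (\<beta> \<odot> (\<alpha> \<odot> \<beta>)) = A2" "\<gamma> \<odot> (\<beta> \<odot> (\<beta> \<odot> \<alpha>)) = A2"
    unfolding A1_def A2_def by (simp_all only: qmul_ac)
  have ex: "2 * snd (\<gamma> \<odot> ((qscale x \<alpha> + qscale x' \<beta>) \<odot> ((qscale y \<alpha> + qscale y' \<beta>) \<odot> (qscale z \<alpha> + qscale z' \<beta>)))) =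
     of_nat g * (x * y * z * of_int a + (x * y * z' + x * y' * z + x' * y * z) * of_int b
      + (x * y' * z' + x' * y * z' + x' * y' * z) * of_int c + x' * y' * z' * of_int d)" for x x' y y' z z'
  proof -
    have "\<gamma> \<odot> ((qscale x \<alpha> + qscale x' \<beta>) \<odot> ((qscale y \<alpha> + qscale y' \<beta>) \<odot> (qscale z \<alpha> + qscale z' \<beta>))) =
      qscale (x * y * z) A0 + qscale (x * y * z' + x * y' * z + x' * y * z) A1 +
      qscale (x * y' * z' + x' * y * z' + x' * y' * z) A2 + qscale (x' * y' * z') A3"
      by (simp add: qmul_add_left qmul_add_right qmul_scale perm A0_def[symmetric] A1_def[symmetric] A2_def[symmetric] A3_def[symmetric] qscale_simps algebra_simps)
    then have "2 * snd (\<gamma> \<odot> ((qscale x \<alpha> + qscale x' \<beta>) \<odot> ((qscale y \<alpha> + qscale y' \<beta>) \<odot> (qscale z \<alpha> + qscale z' \<beta>)))) =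
      x * y * z * (2 * snd A0) + (x * y * z' + x * y' * z + x' * y * z) * (2 * snd A1) +
      (x * y' * z' + x' * y * z' + x' * y' * z) * (2 * snd A2) + x' * y' * z' * (2 * snd A3)"
      by (simp add: qscale_def algebra_simps)
    then show ?thesis unfolding h by (simp add: algebra_simps)
  qed
  show ?thesis unfolding fits_def act_def tri_def f prod.case ex
    by (simp add: power2_eq_square power3_eq_cube algebra_simps)
qed

text \<open>For fixed \<open>v\<close> the symmetric bilinear form \<open>2 * snd (v x y)\<close>
  has determinant \<open>- nm v * ar \<alpha> \<beta> ^ 2\<close> on the basis. Taking
  \<open>\<gamma> \<alpha>\<close> and \<open>\<gamma> \<beta>\<close> for \<open>v\<close> yields
  the outer Hessian coefficients, and the hypothesis \<open>w\<close> turns the factor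
  \<open>nm \<gamma> * ar \<alpha> \<beta> ^ 3\<close> into \<open>g ^ 3\<close>.\<close>

lemma fits_hess:
  assumes f: "fits g \<alpha> \<beta> \<gamma> f" and g: "g > 0" and h: "norm_form \<alpha> \<beta> h0 h1 h2"
    and w: "nm \<gamma> * ar \<alpha> \<beta> ^ 3 = of_nat g ^ 3"
  shows "hess f = (int g * h0, int g * h1, int g * h2)"
proof -
  obtain a b c d where e: "f = (a, b, c, d)" by (cases f)
  note n = h[unfolded norm_form_def]
  let ?g = "of_nat g :: rat"
  have i: "?g * of_int a = 2 * snd (\<gamma> \<odot> (\<alpha> \<odot> (\<alpha> \<odot> \<alpha>)))" "?g * of_int b = 2 * snd (\<gamma> \<odot> (\<alpha> \<odot> (\<alpha> \<odot> \<beta>)))"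
    "?g * of_int c = 2 * snd (\<gamma> \<odot> (\<alpha> \<odot> (\<beta> \<odot> \<beta>)))" "?g * of_int d = 2 * snd (\<gamma> \<odot> (\<beta> \<odot> (\<beta> \<odot> \<beta>)))"
    using f unfolding e fits_def by simp_all
  have j: "snd (\<gamma> \<odot> (\<alpha> \<odot> (\<alpha> \<odot> \<alpha>))) = ?g * of_int a / 2" "snd (\<gamma> \<odot> (\<alpha> \<odot> (\<alpha> \<odot> \<beta>))) = ?g * of_int b / 2"
    "snd (\<gamma> \<odot> (\<alpha> \<odot> (\<beta> \<odot> \<beta>))) = ?g * of_int c / 2" "snd (\<gamma> \<odot> (\<beta> \<odot> (\<beta> \<odot> \<beta>))) = ?g * of_int d / 2"
    unfolding i by simp_all
  have 1: "4 * (snd (v \<odot> (\<alpha> \<odot> \<beta>)) ^ 2 - snd (v \<odot> (\<alpha> \<odot> \<alpha>)) * snd (v \<odot> (\<beta> \<odot> \<beta>))) = nm v * ar \<alpha> \<beta> ^ 2" for v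
    by (simp add: q_defs ar_def power2_eq_square algebra_simps)
  have 2: "4 * (snd (\<gamma> \<odot> (\<alpha> \<odot> (\<alpha> \<odot> \<beta>))) * snd (\<gamma> \<odot> (\<alpha> \<odot> (\<beta> \<odot> \<beta>))) -
     snd (\<gamma> \<odot> (\<alpha> \<odot> (\<alpha> \<odot> \<alpha>))) * snd (\<gamma> \<odot> (\<beta> \<odot> (\<beta> \<odot> \<beta>)))) = nm \<gamma> * ar \<alpha> \<beta> ^ 2 * tr2 D \<alpha> \<beta>"
    by (simp add: q_defs ar_def tr2_def power2_eq_square algebra_simps)
  have k: "x = int g * y" if "?g ^ 2 * of_int x = nm \<gamma> * ar \<alpha> \<beta> ^ 2 * (ar \<alpha> \<beta> * of_int y)" for x y
  proof -
    have "?g ^ 2 * of_int x = ?g ^ 2 * of_int (int g * y)"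
      using that w by (simp add: power2_eq_square power3_eq_cube mult.assoc)
    then show ?thesis using g by (simp only: mult_cancel_left of_int_eq_iff) simp
  qed
  have "?g ^ 2 * of_int (b^2 - a * c) = 4 * (snd ((\<gamma> \<odot> \<alpha>) \<odot> (\<alpha> \<odot> \<beta>)) ^ 2 - snd ((\<gamma> \<odot> \<alpha>) \<odot> (\<alpha> \<odot> \<alpha>)) * snd ((\<gamma> \<odot> \<alpha>) \<odot> (\<beta> \<odot> \<beta>)))"
    unfolding qmul_assoc j by (simp add: field_simps power2_eq_square)
  also have "\<dots> = nm \<gamma> * ar \<alpha> \<beta> ^ 2 * (ar \<alpha> \<beta> * of_int h0)" unfolding 1 qnorm_mult using n by simp
  finally have h0: "b^2 - a * c = int g * h0" by (rule k)
  have "?g ^ 2 * of_int (c^2 - b * d) = 4 * (snd ((\<gamma> \<odot> \<beta>) \<odot> (\<alpha> \<odot> \<beta>)) ^ 2 - snd ((\<gamma> \<odot> \<beta>) \<odot> (\<alpha> \<odot> \<alpha>)) * snd ((\<gamma> \<odot> \<beta>) \<odot> (\<beta> \<odot> \<beta>)))"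
  proof -
    have "(\<gamma> \<odot> \<beta>) \<odot> (\<alpha> \<odot> \<beta>) = \<gamma> \<odot> (\<alpha> \<odot> (\<beta> \<odot> \<beta>))" "(\<gamma> \<odot> \<beta>) \<odot> (\<alpha> \<odot> \<alpha>) = \<gamma> \<odot> (\<alpha> \<odot> (\<alpha> \<odot> \<beta>))"
      "(\<gamma> \<odot> \<beta>) \<odot> (\<beta> \<odot> \<beta>) = \<gamma> \<odot> (\<beta> \<odot> (\<beta> \<odot> \<beta>))" by (simp_all only: qmul_ac)
    then show ?thesis by (simp add: j field_simps power2_eq_square)
  qed
  also have "\<dots> = nm \<gamma> * ar \<alpha> \<beta> ^ 2 * (ar \<alpha> \<beta> * of_int h2)" unfolding 1 qnorm_mult using n by simp
  finally have h2: "c^2 - b * d = int g * h2" by (rule k)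
  have "?g ^ 2 * of_int (b * c - a * d) = 4 * (snd (\<gamma> \<odot> (\<alpha> \<odot> (\<alpha> \<odot> \<beta>))) * snd (\<gamma> \<odot> (\<alpha> \<odot> (\<beta> \<odot> \<beta>))) -
     snd (\<gamma> \<odot> (\<alpha> \<odot> (\<alpha> \<odot> \<alpha>))) * snd (\<gamma> \<odot> (\<beta> \<odot> (\<beta> \<odot> \<beta>))))"
    unfolding j by (simp add: field_simps power2_eq_square)
  also have "\<dots> = nm \<gamma> * ar \<alpha> \<beta> ^ 2 * (ar \<alpha> \<beta> * of_int h1)" unfolding 2 using n by simp
  finally have h1: "b * c - a * d = int g * h1" by (rule k)
  show ?thesis unfolding e hess_def prod.case h0 h1 h2 ..
qed

definition cforms :: "nat \<Rightarrow> quadruple set" where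
  "cforms g = {f. fdisc f = D * int g ^ 2 \<and> hcontent f = g}"

text \<open>Equality of ideal norms would give the last condition only up to sign. With the sign it
  selects an orientation of the basis and reduces the freedom of choice from GL_2 to SL_2.\<close>

definition rel :: "nat \<Rightarrow> quadruple \<Rightarrow> (rat \<times> rat) set \<times> (rat \<times> rat) \<Rightarrow> bool" where
  "rel g f z \<longleftrightarrow> (\<exists>\<alpha> \<beta>. fst z = lat \<alpha> \<beta> \<and> fits g \<alpha> \<beta> (snd z) f \<and> nm (snd z) * ar \<alpha> \<beta> ^ 3 = of_nat g ^ 3)"

lemma cube_pair_form:
  assumes g: "g > 0" and z: "(I, \<gamma>) \<in> cube_pairs g"
  shows "\<exists>f\<in>cforms g. rel g f (I, \<gamma>)"
proof -
  obtain J where J: "J \<in> carrier AA" "J \<subseteq> carrier \<O>" "card (carrier (\<O> Quot J)) = g"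
    "pr \<gamma> \<diamondop> ((I \<diamondop> I) \<diamondop> I) = pr (of_nat g, 0) \<diamondop> J" and I: "I \<in> carrier AA" "nm \<gamma> \<noteq> 0"
    using z unfolding cube_pairs_def by blast
  obtain \<alpha>0 \<beta>0 where b0: "I = lat \<alpha>0 \<beta>0" "ar \<alpha>0 \<beta>0 \<noteq> 0" using AA_basis[OF I(1)] .
  obtain k0 k1 k2 where n0: "norm_form \<alpha>0 \<beta>0 k0 k1 k2" using AA_norm_form[of \<alpha>0 \<beta>0] b0 I(1) by blast
  obtain \<alpha>' \<beta>' where bJ: "J = lat \<alpha>' \<beta>'" "ar \<alpha>' \<beta>' \<noteq> 0" using AA_basis[OF J(1)] .
  obtain l0 l1 l2 where nJ: "norm_form \<alpha>' \<beta>' l0 l1 l2" using AA_norm_form[of \<alpha>' \<beta>'] bJ J(1) by blast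
  have "of_nat g = \<bar>ar \<alpha>' \<beta>'\<bar>" using card_quotient_area[OF nJ] J bJ by simp
  then have "\<bar>nm \<gamma> * ar \<alpha>0 \<beta>0 ^ 3\<bar> = of_nat g ^ 3"
    using norm_cube[OF n0 nJ, of \<gamma> "of_nat g"] J(4) by (simp add: b0 bJ power2_eq_square power3_eq_cube)
  \<comment> \<open>The area enters to an odd power, so exchanging the basis vectors repairs the
    sign.\<close>
  then have "nm \<gamma> * ar \<alpha>0 \<beta>0 ^ 3 = of_nat g ^ 3 \<or> nm \<gamma> * ar \<beta>0 \<alpha>0 ^ 3 = of_nat g ^ 3"
    using ar_simps(7)[of \<alpha>0 \<beta>0] by (auto simp: abs_if split: if_splits)
  moreover have "lat \<beta>0 \<alpha>0 = lat \<alpha>0 \<beta>0" unfolding lat_def by (intro Collect_cong) (metis add.commute)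
  ultimately obtain \<alpha> \<beta> where b: "I = lat \<alpha> \<beta>" "nm \<gamma> * ar \<alpha> \<beta> ^ 3 = of_nat g ^ 3"
    using b0(1) by metis
  have w: "ar \<alpha> \<beta> \<noteq> 0" using b(2) g by auto
  obtain h0 h1 h2 where n: "norm_form \<alpha> \<beta> h0 h1 h2" using AA_norm_form[of \<alpha> \<beta>] w b I(1) by blast
  \<comment> \<open>Products of three elements of \<open>I\<close> with \<gamma> lie in
    \<open>g J\<close>, hence in \<open>g\<close> times the order; this divisibility by
    \<open>g\<close> makes the coefficients of the form integral.\<close>
  have int: "\<exists>n. 2 * snd (\<gamma> \<odot> (x \<odot> (y \<odot> t))) = of_int (int g * n)" if "x \<in> I" "y \<in> I" "t \<in> I" for x y t
  proof -
    have "\<gamma> \<odot> (1, 0) \<in> pr \<gamma>" using O_closed(3) by blast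
    then have "(\<gamma> \<odot> (1, 0)) \<odot> ((x \<odot> y) \<odot> t) \<in> pr (of_nat g, 0) \<diamondop> J"
      unfolding J(4)[symmetric] by (intro ip_mem that)
    also have "\<dots> = (\<lambda>y. (of_nat g, 0) \<odot> y) ` J" by (rule ip_pr[OF AA_module[OF J(1)]])
    finally obtain j where "j \<in> J" "(\<gamma> \<odot> (1, 0)) \<odot> ((x \<odot> y) \<odot> t) = (of_nat g, 0) \<odot> j" by blast
    then have j: "j \<in> J" "\<gamma> \<odot> (x \<odot> (y \<odot> t)) = qscale (of_nat g) j"
      using qmul_rat(1)[of D "of_nat g" j] by (simp_all only: qmul_one(2) qmul_assoc)
    have "j \<in> carrier \<O>" using j(1) J(2) by blast
    then obtain u v where "j = quad_elt D u v" by (rule quad_ringE)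
    then show ?thesis using j(2) by (intro exI[of _ v]) (simp add: qscale_def quad_elt_def)
  qed
  have ab: "\<alpha> \<in> I" "\<beta> \<in> I" unfolding b(1) by (rule lat_mem)+
  obtain a where a: "2 * snd (\<gamma> \<odot> (\<alpha> \<odot> (\<alpha> \<odot> \<alpha>))) = of_int (int g * a)" using int ab by blast
  obtain b' where b': "2 * snd (\<gamma> \<odot> (\<alpha> \<odot> (\<alpha> \<odot> \<beta>))) = of_int (int g * b')" using int ab by blast
  obtain c where c: "2 * snd (\<gamma> \<odot> (\<alpha> \<odot> (\<beta> \<odot> \<beta>))) = of_int (int g * c)" using int ab by blast
  obtain d where d: "2 * snd (\<gamma> \<odot> (\<beta> \<odot> (\<beta> \<odot> \<beta>))) = of_int (int g * d)" using int ab by blast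
  have f: "fits g \<alpha> \<beta> \<gamma> (a, b', c, d)" unfolding fits_def using a b' c d by simp
  have hs: "hess (a, b', c, d) = (int g * h0, int g * h1, int g * h2)" by (rule fits_hess[OF f g n b(2)])
  have "gcd h0 (gcd h1 h2) dvd 1" using n unfolding norm_form_def by (meson dvd_trans gcd_dvd1 gcd_dvd2)
  then have "gcd (int g * h0) (gcd (int g * h1) (int g * h2)) = int g"
    by (simp add: gcd_mult_distrib_int[symmetric])
  then have "hcontent (a, b', c, d) = g" unfolding hcontent_def hs by simp
  moreover have "fdisc (a, b', c, d) = D * int g ^ 2"
    unfolding fdisc_hess[OF hs] norm_form_disc[OF n, symmetric] by (simp add: algebra_simps power2_eq_square)
  ultimately have "(a, b', c, d) \<in> cforms g" unfolding cforms_def by blast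
  moreover have "rel g (a, b', c, d) (I, \<gamma>)" unfolding rel_def fst_conv snd_conv using f b by blast
  ultimately show ?thesis by blast
qed

lemma O_half:
  assumes "even (x - y * D)" shows "(of_int x / 2, of_int y / 2) \<in> carrier \<O>"
proof -
  obtain k where "x - y * D = 2 * k" using assms by (rule evenE)
  then have "x = y * D + 2 * k" by simp
  then have "(of_int x / 2, of_int y / 2) = quad_elt D k y" by (simp add: quad_elt_def add_divide_distrib)
  then show ?thesis by simp
qed

text \<open>The ideal is read off from the Hessian: with \<alpha> equal to 1 the second basis
  element must be \<open>(h1 + sqrt D) / (2 h0)\<close>, and \<gamma> is then forced by the first
  two coefficients of the form. It remains to see that \<open>\<gamma> I^3\<close> lies in
  \<open>g\<close> times the order and that the quotient has norm \<open>g\<close>.\<close>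

lemma form_cube_pair_aux:
  assumes g: "g > 0" and f: "f \<in> cforms g" "hess f = (int g * h0, int g * h1, int g * h2)"
    "gcd h0 (gcd h1 h2) = 1" and h0: "h0 \<noteq> 0"
  shows "\<exists>\<alpha> \<beta> \<gamma>. fits g \<alpha> \<beta> \<gamma> f \<and> (lat \<alpha> \<beta>, \<gamma>) \<in> cube_pairs g \<and> nm \<gamma> * ar \<alpha> \<beta> ^ 3 = of_nat g ^ 3"
proof -
  obtain a b c d where e: "f = (a, b, c, d)" by (cases f)
  have A: "b^2 - a * c = int g * h0" "b * c - a * d = int g * h1" "c^2 - b * d = int g * h2"
    using f(2) unfolding e hess_def by auto
  have gD: "int g \<noteq> 0" using g by simp
  have "D * int g ^ 2 = int g ^ 2 * (h1^2 - 4 * h0 * h2)"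
    using f(1) fdisc_hess[OF f(2)] unfolding cforms_def by (simp add: algebra_simps power2_eq_square)
  then have Dh: "D = h1^2 - 4 * h0 * h2" using gD by simp
  let ?h0 = "of_int h0 :: rat" and ?h1 = "of_int h1 :: rat" and ?h2 = "of_int h2 :: rat"
  define \<alpha> where "\<alpha> = (1 :: rat, 0 :: rat)"
  define \<beta> where "\<beta> = (?h1 / (2 * ?h0), 1 / (2 * ?h0))"
  have one: "\<alpha> \<odot> x = x" "x \<odot> \<alpha> = x" for x by (simp_all add: \<alpha>_def qmul_one)
  have w: "ar \<alpha> \<beta> = 1 / ?h0" using h0 by (simp add: ar_def \<alpha>_def \<beta>_def)
  have n: "norm_form \<alpha> \<beta> h0 h1 h2"
    unfolding norm_form_def w
  proof (intro conjI)
    show "nm \<beta> = 1 / ?h0 * ?h2" unfolding Dh using h0 by (simp add: qnorm_def \<beta>_def field_simps power2_eq_square)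
    show "\<forall>k. k dvd h0 \<longrightarrow> k dvd h1 \<longrightarrow> k dvd h2 \<longrightarrow> k dvd 1" using f(3) by (metis gcd_greatest)
  qed (use h0 in \<open>simp_all add: qnorm_def tr2_def \<alpha>_def \<beta>_def\<close>)
  \<comment> \<open>The products of \<gamma> with the powers of \<beta> are to be
    \<open>g * (Pi + e sqrt D) / 2\<close>, where \<open>e\<close> runs through \<open>a\<close>,
    \<open>b\<close>, \<open>c\<close>, \<open>d\<close>. Comparing second coordinates after
    multiplication by \<beta> forces \<open>P0\<close>, \<open>P1\<close>, \<open>P2\<close>; the
    first coordinate of the last product forces \<open>P3\<close>.\<close>
  define P0 where "P0 = 2 * b * h0 - a * h1"
  define P1 where "P1 = 2 * c * h0 - b * h1"
  define P2 where "P2 = 2 * d * h0 - c * h1"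
  define P3 where "P3 = d * h1 - 2 * c * h2"
  have gr: "int g * x = int g * y \<Longrightarrow> x = y" for x y using gD by simp
  \<comment> \<open>After multiplication by \<open>g\<close> the Hessian coefficients can be
    replaced by their expressions in \<open>a\<close>, \<open>b\<close>, \<open>c\<close>,
    \<open>d\<close>, and the claim becomes a linear syzygy between the form and its Hessian;
    \<open>r2\<close> is its companion.\<close>
  have r1: "P0 * h1 + D * a = 2 * h0 * P1"
  proof (rule gr)
    have "int g * (P0 * h1 + D * a - 2 * h0 * P1) = 4 * h0 * (b * (int g * h1) - a * (int g * h2) - c * (int g * h0))"
      unfolding P0_def P1_def Dh by (simp add: algebra_simps power2_eq_square)
    also have "\<dots> = 0" unfolding A[symmetric] by (simp add: algebra_simps power2_eq_square)
    finally show "int g * (P0 * h1 + D * a) = int g * (2 * h0 * P1)" by (simp add: algebra_simps)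
  qed
  have r2: "P1 * h1 + D * b = 2 * h0 * P2"
  proof (rule gr)
    have "int g * (P1 * h1 + D * b - 2 * h0 * P2) = 4 * h0 * (c * (int g * h1) - b * (int g * h2) - d * (int g * h0))"
      unfolding P1_def P2_def Dh by (simp add: algebra_simps power2_eq_square)
    also have "\<dots> = 0" unfolding A[symmetric] by (simp add: algebra_simps power2_eq_square)
    finally show "int g * (P1 * h1 + D * b) = int g * (2 * h0 * P2)" by (simp add: algebra_simps)
  qed
  have r3: "P2 * h1 + D * c = 2 * h0 * P3"
    unfolding P2_def P3_def Dh by (simp add: algebra_simps power2_eq_square)
  let ?E = "\<lambda>x y. (of_int x / 2, of_int y / 2) :: rat \<times> rat"
  have step: "?E x y \<odot> \<beta> = ?E x' y'" if "x * h1 + D * y = 2 * h0 * x'" "x + y * h1 = 2 * h0 * y'" for x y x' y'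
  proof -
    have e: "of_int x * ?h1 + of_int D * of_int y = 2 * ?h0 * of_int x'" "of_int x + of_int y * ?h1 = 2 * ?h0 * of_int y'"
      using arg_cong[OF that(1), of "of_int :: int \<Rightarrow> rat"] arg_cong[OF that(2), of "of_int :: int \<Rightarrow> rat"] by simp_all
    have "?E x y \<odot> \<beta> = ((of_int x * ?h1 + of_int D * of_int y) / (4 * ?h0), (of_int x + of_int y * ?h1) / (4 * ?h0))"
      by (simp add: qmul_def \<beta>_def add_divide_distrib)
    also have "\<dots> = ?E x' y'" unfolding e using h0 by simp
    finally show ?thesis .
  qed
  have s: "?E P0 a \<odot> \<beta> = ?E P1 b" "?E P1 b \<odot> \<beta> = ?E P2 c" "?E P2 c \<odot> \<beta> = ?E P3 d"
    by (rule step, rule r1 r2 r3, simp add: P0_def P1_def P2_def)+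
  define \<gamma> where "\<gamma> = qscale (of_nat g) (?E P0 a)"
  have m: "\<gamma> \<odot> (\<alpha> \<odot> (\<alpha> \<odot> \<alpha>)) = qscale (of_nat g) (?E P0 a)" "\<gamma> \<odot> (\<alpha> \<odot> (\<alpha> \<odot> \<beta>)) = qscale (of_nat g) (?E P1 b)"
    "\<gamma> \<odot> (\<alpha> \<odot> (\<beta> \<odot> \<beta>)) = qscale (of_nat g) (?E P2 c)" "\<gamma> \<odot> (\<beta> \<odot> (\<beta> \<odot> \<beta>)) = qscale (of_nat g) (?E P3 d)"
    unfolding \<gamma>_def one qmul_assoc[symmetric] qmul_scale s by (rule refl)+
  have fit: "fits g \<alpha> \<beta> \<gamma> f" unfolding e fits_def m prod.case by (simp add: qscale_def)
  \<comment> \<open>The classical relation between a cubic, its Hessian and its cubic covariant, at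
    the leading coefficients: \<open>int g * P0\<close> is \<open>2 b^3 - 3 a b c + a^2 d\<close>.
    It yields the norm of \<gamma>.\<close>
  have "int g ^ 2 * (P0^2 - D * a^2) = 4 * (int g * h0)^3"
  proof -
    have "int g ^ 2 * (P0^2 - D * a^2) = (2 * b * (int g * h0) - a * (int g * h1))^2 - ((int g * h1)^2 - 4 * (int g * h0) * (int g * h2)) * a^2"
      unfolding P0_def Dh by (simp add: algebra_simps power2_eq_square)
    also have "\<dots> = 4 * (int g * h0)^3" unfolding A[symmetric] by (simp add: algebra_simps power2_eq_square power3_eq_cube)
    finally show ?thesis .
  qed
  then have "int g ^ 2 * (P0^2 - D * a^2) = int g ^ 2 * (4 * int g * h0^3)" by (simp add: algebra_simps power2_eq_square power3_eq_cube)
  then have N: "P0^2 - D * a^2 = 4 * int g * h0^3" using gD by simp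
  have "nm \<gamma> = of_nat g * of_nat g * (of_int (P0^2 - D * a^2) / 4)"
    unfolding \<gamma>_def qnorm_simps by (simp add: qnorm_def power2_eq_square field_simps)
  then have N\<gamma>: "nm \<gamma> = of_nat g ^ 3 * ?h0 ^ 3" unfolding N by (simp add: power3_eq_cube)
  then have vol: "nm \<gamma> * ar \<alpha> \<beta> ^ 3 = of_nat g ^ 3" unfolding w using h0 by (simp add: power_divide)
  have nz: "nm \<gamma> \<noteq> 0" using N\<gamma> h0 g by simp
  let ?I = "lat \<alpha> \<beta>"
  have I: "?I \<in> carrier AA" by (rule norm_form_AA[OF n])
  have par: "even (h1 - D)"
  proof -
    obtain l where "h1 = D + 2 * l" using norm_form_parity[OF n] .
    then show ?thesis by simp
  qed
  have el: "?E P0 a \<in> carrier \<O>" "?E P1 b \<in> carrier \<O>" "?E P2 c \<in> carrier \<O>" "?E P3 d \<in> carrier \<O>"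
    using par by (intro O_half; simp add: P0_def P1_def P2_def P3_def; blast)+
  let ?pg = "pr (of_nat g, 0)"
  have Mg: "module ?pg" by (rule module_scale[OF module_O])
  \<comment> \<open>By trilinearity it is enough to test basis elements, whose products with
    \<gamma> are \<open>g\<close> times the elements in \<open>el\<close>; the arguments are
    expanded one at a time.\<close>
  have gen: "\<gamma> \<odot> (x \<odot> (y \<odot> t)) \<in> ?pg" if "x \<in> ?I" "y \<in> ?I" "t \<in> ?I" for x y t
  proof -
    have E: "qscale (of_nat g) u \<in> ?pg" if "u \<in> carrier \<O>" for u
      using that by (auto simp: qmul_rat)
    have mE: "\<gamma> \<odot> (\<alpha> \<odot> (\<alpha> \<odot> \<alpha>)) \<in> ?pg" "\<gamma> \<odot> (\<alpha> \<odot> (\<alpha> \<odot> \<beta>)) \<in> ?pg"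
      "\<gamma> \<odot> (\<alpha> \<odot> (\<beta> \<odot> \<beta>)) \<in> ?pg" "\<gamma> \<odot> (\<beta> \<odot> (\<beta> \<odot> \<beta>)) \<in> ?pg"
      unfolding m by (rule E, rule el)+
    have base: "\<gamma> \<odot> (x \<odot> (y \<odot> t)) \<in> ?pg" if h: "x \<in> {\<alpha>, \<beta>}" "y \<in> {\<alpha>, \<beta>}" "t \<in> {\<alpha>, \<beta>}" for x y t
      using h mE unfolding one by (elim insertE emptyE) (simp_all only: one)
    have comb: "\<gamma> \<odot> (x \<odot> (y \<odot> t)) \<in> ?pg"
      if xI: "x \<in> ?I" and h: "\<And>u. u \<in> {\<alpha>, \<beta>} \<Longrightarrow> \<gamma> \<odot> (u \<odot> (y \<odot> t)) \<in> ?pg" for x y t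
    proof -
      obtain m' n' where x: "x = qscale (of_int m') \<alpha> + qscale (of_int n') \<beta>" using xI by (rule latE)
      have "\<gamma> \<odot> (x \<odot> (y \<odot> t)) = qscale (of_int m') (\<gamma> \<odot> (\<alpha> \<odot> (y \<odot> t))) + qscale (of_int n') (\<gamma> \<odot> (\<beta> \<odot> (y \<odot> t)))"
        unfolding x by (simp only: qmul_add_left qmul_add_right qmul_scale)
      moreover have "\<gamma> \<odot> (\<alpha> \<odot> (y \<odot> t)) \<in> ?pg" "\<gamma> \<odot> (\<beta> \<odot> (y \<odot> t)) \<in> ?pg" by (rule h, blast)+
      ultimately show ?thesis by (simp only: module_add[OF Mg module_int[OF Mg] module_int[OF Mg]])
    qed
    have c1: "\<gamma> \<odot> (x \<odot> (y \<odot> t)) \<in> ?pg" if "x \<in> ?I" "y \<in> {\<alpha>, \<beta>}" "t \<in> {\<alpha>, \<beta>}" for x y t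
      using comb[OF that(1), of y t] base that by blast
    have c2: "\<gamma> \<odot> (x \<odot> (y \<odot> t)) \<in> ?pg" if "x \<in> ?I" "y \<in> ?I" "t \<in> {\<alpha>, \<beta>}" for x y t
    proof -
      have "\<gamma> \<odot> (y \<odot> (x \<odot> t)) \<in> ?pg"
      proof (rule comb[OF that(2)])
        fix u assume "u \<in> {\<alpha>, \<beta>}"
        then have "\<gamma> \<odot> (x \<odot> (u \<odot> t)) \<in> ?pg" by (rule c1[OF that(1) _ that(3)])
        then show "\<gamma> \<odot> (u \<odot> (x \<odot> t)) \<in> ?pg" by (simp only: qmul_left_comm[of D x u])
      qed
      then show ?thesis by (simp only: qmul_left_comm[of D x y])
    qed
    have "\<gamma> \<odot> (t \<odot> (x \<odot> y)) \<in> ?pg"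
    proof (rule comb[OF that(3)])
      fix u assume "u \<in> {\<alpha>, \<beta>}"
      then have "\<gamma> \<odot> (x \<odot> (y \<odot> u)) \<in> ?pg" by (rule c2[OF that(1,2)])
      moreover have "u \<odot> (x \<odot> y) = x \<odot> (y \<odot> u)" by (simp only: qmul_ac)
      ultimately show "\<gamma> \<odot> (u \<odot> (x \<odot> y)) \<in> ?pg" by simp
    qed
    moreover have "t \<odot> (x \<odot> y) = x \<odot> (y \<odot> t)" by (simp only: qmul_ac)
    ultimately show ?thesis by simp
  qed
  define J where "J = pr (1 / of_nat g, 0) \<diamondop> (pr \<gamma> \<diamondop> ((?I \<diamondop> ?I) \<diamondop> ?I))"
  have gg: "(1 / of_nat g, 0) \<odot> (of_nat g, 0) = (1, 0)" using g by (simp add: qmul_rat qscale_def)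
  have pg1: "pr (1 / of_nat g, 0) \<diamondop> ?pg = carrier \<O>"
    using pr_mult[of "(1 / of_nat g, 0)" "(of_nat g, 0)"] unfolding gg by (simp add: qmul_one)
  have g': "nm (1 / of_nat g, 0) \<noteq> 0" using g by (simp add: qnorm_def)
  have L: "pr \<gamma> \<diamondop> ((?I \<diamondop> ?I) \<diamondop> ?I) \<in> carrier AA"
  proof -
    have "?I \<diamondop> ?I \<in> carrier AA" using A.m_closed[OF I I] by (simp only: AA_simps(2))
    then have "(?I \<diamondop> ?I) \<diamondop> ?I \<in> carrier AA" using A.m_closed[OF _ I] by (simp only: AA_simps(2))
    then show ?thesis by (rule class_scale(1)[OF _ nz])
  qed
  have J: "J \<in> carrier AA" unfolding J_def by (rule class_scale(1)[OF L g'])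
  have eqJ: "pr \<gamma> \<diamondop> ((?I \<diamondop> ?I) \<diamondop> ?I) = ?pg \<diamondop> J"
  proof -
    have "?pg \<diamondop> J = (pr (1 / of_nat g, 0) \<diamondop> ?pg) \<diamondop> (pr \<gamma> \<diamondop> ((?I \<diamondop> ?I) \<diamondop> ?I))"
      unfolding J_def by (simp only: ip_ac)
    then show ?thesis unfolding pg1 using ip_O[OF AA_module[OF L]] by simp
  qed
  have "pr \<gamma> \<diamondop> ((?I \<diamondop> ?I) \<diamondop> ?I) \<subseteq> ?pg"
  proof (rule ip_subset)
    fix u v assume "u \<in> pr \<gamma>" and v: "v \<in> (?I \<diamondop> ?I) \<diamondop> ?I"
    then obtain o' where o': "o' \<in> carrier \<O>" "u = \<gamma> \<odot> o'" by blast
    from v have "v \<in> ?I \<diamondop> (?I \<diamondop> ?I)" by (simp only: ip_assoc)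
    then have "\<gamma> \<odot> v \<in> ?pg"
    proof (induction rule: ip_induct)
      case (prod x y)
      from prod(2) show ?case
        by (induction rule: ip_induct) (simp_all add: gen[OF prod(1)] qmul_add_right module_add[OF Mg])
    next
      case (sum s t) then show ?case unfolding qmul_add_right by (rule_tac module_add[OF Mg])
    qed
    then have "o' \<odot> (\<gamma> \<odot> v) \<in> ?pg" by (rule moduleD(4)[OF Mg o'(1)])
    then show "u \<odot> v \<in> ?pg" unfolding o'(2) by (simp only: qmul_ac)
  qed (rule module_add[OF Mg])
  then have "J \<subseteq> pr (1 / of_nat g, 0) \<diamondop> ?pg" unfolding J_def by (rule ip_mono[OF subset_refl])
  then have JO: "J \<subseteq> carrier \<O>" unfolding pg1 .
  obtain \<alpha>' \<beta>' where bJ: "J = lat \<alpha>' \<beta>'" "ar \<alpha>' \<beta>' \<noteq> 0" using AA_basis[OF J] .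
  obtain l0 l1 l2 where nJ: "norm_form \<alpha>' \<beta>' l0 l1 l2" using AA_norm_form[of \<alpha>' \<beta>'] bJ J by blast
  \<comment> \<open>\<open>norm_cube\<close> read backwards: the area of \<open>I\<close> and the
    norm of \<gamma> are known, so the area of \<open>J\<close> follows, and with it the
    index.\<close>
  have "of_nat g ^ 3 = of_nat g ^ 2 * \<bar>ar \<alpha>' \<beta>'\<bar>"
    using norm_cube[OF n nJ, of \<gamma> "of_nat g"] eqJ unfolding bJ vol by simp
  then have "of_nat g ^ 2 * of_nat g = of_nat g ^ 2 * \<bar>ar \<alpha>' \<beta>'\<bar>" by (simp add: power2_eq_square power3_eq_cube)
  then have "\<bar>ar \<alpha>' \<beta>'\<bar> = of_nat g" using g by simp
  then have "card (carrier (\<O> Quot J)) = g" using card_quotient_area[OF nJ] JO unfolding bJ by simp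
  then have "(?I, \<gamma>) \<in> cube_pairs g" unfolding cube_pairs_def using I nz J JO eqJ by blast
  then show ?thesis using fit vol by blast
qed

text \<open>The construction divides by \<open>h0\<close>, so the form is first moved by a matrix of
  determinant 1 at whose first column the Hessian does not vanish; the inverse matrix carries the
  basis back.\<close>

lemma form_cube_pair:
  assumes g: "g > 0" and f: "f \<in> cforms g"
  shows "\<exists>z\<in>cube_pairs g. rel g f z"
proof -
  have "fdisc f \<noteq> 0" using f g D_nonzero by (simp add: cforms_def)
  then obtain h0 h1 h2 where "hess f = (int (hcontent f) * h0, int (hcontent f) * h1, int (hcontent f) * h2)"
    "gcd h0 (gcd h1 h2) = 1" "fdisc f = int (hcontent f) ^ 2 * (h1^2 - 4 * h0 * h2)" by (rule hcontent_disc)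
  moreover have "hcontent f = g" using f by (simp add: cforms_def)
  ultimately have h: "hess f = (int g * h0, int g * h1, int g * h2)" "gcd h0 (gcd h1 h2) = 1"
    "fdisc f = int g ^ 2 * (h1^2 - 4 * h0 * h2)" by simp_all
  have dsc: "h1^2 - 4 * h0 * h2 \<noteq> 0" using h(3) \<open>fdisc f \<noteq> 0\<close> by auto
  have main: "\<exists>z\<in>cube_pairs g. rel g f z" if M: "p * s - q * r = 1" "h0 * p^2 + h1 * p * r + h2 * r^2 \<noteq> 0" for p q r s
  proof -
    let ?M = "(p, q, r, s)" and ?N = "(s, - q, - r, p)"
    have dM: "mdet ?M = 1" "mdet ?N = 1" using M(1) by (simp_all add: mdet_def mult.commute)
    have inv: "minv ?M = ?N" using dM by (simp add: minv_def fscale_def)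
    have undo: "act ?N (act ?M f) = f" using mmul_minv(1)[of ?M] dM unfolding inv by (metis act_mmul mmul_mone(3))
    have "fscale 1 (act ?M f) = act ?M f" by (rule fscale_fscale)
    have "?N \<in> HSL f (act ?M f)" using dM undo by (simp add: HSL_def)
    then have cont: "hcontent (act ?M f) = hcontent f" using hcontent_HSL by (metis empty_iff)
    have cf: "act ?M f \<in> cforms g" using f cont dM by (simp add: cforms_def fdisc_act)
    have hs: "hess (act ?M f) = (int g * (h0 * p^2 + h1 * p * r + h2 * r^2),
        int g * (2 * h0 * p * q + h1 * (p * s + q * r) + 2 * h2 * r * s), int g * (h0 * q^2 + h1 * q * s + h2 * s^2))"
      using hess_act[OF h(1), of p q r s] unfolding M(1) by (simp add: algebra_simps)
    have "int (hcontent (act ?M f)) = int g" using cf by (simp add: cforms_def)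
    then have "int g * gcd (h0 * p^2 + h1 * p * r + h2 * r^2) (gcd (2 * h0 * p * q + h1 * (p * s + q * r) + 2 * h2 * r * s) (h0 * q^2 + h1 * q * s + h2 * s^2)) = int g"
      unfolding hcontent_def hs prod.case by (simp add: gcd_mult_left)
    then have pm: "gcd (h0 * p^2 + h1 * p * r + h2 * r^2) (gcd (2 * h0 * p * q + h1 * (p * s + q * r) + 2 * h2 * r * s) (h0 * q^2 + h1 * q * s + h2 * s^2)) = 1"
      using g by simp
    obtain \<alpha> \<beta> \<gamma> where *: "fits g \<alpha> \<beta> \<gamma> (act ?M f)" "(lat \<alpha> \<beta>, \<gamma>) \<in> cube_pairs g" "nm \<gamma> * ar \<alpha> \<beta> ^ 3 = of_nat g ^ 3"
      using form_cube_pair_aux[OF g cf hs pm M(2)] by blast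
    let ?a = "qscale (of_int s) \<alpha> + qscale (of_int (- r)) \<beta>" and ?b = "qscale (of_int (- q)) \<alpha> + qscale (of_int p) \<beta>"
    have "fits g ?a ?b \<gamma> f" using fits_act[OF *(1), of s "- r" "- q" p] unfolding undo by simp
    moreover have "lat ?a ?b = lat \<alpha> \<beta>" by (rule lat_comb) (use M(1) in \<open>simp add: algebra_simps\<close>)
    moreover have "ar ?a ?b = ar \<alpha> \<beta>"
    proof -
      have "of_int s * of_int p - of_int (- q) * of_int (- r) = (1 :: rat)"
        using arg_cong[OF M(1), of "of_int :: int \<Rightarrow> rat"] by (simp add: algebra_simps)
      then show ?thesis unfolding ar_comb by simp
    qed
    ultimately have "rel g f (lat \<alpha> \<beta>, \<gamma>)" unfolding rel_def fst_conv snd_conv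
      using *(3) by (intro exI[of _ ?a] exI[of _ ?b]) (simp only:)
    then show ?thesis using *(2) by blast
  qed
  \<comment> \<open>The Hessian is nonzero at \<open>(1, 0)\<close>, \<open>(0, 1)\<close> or
    \<open>(1, 1)\<close>: if both outer coefficients vanish, the third value is \<open>h1\<close>,
    nonzero because the discriminant is.\<close>
  consider "h0 \<noteq> 0" | "h2 \<noteq> 0" | "h0 = 0" "h2 = 0" by blast
  then show ?thesis
  proof cases
    case 1 then show ?thesis using main[of 1 1 0 0] by simp
  next
    case 2 then show ?thesis using main[of 0 0 "-1" 1] by simp
  next
    case 3 then show ?thesis using main[of 1 1 0 1] dsc by simp
  qed
qed

text \<open>Equal norm forms give the same ratio of basis elements, so \<kappa>, the quotient of
  \<alpha> and \<alpha>', works for both. The form records the second coordinates of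
  \<open>u\<close> and \<open>?\<theta> \<odot> u\<close>; as \<open>?\<theta>\<close> has nonzero
  second coordinate, they determine \<open>u\<close>, and cancelling the cube of \<alpha>' compares
  \<gamma> with \<gamma>'.\<close>

lemma fits_rigid_aux:
  assumes g: "g > 0" and f: "fits g \<alpha> \<beta> \<gamma> f" "fits g \<alpha>' \<beta>' \<gamma>' f"
    and n: "norm_form \<alpha> \<beta> h0 h1 h2" "norm_form \<alpha>' \<beta>' h0 h1 h2" and h0: "h0 \<noteq> 0"
  shows "\<exists>\<kappa>. nm \<kappa> \<noteq> 0 \<and> \<alpha> = \<kappa> \<odot> \<alpha>' \<and> \<beta> = \<kappa> \<odot> \<beta>' \<and> \<gamma>' = ((\<kappa> \<odot> \<kappa>) \<odot> \<kappa>) \<odot> \<gamma>"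
proof -
  let ?\<theta> = "(of_int h1 / (2 * of_int h0), 1 / (2 * of_int h0)) :: rat \<times> rat"
  have th: "\<beta> = ?\<theta> \<odot> \<alpha>" "nm \<alpha> \<noteq> 0" if "norm_form \<alpha> \<beta> h0 h1 h2" for \<alpha> \<beta>
  proof -
    note n = that[unfolded norm_form_def]
    show "nm \<alpha> \<noteq> 0" using n h0 by simp
    have "(of_int h1 / 2, 1 / 2) \<odot> \<alpha> = qscale (of_int h0) \<beta>"
      using form_mult(1)[of \<alpha> \<beta> 1 "of_int h0" "of_int h1" "of_int h2"] n by simp
    moreover have "?\<theta> = qscale (1 / of_int h0) (of_int h1 / 2, 1 / 2)" by (simp add: qscale_def)
    ultimately show "\<beta> = ?\<theta> \<odot> \<alpha>" using h0 by (simp only: qmul_scale) (simp add: qscale_simps)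
  qed
  note a = th(2)[OF n(1)] and a' = th(2)[OF n(2)] and b = th(1)[OF n(1)] and b' = th(1)[OF n(2)]
  define \<kappa> where "\<kappa> = \<alpha> \<odot> qinv D \<alpha>'"
  have k: "\<alpha> = \<kappa> \<odot> \<alpha>'" unfolding \<kappa>_def using qmul_qinv[OF a'] by (simp add: qmul_assoc qmul_one)
  have kb: "\<beta> = \<kappa> \<odot> \<beta>'" unfolding b b' unfolding k by (simp only: qmul_ac)
  have nk: "nm \<kappa> \<noteq> 0" using a unfolding k qnorm_mult by auto
  define u where "u = \<gamma> \<odot> (\<alpha> \<odot> (\<alpha> \<odot> \<alpha>))"
  define u' where "u' = \<gamma>' \<odot> (\<alpha>' \<odot> (\<alpha>' \<odot> \<alpha>'))"
  have s1: "snd u = snd u'" using f unfolding fits_def u_def u'_def by (cases f) simp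
  have s2: "snd (?\<theta> \<odot> u) = snd (?\<theta> \<odot> u')"
  proof -
    have "?\<theta> \<odot> u = \<gamma> \<odot> (\<alpha> \<odot> (\<alpha> \<odot> \<beta>))" "?\<theta> \<odot> u' = \<gamma>' \<odot> (\<alpha>' \<odot> (\<alpha>' \<odot> \<beta>'))"
      unfolding u_def u'_def b b' by (simp_all only: qmul_ac)
    then show ?thesis using f unfolding fits_def by (cases f) simp
  qed
  have "fst u = fst u'" using s2 h0 unfolding qmul_def by (simp add: s1)
  with s1 have uu: "u = u'" by (simp add: prod_eq_iff)
  have "(\<alpha>' \<odot> (\<alpha>' \<odot> \<alpha>')) \<odot> \<gamma>' = (\<alpha>' \<odot> (\<alpha>' \<odot> \<alpha>')) \<odot> (((\<kappa> \<odot> \<kappa>) \<odot> \<kappa>) \<odot> \<gamma>)"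
    using uu unfolding u_def u'_def k by (simp only: qmul_ac)
  then have "\<gamma>' = ((\<kappa> \<odot> \<kappa>) \<odot> \<kappa>) \<odot> \<gamma>" by (rule qmul_cancel[rotated]) (simp add: qnorm_mult a')
  then show ?thesis using nk k kb by blast
qed

lemma fits_rigid:
  assumes g: "g > 0" and f: "fits g \<alpha> \<beta> \<gamma> f" "fits g \<alpha>' \<beta>' \<gamma>' f"
    and n: "norm_form \<alpha> \<beta> h0 h1 h2" "norm_form \<alpha>' \<beta>' h0 h1 h2"
  shows "\<exists>\<kappa>. nm \<kappa> \<noteq> 0 \<and> \<alpha> = \<kappa> \<odot> \<alpha>' \<and> \<beta> = \<kappa> \<odot> \<beta>' \<and> \<gamma>' = ((\<kappa> \<odot> \<kappa>) \<odot> \<kappa>) \<odot> \<gamma>"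
proof -
  consider "h0 \<noteq> 0" | "h2 \<noteq> 0" | "h0 = 0" "h2 = 0" by blast
  then show ?thesis
  proof cases
    case 1 then show ?thesis by (rule fits_rigid_aux[OF g f n])
  next
    case 2
    have e: "qscale (of_int 0) x + qscale (of_int 1) y = y" "qscale (of_int (- 1)) x + qscale (of_int 0) y = - x" for x y
      by (simp_all add: qscale_simps)
    obtain k where "nm k \<noteq> 0" "\<beta> = k \<odot> \<beta>'" "- \<alpha> = k \<odot> - \<alpha>'" "\<gamma>' = ((k \<odot> k) \<odot> k) \<odot> \<gamma>"
      using fits_rigid_aux[OF g fits_act[OF f(1), of 0 1 "-1" 0, unfolded e] fits_act[OF f(2), of 0 1 "-1" 0, unfolded e]
          norm_form_shear(3)[OF n(1)] norm_form_shear(3)[OF n(2)] 2] by blast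
    then show ?thesis by (intro exI[of _ k]) (simp add: qmul_minus)
  next
    case 3
    then have h: "h0 + 1 * h1 + 1 ^ 2 * h2 \<noteq> 0" using norm_form_disc[OF n(1)] D_nonzero by auto
    have e: "qscale (of_int 1) x + qscale (of_int 1) y = x + qscale (of_int 1) y" "qscale (of_int 0) x + qscale (of_int 1) y = y" for x y
      by (simp_all add: qscale_simps)
    obtain k where k: "nm k \<noteq> 0" "\<alpha> + qscale (of_int 1) \<beta> = k \<odot> (\<alpha>' + qscale (of_int 1) \<beta>')" "\<beta> = k \<odot> \<beta>'" "\<gamma>' = ((k \<odot> k) \<odot> k) \<odot> \<gamma>"
      using fits_rigid_aux[OF g fits_act[OF f(1), of 1 1 0 1, unfolded e] fits_act[OF f(2), of 1 1 0 1, unfolded e]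
          norm_form_shear(2)[OF n(1), of 1] norm_form_shear(2)[OF n(2), of 1] h] by blast
    then have "\<alpha> = k \<odot> \<alpha>'" by (simp add: qscale_simps qmul_add_right)
    then show ?thesis using k by blast
  qed
qed

text \<open>A matrix and a scalar correspond when the scalar takes the basis of \<open>z'\<close>,
  changed by the matrix, to the basis of \<open>z\<close>. A matrix gives a scalar by
  \<open>fits_rigid\<close>; a scalar gives a matrix because it maps one lattice onto the
  other.\<close>

lemma form_pair_homs:
  assumes g: "g > 0" and z: "z \<in> cube_pairs g" "z' \<in> cube_pairs g" and r: "rel g f z" "rel g f' z'"
  shows "(HSL f f' = {} \<longleftrightarrow> CC.H z z' = {}) \<and> card (HSL f f') = card (CC.H z z')"
proof -
  obtain \<alpha> \<beta> where b: "fst z = lat \<alpha> \<beta>" "fits g \<alpha> \<beta> (snd z) f" "nm (snd z) * ar \<alpha> \<beta> ^ 3 = of_nat g ^ 3"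
    using r(1) unfolding rel_def by blast
  obtain \<alpha>' \<beta>' where b': "fst z' = lat \<alpha>' \<beta>'" "fits g \<alpha>' \<beta>' (snd z') f'" "nm (snd z') * ar \<alpha>' \<beta>' ^ 3 = of_nat g ^ 3"
    using r(2) unfolding rel_def by blast
  have c: "fst z \<in> carrier AA" "fst z' \<in> carrier AA" using z unfolding cube_pairs_def by (auto simp del: AA_simps)
  have w: "ar \<alpha> \<beta> \<noteq> 0" "ar \<alpha>' \<beta>' \<noteq> 0" using b(3) b'(3) g by auto
  obtain h0 h1 h2 where n: "norm_form \<alpha> \<beta> h0 h1 h2" using AA_norm_form[of \<alpha> \<beta>] w b c by metis
  have H: "\<kappa> \<in> CC.H z z' \<longleftrightarrow> nm \<kappa> \<noteq> 0 \<and> lat \<alpha> \<beta> = lat (\<kappa> \<odot> \<alpha>') (\<kappa> \<odot> \<beta>') \<and> snd z' = ((\<kappa> \<odot> \<kappa>) \<odot> \<kappa>) \<odot> snd z" for \<kappa>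
  proof -
    have "pr \<kappa> \<diamondop> fst z' = lat (\<kappa> \<odot> \<alpha>') (\<kappa> \<odot> \<beta>')" using ip_pr[OF AA_module[OF c(2)]] b'(1) lat_scale by metis
    then show ?thesis unfolding CC.H_def mem_Collect_eq pow3_KU KU_simps AA_simps(2) b(1) by simp
  qed
  define P where "P M \<kappa> \<longleftrightarrow> (case M of (p, q, r, s) \<Rightarrow> \<alpha> = \<kappa> \<odot> (qscale (of_int p) \<alpha>' + qscale (of_int r) \<beta>') \<and>
     \<beta> = \<kappa> \<odot> (qscale (of_int q) \<alpha>' + qscale (of_int s) \<beta>'))" for M \<kappa>
  \<comment> \<open>Scalars that agree on a basis agree on \<open>e\<close>, and since its norm is
    nonzero \<open>e\<close> can be cancelled even when \<open>K\<close> has zero divisors.\<close>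
  obtain e where e: "e \<in> lat \<alpha>' \<beta>'" "nm e \<noteq> 0" using unit_in_AA[OF c(2)] b'(1) by metis
  show ?thesis
  proof (rule bij_rel_card[where P = P])
    fix M assume M: "M \<in> HSL f f'"
    obtain p q r s where pq: "M = (p, q, r, s)" by (cases M)
    let ?a = "qscale (of_int p) \<alpha>' + qscale (of_int r) \<beta>'" and ?b = "qscale (of_int q) \<alpha>' + qscale (of_int s) \<beta>'"
    have d: "p * s - q * r = 1" and a: "act (p, q, r, s) f' = f" using M by (auto simp: HSL_def mdet_def pq)
    have "of_int p * of_int s - of_int q * of_int r = (1 :: rat)" using d by (metis of_int_1 of_int_diff of_int_mult)
    then have ar': "ar ?a ?b = ar \<alpha>' \<beta>'" unfolding ar_comb by simp
    have l': "lat ?a ?b = lat \<alpha>' \<beta>'" by (rule lat_comb[OF d])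
    have ft: "fits g ?a ?b (snd z') f" using fits_act[OF b'(2), of p r q s] unfolding a .
    obtain k0 k1 k2 where n': "norm_form ?a ?b k0 k1 k2" using AA_norm_form[of ?a ?b] w ar' l' b' c by metis
    have "hess f = (int g * h0, int g * h1, int g * h2)" by (rule fits_hess[OF b(2) g n b(3)])
    moreover have "hess f = (int g * k0, int g * k1, int g * k2)"
      by (rule fits_hess[OF ft g n']) (use b'(3) ar' in simp)
    ultimately have "k0 = h0" "k1 = h1" "k2 = h2" using g by auto
    then have n'': "norm_form ?a ?b h0 h1 h2" using n' by simp
    obtain k where k: "nm k \<noteq> 0" "\<alpha> = k \<odot> ?a" "\<beta> = k \<odot> ?b" "snd z' = ((k \<odot> k) \<odot> k) \<odot> snd z"
      using fits_rigid[OF g b(2) ft n n''] by blast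
    have "lat \<alpha> \<beta> = lat (k \<odot> \<alpha>') (k \<odot> \<beta>')" unfolding k(2,3) using l' by (simp only: lat_scale[symmetric])
    then have kH: "k \<in> CC.H z z' \<and> P M k" unfolding H P_def pq using k by simp
    show "\<exists>!\<kappa>. \<kappa> \<in> CC.H z z' \<and> P M \<kappa>"
    proof (rule ex1I)
      show "k \<in> CC.H z z' \<and> P M k" by (rule kH)
    next
      fix k' assume "k' \<in> CC.H z z' \<and> P M k'"
      then have "\<alpha> = k' \<odot> ?a" "\<beta> = k' \<odot> ?b" unfolding P_def pq by simp_all
      then have k2: "k' \<odot> ?a = k \<odot> ?a" "k' \<odot> ?b = k \<odot> ?b" using k(2,3) by metis+
      obtain m n where em: "e = qscale (of_int m) ?a + qscale (of_int n) ?b" using e(1) unfolding l'[symmetric] by (rule latE)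
      have ex: "e \<odot> x = qscale (of_int m) (x \<odot> ?a) + qscale (of_int n) (x \<odot> ?b)" for x
        unfolding em by (simp only: qmul_comm[of D x] qmul_add_left qmul_scale)
      have "e \<odot> k' = e \<odot> k" unfolding ex k2 ..
      then show "k' = k" by (rule qmul_cancel[OF e(2)])
    qed
  next
    fix k assume k: "k \<in> CC.H z z'"
    then have k': "nm k \<noteq> 0" "lat \<alpha> \<beta> = lat (k \<odot> \<alpha>') (k \<odot> \<beta>')" "snd z' = ((k \<odot> k) \<odot> k) \<odot> snd z" unfolding H by auto
    have "\<alpha> \<in> lat (k \<odot> \<alpha>') (k \<odot> \<beta>')" "\<beta> \<in> lat (k \<odot> \<alpha>') (k \<odot> \<beta>')" unfolding k'(2)[symmetric] by (rule lat_mem)+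
    then obtain p r q s where a0: "\<alpha> = qscale (of_int p) (k \<odot> \<alpha>') + qscale (of_int r) (k \<odot> \<beta>')"
      and b0: "\<beta> = qscale (of_int q) (k \<odot> \<alpha>') + qscale (of_int s) (k \<odot> \<beta>')" by (meson latE)
    let ?a = "qscale (of_int p) \<alpha>' + qscale (of_int r) \<beta>'" and ?b = "qscale (of_int q) \<alpha>' + qscale (of_int s) \<beta>'"
    have ab: "\<alpha> = k \<odot> ?a" "\<beta> = k \<odot> ?b" unfolding a0 b0 by (simp_all only: qmul_add_right qmul_scale)
    \<comment> \<open>The two volume conditions force \<open>dt ^ 3 = 1\<close>, so the determinant
      is 1 and not -1: the orientations selected by \<open>rel\<close> match automatically.\<close>
    define dt where "dt = p * s - q * r"
    have "ar \<alpha> \<beta> = nm k * ((of_int p * of_int s - of_int q * of_int r) * ar \<alpha>' \<beta>')"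
      unfolding ab ar_simps(6) ar_comb ..
    then have "ar \<alpha> \<beta> = nm k * of_int dt * ar \<alpha>' \<beta>'" unfolding dt_def by simp
    then have "nm (snd z) * (nm k * of_int dt * ar \<alpha>' \<beta>') ^ 3 = of_nat g ^ 3" using b(3) by simp
    moreover have "nm (snd z) * (nm k * of_int dt * ar \<alpha>' \<beta>') ^ 3 = of_int dt ^ 3 * (nm (snd z) * nm k ^ 3 * ar \<alpha>' \<beta>' ^ 3)"
      by (simp add: power_mult_distrib mult_ac)
    moreover have "nm (snd z) * nm k ^ 3 * ar \<alpha>' \<beta>' ^ 3 = of_nat g ^ 3"
      using b'(3) unfolding k'(3) qnorm_mult by (simp add: power3_eq_cube mult_ac)
    ultimately have "of_int dt ^ 3 * (of_nat g ^ 3 :: rat) = 1 * of_nat g ^ 3" by simp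
    then have "(of_int dt ^ 3 :: rat) = 1" using g by (simp only: mult_cancel_right) simp
    then have "(of_int (dt ^ 3) :: rat) = of_int 1" by simp
    then have d3: "dt ^ 3 = 1" unfolding of_int_eq_iff .
    then have "dt * (dt * dt) = 1" by (simp add: power3_eq_cube)
    then have "dt = 1 \<or> dt = -1" by (auto simp: zmult_eq_1_iff)
    then have dt: "dt = 1" using d3 by auto
    have "fits g ?a ?b (snd z') (act (p, q, r, s) f')" by (rule fits_act[OF b'(2)])
    then have "fits g \<alpha> \<beta> (snd z) (act (p, q, r, s) f')" unfolding ab fits_scale k'(3) .
    then have "act (p, q, r, s) f' = f" using fits_unique[OF g] b(2) by blast
    then have MH: "(p, q, r, s) \<in> HSL f f' \<and> P (p, q, r, s) k" using dt ab unfolding HSL_def mdet_def dt_def P_def by simp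
    show "\<exists>!M. M \<in> HSL f f' \<and> P M k"
    proof (rule ex1I)
      show "(p, q, r, s) \<in> HSL f f' \<and> P (p, q, r, s) k" by (rule MH)
    next
      fix M' assume M': "M' \<in> HSL f f' \<and> P M' k"
      obtain p' q' r' s' where pq: "M' = (p', q', r', s')" by (cases M')
      have "k \<odot> (qscale (of_int p') \<alpha>' + qscale (of_int r') \<beta>') = k \<odot> ?a" "k \<odot> (qscale (of_int q') \<alpha>' + qscale (of_int s') \<beta>') = k \<odot> ?b"
        using M' ab unfolding P_def pq by auto
      then have "qscale (of_int p') \<alpha>' + qscale (of_int r') \<beta>' = ?a" "qscale (of_int q') \<alpha>' + qscale (of_int s') \<beta>' = ?b"
        using qmul_cancel[OF k'(1)] by blast+
      then show "M' = (p, q, r, s)" using lat_coords_unique[OF w(2)] unfolding pq of_int_eq_iff[symmetric, where 'a = rat] prod.inject by blast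
    qed
  qed
qed

lemma
  assumes g: "g > 0" and U: "finite (CC.U // hom_rel CC.U CC.HU)"
  shows mass_cforms: "mass (cforms g) HSL =
      (\<Sum>J\<in>cube_class_ideals D g. of_nat (card (torsion 3 (Pic D))) * mass CC.U CC.HU)"
    and finite_cforms: "finite (cforms g // hom_rel (cforms g) HSL)"
proof -
  have 1: "\<exists>z\<in>cube_pairs g. rel g f z" if "f \<in> cforms g" for f by (rule form_cube_pair[OF g that])
  have 2: "\<exists>f\<in>cforms g. rel g f z" if "z \<in> cube_pairs g" for z
    using cube_pair_form[OF g, of "fst z" "snd z"] that by simp
  have 3: "(HSL x y = {} \<longleftrightarrow> CC.H x' y' = {}) \<and> card (HSL x y) = card (CC.H x' y')"
    if "x \<in> cforms g" "x' \<in> cube_pairs g" "y \<in> cforms g" "y' \<in> cube_pairs g" "rel g x x'" "rel g y y'" for x x' y y'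
    by (rule form_pair_homs[OF g that(2,4,5,6)])
  note W = weighted_cube_pairs[OF g U]
  show "mass (cforms g) HSL =
      (\<Sum>J\<in>cube_class_ideals D g. of_nat (card (torsion 3 (Pic D))) * mass CC.U CC.HU)"
    unfolding mass_cube_pairs[OF g U, symmetric]
    by (rule mass_transfer[OF W, where R = "rel g"]) ((rule 1 | rule 2 | rule 3); assumption)+
  have "finite (cforms g // hom_rel (cforms g) HSL) \<longleftrightarrow> finite (cube_pairs g // hom_rel (cube_pairs g) CC.H)"
    by (rule finite_transfer[OF W, where R = "rel g"]) ((rule 1 | rule 2 | rule 3); assumption)+
  then show "finite (cforms g // hom_rel (cforms g) HSL)" using finite_cube_pairs[OF g U] by blast
qed

end

section \<open>Units of quadratic orders modulo cubes\<close>

text \<open>Model for the units of a real quadratic order modulo cubes: isolated objects with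
  trivial automorphism groups.\<close>

lemma mass_discrete:
  fixes A :: "'a set" and H :: "'a \<Rightarrow> 'a \<Rightarrow> unit set"
  assumes "finite A" and H: "\<And>x y. H x y = (if x = y then {()} else {})"
  shows "weighted A H" "mass A H = of_nat (card A)" "finite (A // hom_rel A H)"
proof -
  have r: "hom_rel A H = Id_on A" by (auto simp: hom_rel_def H Id_on_def split: if_splits)
  show "weighted A H" unfolding weighted_def r by (auto simp: equiv_def refl_on_def sym_def trans_def H split: if_splits)
  have q: "A // Id_on A = (\<lambda>x. {x}) ` A" by (auto simp: quotient_def Id_on_def)
  have "card ((\<lambda>x. {x}) ` A) = card A" by (rule card_image) simp
  then show "mass A H = of_nat (card A)" unfolding mass_def r q by (simp add: H)
  show "finite (A // hom_rel A H)" unfolding r q using assms by simp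
qed

text \<open>The finiteness condition provides a least positive element \<mu>; a nonzero remainder
  modulo \<mu> would be a smaller one.\<close>

lemma discrete_real_subgroup:
  fixes G :: "real set"
  assumes diff: "\<And>x y. x \<in> G \<Longrightarrow> y \<in> G \<Longrightarrow> x - y \<in> G"
    and l: "l \<in> G" "l \<noteq> 0" and fin: "\<And>M. finite {x \<in> G. 0 < x \<and> x \<le> M}"
  obtains \<mu> where "\<mu> > 0" "\<mu> \<in> G" "\<And>x. x \<in> G \<Longrightarrow> x = of_int \<lfloor>x / \<mu>\<rfloor> * \<mu>" "\<And>n. of_int n * \<mu> \<in> G"
proof -
  have z: "0 \<in> G" using diff[OF l(1) l(1)] by simp
  have neg: "- x \<in> G" if "x \<in> G" for x using diff[OF z that] by simp
  have add: "x + y \<in> G" if "x \<in> G" "y \<in> G" for x y using diff[OF that(1) neg[OF that(2)]] by simp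
  have al: "\<bar>l\<bar> \<in> G" "\<bar>l\<bar> > 0" using l neg by (auto simp: abs_if)
  let ?S = "{x \<in> G. 0 < x \<and> x \<le> \<bar>l\<bar>}"
  have "\<bar>l\<bar> \<in> ?S" using al by simp
  then have S: "finite ?S" "?S \<noteq> {}" using fin by blast+
  define \<mu> where "\<mu> = Min ?S"
  have L: "\<mu> \<in> ?S" unfolding \<mu>_def by (rule Min_in[OF S])
  have min: "\<mu> \<le> x" if "x \<in> G" "0 < x" for x
  proof (cases "x \<le> \<bar>l\<bar>")
    case True then show ?thesis unfolding \<mu>_def using that S by (intro Min_le) auto
  next
    case False then show ?thesis using L by auto
  qed
  have nat: "of_nat n * \<mu> \<in> G" for n
    by (induction n) (use z add L in \<open>auto simp: algebra_simps\<close>)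
  have int: "of_int n * \<mu> \<in> G" for n
    using nat[of "nat n"] neg[OF nat[of "nat (- n)"]] by (cases "n \<ge> 0") auto
  have "x = of_int \<lfloor>x / \<mu>\<rfloor> * \<mu>" if "x \<in> G" for x
  proof -
    let ?r = "x - of_int \<lfloor>x / \<mu>\<rfloor> * \<mu>"
    have r: "?r \<in> G" by (rule diff[OF that int])
    have "\<mu> > 0" using L by blast
    then have "of_int \<lfloor>x / \<mu>\<rfloor> * \<mu> \<le> x" "x < (of_int \<lfloor>x / \<mu>\<rfloor> + 1) * \<mu>"
      using of_int_floor_le[of "x / \<mu>"] real_of_int_floor_add_one_gt[of "x / \<mu>"]
      by (simp_all only: pos_le_divide_eq pos_divide_less_eq)
    then have "0 \<le> ?r" "?r < \<mu>" by (simp_all add: algebra_simps)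
    with min[OF r] show ?thesis by linarith
  qed
  then show ?thesis using that[of \<mu>] L int by blast
qed

text \<open>Infinitely many pairs \<open>(p, q)\<close> approximate the root so well that
  \<open>p^2 - D q^2\<close> stays bounded. Two distinct ones with the same value \<open>N\<close>
  and congruent modulo \<open>N\<close> have a quotient that is integral of norm 1.\<close>

lemma pell_solution:
  fixes D :: int
  assumes D: "D > 0" "\<nexists>k. D = k ^ 2"
  obtains x y :: int where "x ^ 2 - D * y ^ 2 = 1" "y \<noteq> 0"
proof -
  let ?s = "sqrt (real_of_int D)"
  have s: "?s > 0" "?s * ?s = real_of_int D" using D by simp_all
  have irr: "of_int p \<noteq> of_int q * ?s" if "q \<noteq> 0" for p q
  proof
    assume "of_int p = of_int q * ?s"
    then have "(of_int p)\<^sup>2 = (of_int q)\<^sup>2 * (?s * ?s)" by (simp add: power2_eq_square)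
    then have "of_int (p ^ 2) = (of_int (q ^ 2 * D) :: real)" unfolding s by simp
    then have pq: "p ^ 2 = q ^ 2 * D" by (simp only: of_int_eq_iff)
    then have "q ^ 2 dvd p ^ 2" by simp
    then have "q dvd p" by simp
    then obtain k where "p = q * k" by blast
    then have "D = k ^ 2" using pq that by (simp add: power_mult_distrib)
    then show False using D(2) by blast
  qed
  define S where "S = {(p, q). q > 0 \<and> \<bar>of_int p - of_int q * ?s\<bar> * of_int q < 1}"
  have inf: "infinite S"
  proof
    assume fin: "finite S"
    let ?d = "\<lambda>(p, q). \<bar>of_int p - of_int q * ?s\<bar>"
    \<comment> \<open>If \<open>S\<close> were finite, the errors in it would have a positive lower
      bound \<open>m\<close>; Dirichlet's theorem with \<open>N\<close> above \<open>1 / m\<close>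
      gives a pair in \<open>S\<close> with a smaller error.\<close>
    define m where "m = Min (insert 1 (?d ` S))"
    have "m \<in> insert 1 (?d ` S)" unfolding m_def using fin by (intro Min_in) auto
    moreover have "?d z > 0" if "z \<in> S" for z using that irr by (auto simp: S_def)
    ultimately have m0: "m > 0" by auto
    have mle: "m \<le> ?d z" if "z \<in> S" for z unfolding m_def using fin that by (intro Min_le) auto
    obtain N where N1: "1 / m < real N" using reals_Archimedean2[of "1 / m"] by blast
    then have "0 < real N" using m0 divide_pos_pos[of 1 m] by linarith
    then have N: "1 / m < real N" "N > 0" using N1 by simp_all
    obtain h k where hk: "0 < k" "k \<le> int N" "\<bar>of_int k * ?s - of_int h\<bar> < 1 / of_nat N"
      using Dirichlet_approx[OF N(2), of ?s] by blast
    have sw: "\<bar>of_int h - of_int k * ?s\<bar> = \<bar>of_int k * ?s - of_int h\<bar>" by (rule abs_minus_commute)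
    have "\<bar>of_int h - of_int k * ?s\<bar> * of_int k \<le> \<bar>of_int h - of_int k * ?s\<bar> * of_nat N"
    proof (rule mult_left_mono)
      have "real_of_int k \<le> real_of_int (int N)" using hk(2) by (simp only: of_int_le_iff)
      then show "real_of_int k \<le> real N" by simp
    qed simp
    moreover have "\<bar>of_int h - of_int k * ?s\<bar> * of_nat N < 1" using hk(3) N(2) unfolding sw by (simp add: field_simps)
    ultimately have "(h, k) \<in> S" using hk(1) by (simp add: S_def)
    from mle[OF this] have "m < 1 / of_nat N" using hk(3) sw by simp
    moreover have "1 / of_nat N < m" using N m0 by (simp add: field_simps)
    ultimately show False by simp
  qed
  let ?n = "\<lambda>(p, q). p ^ 2 - D * q ^ 2"
  let ?f = "\<lambda>z. (?n z, fst z mod ?n z, snd z mod ?n z)"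
  \<comment> \<open>With \<open>?\<delta>\<close> for \<open>p - q sqrt D\<close> the norm is
    \<open>?\<delta> * (?\<delta> + 2 q sqrt D)\<close>; as
    \<open>\<bar>?\<delta>\<bar> \<le> 1\<close> and \<open>\<bar>?\<delta>\<bar> * q < 1\<close>,
    it is at most \<open>1 + 2 sqrt D\<close> in absolute value.\<close>
  define M where "M = \<lceil>2 * ?s + 1\<rceil>"
  have bnd: "\<bar>?n z\<bar> \<le> M" if z: "z \<in> S" for z
  proof -
    obtain p q where e: "z = (p, q)" by (cases z)
    let ?\<delta> = "of_int p - of_int q * ?s"
    have q: "q > 0" "\<bar>?\<delta>\<bar> * of_int q < 1" using z by (simp_all add: e S_def)
    have q1: "(1 :: real) \<le> of_int q" using q(1) by simp
    have d1: "\<bar>?\<delta>\<bar> \<le> 1" using mult_left_mono[OF q1, of "\<bar>?\<delta>\<bar>"] q(2) by simp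
    have "real_of_int (?n z) = ?\<delta> * (?\<delta> + 2 * of_int q * ?s)"
      using s(2) by (simp add: e power2_eq_square algebra_simps)
    then have "\<bar>real_of_int (?n z)\<bar> = \<bar>?\<delta>\<bar> * \<bar>?\<delta> + 2 * of_int q * ?s\<bar>" by (simp add: abs_mult)
    also have "\<dots> \<le> \<bar>?\<delta>\<bar> * (\<bar>?\<delta>\<bar> + 2 * of_int q * ?s)"
    proof (rule mult_left_mono)
      have "0 \<le> 2 * of_int q * ?s" using s q by simp
      then show "\<bar>?\<delta> + 2 * of_int q * ?s\<bar> \<le> \<bar>?\<delta>\<bar> + 2 * of_int q * ?s"
        using abs_triangle_ineq[of ?\<delta> "2 * of_int q * ?s"] by linarith
    qed simp
    also have "\<dots> = \<bar>?\<delta>\<bar> * \<bar>?\<delta>\<bar> + 2 * ?s * (\<bar>?\<delta>\<bar> * of_int q)" by (simp add: algebra_simps)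
    also have "\<dots> \<le> 1 * 1 + 2 * ?s * 1"
      by (intro add_mono mult_mono) (use d1 s q in simp_all)
    finally have "real_of_int \<bar>?n z\<bar> \<le> 2 * ?s + 1" by simp
    then show ?thesis unfolding M_def by linarith
  qed
  have "?f ` S \<subseteq> {-M..M} \<times> {-M..M} \<times> {-M..M}"
  proof
    fix w assume "w \<in> ?f ` S"
    then obtain z where z: "z \<in> S" "w = ?f z" by blast
    have md: "\<bar>a mod ?n z\<bar> \<le> M" for a
    proof (cases "?n z = 0")
      case True
      obtain p q where e: "z = (p, q)" by (cases z)
      have "D * q ^ 2 = p ^ 2" "q \<noteq> 0" using True z(1) by (auto simp: e S_def)
      have "(of_int q * ?s)\<^sup>2 = real_of_int (D * q ^ 2)" using D by (simp add: power_mult_distrib)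
      also have "\<dots> = (of_int p)\<^sup>2" unfolding \<open>D * q ^ 2 = p ^ 2\<close> by simp
      finally have "of_int q * ?s = of_int p \<or> of_int q * ?s = - of_int p" by (simp add: power2_eq_iff)
      then show ?thesis using irr[OF \<open>q \<noteq> 0\<close>, of p] irr[OF \<open>q \<noteq> 0\<close>, of "- p"] by auto
    next
      case False
      then have "\<bar>a mod ?n z\<bar> \<le> \<bar>?n z\<bar>" using abs_mod_less[of "?n z" a] by linarith
      then show ?thesis using bnd[OF z(1)] by linarith
    qed
    show "w \<in> {-M..M} \<times> {-M..M} \<times> {-M..M}"
      using bnd[OF z(1)] md[of "fst z"] md[of "snd z"] unfolding z(2) by (auto simp: abs_le_iff)
  qed
  then have "finite (?f ` S)" by (rule finite_subset) simp
  from pigeonhole_infinite[OF inf this] obtain z1 where z1: "z1 \<in> S" "infinite {z \<in> S. ?f z = ?f z1}" by blast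
  then have "infinite ({z \<in> S. ?f z = ?f z1} - {z1})" by simp
  then have "{z \<in> S. ?f z = ?f z1} - {z1} \<noteq> {}" by (rule infinite_imp_nonempty)
  then obtain z2 where z2: "z2 \<in> S" "?f z2 = ?f z1" "z2 \<noteq> z1" by blast
  obtain p1 q1 p2 q2 where e: "z1 = (p1, q1)" "z2 = (p2, q2)" by (cases z1; cases z2)
  define N where "N = p1 ^ 2 - D * q1 ^ 2"
  have eq: "p2 ^ 2 - D * q2 ^ 2 = N \<and> p2 mod (p2 ^ 2 - D * q2 ^ 2) = p1 mod N \<and> q2 mod (p2 ^ 2 - D * q2 ^ 2) = q1 mod N"
    using z2(2) unfolding e prod.case fst_conv snd_conv prod.inject N_def .
  then have n2: "p2 ^ 2 - D * q2 ^ 2 = N" by blast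
  from eq have N2: "p2 ^ 2 - D * q2 ^ 2 = N" "p2 mod N = p1 mod N" "q2 mod N = q1 mod N" unfolding n2 by blast+
  have q: "q1 > 0" "q2 > 0" using z1 z2 by (simp_all add: e S_def)
  have N0: "N \<noteq> 0"
  proof
    assume "N = 0"
    then have "D * q1 ^ 2 = p1 ^ 2" by (simp add: N_def)
    then have "q1 ^ 2 dvd p1 ^ 2" by (metis dvd_triv_right)
    then have "q1 dvd p1" by simp
    then obtain k where "p1 = q1 * k" by blast
    then have "D = k ^ 2" using \<open>D * q1 ^ 2 = p1 ^ 2\<close> q by (simp add: power_mult_distrib)
    then show False using D by blast
  qed
  obtain u where u: "p2 = p1 + N * u" using N2(2)[symmetric] by (rule mod_eqE)
  obtain v where v: "q2 = q1 + N * v" using N2(3)[symmetric] by (rule mod_eqE)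
  \<comment> \<open>\<open>x - y sqrt D\<close> is the quotient of \<open>p2 + q2 sqrt D\<close> by
    \<open>p1 + q1 sqrt D\<close>; the congruences modulo \<open>N\<close> make it integral.\<close>
  define x where "x = 1 + p1 * u - D * q1 * v"
  define y where "y = q1 * u - p1 * v"
  have x: "p1 * p2 - D * q1 * q2 = N * x" unfolding u v x_def by (simp add: N_def algebra_simps power2_eq_square)
  have y: "q1 * p2 - p1 * q2 = N * y" unfolding u v y_def by (simp add: algebra_simps)
  have "(p1 * p2 - D * q1 * q2) ^ 2 - D * (q1 * p2 - p1 * q2) ^ 2 = (p1 ^ 2 - D * q1 ^ 2) * (p2 ^ 2 - D * q2 ^ 2)"
    by (simp add: algebra_simps power2_eq_square)
  then have "N ^ 2 * (x ^ 2 - D * y ^ 2) = N ^ 2 * 1" unfolding x y N2 N_def[symmetric]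
    by (simp add: algebra_simps power2_eq_square)
  then have xy: "x ^ 2 - D * y ^ 2 = 1" using N0 by (simp only: mult_cancel_left) simp
  have "y \<noteq> 0"
  proof
    assume y0: "y = 0"
    then have x1: "x = 1 \<or> x = -1" using xy by (simp add: power2_eq_1_iff)
    have c: "q1 * p2 = p1 * q2" using y y0 by simp
    have "q1 * N = p2 * (q1 * p2) - D * q1 * q2 * q2" unfolding N2(1)[symmetric] by (simp add: algebra_simps power2_eq_square)
    also have "\<dots> = q2 * (p1 * p2 - D * q1 * q2)" unfolding c by (simp add: algebra_simps)
    finally have "N * q1 = N * (q2 * x)" unfolding x by (simp add: algebra_simps)
    then have "q1 = q2 * x" using N0 by simp
    then have qq: "q1 = q2" using x1 q by auto
    then have "p1 = p2" using c q by simp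
    then show False using qq z2(3) e by simp
  qed
  then show ?thesis using that xy by blast
qed

context quad
begin

lemma U_iff: "u \<in> CC.U \<longleftrightarrow> u \<in> carrier \<O> \<and> (nm u = 1 \<or> nm u = -1)"
proof
  assume "u \<in> CC.U"
  then have u: "nm u \<noteq> 0" "pr u = carrier \<O>" by (auto simp: CC.U_def KU_simps)
  have "u \<odot> (1, 0) \<in> pr u" using O_closed(3) by blast
  then have uO: "u \<in> carrier \<O>" using u by (simp add: qmul_one)
  have "(1, 0) \<in> pr u" using O_closed(3) unfolding u(2) .
  then obtain r where r: "r \<in> carrier \<O>" "(1, 0) = u \<odot> r" by blast
  obtain m n where mn: "nm u = of_int m" "nm r = of_int n" using nm_O uO r by blast
  have "nm u * nm r = 1" using r(2) qnorm_mult qnorm_simps(1) by metis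
  then have "(of_int (m * n) :: rat) = of_int 1" using mn by simp
  then have "m * n = 1" by (simp only: of_int_eq_iff)
  then have "m = 1 \<or> m = -1" by (auto simp: zmult_eq_1_iff)
  then show "u \<in> carrier \<O> \<and> (nm u = 1 \<or> nm u = -1)" using uO mn by auto
next
  assume u: "u \<in> carrier \<O> \<and> (nm u = 1 \<or> nm u = -1)"
  define v where "v = qscale (nm u) (qconj u)"
  have v: "v \<in> carrier \<O>" using u conj_O[of u] O_uminus[of "qconj u"] by (auto simp: v_def qscale_simps)
  have uv: "u \<odot> v = (1, 0)" unfolding v_def qmul_scale qmul_conj using u by (auto simp: qscale_def)
  have "pr u = carrier \<O>"
  proof
    show "pr u \<subseteq> carrier \<O>" using u O_closed(1) by blast
    show "carrier \<O> \<subseteq> pr u"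
    proof
      fix x assume "x \<in> carrier \<O>"
      then have "v \<odot> x \<in> carrier \<O>" by (rule O_closed(1)[OF v])
      moreover have "u \<odot> (v \<odot> x) = x" by (simp only: qmul_assoc[symmetric] uv qmul_one)
      ultimately show "x \<in> pr u" by (metis imageI)
    qed
  qed
  then show "u \<in> CC.U" using u by (auto simp: CC.U_def KU_simps)
qed

lemma U_mult: "u \<in> CC.U \<Longrightarrow> v \<in> CC.U \<Longrightarrow> u \<odot> v \<in> CC.U"
  using CC.U_closed(1)[of u v] by (simp add: KU_simps)

lemma U_one: "(1, 0) \<in> CC.U" using CC.U_closed(3) by (simp add: KU_simps)

lemma U_neg: "u \<in> CC.U \<Longrightarrow> - u \<in> CC.U"
  unfolding U_iff using O_uminus[of u] by (simp add: qnorm_def)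

lemma U_nm: "u \<in> CC.U \<Longrightarrow> nm u \<noteq> 0" unfolding U_iff by auto

lemma U_inv: assumes "u \<in> CC.U" obtains v where "v \<in> CC.U" "u \<odot> v = (1, 0)"
  using CC.U_closed(4)[OF assms] KU.r_inv[of u] U_nm[OF assms] that[of "inv\<^bsub>units_of K\<^esub> u"]
  by (simp add: KU_simps)

lemma HU_eq: "CC.HU u v = {\<kappa> \<in> CC.U. v = ((\<kappa> \<odot> \<kappa>) \<odot> \<kappa>) \<odot> u}"
  unfolding CC.HU_def pow3_KU KU_simps ..

lemma HU_equiv: "equiv CC.U (hom_rel CC.U CC.HU)"
proof (rule equivI)
  show "hom_rel CC.U CC.HU \<subseteq> CC.U \<times> CC.U" by (auto simp: hom_rel_def)
  show "refl_on CC.U (hom_rel CC.U CC.HU)"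
  proof (rule refl_onI)
    fix u assume u: "u \<in> CC.U"
    have "(1, 0) \<in> CC.HU u u" by (simp add: HU_eq U_one qmul_one)
    then show "(u, u) \<in> hom_rel CC.U CC.HU" using u by (auto simp: hom_rel_def)
  qed
  show "sym (hom_rel CC.U CC.HU)"
  proof (rule symI)
    fix u v assume "(u, v) \<in> hom_rel CC.U CC.HU"
    then obtain k where k: "u \<in> CC.U" "v \<in> CC.U" "k \<in> CC.U" "v = ((k \<odot> k) \<odot> k) \<odot> u" by (auto simp: hom_rel_def HU_eq)
    obtain l where l: "l \<in> CC.U" "k \<odot> l = (1, 0)" by (rule U_inv[OF k(3)])
    have "((l \<odot> l) \<odot> l) \<odot> v = ((k \<odot> l) \<odot> ((k \<odot> l) \<odot> (k \<odot> l))) \<odot> u" unfolding k(4) by (simp only: qmul_ac)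
    then have "u = ((l \<odot> l) \<odot> l) \<odot> v" unfolding l(2) qmul_one by simp
    then have "l \<in> CC.HU v u" using l by (simp add: HU_eq)
    then show "(v, u) \<in> hom_rel CC.U CC.HU" using k by (auto simp: hom_rel_def)
  qed
  show "trans (hom_rel CC.U CC.HU)"
  proof (rule transI)
    fix u v w assume "(u, v) \<in> hom_rel CC.U CC.HU" "(v, w) \<in> hom_rel CC.U CC.HU"
    then obtain k l where k: "u \<in> CC.U" "w \<in> CC.U" "k \<in> CC.U" "v = ((k \<odot> k) \<odot> k) \<odot> u" "l \<in> CC.U" "w = ((l \<odot> l) \<odot> l) \<odot> v"
      by (auto simp: hom_rel_def HU_eq)
    have "w = (((l \<odot> k) \<odot> (l \<odot> k)) \<odot> (l \<odot> k)) \<odot> u" unfolding k(6,4) by (simp only: qmul_ac)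
    then have "l \<odot> k \<in> CC.HU u w" using U_mult[OF k(5,3)] by (simp add: HU_eq)
    then show "(u, w) \<in> hom_rel CC.U CC.HU" using k by (auto simp: hom_rel_def)
  qed
qed

text \<open>For a finite group the kernel and the cokernel of cubing have the same size.\<close>

lemma mass_units_finite:
  assumes fin: "finite CC.U"
  shows "mass CC.U CC.HU = 1"
proof -
  let ?E = "hom_rel CC.U CC.HU"
  \<comment> \<open>The kernel of cubing; by translation every nonempty \<open>CC.HU u v\<close> has
    the same number of elements.\<close>
  define S where "S = {\<kappa> \<in> CC.U. (\<kappa> \<odot> \<kappa>) \<odot> \<kappa> = (1, 0)}"
  have finS: "finite S" using fin by (simp add: S_def)
  have "(1, 0) \<in> S" by (simp add: S_def U_one qmul_one)
  then have S0: "card S > 0" using finS card_gt_0_iff by blast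
  have fib: "card (CC.HU u v) = card S" if uv: "u \<in> CC.U" "v \<in> CC.U" "CC.HU u v \<noteq> {}" for u v
  proof -
    obtain k where k: "k \<in> CC.U" "v = ((k \<odot> k) \<odot> k) \<odot> u" using uv(3) by (auto simp: HU_eq)
    obtain l where l: "l \<in> CC.U" "k \<odot> l = (1, 0)" by (rule U_inv[OF k(1)])
    have l': "l \<odot> k = (1, 0)" using l(2) by (simp only: qmul_comm)
    have "bij_betw (\<lambda>s. k \<odot> s) S (CC.HU u v)"
    proof (rule bij_betw_byWitness[where f' = "\<lambda>s. l \<odot> s"])
      show "\<forall>s\<in>S. l \<odot> (k \<odot> s) = s" "\<forall>s\<in>CC.HU u v. k \<odot> (l \<odot> s) = s"
        by (intro ballI; simp only: qmul_assoc[symmetric] l l' qmul_one)+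
      show "(\<lambda>s. k \<odot> s) ` S \<subseteq> CC.HU u v"
      proof
        fix t assume "t \<in> (\<lambda>s. k \<odot> s) ` S"
        then obtain s where s: "s \<in> CC.U" "(s \<odot> s) \<odot> s = (1, 0)" "t = k \<odot> s" by (auto simp: S_def)
        have "((t \<odot> t) \<odot> t) \<odot> u = ((s \<odot> s) \<odot> s) \<odot> (((k \<odot> k) \<odot> k) \<odot> u)" unfolding s(3) by (simp only: qmul_ac)
        then show "t \<in> CC.HU u v" unfolding s(2) qmul_one HU_eq k(2) using U_mult[OF k(1) s(1)] s(3) by simp
      qed
      show "(\<lambda>s. l \<odot> s) ` CC.HU u v \<subseteq> S"
      proof
        fix t assume "t \<in> (\<lambda>s. l \<odot> s) ` CC.HU u v"
        then obtain s where s: "s \<in> CC.U" "v = ((s \<odot> s) \<odot> s) \<odot> u" "t = l \<odot> s" by (auto simp: HU_eq)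
        have "u \<odot> ((s \<odot> s) \<odot> s) = u \<odot> ((k \<odot> k) \<odot> k)" using s(2) k(2) by (metis qmul_comm)
        then have e: "(s \<odot> s) \<odot> s = (k \<odot> k) \<odot> k" by (rule qmul_cancel[OF U_nm[OF uv(1)]])
        have "(t \<odot> t) \<odot> t = ((l \<odot> l) \<odot> l) \<odot> ((s \<odot> s) \<odot> s)" unfolding s(3) by (simp only: qmul_ac)
        also have "\<dots> = (k \<odot> l) \<odot> ((k \<odot> l) \<odot> (k \<odot> l))" unfolding e by (simp only: qmul_ac)
        finally have "(t \<odot> t) \<odot> t = (1, 0)" unfolding l(2) qmul_one .
        then show "t \<in> S" using U_mult[OF l(1) s(1)] s(3) by (simp add: S_def)
      qed
    qed
    then show ?thesis by (simp add: bij_betw_same_card)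
  qed
  \<comment> \<open>A class is the image of the unit group under
    \<open>\<kappa> \<mapsto> \<kappa>^3 u\<close>, with fibres of size \<open>card S\<close>. Hence
    there are \<open>card S\<close> classes, each of weight \<open>1 / card S\<close>.\<close>
  have cls: "card c * card S = card CC.U" if c: "c \<in> CC.U // ?E" for c
  proof -
    obtain u where u: "u \<in> CC.U" "c = ?E `` {u}" using c by (rule quotientE)
    have c_eq: "c = {v \<in> CC.U. CC.HU u v \<noteq> {}}" using u by (auto simp: hom_rel_def)
    let ?g = "\<lambda>\<kappa>. ((\<kappa> \<odot> \<kappa>) \<odot> \<kappa>) \<odot> u"
    have "?g ` CC.U \<subseteq> c"
    proof
      fix v assume "v \<in> ?g ` CC.U"
      then obtain k where k: "k \<in> CC.U" "v = ?g k" by blast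
      then have "k \<in> CC.HU u v" by (simp add: HU_eq)
      moreover have "v \<in> CC.U" unfolding k(2) using U_mult[OF U_mult[OF U_mult[OF k(1) k(1)] k(1)] u(1)] .
      ultimately show "v \<in> c" unfolding c_eq by blast
    qed
    moreover have "finite c" using fin c_eq by simp
    ultimately have "(\<Sum>v\<in>c. card {\<kappa> \<in> CC.U. ?g \<kappa> = v}) = (\<Sum>\<kappa>\<in>CC.U. 1 :: nat)"
      using sum.group[OF fin, of c ?g "\<lambda>_. 1 :: nat"] unfolding card_eq_sum by blast
    moreover have "{\<kappa> \<in> CC.U. ?g \<kappa> = v} = CC.HU u v" for v by (auto simp: HU_eq)
    ultimately have "(\<Sum>v\<in>c. card (CC.HU u v)) = card CC.U" by simp
    moreover have "card (CC.HU u v) = card S" if "v \<in> c" for v using fib u(1) that unfolding c_eq by blast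
    ultimately show ?thesis by simp
  qed
  have sub: "c \<subseteq> CC.U" if "c \<in> CC.U // ?E" for c by (rule in_quotient_imp_subset[OF HU_equiv that])
  have "card (\<Union> (CC.U // ?E)) = (\<Sum>c\<in>CC.U // ?E. card c)"
  proof (rule card_Union_disjoint)
    show "pairwise disjnt (CC.U // ?E)" unfolding pairwise_def disjnt_def using quotient_disj[OF HU_equiv] by blast
    show "finite c" if "c \<in> CC.U // ?E" for c using finite_subset[OF sub[OF that] fin] .
  qed
  then have "card CC.U = (\<Sum>c\<in>CC.U // ?E. card c)" unfolding Union_quotient[OF HU_equiv] .
  then have "card CC.U * card S = (\<Sum>c\<in>CC.U // ?E. card c * card S)" by (simp add: sum_distrib_right)
  also have "\<dots> = card (CC.U // ?E) * card CC.U" using cls by simp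
  finally have "card CC.U * card S = card CC.U * card (CC.U // ?E)" by (simp only: mult.commute)
  moreover have "card CC.U > 0" using U_one fin by (auto simp: card_gt_0_iff)
  ultimately have cQ: "card (CC.U // ?E) = card S" by simp
  have "mass CC.U CC.HU = (\<Sum>c\<in>CC.U // ?E. 1 / of_nat (card S))"
    unfolding mass_def
  proof (rule sum.cong[OF refl])
    fix c assume c: "c \<in> CC.U // ?E"
    then have "c \<noteq> {}" using in_quotient_imp_non_empty[OF HU_equiv] by blast
    then have s: "(SOME x. x \<in> c) \<in> c" by (simp add: some_in_eq)
    then have su: "(SOME x. x \<in> c) \<in> CC.U" using in_quotient_imp_subset[OF HU_equiv c] by blast
    have "CC.HU (SOME x. x \<in> c) (SOME x. x \<in> c) \<noteq> {}"
      using HU_equiv su by (auto simp: equiv_def refl_on_def hom_rel_def)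
    then show "1 / rat_of_nat (card (CC.HU (SOME x. x \<in> c) (SOME x. x \<in> c))) = 1 / of_nat (card S)"
      using fib[OF su su] by simp
  qed
  also have "\<dots> = 1" using cQ S0 by simp
  finally show ?thesis .
qed

lemma finite_units_neg:
  assumes "D < 0" shows "finite CC.U"
proof (rule finite_subset)
  let ?B = "{- 1 + D..1 - D} \<times> {- 2..2 :: int}"
  show "finite ((\<lambda>(m, n). quad_elt D m n) ` ?B)" by simp
  show "CC.U \<subseteq> (\<lambda>(m, n). quad_elt D m n) ` ?B"
  proof
    fix u assume "u \<in> CC.U"
    then have u: "u \<in> carrier \<O>" "nm u = 1 \<or> nm u = -1" unfolding U_iff by auto
    obtain m n where e: "u = quad_elt D m n" using u(1) by (rule quad_ringE)
    let ?a = "of_int m + of_int n * of_int D / 2 :: rat" and ?b = "of_int n / 2 :: rat"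
    have N: "nm u = ?a * ?a + (- of_int D) * (?b * ?b)" by (simp add: e quad_elt_def qnorm_def)
    have D1: "(1 :: rat) \<le> - of_int D" using assms by (metis of_int_1 of_int_le_iff of_int_minus neg_0_less_iff_less zless_imp_add1_zle add_0)
    have "?b * ?b \<le> (- of_int D) * (?b * ?b)" using mult_right_mono[OF D1, of "?b * ?b"] by simp
    then have s: "?a * ?a \<le> 1" "?b * ?b \<le> 1" using N u(2) zero_le_square[of ?a] zero_le_square[of ?b] by linarith+
    have ab: "\<bar>?a\<bar> \<le> 1" "\<bar>?b\<bar> \<le> 1" using s abs_square_le_1[of ?a] abs_square_le_1[of ?b] by (simp_all add: power2_eq_square)
    then have n2: "\<bar>n\<bar> \<le> 2" by linarith
    have "\<bar>of_int n * of_int D / (2 :: rat)\<bar> = \<bar>?b\<bar> * (- of_int D)" using assms by (simp add: abs_mult)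
    also have "\<dots> \<le> 1 * (- of_int D)" by (rule mult_right_mono[OF ab(2)]) (use D1 in linarith)
    finally have "\<bar>of_int m :: rat\<bar> \<le> 1 + - of_int D" using ab(1) by linarith
    then have "\<bar>m\<bar> \<le> 1 - D" by linarith
    then show "u \<in> (\<lambda>(m, n). quad_elt D m n) ` ?B"
      unfolding e using n2 by (intro image_eqI[of _ _ "(m, n)"]) auto
  qed
qed

text \<open>The two homomorphisms \<open>x + y sqrt D \<mapsto> x \<plusminus> k y\<close> to the
  rationals take the order to integers. The images \<open>s\<close>, \<open>t\<close> of a unit have
  product 1 or -1, and they determine the unit.\<close>

lemma finite_units_square:
  assumes "D = k ^ 2" shows "finite CC.U"
proof (rule finite_subset)
  have k: "k \<noteq> 0" using assms D_nonzero by auto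
  let ?f = "\<lambda>(s, t). ((of_int s + of_int t) / 2, (of_int s - of_int t) / (2 * of_int k)) :: rat \<times> rat"
  show "finite (?f ` ({-1, 1 :: int} \<times> {-1, 1 :: int}))" by simp
  show "CC.U \<subseteq> ?f ` ({-1, 1} \<times> {-1, 1})"
  proof
    fix u assume "u \<in> CC.U"
    then have u: "u \<in> carrier \<O>" "nm u = 1 \<or> nm u = -1" unfolding U_iff by auto
    obtain m n where e: "u = quad_elt D m n" using u(1) by (rule quad_ringE)
    \<comment> \<open>\<open>D \<plusminus> k = k (k \<plusminus> 1)\<close> is even, so \<tau> has
      the integral images \<open>i\<close> and \<open>j\<close>.\<close>
    have ev: "even (k * (k + 1))" "even (k * (k - 1))" by simp_all
    obtain i where "k * (k + 1) = 2 * i" using ev(1) by (rule evenE)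
    moreover obtain j where "k * (k - 1) = 2 * j" using ev(2) by (rule evenE)
    ultimately have ij: "D + k = 2 * i" "D - k = 2 * j" unfolding assms by (simp_all add: power2_eq_square algebra_simps)
    define s where "s = m + n * i"
    define t where "t = m + n * j"
    have i: "(of_int D :: rat) = 2 * of_int i - of_int k" "(of_int D :: rat) = 2 * of_int j + of_int k"
      using arg_cong[OF ij(1), of "of_int :: int \<Rightarrow> rat"] arg_cong[OF ij(2), of "of_int :: int \<Rightarrow> rat"] by simp_all
    have st: "(of_int s :: rat) = fst u + of_int k * snd u" "(of_int t :: rat) = fst u - of_int k * snd u"
      unfolding e quad_elt_def s_def t_def by (simp add: i(1) field_simps, simp add: i(2) field_simps)
    have "(of_int (s * t) :: rat) = nm u" unfolding of_int_mult st qnorm_def assms by (simp add: algebra_simps power2_eq_square)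
    then have "(of_int (s * t) :: rat) = of_int 1 \<or> (of_int (s * t) :: rat) = of_int (- 1)" using u(2) by simp
    then have "\<bar>s * t\<bar> = 1" unfolding of_int_eq_iff by auto
    then have "\<bar>s\<bar> * \<bar>t\<bar> = 1" by (simp only: abs_mult)
    then have "\<bar>s\<bar> = 1 \<and> \<bar>t\<bar> = 1" unfolding zmult_eq_1_iff by auto
    then have S: "s \<in> {-1, 1}" "t \<in> {-1, 1}" by auto
    have "u = ?f (s, t)" using k by (simp add: st prod_eq_iff)
    then show "u \<in> ?f ` ({-1, 1} \<times> {-1, 1})" using S by blast
  qed
qed

text \<open>In the real quadratic case the logarithm identifies the units modulo \<open>\<plusminus>1\<close> with a discrete group.\<close>

lemma mass_units_real:
  assumes D0: "D > 0" and nsq: "\<nexists>k. D = k ^ 2"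
  shows "mass CC.U CC.HU = 3" "finite (CC.U // hom_rel CC.U CC.HU)"
proof -
  define rt where "rt = sqrt (real_of_int D)"
  have s: "rt > 0" "rt * rt = real_of_int D" using D0 by (simp_all add: rt_def)
  \<comment> \<open>One of the two real embeddings; the other is its composite with
    \<open>qconj\<close>. It is injective because \<open>D\<close> is not a square, by
    \<open>irr\<close>.\<close>
  define e where "e x = of_rat (fst x) + of_rat (snd x) * rt" for x :: "rat \<times> rat"
  have e_mult: "e (x \<odot> y) = e x * e y" for x y
    by (simp add: e_def qmul_def of_rat_add of_rat_mult algebra_simps flip: s(2))
  have e_conj: "e x * e (qconj x) = of_rat (nm x)" for x
    unfolding e_mult[symmetric] qmul_conj by (simp add: e_def)
  have e_neg: "e (- x) = - e x" for x by (simp add: e_def of_rat_minus)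
  have e_one: "e (1, 0) = 1" by (simp add: e_def)
  have e_nz: "e u \<noteq> 0" if "u \<in> CC.U" for u
    using e_conj[of u] U_nm[OF that] by auto
  have irr: "y = 0" if "of_rat x + of_rat y * rt = 0" for x y
  proof (rule ccontr)
    assume y: "y \<noteq> 0"
    then have "rt = of_rat (- x / y)" using that by (simp add: of_rat_divide of_rat_minus field_simps)
    then have "of_int D = (of_rat (- x / y) :: real)\<^sup>2" using s(2) by (metis power2_eq_square)
    then have "(of_rat (of_int D) :: real) = of_rat ((- x / y) ^ 2)" by (simp add: of_rat_power of_rat_minus)
    then have D': "of_int D = (x / y) ^ 2" by (simp only: of_rat_eq_iff) simp
    obtain a b where ab: "x / y = of_int a / of_int b" "b > 0" "coprime a b" by (metis Rat_cases Fract_of_int_quotient)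
    have "(of_int (D * b ^ 2) :: rat) = of_int (a ^ 2)" using D' ab by (simp add: field_simps power_divide)
    then have "D * b ^ 2 = a ^ 2" by (simp only: of_int_eq_iff)
    then have "b ^ 2 dvd a ^ 2" by (metis dvd_triv_right)
    then have "b dvd a" by simp
    then obtain k where "a = b * k" by blast
    then have "D = k ^ 2" using \<open>D * b ^ 2 = a ^ 2\<close> ab(2) by (simp add: power_mult_distrib)
    then show False using nsq by blast
  qed
  have e_inj: "x = y" if "e x = e y" for x y
  proof -
    have 0: "of_rat (fst x - fst y) + of_rat (snd x - snd y) * rt = 0"
      using that by (simp add: e_def of_rat_diff algebra_simps)
    from irr[OF this] have "snd x = snd y" by simp
    moreover from this have "fst x = fst y" using 0 by (simp add: of_rat_diff)
    ultimately show "x = y" by (simp add: prod_eq_iff)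
  qed
  define L where "L u = ln \<bar>e u\<bar>" for u
  have L_mult: "L (u \<odot> v) = L u + L v" if "u \<in> CC.U" "v \<in> CC.U" for u v
    using e_nz that by (simp add: L_def e_mult abs_mult ln_mult)
  have L_zero: "u = (1, 0) \<or> u = - (1, 0)" if "u \<in> CC.U" "L u = 0" for u
  proof -
    have "\<bar>e u\<bar> = 1" using that e_nz[OF that(1)] by (simp add: L_def)
    then have "e u = e (1, 0) \<or> e u = e (- (1, 0))" unfolding e_neg e_one by linarith
    then show ?thesis using e_inj by blast
  qed
  have L_one: "L (1, 0) = 0" by (simp add: L_def e_one)
  have L_diff: "L u - L v \<in> L ` CC.U" if uv: "u \<in> CC.U" "v \<in> CC.U" for u v
  proof -
    obtain w where w: "w \<in> CC.U" "v \<odot> w = (1, 0)" by (rule U_inv[OF uv(2)])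
    have "L v + L w = 0" using L_mult[OF uv(2) w(1)] w(2) L_one by simp
    then have "L u - L v = L (u \<odot> w)" using L_mult[OF uv(1) w(1)] by simp
    then show ?thesis using U_mult[OF uv(1) w(1)] by blast
  qed
  have fin: "finite {x \<in> L ` CC.U. 0 < x \<and> x \<le> M}" for M
  proof -
    \<comment> \<open>If \<open>e u\<close> lies between 1 and \<open>exp M\<close> in absolute
      value, its conjugate is at most 1, the norm being 1 or -1. Sum and difference of the two bound
      the coordinates; the value of \<open>B\<close> is merely generous.\<close>
    define B where "B = \<lceil>4 * exp M * (1 + 1 / rt + rt) + 4 * exp M * real_of_int D\<rceil>"
    have "{x \<in> L ` CC.U. 0 < x \<and> x \<le> M} \<subseteq> L ` (\<lambda>(m, n). quad_elt D m n) ` ({-B..B} \<times> {-B..B})"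
    proof
      fix x assume "x \<in> {x \<in> L ` CC.U. 0 < x \<and> x \<le> M}"
      then obtain u where u: "u \<in> CC.U" "x = L u" "0 < L u" "L u \<le> M" by blast
      have M0: "exp M \<ge> 1" using u by simp
      have e1: "\<bar>e u\<bar> \<le> exp M" "\<bar>e u\<bar> \<ge> 1"
      proof -
        have "\<bar>e u\<bar> = exp (L u)" using e_nz[OF u(1)] by (simp add: L_def)
        then show "\<bar>e u\<bar> \<le> exp M" "\<bar>e u\<bar> \<ge> 1" using u(3,4) by simp_all
      qed
      have "\<bar>e u * e (qconj u)\<bar> = 1" unfolding e_conj using u(1) unfolding U_iff by auto
      then have "\<bar>e (qconj u)\<bar> \<le> 1" using mult_right_mono[OF e1(2), of "\<bar>e (qconj u)\<bar>"] by (simp add: abs_mult)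
      then have e2: "\<bar>e (qconj u)\<bar> \<le> exp M" using M0 by linarith
      obtain m n where mn: "u = quad_elt D m n" using u(1) unfolding U_iff by (auto elim: quad_ringE)
      have c1: "e u + e (qconj u) = 2 * of_rat (fst u)" "e u - e (qconj u) = 2 * of_rat (snd u) * rt"
        by (simp_all add: e_def qconj_def of_rat_minus)
      have f: "of_rat (fst u) = real_of_int m + real_of_int n * real_of_int D / 2" "of_rat (snd u) = real_of_int n / 2"
        unfolding mn quad_elt_def by (simp_all add: of_rat_add of_rat_mult of_rat_divide)
      have "real_of_int n * rt = e u - e (qconj u)" unfolding c1 f by simp
      then have "\<bar>real_of_int n\<bar> * rt \<le> 2 * exp M" using e1 e2 s(1) by (simp add: abs_mult[symmetric])
      then have n1: "\<bar>real_of_int n\<bar> \<le> 2 * exp M * (1 / rt)" using s(1) by (simp add: field_simps)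
      have nD: "\<bar>real_of_int n\<bar> * real_of_int D \<le> 2 * exp M * rt"
        using \<open>\<bar>real_of_int n\<bar> * rt \<le> 2 * exp M\<close> s mult_right_mono[of "\<bar>real_of_int n\<bar> * rt" "2 * exp M" rt]
        by (simp add: mult.assoc)
      have "2 * real_of_int m + real_of_int n * real_of_int D = e u + e (qconj u)" unfolding c1 f by simp
      then have "\<bar>2 * real_of_int m + real_of_int n * real_of_int D\<bar> \<le> 2 * exp M"
        using abs_triangle_ineq[of "e u" "e (qconj u)"] e1 e2 by linarith
      moreover have "\<bar>real_of_int n * real_of_int D\<bar> \<le> 2 * exp M * rt" using nD D0 by (simp add: abs_mult)
      ultimately have m1: "\<bar>real_of_int m\<bar> \<le> exp M + exp M * rt" by linarith
      have pos: "0 \<le> exp M * (1 / rt)" "0 \<le> exp M * rt" "0 \<le> exp M * real_of_int D" "0 \<le> exp M" using s D0 by simp_all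
      have ex: "4 * exp M * (1 + 1 / rt + rt) + 4 * exp M * real_of_int D =
          4 * exp M + 4 * (exp M * (1 / rt)) + 4 * (exp M * rt) + 4 * (exp M * real_of_int D)" by (simp add: algebra_simps)
      have "\<bar>real_of_int m\<bar> \<le> of_int B" "\<bar>real_of_int n\<bar> \<le> of_int B"
        using m1 n1 pos unfolding B_def ex by linarith+
      then have "\<bar>m\<bar> \<le> B" "\<bar>n\<bar> \<le> B" by linarith+
      then have "(m, n) \<in> {-B..B} \<times> {-B..B}" by auto
      then have "(\<lambda>(m, n). quad_elt D m n) (m, n) \<in> (\<lambda>(m, n). quad_elt D m n) ` ({-B..B} \<times> {-B..B})" by (rule imageI)
      then show "x \<in> L ` (\<lambda>(m, n). quad_elt D m n) ` ({-B..B} \<times> {-B..B})"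
        unfolding u(2) mn prod.case by (rule imageI)
    qed
    then show ?thesis by (rule finite_subset) simp
  qed
  obtain x y where xy: "x ^ 2 - D * y ^ 2 = 1" "y \<noteq> 0" using pell_solution[OF D0 nsq] .
  define u0 where "u0 = (of_int x :: rat, of_int y :: rat)"
  have u0: "u0 \<in> CC.U"
  proof -
    have "u0 = quad_elt D (x - y * D) (2 * y)" by (simp add: u0_def quad_elt_def)
    moreover have "nm u0 = of_int (x ^ 2 - D * y ^ 2)" by (simp add: u0_def qnorm_def power2_eq_square)
    ultimately show ?thesis unfolding U_iff xy(1) by simp
  qed
  have "L u0 \<noteq> 0" using L_zero[OF u0] xy(2) by (auto simp: u0_def)
  have dif: "a - b \<in> L ` CC.U" if "a \<in> L ` CC.U" "b \<in> L ` CC.U" for a b using that L_diff by blast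
  obtain \<mu> where \<mu>: "\<mu> > 0" "\<mu> \<in> L ` CC.U" "\<And>x. x \<in> L ` CC.U \<Longrightarrow> x = of_int \<lfloor>x / \<mu>\<rfloor> * \<mu>"
    "\<And>n. of_int n * \<mu> \<in> L ` CC.U"
  proof (rule discrete_real_subgroup[OF dif imageI[OF u0] \<open>L u0 \<noteq> 0\<close> fin])
    fix \<mu> :: real
    assume a: "\<mu> > 0" "\<mu> \<in> L ` CC.U" "\<And>x. x \<in> L ` CC.U \<Longrightarrow> x = of_int \<lfloor>x / \<mu>\<rfloor> * \<mu>"
      "\<And>n. of_int n * \<mu> \<in> L ` CC.U"
    show thesis by (rule that[OF a])
  qed
  \<comment> \<open>The exponent of \<open>u\<close> as a power, up to sign, of a fundamental unit,
    whose logarithm is \<mu>.\<close>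
  define \<phi> where "\<phi> u = \<lfloor>L u / \<mu>\<rfloor>" for u
  have ph: "L u = of_int (\<phi> u) * \<mu>" if "u \<in> CC.U" for u unfolding \<phi>_def using \<mu>(3) that by blast
  have ph_mult: "\<phi> (u \<odot> v) = \<phi> u + \<phi> v" if "u \<in> CC.U" "v \<in> CC.U" for u v
  proof -
    have "of_int (\<phi> (u \<odot> v)) * \<mu> = of_int (\<phi> u + \<phi> v) * \<mu>"
      using ph[OF U_mult[OF that]] ph[OF that(1)] ph[OF that(2)] L_mult[OF that] by (simp add: algebra_simps)
    then show ?thesis using \<mu>(1) by (simp only: mult_cancel_right of_int_eq_iff) simp
  qed
  have ph_surj: "\<exists>u\<in>CC.U. \<phi> u = n" for n
  proof -
    obtain u where u: "of_int n * \<mu> = L u" "u \<in> CC.U" using \<mu>(4)[of n] by (rule imageE)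
    have "\<phi> u = n" unfolding \<phi>_def u(1)[symmetric] using \<mu>(1) by simp
    then show ?thesis using u(2) by blast
  qed
  have ph_eq: "u = v \<or> u = - v" if uv: "u \<in> CC.U" "v \<in> CC.U" "\<phi> u = \<phi> v" for u v
  proof -
    obtain w where w: "w \<in> CC.U" "v \<odot> w = (1, 0)" by (rule U_inv[OF uv(2)])
    have "L v + L w = 0" using L_mult[OF uv(2) w(1)] w(2) L_one by simp
    then have "L (u \<odot> w) = 0" using L_mult[OF uv(1) w(1)] ph[OF uv(1)] ph[OF uv(2)] uv(3) by simp
    then have "u \<odot> w = (1, 0) \<or> u \<odot> w = - (1, 0)" by (rule L_zero[OF U_mult[OF uv(1) w(1)]])
    moreover have "u = v \<odot> (u \<odot> w)"
    proof -
      have "v \<odot> (u \<odot> w) = (v \<odot> w) \<odot> u" by (simp only: qmul_ac)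
      then show ?thesis unfolding w(2) qmul_one by simp
    qed
    ultimately show ?thesis by (metis qmul_minus(2) qmul_one(2))
  qed
  let ?H = "\<lambda>i j :: int. if i = j then {()} else {}"
  have cube: "\<phi> ((k \<odot> k) \<odot> k) = 3 * \<phi> k" if "k \<in> CC.U" for k
    using ph_mult[OF U_mult[OF that that] that] ph_mult[OF that that] by simp
  \<comment> \<open>Two units differ by the cube of a unit exactly when their exponents agree modulo
    3, and that unit is then unique; so the groupoid matches three isolated points.\<close>
  have HU3: "(CC.HU u v = {} \<longleftrightarrow> ?H i j = {}) \<and> card (CC.HU u v) = card (?H i j)"
    if uv: "u \<in> CC.U" "i \<in> {0, 1, 2}" "v \<in> CC.U" "j \<in> {0, 1, 2}" "\<phi> u mod 3 = i" "\<phi> v mod 3 = j" for u v i j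
  proof (cases "i = j")
    case False
    have "CC.HU u v = {}"
    proof (rule ccontr)
      assume "CC.HU u v \<noteq> {}"
      then obtain k where k: "k \<in> CC.U" "v = ((k \<odot> k) \<odot> k) \<odot> u" by (auto simp: HU_eq)
      have "\<phi> v = 3 * \<phi> k + \<phi> u" unfolding k(2) using ph_mult[OF U_mult[OF U_mult[OF k(1) k(1)] k(1)] uv(1)] cube[OF k(1)] by simp
      then show False using False uv by simp
    qed
    then show ?thesis using False by simp
  next
    case True
    then have "3 dvd \<phi> v - \<phi> u" using uv by (metis mod_eq_dvd_iff)
    then obtain l where l: "\<phi> v = 3 * l + \<phi> u" unfolding dvd_def by (auto simp: algebra_simps)
    obtain k where k: "k \<in> CC.U" "\<phi> k = l" using ph_surj by blast
    have k3: "((k \<odot> k) \<odot> k) \<odot> u \<in> CC.U" "\<phi> (((k \<odot> k) \<odot> k) \<odot> u) = \<phi> v"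
      using U_mult[OF U_mult[OF U_mult[OF k(1) k(1)] k(1)] uv(1)] ph_mult[OF U_mult[OF U_mult[OF k(1) k(1)] k(1)] uv(1)] cube[OF k(1)] k(2) l by simp_all
    have "v = ((k \<odot> k) \<odot> k) \<odot> u \<or> v = - (((k \<odot> k) \<odot> k) \<odot> u)" by (rule ph_eq[OF uv(3) k3(1)]) (use k3(2) in simp)
    \<comment> \<open>The exponent determines \<open>v\<close> only up to sign, but -1 is a cube, so
      the sign can be absorbed into \<open>k\<close>.\<close>
    then have "\<exists>\<kappa>\<in>CC.U. v = ((\<kappa> \<odot> \<kappa>) \<odot> \<kappa>) \<odot> u"
    proof
      assume "v = - (((k \<odot> k) \<odot> k) \<odot> u)"
      then have "v = (((- k) \<odot> (- k)) \<odot> (- k)) \<odot> u" by (simp add: qmul_minus)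
      then show ?thesis using U_neg[OF k(1)] by blast
    qed (use k(1) in blast)
    then obtain \<kappa> where \<kappa>: "\<kappa> \<in> CC.U" "v = ((\<kappa> \<odot> \<kappa>) \<odot> \<kappa>) \<odot> u" by blast
    \<comment> \<open>Cubing is injective on the reals and \<open>e\<close> is injective, so there
      are no units of order 3.\<close>
    have "CC.HU u v = {\<kappa>}"
    proof (intro equalityI subsetI)
      fix m assume "m \<in> CC.HU u v"
      then have m: "m \<in> CC.U" "v = ((m \<odot> m) \<odot> m) \<odot> u" by (auto simp: HU_eq)
      have "e m ^ 3 * e u = e \<kappa> ^ 3 * e u"
        using arg_cong[OF trans[OF m(2)[symmetric] \<kappa>(2)], of e] by (simp add: e_mult power3_eq_cube)
      then have "e m ^ 3 = e \<kappa> ^ 3" using e_nz[OF uv(1)] by simp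
      then have "root 3 (e m ^ 3) = root 3 (e \<kappa> ^ 3)" by (rule arg_cong)
      then have "e m = e \<kappa>" by (simp add: odd_real_root_power_cancel)
      then show "m \<in> {\<kappa>}" using e_inj by blast
    qed (use \<kappa> in \<open>simp add: HU_eq\<close>)
    then show ?thesis using True by simp
  qed
  have f3: "finite {0, 1, 2 :: int}" by simp
  note md = mass_discrete[OF f3, of ?H, OF refl]
  have l: "\<exists>i\<in>{0, 1, 2}. \<phi> u mod 3 = i" for u
  proof -
    have "0 \<le> \<phi> u mod 3" "\<phi> u mod 3 < 3" by simp_all
    then show ?thesis by auto
  qed
  have r: "\<exists>u\<in>CC.U. \<phi> u mod 3 = i" if "i \<in> {0, 1, 2}" for i
  proof -
    obtain u where u: "u \<in> CC.U" "\<phi> u = i" using ph_surj by blast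
    have "\<phi> u mod 3 = i" unfolding u(2) using that by auto
    then show ?thesis using u(1) by blast
  qed
  have "mass CC.U CC.HU = mass {0, 1, 2} ?H"
    by (rule mass_transfer[OF md(1), where R = "\<lambda>u i. \<phi> u mod 3 = i"]) ((rule l | rule r | rule HU3); assumption)+
  then show "mass CC.U CC.HU = 3" unfolding md(2) by simp
  have "finite (CC.U // hom_rel CC.U CC.HU) \<longleftrightarrow> finite ({0, 1, 2} // hom_rel {0, 1, 2} ?H)"
    by (rule finite_transfer[OF md(1), where R = "\<lambda>u i. \<phi> u mod 3 = i"]) ((rule l | rule r | rule HU3); assumption)+
  then show "finite (CC.U // hom_rel CC.U CC.HU)" using md(3) by simp
qed

lemma mass_units:
  "mass CC.U CC.HU = (if D > 0 \<and> (\<nexists>k. D = k ^ 2) then 3 else 1)" (is ?A)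
  "finite (CC.U // hom_rel CC.U CC.HU)" (is ?B)
proof -
  have "?A \<and> ?B"
  proof (cases "D > 0 \<and> (\<nexists>k. D = k ^ 2)")
    case True then show ?thesis using mass_units_real by simp
  next
    case False
    then have f: "finite CC.U" using finite_units_neg finite_units_square D_nonzero by (metis linorder_neqE_linordered_idom)
    then have "?B" by (rule finite_quotient) (auto simp: hom_rel_def)
    then show ?thesis using mass_units_finite[OF f] False by simp
  qed
  then show ?A ?B by blast+
qed

end

section \<open>Integral bases, traces and discriminants\<close>

context abelian_group
begin

lemma additive_int_pow:
  fixes l :: "'a \<Rightarrow> int"
  assumes l: "\<And>x y. x \<in> carrier G \<Longrightarrow> y \<in> carrier G \<Longrightarrow> l (x \<oplus> y) = l x + l y" and x: "x \<in> carrier G"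
  shows "l (add_pow G (k :: int) x) = k * l x"
proof -
  have z: "l \<zero> = 0" using l[of \<zero> \<zero>] by simp
  have n: "l (add_pow G (m :: nat) x) = int m * l x" for m
    by (induction m) (use x z in \<open>simp_all add: l algebra_simps\<close>)
  have neg: "l (\<ominus> y) = - l y" if "y \<in> carrier G" for y
    using l[of "\<ominus> y" y] that z l_neg[OF that] by simp
  show ?thesis
  proof (cases "k \<ge> 0")
    case True
    then show ?thesis using n[of "nat k"] by (simp add: add_pow_int_ge)
  next
    case False
    then show ?thesis using n[of "nat (- k)"] neg x by (simp add: add_pow_int_lt)
  qed
qed

lemma additive_zcomb:
  fixes l :: "'a \<Rightarrow> int" and b :: "nat \<Rightarrow> 'a"
  assumes l: "\<And>x y. x \<in> carrier G \<Longrightarrow> y \<in> carrier G \<Longrightarrow> l (x \<oplus> y) = l x + l y"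
    and b: "b \<in> {..<n} \<rightarrow> carrier G"
  shows "l (\<Oplus>i\<in>{..<n}. add_pow G (c i :: int) (b i)) = (\<Sum>i<n. c i * l (b i))"
proof -
  have z: "l \<zero> = 0" using l[of \<zero> \<zero>] by simp
  have "l (\<Oplus>i\<in>A. add_pow G (c i) (b i)) = (\<Sum>i\<in>A. c i * l (b i))" if "A \<subseteq> {..<n}" for A
    using finite_subset[OF that finite_lessThan] that
  proof (induction A rule: finite_induct)
    case empty then show ?case by (simp add: z)
  next
    case (insert a A)
    have bA: "\<And>i. i \<in> insert a A \<Longrightarrow> b i \<in> carrier G" using b insert.prems by blast
    then have "l (\<Oplus>i\<in>insert a A. add_pow G (c i) (b i)) = l (add_pow G (c a) (b a) \<oplus> (\<Oplus>i\<in>A. add_pow G (c i) (b i)))"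
      using insert.hyps by (subst finsum_insert) auto
    also have "\<dots> = c a * l (b a) + (\<Sum>i\<in>A. c i * l (b i))"
      using bA insert by (subst l) (auto simp: additive_int_pow[OF l])
    finally show ?case using insert.hyps by simp
  qed
  then show ?thesis by blast
qed

lemma zcomb_closed: "b \<in> {..<n} \<rightarrow> carrier G \<Longrightarrow> (\<Oplus>i\<in>{..<n}. add_pow G (c i :: int) (b i)) \<in> carrier G"
  by (rule finsum_closed) auto

lemma zcomb_plus:
  assumes b: "b \<in> {..<n} \<rightarrow> carrier G"
  shows "(\<Oplus>i\<in>{..<n}. add_pow G (c i + d i :: int) (b i)) =
    (\<Oplus>i\<in>{..<n}. add_pow G (c i) (b i)) \<oplus> (\<Oplus>i\<in>{..<n}. add_pow G (d i) (b i))"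
proof -
  have "(\<Oplus>i\<in>{..<n}. add_pow G (c i + d i) (b i)) = (\<Oplus>i\<in>{..<n}. add_pow G (c i) (b i) \<oplus> add_pow G (d i) (b i))"
  proof (rule finsum_cong')
    fix i assume "i \<in> {..<n}"
    then have "b i \<in> carrier G" using b by blast
    then show "add_pow G (c i + d i) (b i) = add_pow G (c i) (b i) \<oplus> add_pow G (d i) (b i)"
      by (rule add.int_pow_mult)
  qed (use b in auto)
  also have "\<dots> = (\<Oplus>i\<in>{..<n}. add_pow G (c i) (b i)) \<oplus> (\<Oplus>i\<in>{..<n}. add_pow G (d i) (b i))"
    using b by (intro finsum_addf) auto
  finally show ?thesis .
qed

end

locale zbased = cring R for R :: "('a, 'm) ring_scheme" (structure) and n :: nat and b :: "nat \<Rightarrow> 'a" +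
  assumes zb: "zbasis n R b"
begin

abbreviation "co \<equiv> zcoord n R b"

lemma b_carrier: "b \<in> {..<n} \<rightarrow> carrier R" "i < n \<Longrightarrow> b i \<in> carrier R"
  using zb by (auto simp: zbasis_def)

lemma zcomb_in: "zcomb n R b c \<in> carrier R"
  unfolding zcomb_def by (rule zcomb_closed[OF b_carrier(1)])

lemma zcomb_add: "zcomb n R b (\<lambda>i. c i + d i) = zcomb n R b c \<oplus> zcomb n R b d"
  unfolding zcomb_def by (rule zcomb_plus[OF b_carrier(1)])

lemma zcomb_restrict: "zcomb n R b (restrict c {..<n}) = zcomb n R b c"
  unfolding zcomb_def using b_carrier by (intro finsum_cong') auto

lemma inj: "inj_on (zcomb n R b) ({..<n} \<rightarrow>\<^sub>E UNIV)"
  and surj: "zcomb n R b ` ({..<n} \<rightarrow>\<^sub>E UNIV) = carrier R"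
  using zb by (auto simp: zbasis_def bij_betw_def)

lemma co_zcomb: "i < n \<Longrightarrow> co (zcomb n R b c) i = c i"
proof -
  assume i: "i < n"
  have "the_inv_into ({..<n} \<rightarrow>\<^sub>E UNIV) (zcomb n R b) (zcomb n R b (restrict c {..<n})) = restrict c {..<n}"
    by (rule the_inv_into_f_f[OF inj]) simp
  then show ?thesis using i by (simp add: zcoord_def zcomb_restrict)
qed

lemma zcomb_co: "x \<in> carrier R \<Longrightarrow> zcomb n R b (co x) = x"
  unfolding zcoord_def using f_the_inv_into_f[OF inj] surj by blast

lemma co_eqI: "x \<in> carrier R \<Longrightarrow> y \<in> carrier R \<Longrightarrow> (\<And>i. i < n \<Longrightarrow> co x i = co y i) \<Longrightarrow> x = y"
proof -
  assume a: "x \<in> carrier R" "y \<in> carrier R" "\<And>i. i < n \<Longrightarrow> co x i = co y i"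
  have "x = zcomb n R b (restrict (co x) {..<n})" using zcomb_co[OF a(1)] zcomb_restrict by simp
  also have "restrict (co x) {..<n} = restrict (co y) {..<n}" using a(3) by (auto intro: restrict_ext)
  also have "zcomb n R b \<dots> = y" using zcomb_co[OF a(2)] zcomb_restrict by simp
  finally show ?thesis .
qed

lemma co_add: "x \<in> carrier R \<Longrightarrow> y \<in> carrier R \<Longrightarrow> i < n \<Longrightarrow> co (x \<oplus> y) i = co x i + co y i"
  using zcomb_add[of "co x" "co y"] zcomb_co co_zcomb[of i "\<lambda>i. co x i + co y i"] by metis

lemma co_sum:
  assumes "y \<in> {..<m} \<rightarrow> carrier R" "i < n"
  shows "co (zcomb m R y c) i = (\<Sum>j<m. c j * co (y j) i)"
  unfolding zcomb_def by (rule additive_zcomb) (use assms co_add in auto)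

lemma additive_expand:
  fixes l :: "'a \<Rightarrow> int"
  assumes "\<And>x y. x \<in> carrier R \<Longrightarrow> y \<in> carrier R \<Longrightarrow> l (x \<oplus> y) = l x + l y" "x \<in> carrier R"
  shows "l x = (\<Sum>i<n. co x i * l (b i))"
proof -
  have "l x = l (zcomb n R b (co x))" using zcomb_co assms by simp
  also have "\<dots> = (\<Sum>i<n. co x i * l (b i))" unfolding zcomb_def by (rule additive_zcomb[OF assms(1) b_carrier(1)])
  finally show ?thesis .
qed

lemma trace_add:
  "x \<in> carrier R \<Longrightarrow> y \<in> carrier R \<Longrightarrow> trace_wrt n R b (x \<oplus> y) = trace_wrt n R b x + trace_wrt n R b y"
  unfolding trace_wrt_def using b_carrier by (simp add: l_distr co_add sum.distrib)

lemma trace_one: "trace_wrt n R b \<one> = int n"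
proof -
  have "co (b i) i = 1" if "i < n" for i
  proof -
    have "zcomb n R b (\<lambda>j. if j = i then 1 else 0) = b i"
    proof -
      have "zcomb n R b (\<lambda>j. if j = i then 1 else 0) = (\<Oplus>j\<in>{..<n}. if i = j then b j else \<zero>)"
        unfolding zcomb_def using b_carrier by (intro finsum_cong') (auto simp: add_pow_int_ge)
      also have "\<dots> = b i" using that b_carrier by (intro add.finprod_singleton) auto
      finally show ?thesis .
    qed
    then show ?thesis using co_zcomb[OF that, of "\<lambda>j. if j = i then 1 else 0"] by simp
  qed
  then show ?thesis unfolding trace_wrt_def using b_carrier by simp
qed

end

locale two_zbased = B: zbased R n b + C: zbased R n b' for R (structure) and n and b b'
begin

abbreviation "P i j \<equiv> zcoord n R b (b' j) i"
abbreviation "Q j i \<equiv> zcoord n R b' (b i) j"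

lemma co_basis: "i < n \<Longrightarrow> k < n \<Longrightarrow> B.co (b i) k = (if k = i then 1 else 0)"
proof -
  assume i: "i < n" "k < n"
  have "zcomb n R b (\<lambda>j. if j = i then 1 else 0) = (\<Oplus>j\<in>{..<n}. if i = j then b j else \<zero>)"
    unfolding zcomb_def using B.b_carrier by (intro B.finsum_cong') (auto simp: add_pow_int_ge)
  also have "\<dots> = b i" using i B.b_carrier by (intro B.add.finprod_singleton) auto
  finally show ?thesis using B.co_zcomb[OF i(2), of "\<lambda>j. if j = i then 1 else 0"] by simp
qed

lemma PQ: "i < n \<Longrightarrow> k < n \<Longrightarrow> (\<Sum>j<n. P k j * Q j i) = (if k = i then 1 else 0)"
  using B.co_sum[OF C.b_carrier(1), of k "C.co (b i)"] C.zcomb_co[of "b i"] B.b_carrier(2) co_basis[of i k]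
  by (simp add: mult.commute)

text \<open>Similarity invariance of the trace, written in sums: the matrix in the new basis is
  \<open>Q T P\<close>, and exchanging the sums brings \<open>P\<close> and its inverse
  \<open>Q\<close> together.\<close>

lemma trace_wrt_eq:
  assumes x: "x \<in> carrier R" shows "trace_wrt n R b' x = trace_wrt n R b x"
proof -
  let ?T = "\<lambda>i k. B.co (x \<otimes> b k) i"
  have 1: "C.co y j = (\<Sum>i<n. B.co y i * Q j i)" if "y \<in> carrier R" "j < n" for y j
    by (rule B.additive_expand) (use that C.co_add in auto)
  have 2: "B.co (x \<otimes> b' j) i = (\<Sum>k<n. P k j * ?T i k)" if "i < n" "j < n" for i j
    by (rule B.additive_expand[of "\<lambda>y. B.co (x \<otimes> y) i"])
      (use that x C.b_carrier(2) B.co_add in \<open>auto simp: B.r_distr\<close>)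
  have "trace_wrt n R b' x = (\<Sum>j<n. \<Sum>i<n. \<Sum>k<n. ?T i k * (P k j * Q j i))"
    unfolding trace_wrt_def using x C.b_carrier(2)
    by (intro sum.cong refl) (simp add: 1 2 sum_distrib_right sum_distrib_left mult_ac)
  also have "\<dots> = (\<Sum>i<n. \<Sum>k<n. \<Sum>j<n. ?T i k * (P k j * Q j i))"
    by (subst sum.swap) (intro sum.cong refl sum.swap)
  also have "\<dots> = (\<Sum>i<n. \<Sum>k<n. ?T i k * (if k = i then 1 else 0))"
    by (intro sum.cong refl) (simp add: PQ flip: sum_distrib_left)
  also have "\<dots> = trace_wrt n R b x" unfolding trace_wrt_def by (intro sum.cong refl) (simp add: sum.delta if_distrib cong: if_cong)
  finally show ?thesis .
qed

text \<open>The trace form changes by congruence with \<open>P\<close>, whose determinant is 1 or -1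
  since its inverse is integral as well.\<close>

lemma disc_wrt_eq: "disc_wrt n R b' = disc_wrt n R b"
proof -
  let ?P = "Matrix.mat n n (\<lambda>(i, j). P i j)" and ?Q = "Matrix.mat n n (\<lambda>(i, j). Q i j)"
  let ?T = "Matrix.mat n n (\<lambda>(i, j). trace_wrt n R b (b i \<otimes> b j))"
  have car: "?P \<in> carrier_mat n n" "?Q \<in> carrier_mat n n" "?T \<in> carrier_mat n n" by simp_all
  have "?P * ?Q = 1\<^sub>m n"
    by (rule eq_matI) (auto simp: scalar_prod_def atLeast0LessThan PQ)
  then have "Determinant.det ?P * Determinant.det ?Q = 1" using det_mult[OF car(1,2)] by simp
  then have "Determinant.det ?P = 1 \<or> Determinant.det ?P = -1" by (auto simp: zmult_eq_1_iff)
  then have sq: "Determinant.det ?P * Determinant.det ?P = 1" by auto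
  have tr: "trace_wrt n R b (b' i \<otimes> b' j) = (\<Sum>k<n. \<Sum>l<n. P k i * (trace_wrt n R b (b k \<otimes> b l) * P l j))"
    if "i < n" "j < n" for i j
  proof -
    have "trace_wrt n R b (b' i \<otimes> b' j) = (\<Sum>k<n. P k i * trace_wrt n R b (b k \<otimes> b' j))"
      by (rule B.additive_expand[of "\<lambda>y. trace_wrt n R b (y \<otimes> b' j)"])
        (use that C.b_carrier(2) in \<open>auto simp: B.l_distr B.trace_add\<close>)
    also have "\<dots> = (\<Sum>k<n. P k i * (\<Sum>l<n. P l j * trace_wrt n R b (b k \<otimes> b l)))"
    proof (intro sum.cong refl arg_cong2[where f = times])
      fix k assume "k \<in> {..<n}"
      then show "trace_wrt n R b (b k \<otimes> b' j) = (\<Sum>l<n. P l j * trace_wrt n R b (b k \<otimes> b l))"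
        by (intro B.additive_expand[of "\<lambda>y. trace_wrt n R b (b k \<otimes> y)"])
          (use that C.b_carrier(2) B.b_carrier(2) in \<open>auto simp: B.r_distr B.trace_add\<close>)
    qed
    finally show ?thesis by (simp add: sum_distrib_left mult_ac)
  qed
  have "Matrix.mat n n (\<lambda>(i, j). trace_wrt n R b' (b' i \<otimes> b' j)) = transpose_mat ?P * (?T * ?P)"
  proof (rule eq_matI)
    fix i j assume "i < dim_row (transpose_mat ?P * (?T * ?P))" "j < dim_col (transpose_mat ?P * (?T * ?P))"
    then have ij: "i < n" "j < n" by simp_all
    have "trace_wrt n R b' (b' i \<otimes> b' j) = trace_wrt n R b (b' i \<otimes> b' j)"
      by (rule trace_wrt_eq) (use ij C.b_carrier(2) in auto)
    then show "Matrix.mat n n (\<lambda>(i, j). trace_wrt n R b' (b' i \<otimes> b' j)) $$ (i, j) = (transpose_mat ?P * (?T * ?P)) $$ (i, j)"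
      using ij by (simp add: tr scalar_prod_def atLeast0LessThan sum_distrib_left)
  qed simp_all
  then have "disc_wrt n R b' = Determinant.det (transpose_mat ?P * (?T * ?P))" by (simp add: disc_wrt_def)
  also have "\<dots> = Determinant.det ?P * (Determinant.det ?T * Determinant.det ?P)"
  proof -
    have "Determinant.det (transpose_mat ?P * (?T * ?P)) = Determinant.det (transpose_mat ?P) * Determinant.det (?T * ?P)"
      by (rule det_mult[of _ n]) (use car in auto)
    then show ?thesis unfolding det_mult[OF car(3,1)] det_transpose[OF car(1)] .
  qed
  also have "\<dots> = (Determinant.det ?P * Determinant.det ?P) * Determinant.det ?T" by (simp add: mult_ac)
  finally show ?thesis unfolding sq by (simp add: disc_wrt_def)
qed

end

text \<open>Replaces the basis picked by \<open>SOME\<close> by any convenient one.\<close>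

lemma (in cring) zbasis_some:
  assumes "zbasis n R b"
  shows "\<And>x. x \<in> carrier R \<Longrightarrow> ring_trace n R x = trace_wrt n R b x" "ring_disc n R = disc_wrt n R b"
proof -
  interpret two_zbased R n b "SOME b. zbasis n R b"
    by unfold_locales (rule assms, rule someI[of "zbasis n R", OF assms])
  show "ring_trace n R x = trace_wrt n R b x" if "x \<in> carrier R" for x
    unfolding ring_trace_def by (rule trace_wrt_eq[OF that])
  show "ring_disc n R = disc_wrt n R b" unfolding ring_disc_def by (rule disc_wrt_eq)
qed

text \<open>An isomorphism with the standard lattice carries the same information as a basis: the
  basis elements are the preimages of the unit vectors.\<close>

lemma (in cring) rank_ring_iff: "rank_ring n R \<longleftrightarrow> (\<exists>b. zbasis n R b)"
proof
  assume "rank_ring n R"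
  then obtain \<phi> where "\<phi> \<in> iso (add_monoid R) (product_group {..<n} (\<lambda>_. integer_group))"
    unfolding rank_ring_def is_iso_def by blast
  then have hom: "\<And>x y. x \<in> carrier R \<Longrightarrow> y \<in> carrier R \<Longrightarrow> \<phi> (x \<oplus> y) = (\<lambda>i\<in>{..<n}. \<phi> x i + \<phi> y i)"
    and bij: "bij_betw \<phi> (carrier R) ({..<n} \<rightarrow>\<^sub>E UNIV)"
    by (auto simp: iso_def hom_def product_group_def integer_group_def)
  define b where "b i = inv_into (carrier R) \<phi> (\<lambda>j\<in>{..<n}. if j = i then 1 else 0)" for i
  have b: "b i \<in> carrier R" "\<phi> (b i) = (\<lambda>j\<in>{..<n}. if j = i then 1 else 0)" for i
  proof -
    have "(\<lambda>j\<in>{..<n}. if j = i then 1 else 0) \<in> \<phi> ` carrier R" using bij by (simp add: bij_betw_def)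
    then show "b i \<in> carrier R" "\<phi> (b i) = (\<lambda>j\<in>{..<n}. if j = i then 1 else 0)"
      unfolding b_def by (rule inv_into_into, rule f_inv_into_f)
  qed
  have bc: "b \<in> {..<n} \<rightarrow> carrier R" using b by blast
  have ext: "\<phi> x \<in> {..<n} \<rightarrow>\<^sub>E UNIV" if "x \<in> carrier R" for x using bij that by (auto simp: bij_betw_def)
  have z: "\<phi> (zcomb n R b c) j = c j" if "j < n" for c j
  proof -
    have "\<phi> (zcomb n R b c) j = (\<Sum>i<n. c i * \<phi> (b i) j)"
      unfolding zcomb_def by (rule additive_zcomb[OF _ bc]) (use hom that in auto)
    also have "\<dots> = (\<Sum>i<n. if i = j then c i else 0)" using that by (intro sum.cong refl) (auto simp: b)
    also have "\<dots> = c j" using that by simp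
    finally show ?thesis .
  qed
  have zc: "zcomb n R b c \<in> carrier R" for c unfolding zcomb_def by (rule zcomb_closed[OF bc])
  have inv: "\<phi> (zcomb n R b c) = c" if "c \<in> {..<n} \<rightarrow>\<^sub>E UNIV" for c
    using z ext[OF zc] that by (intro PiE_ext[of _ "{..<n}" "\<lambda>_. UNIV"]) auto
  have "bij_betw (zcomb n R b) ({..<n} \<rightarrow>\<^sub>E UNIV) (carrier R)"
  proof (rule bij_betw_byWitness[where f' = \<phi>])
    show "\<forall>x\<in>carrier R. zcomb n R b (\<phi> x) = x"
    proof
      fix x assume x: "x \<in> carrier R"
      have "\<phi> (zcomb n R b (\<phi> x)) = \<phi> x" by (rule inv[OF ext[OF x]])
      then show "zcomb n R b (\<phi> x) = x" using bij x zc by (auto simp: bij_betw_def inj_on_def)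
    qed
  qed (use inv ext zc in auto)
  then show "\<exists>b. zbasis n R b" unfolding zbasis_def using bc by blast
next
  assume "\<exists>b. zbasis n R b"
  then obtain b where "zbasis n R b" ..
  then interpret zbased R n b by unfold_locales
  let ?G = "product_group {..<n} (\<lambda>_. integer_group)"
  have "zcomb n R b \<in> hom ?G (add_monoid R)"
  proof (rule homI)
    fix c d assume "c \<in> carrier ?G" "d \<in> carrier ?G"
    have "c \<otimes>\<^bsub>?G\<^esub> d = restrict (\<lambda>i. c i + d i) {..<n}" by (auto simp: product_group_def integer_group_def)
    then show "zcomb n R b (c \<otimes>\<^bsub>?G\<^esub> d) = zcomb n R b c \<otimes>\<^bsub>add_monoid R\<^esub> zcomb n R b d"
      by (simp add: zcomb_restrict zcomb_add)
  qed (simp add: zcomb_in)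
  then have "zcomb n R b \<in> iso ?G (add_monoid R)"
    using zb by (simp add: iso_def zbasis_def integer_group_def product_group_def)
  then have "?G \<cong> add_monoid R" by (rule is_isoI)
  moreover have "group ?G" by (rule product_group) (rule group_integer_group)
  ultimately have "add_monoid R \<cong> ?G" using group.iso_sym by blast
  then show "rank_ring n R" using is_cring by (simp add: rank_ring_def)
qed

lemma iso_transport:
  assumes R: "cring R" and S: "cring S" and h: "h \<in> ring_iso R S" and b: "zbasis n R b"
  shows "zbasis n S (h \<circ> b)" "\<And>x. x \<in> carrier R \<Longrightarrow> ring_trace n S (h x) = ring_trace n R x"
    "ring_disc n S = ring_disc n R"
proof -
  interpret R: zbased R n b using R b by (simp add: zbased_def zbased_axioms_def)
  interpret S: cring S by fact
  have hh: "h \<in> Ring.ring_hom R S" "bij_betw h (carrier R) (carrier S)" using h by (auto simp: ring_iso_def)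
  interpret h: ring_hom_cring R S h
    by (intro ring_hom_cring.intro ring_hom_cring_axioms.intro R S hh)
  have hb: "h \<circ> b \<in> {..<n} \<rightarrow> carrier S" using R.b_carrier by auto
  have hp: "h (add_pow R (k :: int) x) = add_pow S k (h x)" if "x \<in> carrier R" for k x
  proof -
    have nat: "h (add_pow R (m :: nat) x) = add_pow S m (h x)" for m
      by (induction m) (use that in simp_all)
    show ?thesis using nat that by (cases "k \<ge> 0") (simp_all add: add_pow_int_ge add_pow_int_lt)
  qed
  have hz: "h (zcomb n R b c) = zcomb n S (h \<circ> b) c" for c
  proof -
    have "h (zcomb n R b c) = (\<Oplus>\<^bsub>S\<^esub>i\<in>{..<n}. h (add_pow R (c i) (b i)))"
      unfolding zcomb_def using R.b_carrier by (subst h.hom_finsum) (auto simp: comp_def)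
    also have "\<dots> = zcomb n S (h \<circ> b) c"
      unfolding zcomb_def using R.b_carrier hb by (intro S.finsum_cong') (auto simp: hp)
    finally show ?thesis .
  qed
  have "bij_betw (zcomb n R b) ({..<n} \<rightarrow>\<^sub>E UNIV) (carrier R)" using R.zb by (simp add: zbasis_def)
  then have "bij_betw (h \<circ> zcomb n R b) ({..<n} \<rightarrow>\<^sub>E UNIV) (carrier S)" by (rule bij_betw_trans[OF _ hh(2)])
  moreover have "h \<circ> zcomb n R b = zcomb n S (h \<circ> b)" using hz by (simp add: fun_eq_iff)
  ultimately show zS: "zbasis n S (h \<circ> b)" unfolding zbasis_def using hb by simp
  interpret S: zbased S n "h \<circ> b" using zS by unfold_locales
  have co: "zcoord n S (h \<circ> b) (h x) i = R.co x i" if "x \<in> carrier R" "i < n" for x i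
    using S.co_zcomb[OF that(2), of "R.co x"] R.zcomb_co[OF that(1)] hz[of "R.co x"] by simp
  have tr: "trace_wrt n S (h \<circ> b) (h x) = trace_wrt n R b x" if x: "x \<in> carrier R" for x
    unfolding trace_wrt_def
  proof (rule sum.cong[OF refl])
    fix i assume "i \<in> {..<n}"
    then have i: "i < n" by simp
    have "h x \<otimes>\<^bsub>S\<^esub> (h \<circ> b) i = h (x \<otimes>\<^bsub>R\<^esub> b i)" using x R.b_carrier(2)[OF i] by simp
    then show "zcoord n S (h \<circ> b) (h x \<otimes>\<^bsub>S\<^esub> (h \<circ> b) i) i = R.co (x \<otimes>\<^bsub>R\<^esub> b i) i"
      using co[of "x \<otimes>\<^bsub>R\<^esub> b i" i] x R.b_carrier(2)[OF i] i by simp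
  qed
  show "ring_trace n S (h x) = ring_trace n R x" if "x \<in> carrier R" for x
    using S.zbasis_some(1)[OF zS] R.zbasis_some(1)[OF b] tr that by simp
  have "disc_wrt n S (h \<circ> b) = disc_wrt n R b"
    unfolding disc_wrt_def
  proof (rule arg_cong[where f = Determinant.det], rule cong_mat)
    fix i j assume ij: "i < n" "j < n"
    have "(h \<circ> b) i \<otimes>\<^bsub>S\<^esub> (h \<circ> b) j = h (b i \<otimes>\<^bsub>R\<^esub> b j)" using R.b_carrier(2) ij by simp
    then show "(case (i, j) of (i, j) \<Rightarrow> trace_wrt n S (h \<circ> b) ((h \<circ> b) i \<otimes>\<^bsub>S\<^esub> (h \<circ> b) j)) =
        (case (i, j) of (i, j) \<Rightarrow> trace_wrt n R b (b i \<otimes>\<^bsub>R\<^esub> b j))"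
      using tr[OF R.m_closed[OF R.b_carrier(2)[OF ij(1)] R.b_carrier(2)[OF ij(2)]]] by (simp only: prod.case)
  qed simp_all
  then show "ring_disc n S = ring_disc n R" using S.zbasis_some(2)[OF zS] R.zbasis_some(2)[OF b] by simp
qed

section \<open>Cubic rings with traces divisible by 3, and binary cubic forms\<close>

type_synonym triple = "int \<times> int \<times> int"

definition smul3 :: "int \<Rightarrow> triple \<Rightarrow> triple" where
  "smul3 k = (\<lambda>(x, y, z). (k * x, k * y, k * z))"

lemma additive_triple:
  fixes f :: "triple \<Rightarrow> triple"
  assumes add: "\<And>x y. f (x + y) = f x + f y"
  shows "f (x, y, z) = smul3 x (f (1, 0, 0)) + smul3 y (f (0, 1, 0)) + smul3 z (f (0, 0, 1))"
proof -
  have zero: "f 0 = 0" using add[of 0 0] by simp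
  have neg: "f (- v) = - f v" for v using add[of "- v" v] zero by (simp add: eq_neg_iff_add_eq_0)
  have nat: "f (smul3 (int n) v) = smul3 (int n) (f v)" for n v
  proof (induction n)
    case 0 then show ?case using zero by (simp add: smul3_def split_def zero_prod_def)
  next
    case (Suc n)
    have "smul3 (int (Suc n)) v = smul3 (int n) v + v" for v
      by (cases v) (simp add: smul3_def algebra_simps)
    then show ?case using Suc add by simp
  qed
  have int: "f (smul3 k v) = smul3 k (f v)" for k v
  proof (cases "k \<ge> 0")
    case True then show ?thesis using nat[of "nat k" v] by simp
  next
    case False
    have "smul3 k v = - smul3 (int (nat (- k))) v" for v using False by (cases v) (simp add: smul3_def)
    then show ?thesis using nat[of "nat (- k)" v] neg by simp
  qed
  have "(x, y, z) = smul3 x (1, 0, 0) + smul3 y (0, 1, 0) + smul3 z (0, 0, 1)" by (simp add: smul3_def)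
  then have "f (x, y, z) = f (smul3 x (1, 0, 0)) + f (smul3 y (0, 1, 0)) + f (smul3 z (0, 0, 1))" by (simp only: add)
  then show ?thesis unfolding int .
qed

lemma additive_triple_zero:
  fixes f :: "triple \<Rightarrow> triple"
  assumes "\<And>x y. f (x + y) = f x + f y" "f (1, 0, 0) = 0" "f (0, 1, 0) = 0" "f (0, 0, 1) = 0"
  shows "f v = 0"
  using additive_triple[OF assms(1), of "fst v" "fst (snd v)" "snd (snd v)"] assms(2-4)
  by (simp add: smul3_def zero_prod_def)

text \<open>The last two coordinates are those with respect to a basis \<open>\<omega>\<close>, \<open>\<theta>\<close> of the elements of trace \<open>0\<close>,
  for which the Hessian of the form gives the constant terms of \<open>\<omega>\<^sup>2\<close>, \<open>\<omega>\<theta>\<close> and \<open>\<theta>\<^sup>2\<close>.\<close>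

definition cmul :: "quadruple \<Rightarrow> triple \<Rightarrow> triple \<Rightarrow> triple" where
  "cmul = (\<lambda>(a, b, c, d) (x0, x1, x2) (y0, y1, y2).
     (x0 * y0 + 2 * (b^2 - a * c) * (x1 * y1) + (b * c - a * d) * (x1 * y2 + x2 * y1) + 2 * (c^2 - b * d) * (x2 * y2),
      x0 * y1 + x1 * y0 - b * (x1 * y1) - c * (x1 * y2 + x2 * y1) - d * (x2 * y2),
      x0 * y2 + x2 * y0 + a * (x1 * y1) + b * (x1 * y2 + x2 * y1) + c * (x2 * y2)))"

definition form_ring :: "quadruple \<Rightarrow> triple ring" where
  "form_ring f = \<lparr>carrier = UNIV, monoid.mult = cmul f, monoid.one = (1, 0, 0), ring.zero = 0, ring.add = (+)\<rparr>"

lemma form_ring_simps [simp]: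
  "carrier (form_ring f) = UNIV" "x \<otimes>\<^bsub>form_ring f\<^esub> y = cmul f x y" "\<one>\<^bsub>form_ring f\<^esub> = (1, 0, 0)"
  "\<zero>\<^bsub>form_ring f\<^esub> = 0" "x \<oplus>\<^bsub>form_ring f\<^esub> y = x + y"
  by (simp_all add: form_ring_def)

lemma cmul_comm: "cmul f x y = cmul f y x"
  by (cases f; cases x; cases y) (simp add: cmul_def mult.commute add.commute)

lemma cmul_add: "cmul f (x + y) z = cmul f x z + cmul f y z"
  by (cases f; cases x; cases y; cases z) (simp add: cmul_def algebra_simps)

lemma cmul_add_right: "cmul f z (x + y) = cmul f z x + cmul f z y"
  unfolding cmul_comm[of f z] by (rule cmul_add)

lemma cmul_one: "cmul f (1, 0, 0) x = x"
  by (cases f; cases x) (simp add: cmul_def)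

lemma cmul_basis:
  "cmul (a, b, c, d) (0, 1, 0) (0, 1, 0) = (2 * (b^2 - a * c), - b, a)"
  "cmul (a, b, c, d) (0, 1, 0) (0, 0, 1) = (b * c - a * d, - c, b)"
  "cmul (a, b, c, d) (0, 0, 1) (0, 1, 0) = (b * c - a * d, - c, b)"
  "cmul (a, b, c, d) (0, 0, 1) (0, 0, 1) = (2 * (c^2 - b * d), - d, c)"
  by (simp_all add: cmul_def)

text \<open>The associator \<open>A\<close> is additive in each argument and vanishes if one of them
  is 1, so eight triples of basis vectors remain. Four are symmetric under reversal and fall to
  commutativity; the other four are polynomial identities in the coefficients.\<close>

lemma cmul_assoc: "cmul f (cmul f x y) z = cmul f x (cmul f y z)"
proof -
  define A where "A x y z = cmul f (cmul f x y) z - cmul f x (cmul f y z)" for x y z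
  have add: "A (x + y) z w = A x z w + A y z w" "A z (x + y) w = A z x w + A z y w" "A z w (x + y) = A z w x + A z w y"
    for x y z w by (simp_all add: A_def cmul_add cmul_add_right)
  have one: "A (1, 0, 0) y z = 0" "A x (1, 0, 0) z = 0" "A x y (1, 0, 0) = 0" for x y z
    unfolding A_def cmul_comm[of f _ "(1, 0, 0)"] cmul_one by simp_all
  obtain a b c d where f: "f = (a, b, c, d)" by (cases f)
  have c1: "A (0, 1, 0) (0, 1, 0) (0, 1, 0) = 0" "A (0, 1, 0) (0, 0, 1) (0, 1, 0) = 0"
    "A (0, 0, 1) (0, 1, 0) (0, 0, 1) = 0" "A (0, 0, 1) (0, 0, 1) (0, 0, 1) = 0"
    unfolding A_def by (simp_all add: cmul_comm)
  have c2: "A (0, 1, 0) (0, 1, 0) (0, 0, 1) = 0" "A (0, 0, 1) (0, 1, 0) (0, 1, 0) = 0"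
    "A (0, 1, 0) (0, 0, 1) (0, 0, 1) = 0" "A (0, 0, 1) (0, 0, 1) (0, 1, 0) = 0"
    unfolding A_def f cmul_basis unfolding cmul_def
    by (simp_all add: zero_prod_def algebra_simps power2_eq_square)
  have "A x y z = 0" for x y z
  proof (rule additive_triple_zero[of "\<lambda>x. A x y z"])
    show "A (0, 1, 0) y z = 0"
    proof (rule additive_triple_zero[of "\<lambda>y. A (0, 1, 0) y z"])
      show "A (0, 1, 0) (0, 1, 0) z = 0"
        by (rule additive_triple_zero[of "\<lambda>z. A (0, 1, 0) (0, 1, 0) z"]) (rule add one c1 c2)+
      show "A (0, 1, 0) (0, 0, 1) z = 0"
        by (rule additive_triple_zero[of "\<lambda>z. A (0, 1, 0) (0, 0, 1) z"]) (rule add one c1 c2)+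
    qed (rule add one)+
    show "A (0, 0, 1) y z = 0"
    proof (rule additive_triple_zero[of "\<lambda>y. A (0, 0, 1) y z"])
      show "A (0, 0, 1) (0, 1, 0) z = 0"
        by (rule additive_triple_zero[of "\<lambda>z. A (0, 0, 1) (0, 1, 0) z"]) (rule add one c1 c2)+
      show "A (0, 0, 1) (0, 0, 1) z = 0"
        by (rule additive_triple_zero[of "\<lambda>z. A (0, 0, 1) (0, 0, 1) z"]) (rule add one c1 c2)+
    qed (rule add one)+
  qed (rule add one)+
  then show ?thesis by (simp add: A_def)
qed

lemma cring_form_ring: "cring (form_ring f)"
proof (rule cringI)
  show "abelian_group (form_ring f)"
  proof (rule abelian_groupI)
    fix x :: triple
    show "\<exists>y\<in>carrier (form_ring f). y \<oplus>\<^bsub>form_ring f\<^esub> x = \<zero>\<^bsub>form_ring f\<^esub>"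
      by (rule bexI[of _ "- x"]) simp_all
  qed (simp_all add: add.assoc add.commute)
  show "comm_monoid (form_ring f)"
  proof (rule comm_monoidI)
    fix x y z
    show "x \<otimes>\<^bsub>form_ring f\<^esub> y \<otimes>\<^bsub>form_ring f\<^esub> z = x \<otimes>\<^bsub>form_ring f\<^esub> (y \<otimes>\<^bsub>form_ring f\<^esub> z)"
      unfolding form_ring_simps by (rule cmul_assoc)
    show "x \<otimes>\<^bsub>form_ring f\<^esub> y = y \<otimes>\<^bsub>form_ring f\<^esub> x" unfolding form_ring_simps by (rule cmul_comm)
  qed (simp_all add: cmul_one)
qed (simp add: cmul_add)

definition tbasis :: "nat \<Rightarrow> triple" where
  "tbasis i = (if i = 0 then (1, 0, 0) else if i = 1 then (0, 1, 0) else (0, 0, 1))"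

lemma
  fixes R :: "triple ring"
  assumes R: "cring R" and car: "carrier R = UNIV" and add: "\<And>x y. x \<oplus>\<^bsub>R\<^esub> y = x + y"
  shows zbasis_tbasis: "zbasis 3 R tbasis"
    and zcoord_tbasis: "zcoord 3 R tbasis (x0, x1, x2) 0 = x0" "zcoord 3 R tbasis (x0, x1, x2) 1 = x1"
      "zcoord 3 R tbasis (x0, x1, x2) 2 = x2"
proof -
  interpret R: cring R by fact
  have b: "tbasis \<in> {..<3} \<rightarrow> carrier R" by (simp add: car)
  have l3: "{..<3::nat} = {0, 1, 2}" by auto
  have z: "zcomb 3 R tbasis c = (c 0, c 1, c 2)" for c
  proof -
    have "fst (zcomb 3 R tbasis c) = (\<Sum>i<3. c i * fst (tbasis i))"
      "fst (snd (zcomb 3 R tbasis c)) = (\<Sum>i<3. c i * fst (snd (tbasis i)))"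
      "snd (snd (zcomb 3 R tbasis c)) = (\<Sum>i<3. c i * snd (snd (tbasis i)))"
      unfolding zcomb_def
      using R.additive_zcomb[OF _ b, of fst c] R.additive_zcomb[OF _ b, of "\<lambda>v. fst (snd v)" c]
        R.additive_zcomb[OF _ b, of "\<lambda>v. snd (snd v)" c] by (simp_all add: add)
    then show ?thesis by (simp add: l3 tbasis_def prod_eq_iff)
  qed
  have "bij_betw (zcomb 3 R tbasis) ({..<3} \<rightarrow>\<^sub>E UNIV) (carrier R)"
  proof (rule bij_betw_byWitness[where f' = "\<lambda>(x0, x1, x2). \<lambda>i\<in>{..<3}. if i = 0 then x0 else if i = 1 then x1 else x2"])
    show "\<forall>c\<in>{..<3} \<rightarrow>\<^sub>E UNIV. (case zcomb 3 R tbasis c of (x0, x1, x2) \<Rightarrow> \<lambda>i\<in>{..<3}. if i = 0 then x0 else if i = 1 then x1 else x2) = c"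
    proof
      fix c :: "nat \<Rightarrow> int" assume c: "c \<in> {..<3} \<rightarrow>\<^sub>E UNIV"
      have "(\<lambda>i\<in>{..<3}. if i = 0 then c 0 else if i = 1 then c 1 else c 2) = c"
      proof (rule PiE_ext[of _ "{..<3}" "\<lambda>_. UNIV"])
        fix i :: nat assume "i \<in> {..<3}"
        then have "i = 0 \<or> i = 1 \<or> i = 2" unfolding l3 by simp
        then show "(\<lambda>i\<in>{..<3}. if i = 0 then c 0 else if i = 1 then c 1 else c 2) i = c i" by (elim disjE) simp_all
      qed (use c in simp_all)
      then show "(case zcomb 3 R tbasis c of (x0, x1, x2) \<Rightarrow> \<lambda>i\<in>{..<3}. if i = 0 then x0 else if i = 1 then x1 else x2) = c"
        unfolding z prod.case .
    qed
    show "\<forall>x\<in>carrier R. zcomb 3 R tbasis (case x of (x0, x1, x2) \<Rightarrow> \<lambda>i\<in>{..<3}. if i = 0 then x0 else if i = 1 then x1 else x2) = x"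
      unfolding z by (simp add: split_def)
    show "zcomb 3 R tbasis ` ({..<3} \<rightarrow>\<^sub>E UNIV) \<subseteq> carrier R" unfolding car by (rule subset_UNIV)
    show "(\<lambda>(x0, x1, x2). \<lambda>i\<in>{..<3}. if i = 0 then x0 else if i = 1 then x1 else x2) ` carrier R \<subseteq> {..<3} \<rightarrow>\<^sub>E UNIV"
    proof
      fix c assume "c \<in> (\<lambda>(x0, x1, x2). \<lambda>i\<in>{..<3}. if i = 0 then x0 else if i = 1 then x1 else x2 :: int) ` carrier R"
      then obtain x0 x1 x2 where "c = (\<lambda>i\<in>{..<3}. if i = 0 then x0 else if i = 1 then x1 else x2)" by force
      then show "c \<in> {..<3} \<rightarrow>\<^sub>E UNIV" by simp
    qed
  qed
  then show zb: "zbasis 3 R tbasis" unfolding zbasis_def using b by simp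
  interpret Z: zbased R 3 tbasis using zb by unfold_locales
  define c where "c i = (if i = 0 then x0 else if i = 1 then x1 else x2)" for i :: nat
  have "zcomb 3 R tbasis c = (x0, x1, x2)" unfolding z by (simp add: c_def)
  then show "zcoord 3 R tbasis (x0, x1, x2) 0 = x0" "zcoord 3 R tbasis (x0, x1, x2) 1 = x1"
      "zcoord 3 R tbasis (x0, x1, x2) 2 = x2"
    using Z.co_zcomb[of 0 c] Z.co_zcomb[of 1 c] Z.co_zcomb[of 2 c] by (simp_all add: c_def)
qed

lemma trace_tbasis:
  fixes R :: "triple ring"
  assumes R: "cring R" and car: "carrier R = UNIV" and add: "\<And>x y. x \<oplus>\<^bsub>R\<^esub> y = x + y"
  shows "ring_trace 3 R x = fst (x \<otimes>\<^bsub>R\<^esub> (1, 0, 0)) + fst (snd (x \<otimes>\<^bsub>R\<^esub> (0, 1, 0))) + snd (snd (x \<otimes>\<^bsub>R\<^esub> (0, 0, 1)))"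
proof -
  have co: "zcoord 3 R tbasis v 0 = fst v" "zcoord 3 R tbasis v 1 = fst (snd v)" "zcoord 3 R tbasis v 2 = snd (snd v)" for v
    using zcoord_tbasis[OF R car add, of "fst v" "fst (snd v)" "snd (snd v)"] by simp_all
  have l3: "{..<3::nat} = {0, 1, 2}" by auto
  have "ring_trace 3 R x = trace_wrt 3 R tbasis x"
    by (rule cring.zbasis_some(1)[OF R zbasis_tbasis[OF R car add]]) (simp add: car)
  then show ?thesis unfolding trace_wrt_def l3 using co by (simp add: tbasis_def)
qed

lemma trace_form_ring: "ring_trace 3 (form_ring f) (x0, x1, x2) = 3 * x0"
proof -
  obtain a b c d where f: "f = (a, b, c, d)" by (cases f)
  show ?thesis unfolding f by (subst trace_tbasis[OF cring_form_ring]) (simp_all add: cmul_def)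
qed

lemma det_mat3:
  fixes F :: "nat \<Rightarrow> nat \<Rightarrow> int"
  shows "Determinant.det (Matrix.mat 3 3 (\<lambda>(i, j). F i j)) =
    F 0 0 * F 1 1 * F 2 2 + F 0 1 * F 1 2 * F 2 0 + F 0 2 * F 1 0 * F 2 1 -
    F 0 0 * F 1 2 * F 2 1 - F 0 1 * F 1 0 * F 2 2 - F 0 2 * F 1 1 * F 2 0"
proof -
  have f12: "finite {1, 2::nat}" "0 \<notin> {1, 2::nat}" by auto
  have f2: "finite {2::nat}" "1 \<notin> {2::nat}" by auto
  have s3: "{0..<3} = {0, 1, 2::nat}" by auto
  have "Determinant.det (Matrix.mat 3 3 (\<lambda>(i, j). F i j)) =
      (\<Sum>p | p permutes {0, 1, 2}. of_int (sign p) * (\<Prod>i\<in>{0, 1, 2}. Matrix.mat 3 3 (\<lambda>(i, j). F i j) $$ (i, p i)))"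
    unfolding det_def'[OF mat_carrier] s3 ..
  also have "\<dots> = (\<Sum>p | p permutes {0, 1, 2}. of_int (sign p) * (\<Prod>i\<in>{0, 1, 2}. F i (p i)))"
  proof (intro sum.cong refl arg_cong2[where f = times] prod.cong)
    fix p i assume "p \<in> {p. p permutes {0, 1, 2::nat}}" "i \<in> {0, 1, 2::nat}"
    then have "p permutes {0, 1, 2}" "i \<in> {0, 1, 2}" by blast+
    then have "p i \<in> {0, 1, 2}" by (simp only: permutes_in_image)
    then show "Matrix.mat 3 3 (\<lambda>(i, j). F i j) $$ (i, p i) = F i (p i)" using \<open>i \<in> {0, 1, 2}\<close> by auto
  qed
  also have "\<dots> = F 0 0 * F 1 1 * F 2 2 + F 0 1 * F 1 2 * F 2 0 + F 0 2 * F 1 0 * F 2 1 -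
    F 0 0 * F 1 2 * F 2 1 - F 0 1 * F 1 0 * F 2 2 - F 0 2 * F 1 1 * F 2 0"
    unfolding sum_over_permutations_insert[OF f12] sum_over_permutations_insert[OF f2] permutes_sing
    by (simp add: sign_swap_id permutation_swap_id sign_compose sign_id Transposition.transpose_def)
  finally show ?thesis .
qed

text \<open>The identity is orthogonal to the trace-0 part, where the trace form is 3 times the
  polarised Hessian. With Hessian coefficients \<open>A\<close>, \<open>B\<close>, \<open>C\<close>
  the determinant is \<open>3 * 9 * (4 A C - B^2)\<close>, which is the origin of 27.\<close>

lemma disc_form_ring: "ring_disc 3 (form_ring f) = - 27 * fdisc f"
proof -
  obtain a b c d where f: "f = (a, b, c, d)" by (cases f)
  have zb: "zbasis 3 (form_ring f) tbasis" by (rule zbasis_tbasis[OF cring_form_ring]) simp_all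
  have tr: "trace_wrt 3 (form_ring f) tbasis x = 3 * fst x" for x
    using cring.zbasis_some(1)[OF cring_form_ring zb, of x] trace_form_ring[of f "fst x" "fst (snd x)" "snd (snd x)"] by simp
  have ent: "trace_wrt 3 (form_ring f) tbasis (tbasis i \<otimes>\<^bsub>form_ring f\<^esub> tbasis j) =
      (if i = 0 then if j = 0 then 3 else 0 else if j = 0 then 0 else
       if i = 1 then if j = 1 then 6 * (b^2 - a * c) else 3 * (b * c - a * d)
       else if j = 1 then 3 * (b * c - a * d) else 6 * (c^2 - b * d))" for i j
    unfolding tr by (simp add: tbasis_def f cmul_def)
  have "disc_wrt 3 (form_ring f) tbasis = 3 * (36 * ((b^2 - a * c) * (c^2 - b * d)) - 9 * (b * c - a * d)^2)"
    unfolding disc_wrt_def ent det_mat3 by (simp add: power2_eq_square algebra_simps)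
  then have "ring_disc 3 (form_ring f) = 3 * (36 * ((b^2 - a * c) * (c^2 - b * d)) - 9 * (b * c - a * d)^2)"
    using cring.zbasis_some(2)[OF cring_form_ring zb] by simp
  also have "\<dots> = - 27 * fdisc f" unfolding f fdisc_def prod.case by (simp add: algebra_simps power2_eq_square power3_eq_cube)
  finally show ?thesis .
qed

lemma form_ring_mem: "form_ring f \<in> Z_mat_cubic_rings (- 27 * D) \<longleftrightarrow> f \<in> forms D"
proof -
  have "rank_ring 3 (form_ring f)"
    unfolding cring.rank_ring_iff[OF cring_form_ring] using zbasis_tbasis[OF cring_form_ring, of f] by auto
  moreover have "3 dvd ring_trace 3 (form_ring f) x" for x by (cases x) (simp add: trace_form_ring)
  ultimately show ?thesis
    unfolding Z_mat_cubic_rings_def Z_mat_def forms_def mem_Collect_eq disc_form_ring by simp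
qed

text \<open>\<open>u\<close> generates the solutions with \<open>z = 0\<close>, the kernel of the
  primitive pair \<open>(a, b)\<close> when that pair is defined. By coprimality of
  \<open>g'\<close> and \<open>l'\<close> the possible \<open>z\<close> are the multiples of
  \<open>g'\<close>, and \<open>v\<close> lifts \<open>g'\<close> with the Bezout coefficients
  \<open>p\<close>, \<open>q\<close>.\<close>

lemma kernel_basis:
  fixes l0 l1 l2 :: int
  assumes "(l0, l1, l2) \<noteq> 0"
  obtains u v :: triple where
    "\<And>m n. (case smul3 m u + smul3 n v of (x, y, z) \<Rightarrow> l0 * x + l1 * y + l2 * z) = 0"
    "\<And>x y z. l0 * x + l1 * y + l2 * z = 0 \<Longrightarrow> \<exists>m n. (x, y, z) = smul3 m u + smul3 n v"
    "\<And>m n. smul3 m u + smul3 n v = 0 \<Longrightarrow> m = 0 \<and> n = 0"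
proof (cases "l0 = 0 \<and> l1 = 0")
  case True
  then have l2: "l2 \<noteq> 0" using assms by (simp add: zero_prod_def)
  show ?thesis
  proof (rule that[of "(1, 0, 0)" "(0, 1, 0)"])
    fix x y z assume "l0 * x + l1 * y + l2 * z = 0"
    then have "z = 0" using True l2 by simp
    then have "(x, y, z) = smul3 x (1, 0, 0) + smul3 y (0, 1, 0)" by (simp add: smul3_def)
    then show "\<exists>m n. (x, y, z) = smul3 m (1, 0, 0) + smul3 n (0, 1, 0)" by blast
  qed (simp_all add: True smul3_def zero_prod_def)
next
  case False
  define g where "g = gcd l0 l1"
  have g0: "g \<noteq> 0" using False by (simp add: g_def)
  have "g dvd l0" "g dvd l1" by (simp_all add: g_def)
  then obtain a b where ab: "l0 = g * a" "l1 = g * b" by (elim dvdE)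
  obtain p q where "p * l0 + q * l1 = g" unfolding g_def using bezout_int by blast
  then have "g * (p * a + q * b) = g * 1" unfolding ab by (simp add: algebra_simps)
  then have pq: "p * a + q * b = 1" using g0 by simp
  define k where "k = gcd g l2"
  have k0: "k \<noteq> 0" using g0 by (simp add: k_def)
  have "k dvd g" "k dvd l2" by (simp_all add: k_def)
  then obtain g' l' where gl: "g = k * g'" "l2 = k * l'" by (elim dvdE)
  have "gcd (k * g') (k * l') = k" by (simp only: gl[symmetric] k_def[symmetric])
  moreover have "k \<ge> 0" unfolding k_def by simp
  ultimately have "\<bar>k\<bar> * gcd g' l' = \<bar>k\<bar> * 1" by (simp add: gcd_mult_left)
  then have cop: "coprime g' l'" using k0 by (simp add: coprime_iff_gcd_eq_1)
  have g'0: "g' \<noteq> 0" using g0 gl(1) by (metis mult_zero_right)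
  let ?u = "(- b, a, 0) :: triple" and ?v = "(- (p * l'), - (q * l'), g') :: triple"
  show ?thesis
  proof (rule that[of ?u ?v])
    fix m n
    have "l0 * (m * - b + n * - (p * l')) + l1 * (m * a + n * - (q * l')) + l2 * (n * g') =
      k * g' * n * l' * (1 - (p * a + q * b))" unfolding ab gl(2) gl(1) by (simp add: algebra_simps)
    then show "(case smul3 m ?u + smul3 n ?v of (x, y, z) \<Rightarrow> l0 * x + l1 * y + l2 * z) = 0"
      unfolding pq by (simp add: smul3_def)
  next
    fix x y z assume e: "l0 * x + l1 * y + l2 * z = 0"
    then have "k * (g' * (a * x + b * y) + l' * z) = 0" unfolding ab gl(2) gl(1) by (simp add: algebra_simps)
    then have e': "g' * (a * x + b * y) + l' * z = 0" using k0 by simp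
    then have "l' * z = g' * - (a * x + b * y)" by (simp add: algebra_simps)
    then have "g' dvd l' * z" by (rule dvdI)
    then have "g' dvd z" using cop by (simp add: coprime_dvd_mult_right_iff)
    then obtain n where n: "z = g' * n" by (rule dvdE)
    have "g' * (a * x + b * y + l' * n) = 0" using e' unfolding n by (simp add: algebra_simps)
    then have h: "a * x + b * y = - (l' * n)" using g'0 by simp
    define xx where "xx = x + n * (p * l')"
    define yy where "yy = y + n * (q * l')"
    have "a * xx + b * yy = (a * x + b * y) + n * l' * (p * a + q * b)" by (simp add: xx_def yy_def algebra_simps)
    then have xy0: "a * xx + b * yy = 0" unfolding h pq by simp
    have "xx = (p * a + q * b) * xx - p * (a * xx + b * yy)" unfolding xy0 pq by simp
    then have 1: "xx = (p * yy - q * xx) * - b" by (simp add: algebra_simps)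
    have "yy = (p * a + q * b) * yy - q * (a * xx + b * yy)" unfolding xy0 pq by simp
    then have 2: "yy = (p * yy - q * xx) * a" by (simp add: algebra_simps)
    have "(x, y, z) = smul3 (p * yy - q * xx) ?u + smul3 n ?v"
      using 1 2 n unfolding xx_def[symmetric] by (simp add: smul3_def xx_def yy_def algebra_simps)
    then show "\<exists>m n. (x, y, z) = smul3 m ?u + smul3 n ?v" by blast
  next
    fix m n assume "smul3 m ?u + smul3 n ?v = 0"
    then have e: "m * - b + n * - (p * l') = 0" "m * a + n * - (q * l') = 0" "n * g' = 0"
      by (simp_all add: smul3_def zero_prod_def)
    then have n0: "n = 0" using g'0 by simp
    then have ma: "m * b = 0" "m * a = 0" using e by simp_all
    have "p * (m * a) + q * (m * b) = 0" unfolding ma by simp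
    then have "m * (p * a + q * b) = 0" by (simp only: algebra_simps)
    then show "m = 0 \<and> n = 0" using n0 pq by simp
  qed
qed

text \<open>The products of the last two basis vectors have nine coordinates. That these vectors
  have trace 0 gives two linear relations, associativity of two triple products expresses the three
  constant terms, and the four remaining numbers are the coefficients of a form.\<close>

lemma triple_ring_form:
  fixes R :: "triple ring"
  assumes R: "cring R" and car: "carrier R = UNIV" and add: "\<And>x y. x \<oplus>\<^bsub>R\<^esub> y = x + y"
    and one: "\<one>\<^bsub>R\<^esub> = (1, 0, 0)" and tr: "\<And>x. ring_trace 3 R x = 3 * fst x"
  shows "\<exists>f. \<forall>x y. x \<otimes>\<^bsub>R\<^esub> y = cmul f x y"
proof -
  interpret R: cring R by fact
  let ?e = "(0, 1, 0) :: triple" and ?h = "(0, 0, 1) :: triple"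
  have comm: "x \<otimes>\<^bsub>R\<^esub> y = y \<otimes>\<^bsub>R\<^esub> x" for x y using R.m_comm[of x y] by (simp add: car)
  have assoc: "(x \<otimes>\<^bsub>R\<^esub> y) \<otimes>\<^bsub>R\<^esub> z = x \<otimes>\<^bsub>R\<^esub> (y \<otimes>\<^bsub>R\<^esub> z)" for x y z using R.m_assoc[of x y z] by (simp add: car)
  have ldist: "(x + y) \<otimes>\<^bsub>R\<^esub> z = x \<otimes>\<^bsub>R\<^esub> z + y \<otimes>\<^bsub>R\<^esub> z" for x y z using R.l_distr[of x y z] by (simp add: car add)
  have rdist: "z \<otimes>\<^bsub>R\<^esub> (x + y) = z \<otimes>\<^bsub>R\<^esub> x + z \<otimes>\<^bsub>R\<^esub> y" for x y z using R.r_distr[of x y z] by (simp add: car add)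
  have ones: "(1, 0, 0) \<otimes>\<^bsub>R\<^esub> x = x" "x \<otimes>\<^bsub>R\<^esub> (1, 0, 0) = x" for x
    using R.l_one[of x] R.r_one[of x] unfolding car one by simp_all
  obtain p q r where e11: "?e \<otimes>\<^bsub>R\<^esub> ?e = (p, q, r)" by (cases "?e \<otimes>\<^bsub>R\<^esub> ?e")
  obtain s t u where e12: "?e \<otimes>\<^bsub>R\<^esub> ?h = (s, t, u)" by (cases "?e \<otimes>\<^bsub>R\<^esub> ?h")
  obtain v w z where e22: "?h \<otimes>\<^bsub>R\<^esub> ?h = (v, w, z)" by (cases "?h \<otimes>\<^bsub>R\<^esub> ?h")
  have e21: "?h \<otimes>\<^bsub>R\<^esub> ?e = (s, t, u)" using e12 comm by simp
  have "q + u = 0" using tr[of ?e] unfolding trace_tbasis[OF R car add] ones e11 e12 by simp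
  then have q: "q = - u" by simp
  have "t + z = 0" using tr[of ?h] unfolding trace_tbasis[OF R car add] ones e21 e22 by simp
  then have t: "t = - z" by simp
  have xe: "(x0, x1, x2) \<otimes>\<^bsub>R\<^esub> y = smul3 x0 y + smul3 x1 (?e \<otimes>\<^bsub>R\<^esub> y) + smul3 x2 (?h \<otimes>\<^bsub>R\<^esub> y)" for x0 x1 x2 y
    using additive_triple[of "\<lambda>x. x \<otimes>\<^bsub>R\<^esub> y" x0 x1 x2] ldist ones by simp
  have ey: "x \<otimes>\<^bsub>R\<^esub> (y0, y1, y2) = smul3 y0 x + smul3 y1 (x \<otimes>\<^bsub>R\<^esub> ?e) + smul3 y2 (x \<otimes>\<^bsub>R\<^esub> ?h)" for x y0 y1 y2
    using additive_triple[of "\<lambda>y. x \<otimes>\<^bsub>R\<^esub> y" y0 y1 y2] rdist ones by simp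
  have "smul3 p ?h + smul3 q (s, t, u) + smul3 r (v, w, z) = (p, q, r) \<otimes>\<^bsub>R\<^esub> ?h"
    unfolding xe[of p q r] e12 e22 ..
  also have "\<dots> = ?e \<otimes>\<^bsub>R\<^esub> (s, t, u)" unfolding e11[symmetric] e12[symmetric] assoc ..
  also have "\<dots> = smul3 s ?e + smul3 t (p, q, r) + smul3 u (s, t, u)" unfolding ey[of _ s t u] e11 e12 ..
  finally have 1: "q * t + r * w = s + t * q + u * t" "p + q * u + r * z = t * r + u * u"
    by (simp_all add: smul3_def)
  have "smul3 s ?h + smul3 t (s, t, u) + smul3 u (v, w, z) = (s, t, u) \<otimes>\<^bsub>R\<^esub> ?h"
    unfolding xe[of s t u] e12 e22 ..
  also have "\<dots> = ?e \<otimes>\<^bsub>R\<^esub> (v, w, z)" unfolding e12[symmetric] e22[symmetric] assoc ..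
  also have "\<dots> = smul3 v ?e + smul3 w (p, q, r) + smul3 z (s, t, u)" unfolding ey[of _ v w z] e11 e12 ..
  finally have 2: "t * t + u * w = v + w * q + z * t" by (simp add: smul3_def)
  have s: "s = u * z - r * - w" using 1(1) unfolding q t by (simp add: algebra_simps)
  have p: "p = 2 * (u^2 - r * z)" using 1(2) unfolding q t by (simp add: algebra_simps power2_eq_square)
  have v: "v = 2 * (z^2 - u * - w)" using 2 unfolding q t by (simp add: algebra_simps power2_eq_square)
  show ?thesis
  proof (intro exI[of _ "(r, u, z, - w)"] allI)
    fix x y :: triple
    obtain x0 x1 x2 y0 y1 y2 where xy: "x = (x0, x1, x2)" "y = (y0, y1, y2)" by (cases x, cases y)
    show "x \<otimes>\<^bsub>R\<^esub> y = cmul (r, u, z, - w) x y"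
      unfolding xy xe[of x0 x1 x2] ey[of ?e y0 y1 y2] ey[of ?h y0 y1 y2] e11 e12 e21 e22 p s v q t
      by (simp add: smul3_def cmul_def algebra_simps)
  qed
qed

text \<open>A third of the trace is an integral linear functional with value 1 at the identity, so
  it splits the ring into the integers and its kernel. A basis of the kernel transports the ring to
  triples, with trace 3 times the first coordinate.\<close>

lemma Z_mat_ring_form:
  assumes "C \<in> Z_mat_cubic_rings (- 27 * D)"
  shows "\<exists>f\<in>forms D. ring_iso C (form_ring f) \<noteq> {}"
proof -
  have rk: "rank_ring 3 C" and tr3: "\<And>x. x \<in> carrier C \<Longrightarrow> 3 dvd ring_trace 3 C x" and disc: "ring_disc 3 C = - 27 * D"
    using assms by (auto simp: Z_mat_cubic_rings_def Z_mat_def)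
  interpret C: cring C using rk by (simp add: rank_ring_def)
  obtain b where zb: "zbasis 3 C b" using rk C.rank_ring_iff by blast
  interpret Z: zbased C 3 b using zb by unfold_locales
  have trw: "ring_trace 3 C x = trace_wrt 3 C b x" if "x \<in> carrier C" for x by (rule C.zbasis_some(1)[OF zb that])
  define l where "l x = ring_trace 3 C x div 3" for x
  have l3: "ring_trace 3 C x = 3 * l x" if "x \<in> carrier C" for x
    using tr3[OF that] by (simp add: l_def)
  have ladd: "l (x \<oplus>\<^bsub>C\<^esub> y) = l x + l y" if "x \<in> carrier C" "y \<in> carrier C" for x y
  proof -
    have "ring_trace 3 C (x \<oplus>\<^bsub>C\<^esub> y) = ring_trace 3 C x + ring_trace 3 C y"
      using that trw Z.trace_add by simp
    then show ?thesis using l3 that by simp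
  qed
  have lone: "l \<one>\<^bsub>C\<^esub> = 1" using l3[OF C.one_closed] trw[OF C.one_closed] Z.trace_one by simp
  have l012: "{..<3::nat} = {0, 1, 2}" by auto
  define fn :: "triple \<Rightarrow> nat \<Rightarrow> int" where
    "fn v i = (if i = 0 then fst v else if i = 1 then fst (snd v) else snd (snd v))" for v i
  define Zc where "Zc v = zcomb 3 C b (fn v)" for v
  have Zc_in: "Zc v \<in> carrier C" for v unfolding Zc_def by (rule Z.zcomb_in)
  have Zc_add: "Zc (v + w) = Zc v \<oplus>\<^bsub>C\<^esub> Zc w" for v w
  proof -
    have "fn (v + w) = (\<lambda>i. fn v i + fn w i)" by (simp add: fn_def fun_eq_iff)
    then show ?thesis unfolding Zc_def using Z.zcomb_add by simp
  qed
  have co_Zc: "Z.co (Zc v) 0 = fst v" "Z.co (Zc v) 1 = fst (snd v)" "Z.co (Zc v) 2 = snd (snd v)" for v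
    unfolding Zc_def by (simp_all add: Z.co_zcomb fn_def)
  have Zc_co: "Zc (Z.co x 0, Z.co x 1, Z.co x 2) = x" if x: "x \<in> carrier C" for x
  proof (rule Z.co_eqI[OF Zc_in x])
    fix i :: nat assume "i < 3"
    then have "i \<in> {0, 1, 2}" using l012 by blast
    then show "Z.co (Zc (Z.co x 0, Z.co x 1, Z.co x 2)) i = Z.co x i"
      using co_Zc[of "(Z.co x 0, Z.co x 1, Z.co x 2)"] by auto
  qed
  define l0 where "l0 = l (b 0)"
  define l1 where "l1 = l (b 1)"
  define l2 where "l2 = l (b 2)"
  define ll :: "triple \<Rightarrow> int" where "ll = (\<lambda>(x, y, z). l0 * x + l1 * y + l2 * z)"
  have lZ: "l (Zc v) = ll v" for v
    using Z.additive_expand[of l "Zc v"] ladd Zc_in co_Zc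
    by (simp add: l012 ll_def split_def l0_def l1_def l2_def mult.commute)
  define e :: triple where "e = (Z.co \<one>\<^bsub>C\<^esub> 0, Z.co \<one>\<^bsub>C\<^esub> 1, Z.co \<one>\<^bsub>C\<^esub> 2)"
  have Ze: "Zc e = \<one>\<^bsub>C\<^esub>" unfolding e_def by (rule Zc_co) simp
  have lle: "ll e = 1" using lZ[of e] Ze lone by simp
  then have "(l0, l1, l2) \<noteq> 0" by (auto simp: ll_def zero_prod_def split_def)
  then obtain u v where uv: "\<And>m n. ll (smul3 m u + smul3 n v) = 0"
    "\<And>x. ll x = 0 \<Longrightarrow> \<exists>m n. x = smul3 m u + smul3 n v"
    "\<And>m n. smul3 m u + smul3 n v = 0 \<Longrightarrow> m = 0 \<and> n = 0"
    by (rule kernel_basis) (force simp: ll_def)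
  have ll_add: "ll (x + y) = ll x + ll y" for x y by (simp add: ll_def split_def algebra_simps)
  have ll_smul: "ll (smul3 k x) = k * ll x" for k x by (simp add: ll_def smul3_def split_def algebra_simps)
  have smul_add: "smul3 (k + m) x = smul3 k x + smul3 m x" for k m x
    by (cases x) (simp add: smul3_def algebra_simps)
  \<comment> \<open>Coordinates adapted to the splitting: the multiple of the identity
    \<open>e\<close>, then the coefficients in the kernel basis \<open>u\<close>,
    \<open>v\<close>.\<close>
  define L where "L = (\<lambda>(x0, x1, x2). smul3 x0 e + (smul3 x1 u + smul3 x2 v))"
  have L_add: "L (x + y) = L x + L y" for x y
    by (cases x; cases y) (simp add: L_def smul_add algebra_simps)
  have llL: "ll (L x) = fst x" for x
    by (cases x) (simp add: L_def ll_add[of "smul3 _ e"] ll_smul lle uv(1))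
  have L0: "x = 0" if "L x = 0" for x
  proof -
    obtain x0 x1 x2 where x: "x = (x0, x1, x2)" by (cases x)
    have "ll 0 = 0" by (simp add: ll_def zero_prod_def)
    then have x0: "x0 = 0" using llL[of x] that x by simp
    then have "smul3 x1 u + smul3 x2 v = 0" using that unfolding x L_def by (simp add: smul3_def split_def flip: zero_prod_def)
    then show ?thesis using uv(3) x x0 by (simp add: zero_prod_def)
  qed
  have L_inj: "x = y" if "L x = L y" for x y
    using L0[of "x - y"] L_add[of "x - y" y] that by simp
  have L_surj: "\<exists>y. L y = x" for x
  proof -
    have "smul3 (ll x) e + (x - smul3 (ll x) e) = x" by simp
    then have "ll (x - smul3 (ll x) e) = 0" using ll_add[of "smul3 (ll x) e" "x - smul3 (ll x) e"] by (simp add: ll_smul lle)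
    then obtain m n where "x - smul3 (ll x) e = smul3 m u + smul3 n v" using uv(2) by blast
    then have "L (ll x, m, n) = x" by (simp add: L_def algebra_simps)
    then show ?thesis by blast
  qed
  have bij: "bij_betw (\<lambda>x. Zc (L x)) UNIV (carrier C)"
  proof (rule bij_betwI')
    fix x y
    have "v = (Z.co (Zc v) 0, Z.co (Zc v) 1, Z.co (Zc v) 2)" for v unfolding co_Zc by simp
    then have "L x = L y" if "Zc (L x) = Zc (L y)" using that by metis
    then show "(Zc (L x) = Zc (L y)) = (x = y)" using L_inj by blast
  next
    fix y assume "y \<in> carrier C"
    then show "\<exists>x\<in>UNIV. y = Zc (L x)" using Zc_co[of y] L_surj by (metis UNIV_I)
  qed (rule Zc_in)
  define \<psi> where "\<psi> x = Zc (L x)" for x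
  define \<kappa> where "\<kappa> = the_inv_into UNIV \<psi>"
  have \<psi>: "bij_betw \<psi> UNIV (carrier C)" using bij by (simp add: \<psi>_def[abs_def])
  have \<psi>\<kappa>: "\<psi> (\<kappa> y) = y" if "y \<in> carrier C" for y
    unfolding \<kappa>_def using f_the_inv_into_f_bij_betw[OF \<psi>] that by blast
  have \<kappa>\<psi>: "\<kappa> (\<psi> x) = x" for x
    unfolding \<kappa>_def by (rule the_inv_into_f_f) (use \<psi> in \<open>auto simp: bij_betw_def\<close>)
  have \<psi>_in: "\<psi> x \<in> carrier C" for x unfolding \<psi>_def by (rule Zc_in)
  have \<psi>_add: "\<psi> (x + y) = \<psi> x \<oplus>\<^bsub>C\<^esub> \<psi> y" for x y by (simp add: \<psi>_def L_add Zc_add)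
  have L1: "L (1, 0, 0) = e" by (cases e; cases u; cases v) (simp add: L_def smul3_def)
  have \<psi>_one: "\<psi> (1, 0, 0) = \<one>\<^bsub>C\<^esub>" by (simp add: \<psi>_def L1 Ze)
  \<comment> \<open>The zero is written as the image of the zero of \<open>C\<close>, so that
    transport of the ring structure, which overrides this field, returns \<open>S\<close>
    itself.\<close>
  define S :: "triple ring" where
    "S = \<lparr>carrier = UNIV, monoid.mult = (\<lambda>x y. \<kappa> (\<psi> x \<otimes>\<^bsub>C\<^esub> \<psi> y)), monoid.one = (1, 0, 0), ring.zero = \<kappa> \<zero>\<^bsub>C\<^esub>, ring.add = (+)\<rparr>"
  have S: "carrier S = UNIV" "x \<oplus>\<^bsub>S\<^esub> y = x + y" "x \<otimes>\<^bsub>S\<^esub> y = \<kappa> (\<psi> x \<otimes>\<^bsub>C\<^esub> \<psi> y)" "\<one>\<^bsub>S\<^esub> = (1, 0, 0)" "S\<lparr>ring.zero := \<kappa> \<zero>\<^bsub>C\<^esub>\<rparr> = S" for x y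
    by (simp_all add: S_def)
  have \<kappa>_bij: "bij_betw \<kappa> (carrier C) UNIV" unfolding \<kappa>_def by (rule bij_betw_the_inv_into[OF \<psi>])
  have \<kappa>_add: "\<kappa> (x \<oplus>\<^bsub>C\<^esub> y) = \<kappa> x + \<kappa> y" if "x \<in> carrier C" "y \<in> carrier C" for x y
    using \<psi>_add[of "\<kappa> x" "\<kappa> y"] \<psi>\<kappa> \<kappa>\<psi> that by metis
  have iso: "\<kappa> \<in> ring_iso C S"
  proof (rule ring_iso_memI)
    show "\<kappa> \<one>\<^bsub>C\<^esub> = \<one>\<^bsub>S\<^esub>" unfolding S \<psi>_one[symmetric] \<kappa>\<psi> ..
    show "bij_betw \<kappa> (carrier C) (carrier S)" unfolding S by (rule \<kappa>_bij)
  qed (simp_all add: S \<psi>\<kappa> \<kappa>_add)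
  have crS: "cring S" using C.ring_iso_imp_img_cring[OF iso] unfolding S(5) .
  have trS: "ring_trace 3 S x = 3 * fst x" for x
  proof -
    have "ring_trace 3 S (\<kappa> (\<psi> x)) = 3 * l (\<psi> x)"
      using iso_transport(2)[OF C.is_cring crS iso zb \<psi>_in] l3[OF \<psi>_in] by simp
    moreover have "l (\<psi> x) = fst x" unfolding \<psi>_def lZ llL ..
    ultimately show ?thesis unfolding \<kappa>\<psi> by simp
  qed
  obtain f where f: "\<forall>x y. x \<otimes>\<^bsub>S\<^esub> y = cmul f x y" using triple_ring_form[OF crS S(1) S(2) S(4) trS] by (rule exE)
  have iso': "\<kappa> \<in> ring_iso C (form_ring f)"
  proof (rule ring_iso_memI)
    fix x y assume xy: "x \<in> carrier C" "y \<in> carrier C"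
    show "\<kappa> (x \<otimes>\<^bsub>C\<^esub> y) = \<kappa> x \<otimes>\<^bsub>form_ring f\<^esub> \<kappa> y"
      using ring_iso_memE(2)[OF iso xy] f by simp
    show "\<kappa> (x \<oplus>\<^bsub>C\<^esub> y) = \<kappa> x \<oplus>\<^bsub>form_ring f\<^esub> \<kappa> y" using \<kappa>_add[OF xy] by simp
  next
    show "\<kappa> \<one>\<^bsub>C\<^esub> = \<one>\<^bsub>form_ring f\<^esub>" using ring_iso_memE(4)[OF iso] by (simp add: S)
    show "bij_betw \<kappa> (carrier C) (carrier (form_ring f))" using \<kappa>_bij by simp
  qed simp
  have "- 27 * fdisc f = - 27 * D"
    using iso_transport(3)[OF C.is_cring cring_form_ring iso' zb] disc disc_form_ring by simp
  then have "f \<in> forms D" by (simp add: forms_def)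
  then show ?thesis using iso' by blast
qed

section \<open>Isomorphisms of form rings as integral matrices\<close>

definition lin :: "quadruple \<Rightarrow> triple \<Rightarrow> triple" where
  "lin = (\<lambda>(p, q, r, s) (x0, x1, x2). (x0, p * x1 + q * x2, r * x1 + s * x2))"

lemma lin_mmul: "lin (mmul M N) x = lin M (lin N x)"
  by (cases M; cases N; cases x) (simp add: lin_def mmul_def algebra_simps)

lemma lin_mone: "lin mone x = x"
  by (cases x) (simp add: lin_def mone_def)

lemma lin_add: "lin M (x + y) = lin M x + lin M y"
  by (cases M; cases x; cases y) (simp add: lin_def algebra_simps)

lemma lin_one: "lin M (1, 0, 0) = (1, 0, 0)"
  by (cases M) (simp add: lin_def)

lemma lin_inj: "(\<And>x. lin M x = lin N x) \<Longrightarrow> M = N"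
proof -
  assume a: "\<And>x. lin M x = lin N x"
  obtain p q r s p' q' r' s' where MN: "M = (p, q, r, s)" "N = (p', q', r', s')" by (cases M, cases N)
  show ?thesis using a[of "(0, 1, 0)"] a[of "(0, 0, 1)"] by (simp add: MN lin_def)
qed

text \<open>For elements of trace \<open>0\<close>, the value of the trilinear form at \<open>x\<close>, \<open>y\<close>, \<open>z\<close> is the determinant
  of \<open>z\<close> and the trace-\<open>0\<close> part of \<open>x y\<close>.\<close>

lemma cmul_tri:
  assumes "hess f = (A, B, C)"
  shows "cmul f (x0, x1, x2) (y0, y1, y2) =
    (x0 * y0 + (2 * A * (x1 * y1) + B * (x1 * y2 + x2 * y1) + 2 * C * (x2 * y2)),
     x0 * y1 + x1 * y0 - tri f x1 x2 y1 y2 0 1, x0 * y2 + x2 * y0 + tri f x1 x2 y1 y2 1 0)"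
proof -
  obtain a b c d where f: "f = (a, b, c, d)" by (cases f)
  have e: "A = b^2 - a * c" "B = b * c - a * d" "C = c^2 - b * d" using assms by (auto simp: f hess_def)
  show ?thesis unfolding f e by (simp add: cmul_def tri_def algebra_simps)
qed

text \<open>The first coordinates agree by covariance of the Hessian. For the others
  \<open>cmul_tri\<close> describes a product by its determinant pairing with a third vector;
  invariance of \<open>tri\<close> up to the sign \<epsilon> gives two linear equations for
  \<open>U1\<close>, \<open>U2\<close>, solved with the adjugate matrix.\<close>

lemma lin_cmul:
  assumes M: "M \<in> HGL f f'"
  shows "lin M (cmul f x y) = cmul f' (lin M x) (lin M y)"
proof -
  obtain p q r s where Me: "M = (p, q, r, s)" by (cases M)
  obtain x0 x1 x2 y0 y1 y2 where xy: "x = (x0, x1, x2)" "y = (y0, y1, y2)" by (cases x, cases y)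
  define \<epsilon> where "\<epsilon> = p * s - q * r"
  have e: "\<epsilon> = 1 \<or> \<epsilon> = -1" and act: "act (p, q, r, s) f' = fscale \<epsilon> f"
    using M by (auto simp: HGL_def Me mdet_def \<epsilon>_def)
  obtain A B C where h': "hess f' = (A, B, C)" by (cases "hess f'")
  have e2: "(p * s - q * r)^2 = 1" using e by (auto simp: \<epsilon>_def)
  have h: "hess f = (A * p^2 + B * p * r + C * r^2, 2 * A * p * q + B * (p * s + q * r) + 2 * C * r * s, A * q^2 + B * q * s + C * s^2)"
    using hess_act[OF h', of p q r s] hess_fscale[OF e, of f] unfolding act e2 by simp
  have ts: "tri (fscale \<epsilon> f) a a' b b' c c' = \<epsilon> * tri f a a' b b' c c'" for a a' b b' c c'
    by (cases f) (simp add: tri_def fscale_def algebra_simps)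
  define X1 where "X1 = p * x1 + q * x2"
  define X2 where "X2 = r * x1 + s * x2"
  define Y1 where "Y1 = p * y1 + q * y2"
  define Y2 where "Y2 = r * y1 + s * y2"
  define T1 where "T1 = tri f x1 x2 y1 y2 1 0"
  define T2 where "T2 = tri f x1 x2 y1 y2 0 1"
  define U1 where "U1 = tri f' X1 X2 Y1 Y2 1 0"
  define U2 where "U2 = tri f' X1 X2 Y1 Y2 0 1"
  have U: "tri f' X1 X2 Y1 Y2 z z' = z * U1 + z' * U2" for z z'
    unfolding U1_def U2_def by (cases f') (simp add: tri_def algebra_simps)
  have key: "\<epsilon> * tri f x1 x2 y1 y2 z z' = (p * z + q * z') * U1 + (r * z + s * z') * U2" for z z'
    unfolding ts[symmetric] act[symmetric] tri_act X1_def[symmetric] X2_def[symmetric] Y1_def[symmetric] Y2_def[symmetric] U ..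
  have k1: "\<epsilon> * T1 = p * U1 + r * U2" and k2: "\<epsilon> * T2 = q * U1 + s * U2"
    using key[of 1 0] key[of 0 1] by (simp_all add: T1_def T2_def)
  have "\<epsilon> * (s * T1 - r * T2) = s * (\<epsilon> * T1) - r * (\<epsilon> * T2)" "\<epsilon> * (p * T2 - q * T1) = p * (\<epsilon> * T2) - q * (\<epsilon> * T1)"
    by (simp_all add: algebra_simps)
  then have "\<epsilon> * (s * T1 - r * T2) = \<epsilon> * U1" "\<epsilon> * (p * T2 - q * T1) = \<epsilon> * U2"
    unfolding k1 k2 unfolding \<epsilon>_def by (simp_all add: algebra_simps)
  then have u: "U1 = s * T1 - r * T2" "U2 = p * T2 - q * T1" using e by auto
  show ?thesis
    unfolding xy Me cmul_tri[OF h] lin_def prod.case cmul_tri[OF h'] X1_def[symmetric] X2_def[symmetric] Y1_def[symmetric] Y2_def[symmetric]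
      T1_def[symmetric] T2_def[symmetric] U1_def[symmetric] U2_def[symmetric] u prod.inject
    by (intro conjI; simp add: X1_def X2_def Y1_def Y2_def algebra_simps power2_eq_square)
qed

lemma lin_iso:
  assumes M: "M \<in> HGL f f'"
  shows "lin M \<in> ring_iso (form_ring f) (form_ring f')"
proof (rule ring_iso_memI)
  have d: "mdet M = 1 \<or> mdet M = -1" using M by (simp add: HGL_def)
  show "bij_betw (lin M) (carrier (form_ring f)) (carrier (form_ring f'))"
    by (rule bij_betw_byWitness[where f' = "lin (minv M)"])
      (simp_all add: mmul_minv[OF d] lin_mone flip: lin_mmul)
qed (simp_all add: lin_cmul[OF M] lin_add lin_one)

text \<open>Isomorphisms preserve the trace, that is the first coordinate, so they have the shape
  \<open>lin M\<close>. Preimages of the basis vectors supply an integral inverse and hence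
  determinant 1 or -1; comparing products through \<open>cmul_tri\<close> gives the transformation
  law of the forms.\<close>

lemma iso_lin:
  assumes h: "h \<in> ring_iso (form_ring f) (form_ring f')"
  obtains M where "M \<in> HGL f f'" "h = lin M"
proof -
  have add: "h (x + y) = h x + h y" and mul: "h (cmul f x y) = cmul f' (h x) (h y)" for x y
    using ring_iso_memE(2,3)[OF h, of x y] by simp_all
  have h1: "h (1, 0, 0) = (1, 0, 0)" using ring_iso_memE(4)[OF h] by simp
  have zb: "zbasis 3 (form_ring f) tbasis" by (rule zbasis_tbasis[OF cring_form_ring]) simp_all
  have tr: "fst (h x) = fst x" for x
    using iso_transport(2)[OF cring_form_ring cring_form_ring h zb, of x]
      trace_form_ring[of f "fst x" "fst (snd x)" "snd (snd x)"] trace_form_ring[of f' "fst (h x)" "fst (snd (h x))" "snd (snd (h x))"] by simp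
  define p q r s where "p = fst (snd (h (0, 1, 0)))" and "q = fst (snd (h (0, 0, 1)))"
    and "r = snd (snd (h (0, 1, 0)))" and "s = snd (snd (h (0, 0, 1)))"
  then have pr: "h (0, 1, 0) = (0, p, r)" and qs: "h (0, 0, 1) = (0, q, s)" by (simp_all add: prod_eq_iff tr)
  have hl: "h = lin (p, q, r, s)"
  proof
    fix x :: triple
    obtain x0 x1 x2 where x: "x = (x0, x1, x2)" by (cases x)
    show "h x = lin (p, q, r, s) x"
      unfolding x additive_triple[of h, OF add, of x0 x1 x2] h1 pr qs by (simp add: smul3_def lin_def mult.commute)
  qed
  have "bij h" using ring_iso_memE(5)[OF h] by simp
  then have surj: "h (inv_into UNIV h y) = y" for y by (rule surj_f_inv_f[OF bij_is_surj])
  obtain a0 a1 a2 where a: "inv_into UNIV h (0, 1, 0) = (a0, a1, a2)" by (cases "inv_into UNIV h (0, 1, 0)")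
  obtain c0 c1 c2 where c: "inv_into UNIV h (0, 0, 1) = (c0, c1, c2)" by (cases "inv_into UNIV h (0, 0, 1)")
  have "lin (p, q, r, s) (a0, a1, a2) = (0, 1, 0)" "lin (p, q, r, s) (c0, c1, c2) = (0, 0, 1)"
    using surj[of "(0, 1, 0)"] surj[of "(0, 0, 1)"] unfolding a c unfolding hl .
  then have "mmul (p, q, r, s) (a1, c1, a2, c2) = mone" by (simp add: lin_def mmul_def mone_def)
  then have "mdet (p, q, r, s) * mdet (a1, c1, a2, c2) = 1" unfolding mdet_mmul[symmetric] by (simp add: mmul_mone)
  then have d: "mdet (p, q, r, s) = 1 \<or> mdet (p, q, r, s) = -1" unfolding zmult_eq_1_iff by blast
  obtain A B C where hf: "hess f = (A, B, C)" by (cases "hess f")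
  obtain A' B' C' where hf': "hess f' = (A', B', C')" by (cases "hess f'")
  have key: "tri f' (p * x + q * x') (r * x + s * x') (p * y + q * y') (r * y + s * y') (p * z + q * z') (r * z + s * z') =
      (p * s - q * r) * tri f x x' y y' z z'" for x x' y y' z z'
  proof -
    let ?T = "\<lambda>z z'. tri f x x' y y' z z'"
    let ?U = "\<lambda>z z'. tri f' (p * x + q * x') (r * x + s * x') (p * y + q * y') (r * y + s * y') z z'"
    have "- ?U 0 1 = p * - ?T 0 1 + q * ?T 1 0" "?U 1 0 = r * - ?T 0 1 + s * ?T 1 0"
      using mul[of "(0, x, x')" "(0, y, y')"] unfolding hl cmul_tri[OF hf] unfolding lin_def prod.case cmul_tri[OF hf'] prod.inject
      by simp_all
    then have u: "?U 0 1 = p * ?T 0 1 - q * ?T 1 0" "?U 1 0 = s * ?T 1 0 - r * ?T 0 1" by simp_all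
    have T: "tri f x x' y y' z z' = z * ?T 1 0 + z' * ?T 0 1" for z z'
      by (cases f) (simp add: tri_def algebra_simps)
    have U: "?U w w' = w * ?U 1 0 + w' * ?U 0 1" for w w'
      by (cases f') (simp add: tri_def algebra_simps)
    show ?thesis unfolding U[of "p * z + q * z'"] u T[of z z'] by (simp add: algebra_simps)
  qed
  obtain a b c d where fe: "f = (a, b, c, d)" by (cases f)
  have t: "tri (a, b, c, d) 1 0 1 0 1 0 = a" "tri (a, b, c, d) 1 0 1 0 0 1 = b" "tri (a, b, c, d) 1 0 0 1 0 1 = c"
    "tri (a, b, c, d) 0 1 0 1 0 1 = d" by (simp_all add: tri_def)
  have "act (p, q, r, s) f' = fscale (mdet (p, q, r, s)) f"
    using key[of 1 0 1 0 1 0] key[of 1 0 1 0 0 1] key[of 1 0 0 1 0 1] key[of 0 1 0 1 0 1]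
    unfolding fe by (simp add: act_def fscale_def mdet_def t)
  then have "(p, q, r, s) \<in> HGL f f'" using d by (intro HGL_I)
  then show ?thesis using that hl by blast
qed

text \<open>Extends \<open>ring_Aut\<close> to maps between different rings; extensionality again
  prevents counting one map twice.\<close>

definition Hring :: "('a, 'm) ring_scheme \<Rightarrow> ('b, 'n) ring_scheme \<Rightarrow> ('a \<Rightarrow> 'b) set" where
  "Hring C D = ring_iso C D \<inter> extensional (carrier C)"

text \<open>After a choice of isomorphisms \<open>g\<close>, \<open>g'\<close> to form rings,
  \<open>h\<close> corresponds to the matrix \<open>M\<close> with
  \<open>g' (h x) = lin M (g x)\<close>. \<open>iso_lin\<close> and \<open>lin_iso\<close> give
  existence in the two directions, \<open>lin_inj\<close> and extensionality give
  uniqueness.\<close>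

lemma mass_Hring: "mass (Z_mat_cubic_rings (- 27 * D)) Hring = mass (forms D) HGL"
proof (rule mass_transfer[OF hom_groupoid.weighted[OF HGL_groupoid], where R = "\<lambda>C f. ring_iso C (form_ring f) \<noteq> {}"])
  fix C assume "C \<in> Z_mat_cubic_rings (- 27 * D)"
  then show "\<exists>f\<in>forms D. ring_iso C (form_ring f) \<noteq> {}" by (rule Z_mat_ring_form)
next
  fix f assume "f \<in> forms D"
  then show "\<exists>C\<in>Z_mat_cubic_rings (- 27 * D). ring_iso C (form_ring f) \<noteq> {}"
    using form_ring_mem[of f D] ring_iso_set_refl[of "form_ring f"] by blast
next
  fix C f C' f'
  assume C: "C \<in> Z_mat_cubic_rings (- 27 * D)" and C': "C' \<in> Z_mat_cubic_rings (- 27 * D)"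
    and R: "ring_iso C (form_ring f) \<noteq> {}" "ring_iso C' (form_ring f') \<noteq> {}"
  obtain g g' where g: "g \<in> ring_iso C (form_ring f)" and g': "g' \<in> ring_iso C' (form_ring f')" using R by blast
  have rC: "cring C" "cring C'" using C C' by (simp_all add: Z_mat_cubic_rings_def rank_ring_def)
  have ri: "ring C" "ring C'" using rC by (simp_all add: cring.axioms(1))
  have bg: "bij_betw g (carrier C) UNIV" "bij_betw g' (carrier C') UNIV"
    using ring_iso_memE(5)[OF g] ring_iso_memE(5)[OF g'] by simp_all
  let ?i = "inv_into (carrier C) g" and ?i' = "inv_into (carrier C') g'"
  have i: "?i \<in> ring_iso (form_ring f) C" "?i' \<in> ring_iso (form_ring f') C'"
    using ring_iso_set_sym[OF ri(1) g] ring_iso_set_sym[OF ri(2) g'] by blast+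
  have gi: "g (?i x) = x" "g' (?i' x) = x" for x using bg by (simp_all add: bij_betw_inv_into_right)
  have ig: "x \<in> carrier C \<Longrightarrow> ?i (g x) = x" for x using bg by (simp add: bij_betw_inv_into_left)
  have inC: "?i x \<in> carrier C" for x using ring_iso_memE(1)[OF i(1), of x] by simp
  have inj': "x \<in> carrier C' \<Longrightarrow> y \<in> carrier C' \<Longrightarrow> g' x = g' y \<Longrightarrow> x = y" for x y
    using bg(2) by (simp add: bij_betw_def inj_on_def)
  show "(Hring C C' = {} \<longleftrightarrow> HGL f f' = {}) \<and> card (Hring C C') = card (HGL f f')"
  proof (rule bij_rel_card[where P = "\<lambda>h M. \<forall>x\<in>carrier C. g' (h x) = lin M (g x)"])
    fix h assume "h \<in> Hring C C'"
    then have h: "h \<in> ring_iso C C'" by (simp add: Hring_def)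
    have "g' \<circ> (h \<circ> ?i) \<in> ring_iso (form_ring f) (form_ring f')"
      by (rule ring_iso_set_trans[OF ring_iso_set_trans[OF i(1) h] g'])
    then obtain M where M: "M \<in> HGL f f'" "g' \<circ> (h \<circ> ?i) = lin M" by (rule iso_lin)
    show "\<exists>!M. M \<in> HGL f f' \<and> (\<forall>x\<in>carrier C. g' (h x) = lin M (g x))"
    proof (rule ex1I[of _ M])
      show "M \<in> HGL f f' \<and> (\<forall>x\<in>carrier C. g' (h x) = lin M (g x))"
        using M ig by (simp add: fun_eq_iff flip: M(2))
    next
      fix N assume N: "N \<in> HGL f f' \<and> (\<forall>x\<in>carrier C. g' (h x) = lin N (g x))"
      show "N = M"
      proof (rule lin_inj)
        fix x
        have "lin N (g (?i x)) = g' (h (?i x))" using N inC by simp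
        also have "\<dots> = lin M x" by (simp flip: M(2))
        finally show "lin N x = lin M x" by (simp add: gi)
      qed
    qed
  next
    fix M assume M: "M \<in> HGL f f'"
    let ?h = "restrict (?i' \<circ> (lin M \<circ> g)) (carrier C)"
    have "?i' \<circ> (lin M \<circ> g) \<in> ring_iso C C'"
      by (rule ring_iso_set_trans[OF ring_iso_set_trans[OF g lin_iso[OF M]] i(2)])
    then have "?h \<in> ring_iso C C'" by (rule ring.ring_iso_restrict[OF ri(1)]) simp
    then have h: "?h \<in> Hring C C'" by (simp add: Hring_def)
    show "\<exists>!h. h \<in> Hring C C' \<and> (\<forall>x\<in>carrier C. g' (h x) = lin M (g x))"
    proof (rule ex1I[of _ ?h])
      show "?h \<in> Hring C C' \<and> (\<forall>x\<in>carrier C. g' (?h x) = lin M (g x))" using h by (simp add: gi)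
    next
      fix k assume k: "k \<in> Hring C C' \<and> (\<forall>x\<in>carrier C. g' (k x) = lin M (g x))"
      show "k = ?h"
      proof (rule extensionalityI[of _ "carrier C"])
        show "k \<in> extensional (carrier C)" "?h \<in> extensional (carrier C)" using k h by (simp_all add: Hring_def)
        fix x assume x: "x \<in> carrier C"
        have mem: "k x \<in> carrier C'" "?h x \<in> carrier C'"
          using k h x ring_iso_memE(1)[of _ C C' x] unfolding Hring_def by blast+
        have "g' (k x) = g' (?h x)" using k x by (simp add: gi)
        then show "k x = ?h x" by (rule inj'[OF mem])
      qed
    qed
  qed
qed

lemma h_hat_forms: "h_hat D = mass (forms D) HGL"
proof -
  let ?S = "Z_mat_cubic_rings (- 27 * D)"
  have "ring_iso C E \<noteq> {} \<longleftrightarrow> Hring C E \<noteq> {}" if "C \<in> ?S" for C E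
  proof
    assume "ring_iso C E \<noteq> {}"
    then obtain h where h: "h \<in> ring_iso C E" by blast
    have "ring C" using that cring.axioms(1) by (auto simp: Z_mat_cubic_rings_def rank_ring_def)
    then have "restrict h (carrier C) \<in> ring_iso C E" by (rule ring.ring_iso_restrict[OF _ h]) simp
    then show "Hring C E \<noteq> {}" unfolding Hring_def by blast
  qed (auto simp: Hring_def)
  then have "{(C, E). C \<in> ?S \<and> E \<in> ?S \<and> C \<simeq> E} = hom_rel ?S Hring"
    unfolding hom_rel_def is_ring_iso_def by blast
  then have "h_hat D = mass ?S Hring" by (simp add: h_hat_def Let_def mass_def ring_Aut_def Hring_def)
  then show ?thesis unfolding mass_Hring .
qed

lemma HSL_groupoid: "hom_groupoid A HSL mmul minv"
proof -
  interpret G: hom_groupoid UNIV HGL mmul minv by (rule HGL_groupoid)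
  show ?thesis
  proof unfold_locales
    fix f show "HSL f f \<noteq> {}" using mmul_mone(3)[of f] mmul_mone(4) unfolding HSL_def by blast
  next
    fix f g h m n assume "m \<in> HSL f g" "n \<in> HSL g h"
    then show "mmul n m \<in> HSL f h" using G.cmp[of f g h m n] by (simp add: HSL_eq mdet_mmul)
  next
    fix f g m assume "m \<in> HSL f g"
    then show "minv m \<in> HSL g f" using G.ivs[of f g m] by (simp add: HSL_eq mdet_minv)
  next
    fix f g h m n assume "m \<in> HSL f g" "n \<in> HSL h f"
    then show "mmul (minv m) (mmul m n) = n" using G.cancel_left[of f g h m n] by (simp add: HSL_eq)
  next
    fix f g h m n assume "m \<in> HSL f g" "n \<in> HSL h g"
    then show "mmul m (mmul (minv m) n) = n" using G.cancel_left'[of f g h m n] by (simp add: HSL_eq)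
  next
    fix f g h m n assume "m \<in> HSL f g" "n \<in> HSL g h"
    then show "mmul (mmul n m) (minv m) = n" using G.cancel_right[of f g h m n] by (simp add: HSL_eq)
  next
    fix f g h m n assume "m \<in> HSL f g" "n \<in> HSL f h"
    then show "mmul (mmul n (minv m)) m = n" using G.cancel_right'[of f g h m n] by (simp add: HSL_eq)
  qed
qed

section \<open>Assembling the count over all discriminants\<close>

lemma finite_square_divisors:
  assumes "\<Delta> \<noteq> (0 :: int)"
  shows "finite {(g :: nat, \<Delta>'). g > 0 \<and> \<Delta>' \<in> Discs \<and> \<Delta>' * int g ^ 2 = \<Delta>}"
proof (rule finite_subset)
  show "finite ({..nat \<bar>\<Delta>\<bar>} \<times> {- \<bar>\<Delta>\<bar>..\<bar>\<Delta>\<bar>})" by simp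
  show "{(g :: nat, \<Delta>'). g > 0 \<and> \<Delta>' \<in> Discs \<and> \<Delta>' * int g ^ 2 = \<Delta>} \<subseteq> {..nat \<bar>\<Delta>\<bar>} \<times> {- \<bar>\<Delta>\<bar>..\<bar>\<Delta>\<bar>}"
  proof (rule subsetI, clarify)
    fix g :: nat and d assume g: "g > 0" and e: "\<Delta> = d * int g ^ 2"
    have "d dvd \<Delta>" "int g dvd \<Delta>" using e by (auto simp: power2_eq_square)
    then have "\<bar>d\<bar> \<le> \<bar>\<Delta>\<bar>" "int g \<le> \<bar>\<Delta>\<bar>" using assms dvd_imp_le_int[of \<Delta> d] dvd_imp_le_int[of \<Delta> "int g"] by simp_all
    then show "g \<in> {..nat \<bar>d * int g ^ 2\<bar>} \<and> d \<in> {- \<bar>d * int g ^ 2\<bar>..\<bar>d * int g ^ 2\<bar>}" unfolding e by (simp add: le_nat_iff abs_le_iff)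
  qed
qed

text \<open>The Hessian divided by its content is a binary quadratic form, and its discriminant is
  congruent modulo 4 to the square of the middle coefficient.\<close>

lemma form_disc_Discs:
  assumes "fdisc f \<noteq> 0"
  obtains \<Delta>' where "hcontent f > 0" "\<Delta>' \<in> Discs" "\<Delta>' * int (hcontent f) ^ 2 = fdisc f"
proof -
  obtain h0 h1 h2 where h: "hcontent f > 0" "fdisc f = int (hcontent f) ^ 2 * (h1^2 - 4 * h0 * h2)"
    using assms by (rule hcontent_disc)
  have n0: "h1^2 - 4 * h0 * h2 \<noteq> 0" using h assms by auto
  have "h1^2 - 4 * h0 * h2 \<in> Discs"
  proof (cases "even h1")
    case True
    then obtain k where "h1 = 2 * k" by (rule evenE)
    then have "h1^2 - 4 * h0 * h2 = 4 * (k^2 - h0 * h2)" by (simp add: power2_eq_square algebra_simps)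
    then have "4 dvd h1^2 - 4 * h0 * h2" by (rule dvdI)
    then show ?thesis using n0 by (simp add: Discs_def)
  next
    case False
    then obtain k where "h1 = 2 * k + 1" by (rule oddE)
    then have "h1^2 - 4 * h0 * h2 = 1 + 4 * (k^2 + k - h0 * h2)" by (simp add: power2_eq_square algebra_simps)
    then have "(h1^2 - 4 * h0 * h2) mod 4 = 1" by presburger
    then show ?thesis by (simp add: Discs_def)
  qed
  then show ?thesis using that h by (simp add: mult.commute)
qed

text \<open>The mass of the units depends on whether the discriminant is a square; this makes it the
  same for all terms of the sum.\<close>

lemma square_quotient_iff:
  assumes "d * int g ^ 2 = \<Delta>" "g > 0"
  shows "(\<exists>k::int. \<Delta> = k ^ 2) \<longleftrightarrow> (\<exists>k. d = k ^ 2)"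
proof
  assume "\<exists>k. \<Delta> = k ^ 2"
  then obtain k where k: "k ^ 2 = d * int g ^ 2" using assms by metis
  then have "int g ^ 2 dvd k ^ 2" by (metis dvd_triv_right)
  then have "int g dvd k" by simp
  then obtain m where "k = int g * m" by (rule dvdE)
  then have "m ^ 2 * int g ^ 2 = d * int g ^ 2" using k by (simp add: power_mult_distrib)
  then have "d = m ^ 2" using assms(2) by simp
  then show "\<exists>k. d = k ^ 2" ..
next
  assume "\<exists>k. d = k ^ 2"
  then obtain k where "d = k ^ 2" ..
  then have "\<Delta> = (k * int g) ^ 2" using assms by (simp add: power_mult_distrib)
  then show "\<exists>k. \<Delta> = k ^ 2" ..
qed

theorem theorem5p4:
  fixes \<Delta> :: int and w \<eta> :: rat
  assumes "\<Delta> \<in> Discs"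
    and "w = (if \<exists>k::int. \<Delta> = k ^ 2 then 3 else 1)"
    and "\<eta> = (if \<Delta> > 0 then 1 / 3 else 1)"
  shows "2 * w * \<eta> * h_hat \<Delta> =
    (\<Sum>(g, \<Delta>') \<in> {(g :: nat, \<Delta>'). g > 0 \<and> \<Delta>' \<in> Discs \<and> \<Delta>' * int g ^ 2 = \<Delta>}.
       \<Sum>J \<in> cube_class_ideals \<Delta>' g. of_nat (card (torsion 3 (Pic \<Delta>'))))"
proof -
  define T where "T = {(g :: nat, \<Delta>'). g > 0 \<and> \<Delta>' \<in> Discs \<and> \<Delta>' * int g ^ 2 = \<Delta>}"
  \<comment> \<open>The second component is determined by the first; it is carried along so that the
    invariant takes values in the index set of the sum.\<close>
  define p where "p f = (hcontent f, \<Delta> div int (hcontent f) ^ 2)" for f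
  define u :: rat where "u = (if \<Delta> > 0 \<and> (\<nexists>k. \<Delta> = k ^ 2) then 3 else 1)"
  let ?c = "\<lambda>(g, \<Delta>'). \<Sum>J\<in>cube_class_ideals \<Delta>' g. of_nat (card (torsion 3 (Pic \<Delta>'))) :: rat"
  have D0: "\<Delta> \<noteq> 0" using assms(1) by (auto simp: Discs_def)
  have T: "finite T" unfolding T_def by (rule finite_square_divisors[OF D0])
  have sub: "p ` forms \<Delta> \<subseteq> T"
  proof
    fix t assume "t \<in> p ` forms \<Delta>"
    then obtain f where f: "fdisc f = \<Delta>" "t = p f" unfolding forms_def by blast
    have "fdisc f \<noteq> 0" using f D0 by simp
    then obtain \<Delta>' where d: "hcontent f > 0" "\<Delta>' \<in> Discs" "\<Delta>' * int (hcontent f) ^ 2 = fdisc f" by (rule form_disc_Discs)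
    then have "\<Delta> div int (hcontent f) ^ 2 = \<Delta>'" unfolding f(1)[symmetric] d(3)[symmetric] by simp
    then show "t \<in> T" using d f by (simp add: p_def T_def)
  qed
  have fib: "mass {f \<in> forms \<Delta>. p f = t} HSL = u * ?c t"
    "finite ({f \<in> forms \<Delta>. p f = t} // hom_rel {f \<in> forms \<Delta>. p f = t} HSL)" if t: "t \<in> T" for t
  proof -
    obtain g \<Delta>' where t_eq: "t = (g, \<Delta>')" by (cases t)
    have g: "g > 0" and d: "\<Delta>' \<in> Discs" and e: "\<Delta>' * int g ^ 2 = \<Delta>" using t by (simp_all add: T_def t_eq)
    interpret Q: quad \<Delta>' by unfold_locales (rule d)
    have "\<Delta> div int g ^ 2 = \<Delta>'" using g by (simp flip: e)
    then have F: "{f \<in> forms \<Delta>. p f = t} = Q.cforms g"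
      unfolding forms_def p_def t_eq Q.cforms_def e by auto
    have "(\<Delta> > 0 \<and> (\<nexists>k. \<Delta> = k ^ 2)) = (\<Delta>' > 0 \<and> (\<nexists>k. \<Delta>' = k ^ 2))"
      using square_quotient_iff[OF e g] g by (simp flip: e add: zero_less_mult_iff)
    then have U: "mass Q.CC.U Q.CC.HU = u" unfolding u_def by (simp add: Q.mass_units(1))
    show "mass {f \<in> forms \<Delta>. p f = t} HSL = u * ?c t"
      unfolding F Q.mass_cforms[OF g Q.mass_units(2)] U by (simp add: t_eq sum_distrib_left mult.commute)
    show "finite ({f \<in> forms \<Delta>. p f = t} // hom_rel {f \<in> forms \<Delta>. p f = t} HSL)"
      unfolding F by (rule Q.finite_cforms[OF g Q.mass_units(2)])
  qed
  have inv: "HSL f f' \<noteq> {} \<Longrightarrow> p f = p f'" for f f' unfolding p_def using hcontent_HSL by metis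
  have W: "weighted (forms \<Delta>) HSL" by (rule hom_groupoid.weighted[OF HSL_groupoid])
  have fin: "finite (forms \<Delta> // hom_rel (forms \<Delta>) HSL)"
    by (rule finite_partition[OF W inv T sub fib(2)])
  have "2 * h_hat \<Delta> = mass (forms \<Delta>) HSL" unfolding h_hat_forms mass_HSL[OF fin] ..
  also have "\<dots> = (\<Sum>t\<in>T. mass {f \<in> forms \<Delta>. p f = t} HSL)"
    by (rule mass_partition[OF W inv T sub fib(2)])
  also have "\<dots> = u * (\<Sum>t\<in>T. ?c t)" unfolding sum_distrib_left by (rule sum.cong[OF refl fib(1)])
  finally have "w * \<eta> * (2 * h_hat \<Delta>) = (w * \<eta> * u) * (\<Sum>t\<in>T. ?c t)" by (simp only: mult.assoc)
  \<comment> \<open>Three cases: positive and not a square, where \<open>\<eta> * u = 1\<close>; a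
    positive square, where \<open>w * \<eta> = 1\<close>; and negative, where all factors are 1. A
    nonzero square is positive.\<close>
  moreover have "w * \<eta> * u = 1"
  proof -
    have "\<not> (\<exists>k. \<Delta> = k ^ 2)" if "\<not> \<Delta> > 0"
    proof
      assume "\<exists>k. \<Delta> = k ^ 2"
      then show False using that D0 by auto
    qed
    then show ?thesis using assms(2,3) by (auto simp: u_def)
  qed
  ultimately have "w * \<eta> * (2 * h_hat \<Delta>) = (\<Sum>t\<in>T. ?c t)" by (simp only: mult_1)
  moreover have "2 * w * \<eta> * h_hat \<Delta> = w * \<eta> * (2 * h_hat \<Delta>)" by simp
  ultimately show ?thesis unfolding T_def by (simp only:)
qed

end
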